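(* Let $\alpha_1,\alpha_2\in\mathbb{R}$, $0<q\le\infty$, $0<p<\infty$ and $\lambda>d\max(1,1/q,1/p)$. If $$(d+1)\alpha_2+\frac{d-1}{q}+\lambda\le2\alpha_1,$$ then $\mathbf{F}^{\alpha_1,q}_p\hookrightarrow\mathbf{F}^{\alpha_2,q}_p(AB)$.
   Context: $X\hookrightarrow Y$ means $X\subset Y$ and $\|f\|_Y\le C\|f\|_X$ for all $f\in X$. Let $d\ge2$. Frequency vectors $\xi\in\hat{\mathbb{R}}^d$ are row vectors, and $\hat g(\xi)=\int_{\mathbb{R}^d}g(x)e^{-2\pi i\xi x}dx$. $\mathcal{S}$, $\mathcal{S}'$ are the Schwartz class and tempered distributions on $\mathbb{R}^d$. Classical (dyadic isotropic) inhomogeneous Triebel–Lizorkin space. Let $\varphi,\Phi\in\mathcal{S}$ with $\operatorname{supp}\hat\varphi\subseteq\{\frac12\le|\xi|\le2\}$, $\operatorname{supp}\hat\Phi\subseteq\{|\xi|\le2\}$, $|\hat\varphi(\xi)|\ge c>0$ for $\frac35\le|\xi|\le\frac53$, $|\hat\Phi(\xi)|\ge c>0$ for $|\xi|\le\frac53$; $\varphi_{2^\nu I}(x)=2^{d\nu}\varphi(2^\nu x)$. $\mathbf{F}^{\alpha,q}_p$ is the set of $f\in\mathcal{S}'$ with $\|f\|_{\mathbf{F}^{\alpha,q}_p}=\|\Phi*f\|_{L^p}+\big\|\big(\sum_{\nu=0}^\infty(2^{\nu\alpha}|\varphi_{2^\nu I}*f|)^q\big)^{1/q}\big\|_{L^p}<\infty$.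 Shearlets. Fix $\hat\psi_1,\hat\psi_2\in C^\infty(\mathbb{R})$ with $\operatorname{supp}\hat\psi_1\subset[-\frac12,-\frac1{16}]\cup[\frac1{16},\frac12]$, $\operatorname{supp}\hat\psi_2\subset[-1,1]$, $\sum_{j\ge0}|\hat\psi_1(2^{-2j}\omega)|^2=1$ for $|\omega|\ge\frac18$, and $|\hat\psi_2(\omega-1)|^2+|\hat\psi_2(\omega)|^2+|\hat\psi_2(\omega+1)|^2=1$ for $|\omega|\le1$. For $\mathfrak d=1,\dots,d$ let $\hat\psi^{(\mathfrak d)}(\xi)=\hat\psi_1(\xi_{\mathfrak d})\prod_{i\ne\mathfrak d}\hat\psi_2(\xi_i/\xi_{\mathfrak d})$. Let $A_{(\mathfrak d)}$ be the diagonal $d\times d$ matrix with entry $4$ in position $\mathfrak d$ and $2$ elsewhere. For $\ell\in\mathbb{Z}^{d-1}$ let $B^{[\ell]}_{(\mathfrak d)}$ be the identity matrix with the off-diagonal entries of row $\mathfrak d$ replaced, in order, by $\ell_1,\dots,\ell_{d-1}$; its inverse is $B^{[-\ell]}_{(\mathfrak d)}$. Write $|[\ell]|\preceq2^j$ if $|\ell_i|\le2^j$ for all $i$. For an invertible matrix $M$, $\psi_M(x)=|\det M|^{-1}\psi(M^{-1}x)$, and $\tilde\psi(x)=\overline{\psi(-x)}$. Let $\hat\Psi\in C_c^\infty(\hat{\mathbb{R}}^d)$ with $\operatorname{supp}\hat\Psi\subset[-\frac14,\frac14]^d$ and $|\hat\Psi|=1$ on $\mathcal R=[-\frac18,\frac18]^d$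 be such that for all $\xi$ $$|\hat\Psi(\xi)|^2\chi_{\mathcal R}(\xi)+\sum_{\mathfrak d=1}^d\sum_{j\ge0}\sum_{|[\ell]|\preceq2^j}|\hat\psi^{(\mathfrak d)}(\xi A^{-j}_{(\mathfrak d)}B^{[-\ell]}_{(\mathfrak d)})|^2\chi_{\mathcal D^{(\mathfrak d)}}(\xi)=1,$$ where $\mathcal D^{(\mathfrak d)}=\{\xi:|\xi_{\mathfrak d}|\ge\frac18,\ |\xi_i/\xi_{\mathfrak d}|\le1\ (i\ne\mathfrak d)\}$. Put $|Q_j|=2^{-(d+1)j}$. Shear anisotropic inhomogeneous Triebel–Lizorkin space. $\mathbf{F}^{\alpha,q}_p(AB)$ is the set of $f\in\mathcal{S}'$ with $$\|f\|_{\mathbf{F}^{\alpha,q}_p(AB)}=\|f*\Psi\|_{L^p}+\Big\|\Big(\sum_{\mathfrak d=1}^d\sum_{j\ge0}\sum_{|[\ell]|\preceq2^j}\big[|Q_j|^{-\alpha}|\tilde\psi^{(\mathfrak d)}_{A^{-j}_{(\mathfrak d)}B^{[-\ell]}_{(\mathfrak d)}}*f|\big]^q\Big)^{1/q}\Big\|_{L^p}<\infty$$ (supremum when $q=\infty$).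
   Formalization: The partition-of-unity identity for the generators is required only for almost every ξ: required for all ξ it cannot hold, since at ξ=(1,…,1), which lies in all d closed cones, each cone contributes 1 and the sum is d ≥ 2. *)

theory Defs
  imports "HOL-Analysis.Analysis"
begin

section \<open>Schwartz functions, tempered distributions, Fourier transform\<close>

definition supp :: "('a::topological_space \<Rightarrow> complex) \<Rightarrow> 'a set" where
  "supp f = closure {x. f x \<noteq> 0}"

text \<open>A list of basis vectors plays the role of a multi-index.\<close>

definition dir_deriv ::
    "'a::euclidean_space \<Rightarrow> ('a \<Rightarrow> complex) \<Rightarrow> 'a \<Rightarrow> complex" where
  "dir_deriv v f = (\<lambda>x. frechet_derivative f (at x) v)"

definition iter_deriv ::
    "'a::euclidean_space list \<Rightarrow> ('a \<Rightarrow> complex) \<Rightarrow> 'a \<Rightarrow> complex" where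
  "iter_deriv vs f = foldr dir_deriv vs f"

definition smooth :: "('a::euclidean_space \<Rightarrow> complex) \<Rightarrow> bool" where
  "smooth f \<longleftrightarrow> (\<forall>vs x. set vs \<subseteq> Basis \<longrightarrow> iter_deriv vs f differentiable (at x))"

definition schwartz :: "('a::euclidean_space \<Rightarrow> complex) set" where
  "schwartz = {f. smooth f \<and>
     (\<forall>N vs. set vs \<subseteq> Basis \<longrightarrow>
        bounded (range (\<lambda>x. (1 + norm x) ^ N *\<^sub>R iter_deriv vs f x)))}"

definition schwartz_norm :: "nat \<Rightarrow> ('a::euclidean_space \<Rightarrow> complex) \<Rightarrow> real" where
  "schwartz_norm N f =
     (SUP (vs, x) \<in> {vs. set vs \<subseteq> Basis \<and> length vs \<le> N} \<times> UNIV.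
        (1 + norm x) ^ N * norm (iter_deriv vs f x))"

text \<open>Linear functionals on the Schwartz class that are continuous at the origin, hence everywhere,
  for the topology given by the increasing family of norms \<^term>\<open>schwartz_norm\<close>. A functional is
  extended by zero outside the Schwartz class, so that equal distributions are equal functions.\<close>

definition tempered_distributions ::
    "(('a::euclidean_space \<Rightarrow> complex) \<Rightarrow> complex) set" where
  "tempered_distributions = {u.
     (\<forall>f. f \<notin> schwartz \<longrightarrow> u f = 0) \<and>
     (\<forall>f\<in>schwartz. \<forall>g\<in>schwartz. u (\<lambda>x. f x + g x) = u f + u g) \<and>
     (\<forall>c. \<forall>f\<in>schwartz. u (\<lambda>x. c * f x) = c * u f) \<and>
     (\<forall>e>0. \<exists>N. \<exists>\<delta>>0. \<forall>f\<in>schwartz. schwartz_norm N f < \<delta> \<longrightarrow> norm (u f) < e)}"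

definition conv ::
    "('a::euclidean_space \<Rightarrow> complex) \<Rightarrow> (('a \<Rightarrow> complex) \<Rightarrow> complex) \<Rightarrow> 'a \<Rightarrow> complex" where
  "conv g u = (\<lambda>x. u (\<lambda>y. g (x - y)))"

definition fourier :: "('a::euclidean_space \<Rightarrow> complex) \<Rightarrow> 'a \<Rightarrow> complex" where
  "fourier g = (\<lambda>\<xi>. LINT x|lborel. g x * exp (- 2 * pi * \<i> * complex_of_real (\<xi> \<bullet> x)))"

definition inverse_fourier :: "('a::euclidean_space \<Rightarrow> complex) \<Rightarrow> 'a \<Rightarrow> complex" where
  "inverse_fourier h = (\<lambda>x. LINT \<xi>|lborel. h \<xi> * exp (2 * pi * \<i> * complex_of_real (\<xi> \<bullet> x)))"

section \<open>Quasi-norms\<close>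

text \<open>Only used with a positive exponent.\<close>

definition epowr :: "ennreal \<Rightarrow> real \<Rightarrow> ennreal" where
  "epowr x a = (if x = \<infinity> then \<infinity> else ennreal (enn2real x powr a))"

definition Lp_norm :: "real \<Rightarrow> ('a::euclidean_space \<Rightarrow> ennreal) \<Rightarrow> ennreal" where
  "Lp_norm p g = epowr (\<integral>\<^sup>+ x. epowr (g x) p \<partial>lborel) (1 / p)"

definition lq_norm :: "ennreal \<Rightarrow> 'i set \<Rightarrow> ('i \<Rightarrow> ennreal) \<Rightarrow> ennreal" where
  "lq_norm q I a =
     (if q = \<infinity> then (SUP i\<in>I. a i)
      else epowr (infsum (\<lambda>i. epowr (a i) (enn2real q)) I) (1 / enn2real q))"

definition embeds ::
    "'f set \<Rightarrow> ('f \<Rightarrow> ennreal) \<Rightarrow> 'f set \<Rightarrow> ('f \<Rightarrow> ennreal) \<Rightarrow> bool" where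
  "embeds X norm_X Y norm_Y \<longleftrightarrow>
     X \<subseteq> Y \<and> (\<exists>C::real. \<forall>f\<in>X. norm_Y f \<le> ennreal C * norm_X f)"

section \<open>The dyadic isotropic Triebel--Lizorkin space\<close>

definition dyadic_pair :: "(real^'d \<Rightarrow> complex) \<Rightarrow> (real^'d \<Rightarrow> complex) \<Rightarrow> bool" where
  "dyadic_pair \<Phi> \<phi> \<longleftrightarrow>
     \<Phi> \<in> schwartz \<and> \<phi> \<in> schwartz \<and>
     supp (fourier \<phi>) \<subseteq> {\<xi>. 1/2 \<le> norm \<xi> \<and> norm \<xi> \<le> 2} \<and>
     supp (fourier \<Phi>) \<subseteq> {\<xi>. norm \<xi> \<le> 2} \<and>
     (\<exists>c>0. (\<forall>\<xi>. 3/5 \<le> norm \<xi> \<and> norm \<xi> \<le> 5/3 \<longrightarrow> norm (fourier \<phi> \<xi>) \<ge> c) \<and>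
            (\<forall>\<xi>. norm \<xi> \<le> 5/3 \<longrightarrow> norm (fourier \<Phi> \<xi>) \<ge> c))"

definition dyadic_dilate :: "nat \<Rightarrow> (real^'d \<Rightarrow> complex) \<Rightarrow> real^'d \<Rightarrow> complex" where
  "dyadic_dilate \<nu> \<phi> = (\<lambda>x. 2 ^ (CARD('d) * \<nu>) * \<phi> (2 ^ \<nu> *\<^sub>R x))"

definition TL_norm ::
    "(real^'d \<Rightarrow> complex) \<Rightarrow> (real^'d \<Rightarrow> complex) \<Rightarrow> real \<Rightarrow> ennreal \<Rightarrow> real \<Rightarrow>
     ((real^'d \<Rightarrow> complex) \<Rightarrow> complex) \<Rightarrow> ennreal" where
  "TL_norm \<Phi> \<phi> \<alpha> q p f =
     Lp_norm p (\<lambda>x. ennreal (norm (conv \<Phi> f x))) +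
     Lp_norm p (\<lambda>x. lq_norm q UNIV
       (\<lambda>\<nu>. ennreal (2 powr (real \<nu> * \<alpha>) * norm (conv (dyadic_dilate \<nu> \<phi>) f x))))"

definition TL_space ::
    "(real^'d \<Rightarrow> complex) \<Rightarrow> (real^'d \<Rightarrow> complex) \<Rightarrow> real \<Rightarrow> ennreal \<Rightarrow> real \<Rightarrow>
     ((real^'d \<Rightarrow> complex) \<Rightarrow> complex) set" where
  "TL_space \<Phi> \<phi> \<alpha> q p = {f \<in> tempered_distributions. TL_norm \<Phi> \<phi> \<alpha> q p f < \<infinity>}"

section \<open>Shearlets\<close>

definition shearlet_generators :: "(real \<Rightarrow> complex) \<Rightarrow> (real \<Rightarrow> complex) \<Rightarrow> bool" where
  "shearlet_generators \<psi>1h \<psi>2h \<longleftrightarrow>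
     smooth \<psi>1h \<and> smooth \<psi>2h \<and>
     supp \<psi>1h \<subseteq> {-1/2 .. -1/16} \<union> {1/16 .. 1/2} \<and>
     supp \<psi>2h \<subseteq> {-1 .. 1} \<and>
     (\<forall>\<omega>. \<bar>\<omega>\<bar> \<ge> 1/8 \<longrightarrow> (\<lambda>j. (norm (\<psi>1h (\<omega> / 2 ^ (2 * j))))\<^sup>2) sums 1) \<and>
     (\<forall>\<omega>. \<bar>\<omega>\<bar> \<le> 1 \<longrightarrow>
        (norm (\<psi>2h (\<omega> - 1)))\<^sup>2 + (norm (\<psi>2h \<omega>))\<^sup>2 + (norm (\<psi>2h (\<omega> + 1)))\<^sup>2 = 1)"

text \<open>Where \<^term>\<open>\<xi> $ \<dd> = 0\<close> the first factor vanishes, so the totalised quotient is harmless.\<close>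

definition shearlet_hat ::
    "(real \<Rightarrow> complex) \<Rightarrow> (real \<Rightarrow> complex) \<Rightarrow> 'd::finite \<Rightarrow> real^'d \<Rightarrow> complex" where
  "shearlet_hat \<psi>1h \<psi>2h \<dd> = (\<lambda>\<xi>. \<psi>1h (\<xi> $ \<dd>) * (\<Prod>i\<in>UNIV - {\<dd>}. \<psi>2h (\<xi> $ i / \<xi> $ \<dd>)))"

definition shearlet ::
    "(real \<Rightarrow> complex) \<Rightarrow> (real \<Rightarrow> complex) \<Rightarrow> 'd::finite \<Rightarrow> real^'d \<Rightarrow> complex" where
  "shearlet \<psi>1h \<psi>2h \<dd> = inverse_fourier (shearlet_hat \<psi>1h \<psi>2h \<dd>)"

definition A_mat :: "'d::finite \<Rightarrow> real^'d^'d" where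
  "A_mat \<dd> = (\<chi> i k. if i = k then (if i = \<dd> then 4 else 2) else 0)"

text \<open>An element of \<open>\<int>\<^bsup>d-1\<^esup>\<close> is encoded as an integer vector indexed by all \<open>d\<close> coordinates with
  entry 0 in position \<open>\<dd>\<close>; its remaining entries, in order, are the shear parameters.\<close>

definition B_mat :: "'d::finite \<Rightarrow> int^'d \<Rightarrow> real^'d^'d" where
  "B_mat \<dd> l = (\<chi> i k. if i = k then 1 else if i = \<dd> then real_of_int (l $ k) else 0)"

definition shear_index :: "('d::finite \<times> nat \<times> (int^'d)) set" where
  "shear_index = {(\<dd>, j, l). l $ \<dd> = 0 \<and> (\<forall>i. \<bar>l $ i\<bar> \<le> 2 ^ j)}"

text \<open>Matrix powers are spelled out because the library's power on
  \<^typ>\<open>real^'d^'d\<close> is componentwise.\<close>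

definition mat_pow :: "real^'d^'d \<Rightarrow> nat \<Rightarrow> real^'d^'d" where
  "mat_pow M n = (((**) M) ^^ n) (mat 1)"

definition shear_mat :: "'d::finite \<Rightarrow> nat \<Rightarrow> int^'d \<Rightarrow> real^'d^'d" where
  "shear_mat \<dd> j l = mat_pow (matrix_inv (A_mat \<dd>)) j ** B_mat \<dd> (- l)"

definition mat_dilate :: "real^'d^'d \<Rightarrow> (real^'d \<Rightarrow> complex) \<Rightarrow> real^'d \<Rightarrow> complex" where
  "mat_dilate M \<psi> = (\<lambda>x. complex_of_real (inverse \<bar>det M\<bar>) * \<psi> (matrix_inv M *v x))"

definition tilde :: "(real^'d \<Rightarrow> complex) \<Rightarrow> real^'d \<Rightarrow> complex" where
  "tilde \<psi> = (\<lambda>x. cnj (\<psi> (- x)))"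

definition R_cube :: "(real^'d) set" where
  "R_cube = {\<xi>. \<forall>i. \<bar>\<xi> $ i\<bar> \<le> 1/8}"

definition D_cone :: "'d::finite \<Rightarrow> (real^'d) set" where
  "D_cone \<dd> = {\<xi>. \<bar>\<xi> $ \<dd>\<bar> \<ge> 1/8 \<and> (\<forall>i. i \<noteq> \<dd> \<longrightarrow> \<bar>\<xi> $ i / \<xi> $ \<dd>\<bar> \<le> 1)}"

text \<open>The partition of unity is required almost everywhere: at a point of two of the closed cones,
  such as \<open>(1,\<dots>,1)\<close>, each of them contributes 1 by the conditions on the generators, so the
  pointwise identity fails on the null set of common boundary points for every choice of the
  generators.\<close>

definition coarse_generator ::
    "(real \<Rightarrow> complex) \<Rightarrow> (real \<Rightarrow> complex) \<Rightarrow> (real^'d \<Rightarrow> complex) \<Rightarrow> bool" where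
  "coarse_generator \<psi>1h \<psi>2h \<Psi>h \<longleftrightarrow>
     smooth \<Psi>h \<and>
     supp \<Psi>h \<subseteq> {\<xi>. \<forall>i. \<bar>\<xi> $ i\<bar> \<le> 1/4} \<and>
     (\<forall>\<xi>\<in>R_cube. norm (\<Psi>h \<xi>) = 1) \<and>
     (AE \<xi> in lborel.
        ennreal ((norm (\<Psi>h \<xi>))\<^sup>2 * indicator R_cube \<xi>) +
        infsum (\<lambda>(\<dd>, j, l).
            ennreal ((norm (shearlet_hat \<psi>1h \<psi>2h \<dd> (\<xi> v* shear_mat \<dd> j l)))\<^sup>2
                     * indicator (D_cone \<dd>) \<xi>))
          shear_index = 1)"

section \<open>The shear anisotropic Triebel--Lizorkin space\<close>

definition Q_vol :: "'d itself \<Rightarrow> nat \<Rightarrow> real" where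
  "Q_vol _ j = 2 powr (- (real CARD('d) + 1) * real j)"

definition shear_TL_norm ::
    "(real \<Rightarrow> complex) \<Rightarrow> (real \<Rightarrow> complex) \<Rightarrow> (real^'d \<Rightarrow> complex) \<Rightarrow>
     real \<Rightarrow> ennreal \<Rightarrow> real \<Rightarrow> ((real^'d \<Rightarrow> complex) \<Rightarrow> complex) \<Rightarrow> ennreal" where
  "shear_TL_norm \<psi>1h \<psi>2h \<Psi>h \<alpha> q p f =
     Lp_norm p (\<lambda>x. ennreal (norm (conv (inverse_fourier \<Psi>h) f x))) +
     Lp_norm p (\<lambda>x. lq_norm q shear_index
       (\<lambda>(\<dd>, j, l). ennreal (Q_vol TYPE('d) j powr (- \<alpha>) *
          norm (conv (mat_dilate (shear_mat \<dd> j l) (tilde (shearlet \<psi>1h \<psi>2h \<dd>))) f x))))"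

definition shear_TL_space ::
    "(real \<Rightarrow> complex) \<Rightarrow> (real \<Rightarrow> complex) \<Rightarrow> (real^'d \<Rightarrow> complex) \<Rightarrow>
     real \<Rightarrow> ennreal \<Rightarrow> real \<Rightarrow> ((real^'d \<Rightarrow> complex) \<Rightarrow> complex) set" where
  "shear_TL_space \<psi>1h \<psi>2h \<Psi>h \<alpha> q p =
     {f \<in> tempered_distributions. shear_TL_norm \<psi>1h \<psi>2h \<Psi>h \<alpha> q p f < \<infinity>}"

end

theory Submission
  imports Defs "HOL-Probability.Characteristic_Functions"
begin

text \<open>The symbol of a shearlet of scale \<open>j\<close> lives at frequencies comparable to \<open>2\<^bsup>2j\<^esup>\<close>, so the
  shearlet coefficient of \<open>f\<close> only sees boundedly many dyadic pieces \<open>g\<^sub>\<kappa>\<close> of \<open>f\<close>. Since the shearlet has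
  spread \<open>2\<^bsup>-j\<^esup>\<close>, which is \<open>2\<^bsup>j\<^esup>\<close> times the spread of the dyadic kernels, the coefficient is at most
  \<open>C 2\<^bsup>jl\<^esup>\<close> times the sum of the Peetre maximal functions of the \<open>g\<^sub>\<kappa>\<close> with exponent \<open>l\<close>. Their \<open>p\<close>-th
  powers are bounded by averages of \<open>\<bar>g\<^sub>\<kappa>\<bar>\<^sup>p\<close> against an integrable weight as soon as \<open>l p > d\<close>.

  The hypothesis on \<open>lam\<close> is strict, so \<open>l\<close> can be taken smaller than \<open>lam\<close>. The factor
  \<open>2\<^bsup>-j(lam-l)\<^esup>\<close> thus gained makes the sums over \<open>j\<close> geometric: each dyadic piece may be estimated
  separately in \<open>L\<^sup>p\<close>, and no vector valued maximal inequality is needed. The number of shears at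
  scale \<open>j\<close> is of order \<open>2\<^bsup>j(d-1)\<^esup>\<close>, which accounts for the term \<open>(d-1)/q\<close>.\<close>

section \<open>Differentiability classes\<close>

text \<open>The obstacle is that \<open>f\<close> is an arbitrary tempered distribution: its
  convolutions are known only to be continuous with polynomial growth, so the weighted suprema in
  the Peetre inequality are not finite for free. Moreover the dyadic pair is only bounded below on
  certain sets and satisfies no reproducing identity, so dual functions are built by dividing by the
  sum of the squared moduli of the Fourier transforms. This needs a local notion of smoothness,
  closed under quotients and gluing, which also handles the quotients in the shearlet symbols. No
  cutoff has to be constructed by hand, since the squared modulus of \<open>\<Psi>h\<close> is one.
  Uniformity in the scale comes from using just two resolutions: one for the scales up to 2, which
  contains \<open>\<Phi>\<close>, and one made of dilates of \<open>\<phi>\<close> alone, which is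
  dilated to serve all larger scales.\<close>

definition grad_map :: "('a::euclidean_space \<Rightarrow> 'a \<Rightarrow> complex) \<Rightarrow> 'a \<Rightarrow> 'a \<Rightarrow> complex" where
  "grad_map D x v = (\<Sum>b\<in>Basis. (v \<bullet> b) *\<^sub>R D b x)"

text \<open>A local counterpart of \<open>smooth\<close>, meant for open \<open>U\<close>: quotients
  are smooth only where the denominator does not vanish, so the class has to live on subsets. The
  partial derivatives are quantified existentially, which lets closure properties be proved by
  writing down a formula for them.\<close>

fun Ck_on :: "nat \<Rightarrow> 'a::euclidean_space set \<Rightarrow> ('a \<Rightarrow> complex) \<Rightarrow> bool" where
  "Ck_on 0 U h \<longleftrightarrow> continuous_on U h"
| "Ck_on (Suc n) U h \<longleftrightarrow> (\<exists>D. (\<forall>x\<in>U. (h has_derivative grad_map D x) (at x)) \<and> (\<forall>b\<in>Basis. Ck_on n U (D b)))"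

lemma Ck_on_SucI:
  assumes "\<And>x. x \<in> U \<Longrightarrow> (h has_derivative grad_map D x) (at x)" and "\<And>b. b \<in> Basis \<Longrightarrow> Ck_on n U (D b)"
  shows "Ck_on (Suc n) U h"
  using assms by auto

lemma grad_map_Basis: "b \<in> Basis \<Longrightarrow> grad_map D x b = D b x"
  by (simp add: grad_map_def inner_Basis if_distrib[of "\<lambda>r. r *\<^sub>R _"] sum.delta cong: if_cong)

lemma has_derivative_grad_map:
  assumes "(h has_derivative h') (at x)"
  shows "(h has_derivative grad_map (\<lambda>b y. h' b) x) (at x)"
proof -
  interpret bounded_linear h' using assms by (rule has_derivative_bounded_linear)
  have "h' = grad_map (\<lambda>b y. h' b) x"
  proof
    fix v
    have "h' v = h' (\<Sum>b\<in>Basis. (v \<bullet> b) *\<^sub>R b)" by (simp add: euclidean_representation)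
    then show "h' v = grad_map (\<lambda>b y. h' b) x v"
      by (simp only: grad_map_def sum scaleR)
  qed
  then show ?thesis using assms by simp
qed

lemma Ck_on_cong:
  assumes "open U" "\<And>x. x \<in> U \<Longrightarrow> h x = g x"
  shows "Ck_on n U h \<longleftrightarrow> Ck_on n U g"
proof (cases n)
  case 0 then show ?thesis using assms by (simp cong: continuous_on_cong)
next
  case (Suc m)
  have "(h has_derivative D) (at x) \<longleftrightarrow> (g has_derivative D) (at x)" if "x \<in> U" for x D
    using assms that by (metis has_derivative_transform_within_open)
  then show ?thesis using Suc by (simp cong: ball_cong)
qed

lemma Ck_on_mono: "Ck_on n U h \<Longrightarrow> V \<subseteq> U \<Longrightarrow> Ck_on n V h"
proof (induction n arbitrary: h)
  case (Suc n) then show ?case unfolding Ck_on.simps(2) by (meson subsetD)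
qed (auto intro: continuous_on_subset)

lemma Ck_on_Suc_imp: "Ck_on (Suc n) U h \<Longrightarrow> Ck_on n U h"
proof (induction n arbitrary: h)
  case 0
  then show ?case
    by (auto intro!: continuous_at_imp_continuous_on dest: has_derivative_continuous)
next
  case (Suc n)
  then obtain D where D: "\<forall>x\<in>U. (h has_derivative grad_map D x) (at x)"
     "\<forall>b\<in>Basis. Ck_on (Suc n) U (D b)"
    unfolding Ck_on.simps(2) by blast
  then show ?case using Suc.IH by (blast intro: Ck_on_SucI)
qed

lemma Ck_on_le: "Ck_on n U h \<Longrightarrow> m \<le> n \<Longrightarrow> Ck_on m U h"
proof (induction n)
  case (Suc n) then show ?case using Ck_on_Suc_imp by (metis le_Suc_eq)
qed simp

lemma Ck_on_continuous: "Ck_on n U h \<Longrightarrow> continuous_on U h"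
  using Ck_on_le[of n U h 0] by simp

lemma Ck_on_const: "Ck_on n U (\<lambda>x. c)"
proof (induction n arbitrary: c)
  case (Suc n)
  show ?case
    by (rule Ck_on_SucI[where D="\<lambda>b x. 0"]) (auto simp: Suc grad_map_def[abs_def])
qed simp

lemma Ck_on_add: "Ck_on n U f \<Longrightarrow> Ck_on n U g \<Longrightarrow> Ck_on n U (\<lambda>x. f x + g x)"
proof (induction n arbitrary: f g)
  case (Suc n)
  then obtain D E where
    D: "\<forall>x\<in>U. (f has_derivative grad_map D x) (at x)" "\<forall>b\<in>Basis. Ck_on n U (D b)" and
    E: "\<forall>x\<in>U. (g has_derivative grad_map E x) (at x)" "\<forall>b\<in>Basis. Ck_on n U (E b)"
    unfolding Ck_on.simps(2) by blast
  show ?case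
  proof (rule Ck_on_SucI[where D="\<lambda>b x. D b x + E b x"])
    fix x assume "x \<in> U"
    then have "((\<lambda>x. f x + g x) has_derivative (\<lambda>v. grad_map D x v + grad_map E x v)) (at x)"
      using D E by (intro has_derivative_add) auto
    then show "((\<lambda>x. f x + g x) has_derivative grad_map (\<lambda>b x. D b x + E b x) x) (at x)"
      by (simp add: grad_map_def[abs_def] sum.distrib scaleR_add_right)
  qed (use D E Suc.IH in auto)
qed (auto intro: continuous_on_add)

lemma Ck_on_mult: "Ck_on n U f \<Longrightarrow> Ck_on n U g \<Longrightarrow> Ck_on n U (\<lambda>x. f x * g x)"
proof (induction n arbitrary: f g)
  case (Suc n)
  then obtain D E where
    D: "\<forall>x\<in>U. (f has_derivative grad_map D x) (at x)" "\<forall>b\<in>Basis. Ck_on n U (D b)" and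
    E: "\<forall>x\<in>U. (g has_derivative grad_map E x) (at x)" "\<forall>b\<in>Basis. Ck_on n U (E b)"
    unfolding Ck_on.simps(2) by blast
  have "Ck_on n U f" "Ck_on n U g" using Suc.prems Ck_on_Suc_imp by auto
  show ?case
  proof (rule Ck_on_SucI[where D="\<lambda>b x. f x * E b x + D b x * g x"])
    fix x assume "x \<in> U"
    then have "((\<lambda>x. f x * g x) has_derivative (\<lambda>v. f x * grad_map E x v + grad_map D x v * g x)) (at x)"
      using D E by (intro has_derivative_mult) auto
    then show "((\<lambda>x. f x * g x) has_derivative grad_map (\<lambda>b x. f x * E b x + D b x * g x) x) (at x)"
      by (simp add: grad_map_def[abs_def] sum.distrib scaleR_add_right sum_distrib_left sum_distrib_right)
  qed (use D E \<open>Ck_on n U f\<close> \<open>Ck_on n U g\<close> in \<open>auto intro!: Ck_on_add Suc.IH\<close>)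
qed (auto intro: continuous_on_mult)

lemma Ck_on_cnj: "Ck_on n U f \<Longrightarrow> Ck_on n U (\<lambda>x. cnj (f x))"
proof (induction n arbitrary: f)
  case (Suc n)
  then obtain D where
    D: "\<forall>x\<in>U. (f has_derivative grad_map D x) (at x)" "\<forall>b\<in>Basis. Ck_on n U (D b)"
    unfolding Ck_on.simps(2) by blast
  show ?case
  proof (rule Ck_on_SucI[where D="\<lambda>b x. cnj (D b x)"])
    fix x assume "x \<in> U"
    then have "((\<lambda>x. cnj (f x)) has_derivative (\<lambda>v. cnj (grad_map D x v))) (at x)"
      using D by (intro has_derivative_cnj) auto
    then show "((\<lambda>x. cnj (f x)) has_derivative grad_map (\<lambda>b x. cnj (D b x)) x) (at x)"
      by (simp add: grad_map_def[abs_def] )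
  qed (use D Suc.IH in auto)
qed (auto intro: continuous_on_cnj)

lemma Ck_on_inverse:
  assumes "Ck_on n U f" "\<And>x. x \<in> U \<Longrightarrow> f x \<noteq> 0"
  shows "Ck_on n U (\<lambda>x. inverse (f x))"
  using assms(1)
proof (induction n)
  case 0 then show ?case using assms(2) by (auto intro: continuous_on_inverse)
next
  case (Suc n)
  then obtain D where
    D: "\<forall>x\<in>U. (f has_derivative grad_map D x) (at x)" "\<forall>b\<in>Basis. Ck_on n U (D b)"
    unfolding Ck_on.simps(2) by blast
  have I: "Ck_on n U (\<lambda>x. inverse (f x))" using Suc Ck_on_Suc_imp by auto
  show ?case
  \<comment> \<open>The sign is written as a constant factor, so that the rules for products and
    constants cover this formula.\<close>
  proof (rule Ck_on_SucI[where D="\<lambda>b x. - 1 * (inverse (f x) * D b x * inverse (f x))"])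
    fix x assume "x \<in> U"
    then have "((\<lambda>x. inverse (f x)) has_derivative (\<lambda>v. - (inverse (f x) * grad_map D x v * inverse (f x)))) (at x)"
      using D assms(2) by (intro Deriv.has_derivative_inverse) auto
    then show "((\<lambda>x. inverse (f x)) has_derivative grad_map (\<lambda>b x. - 1 * (inverse (f x) * D b x * inverse (f x))) x) (at x)"
      by (simp add: grad_map_def[abs_def] sum_distrib_left sum_distrib_right sum_negf)
  next
    fix b :: 'a assume "b \<in> Basis"
    then show "Ck_on n U (\<lambda>x. - 1 * (inverse (f x) * D b x * inverse (f x)))"
      using D I by (intro Ck_on_mult Ck_on_const) auto
  qed
qed

lemma Ck_on_sum: "(\<And>i. i \<in> I \<Longrightarrow> Ck_on n U (f i)) \<Longrightarrow> Ck_on n U (\<lambda>x. \<Sum>i\<in>I. f i x)"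
  by (induction I rule: infinite_finite_induct) (auto intro: Ck_on_const Ck_on_add)

lemma Ck_on_prod: "(\<And>i. i \<in> I \<Longrightarrow> Ck_on n U (f i)) \<Longrightarrow> Ck_on n U (\<lambda>x. \<Prod>i\<in>I. f i x)"
  by (induction I rule: infinite_finite_induct) (auto intro: Ck_on_const Ck_on_mult)

lemma Ck_on_linear_compose:
  fixes L :: "'a::euclidean_space \<Rightarrow> 'b::euclidean_space"
  assumes "bounded_linear L" "Ck_on n V f" "L ` U \<subseteq> V"
  shows "Ck_on n U (\<lambda>x. f (L x))"
  using assms(2)
proof (induction n arbitrary: f)
  case 0
  then show ?case using assms(1,3) 
    using continuous_on_compose2[of V f U L] linear_continuous_on[OF assms(1)] by auto
next
  case (Suc n)
  then obtain D where
    D: "\<forall>x\<in>V. (f has_derivative grad_map D x) (at x)" "\<forall>b\<in>Basis. Ck_on n V (D b)"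
    unfolding Ck_on.simps(2) by blast
  show ?case
  \<comment> \<open>Chain rule in coordinates: the coefficients \<open>L b \<bullet> c\<close> are
    constants, hence of every class.\<close>
  proof (rule Ck_on_SucI[where D="\<lambda>b x. \<Sum>c\<in>Basis. complex_of_real (L b \<bullet> c) * D c (L x)"])
    fix x assume "x \<in> U"
    then have "((\<lambda>x. f (L x)) has_derivative (\<lambda>v. grad_map D (L x) (L v))) (at x)"
      using D(1) assms(3) has_derivative_compose[OF bounded_linear_imp_has_derivative[OF assms(1)], of f "grad_map D (L x)" x UNIV]
      by auto
    moreover have "(\<lambda>v. grad_map D (L x) (L v)) = grad_map (\<lambda>b x. \<Sum>c\<in>Basis. complex_of_real (L b \<bullet> c) * D c (L x)) x"
    proof
      fix v
      interpret L: bounded_linear L by fact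
      have "L v = L (\<Sum>b\<in>Basis. (v \<bullet> b) *\<^sub>R b)" by (simp add: euclidean_representation)
      then have "L v = (\<Sum>b\<in>Basis. (v \<bullet> b) *\<^sub>R L b)" by (simp only: L.sum L.scaleR)
      then have "L v \<bullet> c = (\<Sum>b\<in>Basis. (v \<bullet> b) * (L b \<bullet> c))" for c
        by (simp only: inner_sum_left inner_scaleR_left)
      then have "grad_map D (L x) (L v) = (\<Sum>c\<in>Basis. \<Sum>b\<in>Basis. ((v \<bullet> b) * (L b \<bullet> c)) *\<^sub>R D c (L x))"
        by (simp only: grad_map_def scaleR_sum_left)
      also have "\<dots> = (\<Sum>b\<in>Basis. \<Sum>c\<in>Basis. ((v \<bullet> b) * (L b \<bullet> c)) *\<^sub>R D c (L x))"
        by (rule sum.swap)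
      also have "\<dots> = grad_map (\<lambda>b x. \<Sum>c\<in>Basis. complex_of_real (L b \<bullet> c) * D c (L x)) x v"
        by (simp add: grad_map_def scaleR_conv_of_real sum_distrib_left mult.assoc)
      finally show "grad_map D (L x) (L v) = grad_map (\<lambda>b x. \<Sum>c\<in>Basis. complex_of_real (L b \<bullet> c) * D c (L x)) x v" .
    qed
    ultimately show "((\<lambda>x. f (L x)) has_derivative grad_map (\<lambda>b x. \<Sum>c\<in>Basis. complex_of_real (L b \<bullet> c) * D c (L x)) x) (at x)"
      by simp
  qed (use D Suc.IH in \<open>auto intro!: Ck_on_sum Ck_on_mult Ck_on_const\<close>)
qed

lemma Ck_on_linear:
  assumes "bounded_linear L" shows "Ck_on n U (\<lambda>x. complex_of_real (L x))"
proof -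
  have "Ck_on n U complex_of_real" for U :: "real set"
  proof (cases n)
    case (Suc m)
    have "(complex_of_real has_derivative grad_map (\<lambda>b x. 1) x) (at x)" for x
      using bounded_linear_imp_has_derivative[OF bounded_linear_of_real, of "at x"]
      by (simp add: grad_map_def[abs_def] scaleR_conv_of_real)
    then show ?thesis unfolding Suc by (intro Ck_on_SucI) (auto intro: Ck_on_const)
  qed (simp add: continuous_on_of_real_id)
  then show ?thesis using Ck_on_linear_compose[OF assms, of n UNIV complex_of_real U] by auto
qed

lemma Ck_on_Re: "Ck_on n U f \<Longrightarrow> Ck_on n U (\<lambda>x. complex_of_real (Re (f x)))"
proof -
  assume f: "Ck_on n U f"
  have "(\<lambda>x. complex_of_real (Re (f x))) = (\<lambda>x. (1/2) * (f x + cnj (f x)))"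
    by (auto simp: complex_eq_iff)
  then show ?thesis using f by (simp only:) (intro Ck_on_mult Ck_on_add Ck_on_cnj Ck_on_const; simp)
qed

text \<open>Chain rule with a real inner function. The class speaks of complex-valued functions
  only, so \<open>u\<close> is embedded by \<open>complex_of_real\<close>, and real parts recover
  its derivatives.\<close>

lemma Ck_on_real_compose:
  fixes g :: "real \<Rightarrow> complex" and u :: "'a::euclidean_space \<Rightarrow> real"
  assumes "Ck_on n UNIV g" "Ck_on n U (\<lambda>x. complex_of_real (u x))"
  shows "Ck_on n U (\<lambda>x. g (u x))"
  using assms
proof (induction n arbitrary: g)
  case 0
  have "continuous_on U (\<lambda>x. Re (complex_of_real (u x)))"
    using 0 by (intro continuous_on_Re) auto
  then show ?case using 0 by (auto intro: continuous_on_compose2[of UNIV g])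
next
  case (Suc n)
  from Suc.prems obtain D where
    D: "\<forall>x\<in>U. ((\<lambda>x. complex_of_real (u x)) has_derivative grad_map D x) (at x)" "\<forall>b\<in>Basis. Ck_on n U (D b)"
    unfolding Ck_on.simps(2) by blast
  from Suc.prems(1) obtain E where
    E: "\<And>t. (g has_derivative grad_map E t) (at t)" "Ck_on n UNIV (E 1)"
    by auto
  show ?case
  proof (rule Ck_on_SucI[where D="\<lambda>b x. complex_of_real (Re (D b x)) * E 1 (u x)"])
    fix x assume "x \<in> U"
    then have "((\<lambda>x. Re (complex_of_real (u x))) has_derivative (\<lambda>v. Re (grad_map D x v))) (at x)"
      using D by (intro has_derivative_Re) auto
    then have "(u has_derivative (\<lambda>v. Re (grad_map D x v))) (at x)" by simp
    from has_derivative_compose[OF this E(1)]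
    have "((\<lambda>x. g (u x)) has_derivative (\<lambda>v. grad_map E (u x) (Re (grad_map D x v)))) (at x)" .
    moreover have "(\<lambda>v. grad_map E (u x) (Re (grad_map D x v))) = grad_map (\<lambda>b x. complex_of_real (Re (D b x)) * E 1 (u x)) x"
      by (auto simp: grad_map_def scaleR_conv_of_real sum_distrib_right mult.assoc)
    ultimately show "((\<lambda>x. g (u x)) has_derivative grad_map (\<lambda>b x. complex_of_real (Re (D b x)) * E 1 (u x)) x) (at x)"
      by simp
  next
    fix b :: 'a assume "b \<in> Basis"
    show "Ck_on n U (\<lambda>x. complex_of_real (Re (D b x)) * E 1 (u x))"
      using D(2) \<open>b \<in> Basis\<close>
      by (intro Ck_on_mult[OF Ck_on_Re Suc.IH[OF E(2) Ck_on_Suc_imp[OF Suc.prems(2)]]]) auto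
  qed
qed

text \<open>Uniqueness of the derivative makes the two families of partial derivatives agree on the
  overlap, so they glue to one family, to which the induction hypothesis applies.\<close>

lemma Ck_on_Un:
  assumes "open U" "open V" "Ck_on n U h" "Ck_on n V h"
  shows "Ck_on n (U \<union> V) h"
  using assms(3,4)
proof (induction n arbitrary: h)
  case 0 then show ?case using assms(1,2) by (auto intro: continuous_on_open_Un)
next
  case (Suc n)
  then obtain D E where
    D: "\<forall>x\<in>U. (h has_derivative grad_map D x) (at x)" "\<forall>b\<in>Basis. Ck_on n U (D b)" and
    E: "\<forall>x\<in>V. (h has_derivative grad_map E x) (at x)" "\<forall>b\<in>Basis. Ck_on n V (E b)"
    unfolding Ck_on.simps(2) by blast
  define F where "F = (\<lambda>b x. if x \<in> U then D b x else E b x)"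
  have eq: "D b x = E b x" if "x \<in> U" "x \<in> V" "b \<in> Basis" for b x
  proof -
    have "grad_map D x = grad_map E x"
      using D E that by (blast intro: has_derivative_unique)
    then have "grad_map D x b = grad_map E x b" by simp
    then show ?thesis using that by (simp add: grad_map_Basis)
  qed
  show ?case
  proof (rule Ck_on_SucI[where D=F])
    fix x assume x: "x \<in> U \<union> V"
    have "grad_map F x = (if x \<in> U then grad_map D x else grad_map E x)"
      by (auto simp: grad_map_def F_def)
    then show "(h has_derivative grad_map F x) (at x)" using x D E by auto
  next
    fix b :: 'a assume b: "b \<in> Basis"
    have "Ck_on n U (F b)" using D b Ck_on_cong[OF assms(1), of "F b" "D b"] by (auto simp: F_def)
    moreover have "Ck_on n V (F b)" using E b eq Ck_on_cong[OF assms(2), of "F b" "E b"] by (auto simp: F_def)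
    ultimately show "Ck_on n (U \<union> V) (F b)" by (rule Suc.IH)
  qed
qed

text \<open>The function is glued to the zero function on the open complement of \<open>S\<close>.
  This makes quotients globally smooth once a cutoff keeps them away from the zeros of the
  denominator.\<close>

lemma Ck_on_zero_extend:
  assumes "open U" "closed S" "S \<subseteq> U" "Ck_on n U h" "\<And>x. x \<notin> S \<Longrightarrow> h x = 0"
  shows "Ck_on n UNIV h"
proof -
  have "Ck_on n (-S) h"
    using Ck_on_cong[of "-S" h "\<lambda>_. 0" n] assms by (auto intro: Ck_on_const)
  then have "Ck_on n (U \<union> -S) h" using assms by (intro Ck_on_Un) auto
  moreover have "U \<union> -S = UNIV" using assms by auto
  ultimately show ?thesis by simp
qed

section \<open>Iterated derivatives, smooth functions and test functions\<close>

lemma iter_deriv_Nil [simp]: "iter_deriv [] f = f"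
  by (simp add: iter_deriv_def)

lemma iter_deriv_Cons: "iter_deriv (b # vs) f = dir_deriv b (iter_deriv vs f)"
  by (simp add: iter_deriv_def)

lemma iter_deriv_append: "iter_deriv (us @ vs) f = iter_deriv us (iter_deriv vs f)"
  by (simp add: iter_deriv_def)

lemma iter_deriv_singleton: "iter_deriv [b] f = dir_deriv b f"
  by (simp add: iter_deriv_def)

lemma differentiable_has_derivative_dir_deriv:
  assumes "h differentiable (at x)"
  shows "(h has_derivative grad_map (\<lambda>b. dir_deriv b h) x) (at x)"
  using has_derivative_grad_map[OF assms[unfolded frechet_derivative_works]]
  by (simp add: grad_map_def[abs_def] dir_deriv_def)

text \<open>\<open>iter_deriv\<close> applies the last list entry first, so the additional
  derivative is an entry appended at the end.\<close>

lemma smooth_dir_deriv: "smooth f \<Longrightarrow> b \<in> Basis \<Longrightarrow> smooth (dir_deriv b f)"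
  unfolding smooth_def by (metis iter_deriv_append iter_deriv_singleton set_append set_simps Un_least
      empty_subsetI insert_subset)

lemma smooth_differentiable: "smooth f \<Longrightarrow> f differentiable (at x)"
  unfolding smooth_def by (metis iter_deriv_Nil empty_subsetI set_empty2)

lemma smooth_Ck_on: "smooth f \<Longrightarrow> Ck_on n UNIV f"
proof (induction n arbitrary: f)
  case 0 then show ?case
    by (auto intro!: continuous_at_imp_continuous_on differentiable_imp_continuous_within smooth_differentiable)
next
  case (Suc n) then show ?case
    by (intro Ck_on_SucI[where D="\<lambda>b. dir_deriv b f"])
      (auto intro: differentiable_has_derivative_dir_deriv smooth_dir_deriv smooth_differentiable)
qed

definition test_function :: "('a::euclidean_space \<Rightarrow> complex) \<Rightarrow> bool" where
  "test_function h \<longleftrightarrow> (\<forall>n. Ck_on n UNIV h) \<and> (\<exists>R. \<forall>x. R < norm x \<longrightarrow> h x = 0)"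

lemma test_function_continuous: "test_function h \<Longrightarrow> continuous_on UNIV h"
  unfolding test_function_def using Ck_on_continuous by blast

lemma test_function_mult:
  assumes "test_function h" "\<And>n. Ck_on n UNIV g" shows "test_function (\<lambda>x. h x * g x)"
  using assms unfolding test_function_def by (auto intro!: Ck_on_mult) 

text \<open>Membership in \<open>Ck_on\<close> for each order comes with its own family of partial
  derivatives. These all coincide by uniqueness of the derivative, so the family of order one is
  itself of every class. Outside the support the function is locally zero, and so are its
  derivatives.\<close>

lemma test_function_deriv:
  assumes "test_function h"
  obtains D where "\<And>x. (h has_derivative grad_map D x) (at x)" "\<And>b. b \<in> Basis \<Longrightarrow> test_function (D b)"
proof -
  obtain R where R: "\<And>x. R < norm x \<Longrightarrow> h x = 0"
    using assms unfolding test_function_def by blast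
  have C: "Ck_on n UNIV h" for n
    using assms unfolding test_function_def by blast
  from C[of "Suc 0"] obtain D0 where D0: "\<forall>x\<in>UNIV. (h has_derivative grad_map D0 x) (at x)"
    unfolding Ck_on.simps(2) by blast
  have D: "Ck_on n UNIV (D0 b)" if b: "b \<in> Basis" for n b
  proof -
    from C[of "Suc n"] obtain D1 where D1: "\<forall>x\<in>UNIV. (h has_derivative grad_map D1 x) (at x)"
      "\<forall>b\<in>Basis. Ck_on n UNIV (D1 b)"
      unfolding Ck_on.simps(2) by blast
    have "D1 b = D0 b"
    proof
      fix x
      have "grad_map D0 x = grad_map D1 x" using D0 D1 by (blast intro: has_derivative_unique)
      then show "D1 b x = D0 b x" using b by (metis grad_map_Basis)
    qed
    then show ?thesis using D1 b by auto
  qed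
  have "D0 b x = 0" if "b \<in> Basis" "R < norm x" for b x
  proof -
    have "open {y::'a. R < norm y}" by (intro open_Collect_less continuous_intros)
    then have "(h has_derivative (\<lambda>_. 0)) (at x)"
      using R that has_derivative_transform_within_open[of "\<lambda>_. 0" "\<lambda>_. 0" x UNIV "{y. R < norm y}" h]
      by auto
    then have "grad_map D0 x = (\<lambda>_. 0)" using D0 by (blast intro: has_derivative_unique)
    then show ?thesis using that by (metis grad_map_Basis)
  qed
  then have "test_function (D0 b)" if "b \<in> Basis" for b
    unfolding test_function_def using that D by blast
  then show ?thesis using that D0 by blast
qed

section \<open>Integrals under affine maps, rapidly decreasing functions\<close>

text \<open>Change of variables with the map left abstract: the hypothesis expresses Lebesgue
  measure as \<open>k\<close> times its image under \<open>L\<close>. Scalings, translations and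
  shear matrices are all instances.\<close>

lemma nn_integral_density_distr:
  assumes L: "(lborel :: 'a::euclidean_space measure) = density (distr lborel borel L) (\<lambda>_. ennreal k)"
    and [measurable]: "L \<in> borel_measurable borel" "f \<in> borel_measurable borel"
  shows "(\<integral>\<^sup>+x. f x \<partial>lborel) = ennreal k * (\<integral>\<^sup>+x. f (L x) \<partial>(lborel :: 'a measure))"
  by (subst L) (simp add: nn_integral_density nn_integral_distr nn_integral_cmult)

lemma integral_density_distr:
  fixes f :: "'a::euclidean_space \<Rightarrow> complex"
  assumes L: "(lborel :: 'a measure) = density (distr lborel borel L) (\<lambda>_. ennreal k)"
    and [measurable]: "L \<in> borel_measurable borel" "f \<in> borel_measurable borel" and "k \<ge> 0"
  shows "(\<integral>x. f x \<partial>lborel) = k *\<^sub>R (\<integral>x. f (L x) \<partial>lborel)"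
  by (subst L) (simp add: integral_density integral_distr \<open>k \<ge> 0\<close>)

lemma integrable_density_distr:
  fixes f :: "'a::euclidean_space \<Rightarrow> 'b::{banach,second_countable_topology}"
  assumes L: "(lborel :: 'a measure) = density (distr lborel borel L) (\<lambda>_. ennreal k)"
    and [measurable]: "L \<in> borel_measurable borel" "f \<in> borel_measurable borel" and "k > 0"
  shows "integrable lborel f \<longleftrightarrow> integrable lborel (\<lambda>x. f (L x))"
proof -
  have "integrable lborel f \<longleftrightarrow> integrable (density (distr lborel borel L) (\<lambda>_. ennreal k)) f"
    by (subst L) simp
  also have "\<dots> \<longleftrightarrow> integrable lborel (\<lambda>x. f (L x))"
  proof -
    have "integrable lborel (\<lambda>x. f (L x))" if "integrable lborel (\<lambda>x. k *\<^sub>R f (L x))"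
      using integrable_scaleR_right[of "inverse k", OF that] \<open>k > 0\<close> by simp
    then show ?thesis
      using \<open>k > 0\<close> by (auto simp: integrable_density integrable_distr_eq)
  qed
  finally show ?thesis .
qed

lemma lborel_scale:
  fixes t :: "'a::euclidean_space"
  assumes "c \<noteq> 0"
  shows "(lborel :: 'a measure) = density (distr lborel borel (\<lambda>x. c *\<^sub>R x + t)) (\<lambda>_. ennreal (\<bar>c\<bar> ^ DIM('a)))"
  using lborel_affine[OF assms, of t] by (simp add: ennreal_power add.commute)

lemma nn_integral_scale:
  assumes "c \<noteq> 0" and [measurable]: "f \<in> borel_measurable borel"
  shows "(\<integral>\<^sup>+x. f x \<partial>lborel) = ennreal (\<bar>c\<bar> ^ DIM('a)) * (\<integral>\<^sup>+x. f (c *\<^sub>R x + t) \<partial>(lborel :: 'a::euclidean_space measure))"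
  by (rule nn_integral_density_distr[OF lborel_scale[OF assms(1)]]) measurable

lemma integral_scale:
  fixes f :: "'a::euclidean_space \<Rightarrow> complex"
  assumes "c \<noteq> 0" and [measurable]: "f \<in> borel_measurable borel"
  shows "(\<integral>x. f x \<partial>lborel) = (\<bar>c\<bar> ^ DIM('a)) *\<^sub>R (\<integral>x. f (c *\<^sub>R x + t) \<partial>lborel)"
  by (rule integral_density_distr[OF lborel_scale[OF assms(1)]]) auto

lemma integrable_scale:
  fixes f :: "'a::euclidean_space \<Rightarrow> 'b::{banach,second_countable_topology}"
  assumes "c \<noteq> 0" and [measurable]: "f \<in> borel_measurable borel"
  shows "integrable lborel f \<longleftrightarrow> integrable lborel (\<lambda>x. f (c *\<^sub>R x + t))"
  using assms(1) by (intro integrable_density_distr[OF lborel_scale[OF assms(1)]]) auto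

lemma nn_integral_translate:
  assumes [measurable]: "f \<in> borel_measurable borel"
  shows "(\<integral>\<^sup>+x. f (x + t) \<partial>lborel) = (\<integral>\<^sup>+x. f x \<partial>(lborel :: 'a::euclidean_space measure))"
  using nn_integral_scale[of 1 f t] by simp

lemma integral_translate:
  fixes f :: "'a::euclidean_space \<Rightarrow> complex"
  assumes [measurable]: "f \<in> borel_measurable borel"
  shows "(\<integral>x. f (x + t) \<partial>lborel) = (\<integral>x. f x \<partial>lborel)"
  using integral_scale[of 1 f t] by simp

lemma integral_reflect:
  fixes f :: "'a::euclidean_space \<Rightarrow> complex"
  assumes [measurable]: "f \<in> borel_measurable borel"
  shows "(\<integral>x. f (t - x) \<partial>lborel) = (\<integral>x. f x \<partial>lborel)"
  using integral_scale[of "-1" f t] by simp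

lemma integrable_reflect:
  fixes f :: "'a::euclidean_space \<Rightarrow> 'b::{banach,second_countable_topology}"
  assumes [measurable]: "f \<in> borel_measurable borel"
  shows "integrable lborel (\<lambda>x. f (t - x)) \<longleftrightarrow> integrable lborel f"
  using integrable_scale[of "-1" f t] by simp

text \<open>The weight is dominated by a sum over dyadic balls, the ball of radius
  \<open>2 ^ Suc k\<close> carrying the height \<open>2 powr (- m * k)\<close>. Its volume grows
  like \<open>2 powr (d * k)\<close>, so the integral is bounded by a geometric series of ratio
  \<open>2 powr (d - m)\<close>.\<close>

lemma nn_integral_weight_finite:
  assumes "real DIM('a) < m"
  shows "(\<integral>\<^sup>+x. ennreal ((1 + norm x) powr - m) \<partial>(lborel :: 'a::euclidean_space measure)) < \<infinity>"
proof -
  define d where "d = DIM('a)"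
  have m: "m > 0" using assms by (smt (verit) of_nat_0_le_iff)
  have bnd: "ennreal ((1 + norm x) powr - m) \<le> (\<Sum>k. ennreal (2 powr (- m * k)) * indicator (ball 0 (2 ^ Suc k)) x)" for x :: 'a
  proof -
    \<comment> \<open>The dyadic shell of \<open>x\<close>: the integer with
      \<open>2 ^ k \<le> 1 + norm x < 2 ^ Suc k\<close>.\<close>
    define k where "k = nat \<lfloor>log 2 (1 + norm x)\<rfloor>"
    have l0: "log 2 (1 + norm x) \<ge> 0" by (simp add: zero_le_log_cancel_iff add_pos_nonneg)
    have k1: "real k \<le> log 2 (1 + norm x)" "log 2 (1 + norm x) < real k + 1"
      unfolding k_def using l0 by linarith+
    have "2 powr real k \<le> 1 + norm x" "1 + norm x < 2 powr (real k + 1)"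
      using k1 by (simp_all add: le_log_iff log_less_iff add_pos_nonneg)
    then have "x \<in> ball 0 (2 ^ Suc k)" and "2 powr real k \<le> 1 + norm x"
      by (auto simp: powr_add powr_realpow simp del: power_Suc) (simp add: mult.commute)
    then have "(1 + norm x) powr - m \<le> (2 powr real k) powr - m"
      using m by (intro powr_mono2') auto
    also have "\<dots> = 2 powr (- m * k)" by (simp add: powr_powr mult.commute)
    finally have "ennreal ((1 + norm x) powr - m) \<le> ennreal (2 powr (- m * k)) * indicator (ball 0 (2 ^ Suc k)) x"
      using \<open>x \<in> ball 0 (2 ^ Suc k)\<close> by (simp add: ennreal_leI)
    also have "\<dots> \<le> (\<Sum>k. ennreal (2 powr (- m * k)) * indicator (ball 0 (2 ^ Suc k)) x)"
      using sum_le_suminf[of "\<lambda>k. ennreal (2 powr (- m * k)) * indicator (ball 0 (2 ^ Suc k)) x" "{k}"]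
      by (simp only: sum.insert finite.intros sum.empty) (simp del: power_Suc sum_mult_indicator)
    finally show ?thesis .
  qed
  define S :: "nat \<Rightarrow> 'a set" where "S k = ball 0 (2 ^ Suc k)" for k
  define w :: "nat \<Rightarrow> ennreal" where "w k = ennreal (2 powr (- m * k))" for k
  have [measurable]: "S k \<in> sets borel" for k by (simp add: S_def)
  have "(\<integral>\<^sup>+x. ennreal ((1 + norm x) powr - m) \<partial>(lborel :: 'a measure)) \<le>
    (\<integral>\<^sup>+x. (\<Sum>k. w k * indicator (S k) x) \<partial>(lborel :: 'a measure))"
    unfolding S_def w_def by (intro nn_integral_mono bnd)
  also have "\<dots> = (\<Sum>k. \<integral>\<^sup>+x. w k * indicator (S k) x \<partial>(lborel :: 'a measure))"
    by (rule nn_integral_suminf) measurable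
  also have "\<dots> = (\<Sum>k. w k * emeasure lborel (S k))"
    by (intro suminf_cong nn_integral_cmult_indicator) simp
  also have "\<dots> = (\<Sum>k. ennreal (unit_ball_vol d * 2 ^ d * (2 powr (real d - m)) ^ k))"
  proof (intro suminf_cong)
    fix k
    have "2 powr (- m * k) * (unit_ball_vol d * (2 ^ Suc k) ^ d) = unit_ball_vol d * 2 ^ d * (2 powr (real d - m)) ^ k"
    proof -
      have "(2 ^ Suc k) ^ d = (2::real) ^ d * 2 powr (real d * real k)"
        by (simp add: power_mult_distrib power_mult[symmetric] powr_realpow[symmetric] powr_powr mult.commute)
      moreover have "(2 powr (real d - m)) ^ k = 2 powr (real d * real k) * 2 powr (- m * k)"
        by (simp add: powr_realpow[symmetric] powr_powr powr_add[symmetric] algebra_simps)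
      ultimately show ?thesis by simp
    qed
    then show "w k * emeasure lborel (S k) = ennreal (unit_ball_vol d * 2 ^ d * (2 powr (real d - m)) ^ k)"
      unfolding S_def w_def by (subst emeasure_ball) (auto simp: ennreal_mult'[symmetric] d_def)
  qed
  also have "\<dots> < \<infinity>"
  proof -
    have "2 powr (real d - m) < 2 powr 0" using assms by (intro powr_less_mono) (auto simp: d_def)
    then have "summable (\<lambda>k. unit_ball_vol d * 2 ^ d * (2 powr (real d - m)) ^ k)"
      by (intro summable_mult summable_geometric) simp
    then show ?thesis
      by (subst suminf_ennreal2) auto
  qed
  finally show ?thesis .
qed

lemma integrable_weight:
  assumes "real DIM('a) < m"
  shows "integrable lborel (\<lambda>x::'a::euclidean_space. (1 + norm x) powr - m)"
  by (rule integrableI_nonneg) (use nn_integral_weight_finite[OF assms] in auto)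

text \<open>Decay without any condition on derivatives. This is what is required of the kernels
  integrated against a convolution, whereas membership in \<open>schwartz\<close> is required only
  of functions to which a distribution is applied.\<close>

definition rapid :: "('a::euclidean_space \<Rightarrow> complex) \<Rightarrow> bool" where
  "rapid g \<longleftrightarrow> continuous_on UNIV g \<and> (\<forall>N::nat. \<exists>B. \<forall>x. (1 + norm x) ^ N * norm (g x) \<le> B)"

lemma rapid_continuous: "rapid g \<Longrightarrow> continuous_on UNIV g"
  by (simp add: rapid_def)

lemma rapid_measurable: "rapid g \<Longrightarrow> g \<in> borel_measurable borel"
  by (simp add: rapid_def borel_measurable_continuous_onI)

lemma rapid_decay:
  assumes "rapid g" obtains B where "B > 0" "\<And>x. norm (g x) \<le> B * (1 + norm x) powr - a"
proof -
  obtain N :: nat where N: "a \<le> real N" by (meson real_arch_simple)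
  obtain B where B: "\<And>x. (1 + norm x) ^ N * norm (g x) \<le> B"
    using assms unfolding rapid_def by blast
  have "norm (g x) \<le> (\<bar>B\<bar> + 1) * (1 + norm x) powr - a" for x
  proof -
    have "(1 + norm x) powr a * norm (g x) \<le> (1 + norm x) powr N * norm (g x)"
      using N by (intro mult_right_mono powr_mono) auto
    also have "\<dots> \<le> \<bar>B\<bar> + 1" using B[of x] by (subst powr_realpow) (auto simp: add_pos_nonneg)
    finally have "(1 + norm x) powr - a * ((1 + norm x) powr a * norm (g x)) \<le> (1 + norm x) powr - a * (\<bar>B\<bar> + 1)"
      by (intro mult_left_mono) auto
    moreover have "(1 + norm x) powr - a * ((1 + norm x) powr a * norm (g x)) = norm (g x)"
      by (simp add: mult.assoc[symmetric] powr_add[symmetric] add_nonneg_eq_0_iff)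
    ultimately show ?thesis by (metis mult.commute)
  qed
  then show ?thesis by (intro that[of "\<bar>B\<bar> + 1"]) auto
qed

lemma rapidI:
  assumes "continuous_on UNIV g" "\<And>N::nat. \<exists>B. \<forall>x. (1 + norm x) ^ N * norm (g x) \<le> B"
  shows "rapid g"
  using assms by (simp add: rapid_def)

lemma rapid_bounded: assumes "rapid g" obtains B where "B > 0" "\<And>x. norm (g x) \<le> B"
proof -
  obtain B where "B > 0" "\<And>x. norm (g x) \<le> B * (1 + norm x) powr - 0"
    using rapid_decay[OF assms] by blast
  then show ?thesis using that[of B] by (simp add: add_nonneg_eq_0_iff)
qed

lemma rapid_integrable_powr:
  assumes "rapid g"
  shows "integrable lborel (\<lambda>x. (1 + norm x) powr a * norm (g x))"
proof -
  have [measurable]: "g \<in> borel_measurable borel" using assms by (rule rapid_measurable)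
  obtain B where B: "B > 0" "\<And>x. norm (g x) \<le> B * (1 + norm x) powr - (a + real DIM('a) + 1)"
    using rapid_decay[OF assms] by blast
  show ?thesis
  proof (rule Bochner_Integration.integrable_bound)
    show "integrable lborel (\<lambda>x::'a. B * (1 + norm x) powr - (real DIM('a) + 1))"
      by (intro integrable_mult_right integrable_weight) simp
    show "AE x in lborel. norm ((1 + norm x) powr a * norm (g x)) \<le> norm (B * (1 + norm x) powr - (real DIM('a) + 1))"
    proof (intro AE_I2)
      fix x :: 'a
      have "(1 + norm x) powr a * norm (g x) \<le> (1 + norm x) powr a * (B * (1 + norm x) powr - (a + real DIM('a) + 1))"
        using B by (intro mult_left_mono) auto
      also have "\<dots> = B * ((1 + norm x) powr (a + - (a + real DIM('a) + 1)))"
        by (simp only: powr_add mult_ac)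
      finally show "norm ((1 + norm x) powr a * norm (g x)) \<le> norm (B * (1 + norm x) powr - (real DIM('a) + 1))"
        using B(1) by simp
    qed
  qed auto
qed

lemma rapid_integrable_weight:
  assumes "rapid g"
  shows "integrable lborel (\<lambda>x. (1 + norm x) ^ N * norm (g x))"
  using rapid_integrable_powr[OF assms, of "real N"]
  by (simp add: powr_realpow add_pos_nonneg)

lemma rapid_integrable: "rapid g \<Longrightarrow> integrable lborel g"
  using rapid_integrable_weight[of g 0] rapid_measurable[of g]
  by (simp add: integrable_norm_iff)

lemma rapid_mult_bounded:
  assumes "rapid g" "continuous_on UNIV h" "\<And>x. norm (h x) \<le> C * (1 + norm x) ^ m"
  shows "rapid (\<lambda>x. h x * g x)"
proof (rule rapidI)
  show "continuous_on UNIV (\<lambda>x. h x * g x)"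
    using assms rapid_continuous by (intro continuous_on_mult) auto
  fix N
  obtain B where B: "\<And>x. (1 + norm x) ^ (N + m) * norm (g x) \<le> B"
    using assms(1) unfolding rapid_def by blast
  have "(1 + norm x) ^ N * norm (h x * g x) \<le> \<bar>C\<bar> * B" for x
  proof -
    have "norm (h x) \<le> \<bar>C\<bar> * (1 + norm x) ^ m"
      using assms(3)[of x] by (smt (verit) mult_right_mono zero_le_power norm_ge_zero)
    then have "(1 + norm x) ^ N * norm (h x * g x) \<le> (1 + norm x) ^ N * ((\<bar>C\<bar> * (1 + norm x) ^ m) * norm (g x))"
      unfolding norm_mult by (intro mult_left_mono mult_right_mono) auto
    also have "\<dots> = \<bar>C\<bar> * ((1 + norm x) ^ (N + m) * norm (g x))" by (simp add: power_add)
    also have "\<dots> \<le> \<bar>C\<bar> * B" by (intro mult_left_mono B) auto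
    finally show ?thesis .
  qed
  then show "\<exists>B. \<forall>x. (1 + norm x) ^ N * norm (h x * g x) \<le> B" by blast
qed

lemma rapid_inner_mult: "rapid g \<Longrightarrow> rapid (\<lambda>x. complex_of_real (x \<bullet> b) * g x)"
  by (rule rapid_mult_bounded[where C="norm b" and m=1])
    (auto intro!: continuous_intros order_trans[OF Cauchy_Schwarz_ineq2] mult_right_mono simp: algebra_simps)

lemma rapid_cmult: "rapid g \<Longrightarrow> rapid (\<lambda>x. c * g x)"
  by (rule rapid_mult_bounded[where C="norm c" and m=0]) auto

lemma rapid_cnj: "rapid g \<Longrightarrow> rapid (\<lambda>x. cnj (g x))"
  by (simp add: rapid_def continuous_on_cnj)

lemma rapid_compose:
  fixes L :: "'a::euclidean_space \<Rightarrow> 'b::euclidean_space"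
  assumes "rapid g" "continuous_on UNIV L" "\<And>x. norm x \<le> C * norm (L x)"
  shows "rapid (\<lambda>x. g (L x))"
proof (rule rapidI)
  show "continuous_on UNIV (\<lambda>x. g (L x))"
    using continuous_on_compose2[of UNIV g UNIV L] assms rapid_continuous by auto
  fix N
  obtain B where B: "\<And>x. (1 + norm x) ^ N * norm (g x) \<le> B"
    using assms(1) unfolding rapid_def by blast
  have "(1 + norm x) ^ N * norm (g (L x)) \<le> (1 + \<bar>C\<bar>) ^ N * B" for x
  proof -
    have "norm x \<le> \<bar>C\<bar> * norm (L x)" using assms(3)[of x] by (smt (verit) mult_right_mono norm_ge_zero)
    then have "1 + norm x \<le> (1 + \<bar>C\<bar>) * (1 + norm (L x))"
      using norm_ge_zero[of "L x"] abs_ge_zero[of C] by (simp add: algebra_simps del: norm_ge_zero abs_ge_zero)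
    then have "(1 + norm x) ^ N * norm (g (L x)) \<le> ((1 + \<bar>C\<bar>) * (1 + norm (L x))) ^ N * norm (g (L x))"
      by (intro mult_right_mono power_mono) auto
    also have "\<dots> = (1 + \<bar>C\<bar>) ^ N * ((1 + norm (L x)) ^ N * norm (g (L x)))" by (simp add: power_mult_distrib)
    also have "\<dots> \<le> (1 + \<bar>C\<bar>) ^ N * B" by (intro mult_left_mono B) auto
    finally show ?thesis .
  qed
  then show "\<exists>B. \<forall>x. (1 + norm x) ^ N * norm (g (L x)) \<le> B" by blast
qed

lemma rapid_minus: "rapid g \<Longrightarrow> rapid (\<lambda>x. g (- x))"
  by (rule rapid_compose[where C=1]) (auto intro!: continuous_intros)

lemma test_function_bounded:
  assumes "test_function h" obtains B where "B > 0" "\<And>x. norm (h x) \<le> B"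
proof -
  obtain R where R: "\<And>x. R < norm x \<Longrightarrow> h x = 0" using assms unfolding test_function_def by blast
  have "bounded (h ` cball 0 R)"
    using test_function_continuous[OF assms]
    by (intro compact_imp_bounded compact_continuous_image) (auto intro: continuous_on_subset)
  then obtain B where B: "\<And>x. x \<in> cball 0 R \<Longrightarrow> norm (h x) \<le> B"
    unfolding bounded_iff by blast
  have "norm (h x) \<le> \<bar>B\<bar> + 1" for x
    using R[of x] B[of x] by (cases "norm x \<le> R") auto
  then show ?thesis by (intro that[of "\<bar>B\<bar> + 1"]) auto
qed

lemma test_function_rapid:
  assumes "test_function h" shows "rapid h"
proof (rule rapidI[OF test_function_continuous[OF assms]])
  fix N
  obtain R where R: "\<And>x. R < norm x \<Longrightarrow> h x = 0" using assms unfolding test_function_def by blast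
  obtain B where B: "B > 0" "\<And>x. norm (h x) \<le> B" using test_function_bounded[OF assms] by blast
  have "(1 + norm x) ^ N * norm (h x) \<le> (1 + \<bar>R\<bar>) ^ N * B" for x
  proof (cases "norm x \<le> R")
    case True then show ?thesis using B by (intro mult_mono power_mono) auto
  next
    case False then show ?thesis using R[of x] B by simp
  qed
  then show "\<exists>B. \<forall>x. (1 + norm x) ^ N * norm (h x) \<le> B" by blast
qed

section \<open>Differentiation under the integral sign and Taylor bounds\<close>

lemma has_derivative_lebesgue_integral:
  fixes H :: "'e::euclidean_space \<Rightarrow> 'x::euclidean_space \<Rightarrow> complex"
  assumes int: "\<And>v. norm v \<le> 1 \<Longrightarrow> integrable M (H (y + v))"
    and int': "\<And>b. b \<in> Basis \<Longrightarrow> integrable M (H' b)" and k: "integrable M k"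
    and bnd: "\<And>v x. norm v \<le> 1 \<Longrightarrow> norm (H (y + v) x - H y x - (\<Sum>b\<in>Basis. (v \<bullet> b) *\<^sub>R H' b x)) \<le> (norm v)\<^sup>2 * k x"
  shows "((\<lambda>y. \<integral>x. H y x \<partial>M) has_derivative grad_map (\<lambda>b y. \<integral>x. H' b x \<partial>M) y) (at y)"
  unfolding has_derivative_at
proof
  let ?D = "grad_map (\<lambda>b y. \<integral>x. H' b x \<partial>M) y"
  show "bounded_linear ?D"
    unfolding grad_map_def[abs_def] by (intro bounded_linear_sum bounded_linear_scaleR_const bounded_linear_inner_left)
  define C where "C = \<bar>integral\<^sup>L M k\<bar>"
  \<comment> \<open>A remainder that is quadratic in \<open>v\<close> with an integrable factor
    integrates to something quadratic in \<open>v\<close>; after division by \<open>norm v\<close> a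
    linear bound remains.\<close>
  have *: "norm (norm ((\<integral>x. H (y + v) x \<partial>M) - (\<integral>x. H y x \<partial>M) - ?D v) / norm v) \<le> norm v * C" if v: "norm v \<le> 1" for v
  proof -
    have "(\<integral>x. H (y + v) x \<partial>M) - (\<integral>x. H y x \<partial>M) - ?D v =
        (\<integral>x. H (y + v) x - H y x - (\<Sum>b\<in>Basis. (v \<bullet> b) *\<^sub>R H' b x) \<partial>M)"
      using int[OF v] int[of 0] int' by (simp add: grad_map_def)
    also have "norm \<dots> \<le> (\<integral>x. (norm v)\<^sup>2 * k x \<partial>M)"
      by (rule Bochner_Integration.integral_norm_bound_integral)
        (use int[OF v] int[of 0] int' k bnd[OF v] in \<open>auto intro!: Bochner_Integration.integrable_diff Bochner_Integration.integrable_sum\<close>)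
    also have "\<dots> = (norm v)\<^sup>2 * integral\<^sup>L M k" by simp
    also have "\<dots> \<le> (norm v)\<^sup>2 * C" unfolding C_def by (intro mult_left_mono) auto
    finally show ?thesis by (cases "v = 0") (auto simp: field_simps power2_eq_square)
  qed
  have "((\<lambda>v::'e. norm v * C) \<longlongrightarrow> 0) (at 0)" by (auto intro!: tendsto_eq_intros)
  moreover have "eventually (\<lambda>v. norm (norm ((\<integral>x. H (y + v) x \<partial>M) - (\<integral>x. H y x \<partial>M) - ?D v) / norm v) \<le> norm v * C) (at 0)"
    unfolding eventually_at using * by (intro exI[of _ 1]) (auto simp only: dist_norm diff_zero less_imp_le zero_less_one)
  ultimately show "(\<lambda>v. norm ((\<integral>x. H (y + v) x \<partial>M) - (\<integral>x. H y x \<partial>M) - ?D v) / norm v) \<midarrow>0\<rightarrow> 0"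
    by (rule Lim_null_comparison[rotated])
qed

lemma onorm_grad_map_le:
  assumes "\<And>b. b \<in> Basis \<Longrightarrow> norm (D b x) \<le> B"
  shows "onorm (grad_map D (x::'a::euclidean_space)) \<le> real DIM('a) * B"
proof (rule onorm_le)
  fix v :: 'a
  have "norm (grad_map D x v) \<le> (\<Sum>b\<in>(Basis::'a set). norm v * B)"
    unfolding grad_map_def
    by (intro sum_norm_le) (use assms in \<open>auto intro!: mult_mono Basis_le_norm\<close>)
  then show "norm (grad_map D x v) \<le> real DIM('a) * B * norm v" by (simp add: mult_ac)
qed

lemma lipschitz_grad_map:
  fixes h :: "'a::euclidean_space \<Rightarrow> complex"
  assumes "\<And>x. x \<in> closed_segment y z \<Longrightarrow> (h has_derivative grad_map D x) (at x)"
    and "\<And>x b. x \<in> closed_segment y z \<Longrightarrow> b \<in> Basis \<Longrightarrow> norm (D b x) \<le> B"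
  shows "norm (h z - h y) \<le> real DIM('a) * B * norm (z - y)"
  by (rule differentiable_bound[where S="closed_segment y z" and f'="grad_map D"])
    (use assms in \<open>auto intro!: onorm_grad_map_le intro: has_derivative_at_withinI\<close>)

text \<open>The mean value inequality applied to \<open>h\<close> minus its linearisation at
  \<open>y\<close>: along the segment the gradient deviates from its value at \<open>y\<close> by at
  most a multiple of \<open>B * norm (z - y)\<close>, again by the mean value inequality.\<close>

lemma taylor_grad_map:
  fixes h :: "'a::euclidean_space \<Rightarrow> complex"
  assumes D: "\<And>x. x \<in> closed_segment y z \<Longrightarrow> (h has_derivative grad_map D x) (at x)"
    and E: "\<And>x b. x \<in> closed_segment y z \<Longrightarrow> b \<in> Basis \<Longrightarrow> (D b has_derivative grad_map (E b) x) (at x)"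
    and B: "\<And>x b c. x \<in> closed_segment y z \<Longrightarrow> b \<in> Basis \<Longrightarrow> c \<in> Basis \<Longrightarrow> norm (E b c x) \<le> B"
  shows "norm (h z - h y - grad_map D y (z - y)) \<le> (norm (z - y))\<^sup>2 * ((real DIM('a))\<^sup>2 * B)"
proof -
  have B0: "B \<ge> 0" using B[of y] SOME_Basis by (meson ends_in_segment(1) norm_ge_zero order_trans)
  have "norm (h z - h y - grad_map D y (z - y)) \<le> norm (z - y) * (real DIM('a) * (real DIM('a) * B * norm (z - y)))"
  proof (rule differentiable_bound_linearization[where S="closed_segment y z" and f'="grad_map D"])
    fix x assume x: "x \<in> closed_segment y z"
    have sub: "closed_segment y x \<subseteq> closed_segment y z" using x by (simp add: subset_closed_segment)
    have "norm (D b x - D b y) \<le> real DIM('a) * B * norm (z - y)" if "b \<in> Basis" for b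
    proof -
      have "norm (D b x - D b y) \<le> real DIM('a) * B * norm (x - y)"
        using sub that by (intro lipschitz_grad_map[where D="E b"] E B) auto
      also have "\<dots> \<le> real DIM('a) * B * norm (z - y)"
        using x B0 segment_bound(1)[OF x] by (intro mult_left_mono) (auto simp: norm_minus_commute)
      finally show ?thesis .
    qed
    moreover have "grad_map D x - grad_map D y = grad_map (\<lambda>b x. D b x - D b y) x"
      by (auto simp: grad_map_def fun_eq_iff sum_subtractf scaleR_diff_right)
    ultimately show "onorm (grad_map D x - grad_map D y) \<le> real DIM('a) * (real DIM('a) * B * norm (z - y))"
      by (auto intro!: onorm_grad_map_le)
  next
    fix t :: real assume "t \<in> {0..1}"
    then show "y + t *\<^sub>R (z - y) \<in> closed_segment y z"
      by (auto simp: closed_segment_def algebra_simps intro!: exI[of _ t])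
  qed (use D in \<open>auto intro: has_derivative_at_withinI\<close>)
  then show ?thesis by (simp add: power2_eq_square mult_ac)
qed

section \<open>Fourier transform\<close>

lemma fourier_cis: "fourier g \<xi> = (LINT x|lborel. g x * cis (- (2 * pi * (\<xi> \<bullet> x))))"
  unfolding fourier_def cis_conv_exp by (simp add: mult_ac)

lemma inverse_fourier_cis: "inverse_fourier h x = (LINT \<xi>|lborel. h \<xi> * cis (2 * pi * (\<xi> \<bullet> x)))"
  unfolding inverse_fourier_def cis_conv_exp by (simp add: mult_ac)

lemma inverse_fourier_eq_fourier: "inverse_fourier h x = fourier h (- x)"
  by (simp add: fourier_cis inverse_fourier_cis inner_commute)

lemma cis_measurable [measurable]: "cis \<in> borel_measurable borel"
  by (intro borel_measurable_continuous_onI continuous_intros)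

lemma integrable_mult_cis:
  assumes "integrable lborel g" "f \<in> borel_measurable lborel"
  shows "integrable lborel (\<lambda>x::'a::euclidean_space. g x * cis (f x))"
proof (rule Bochner_Integration.integrable_bound[OF assms(1)])
  have [measurable]: "g \<in> borel_measurable lborel" "f \<in> borel_measurable lborel" using assms by auto
  show "(\<lambda>x. g x * cis (f x)) \<in> borel_measurable lborel" by measurable
qed (simp add: norm_mult)

lemma norm_fourier_le: "norm (fourier g \<xi>) \<le> (LINT x|lborel. norm (g x))"
proof -
  have "norm (fourier g \<xi>) \<le> (LINT x|lborel. norm (g x * cis (- (2 * pi * (\<xi> \<bullet> x)))))"
    unfolding fourier_cis by (rule integral_norm_bound)
  then show ?thesis by (simp add: norm_mult)
qed

lemma fourier_continuous:
  fixes g :: "'a::euclidean_space \<Rightarrow> complex"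
  assumes "integrable lborel g" shows "continuous_on UNIV (fourier g)"
  unfolding continuous_on_sequentially
proof safe
  fix X and \<xi> :: 'a assume X: "X \<longlonglongrightarrow> \<xi>"
  have [measurable]: "g \<in> borel_measurable lborel" using assms by auto
  have "(\<lambda>n. fourier g (X n)) \<longlonglongrightarrow> fourier g \<xi>"
    unfolding fourier_cis
  proof (rule integral_dominated_convergence[where w="\<lambda>x. norm (g x)"])
    show "AE x in lborel. (\<lambda>n. g x * cis (- (2 * pi * (X n \<bullet> x)))) \<longlonglongrightarrow> g x * cis (- (2 * pi * (\<xi> \<bullet> x)))"
      using X by (intro AE_I2 tendsto_intros)
  qed (use assms in \<open>auto simp: norm_mult\<close>)
  then show "(fourier g \<circ> X) \<longlonglongrightarrow> fourier g \<xi>" by (simp add: o_def)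
qed

lemma norm_cis_remainder: "norm (cis t - 1 - \<i> * complex_of_real t) \<le> t\<^sup>2"
proof -
  have "norm (cis t - 1 - \<i> * complex_of_real t) \<le> \<bar>t\<bar>\<^sup>2 / 2"
    using iexp_approx1[of t 1] by (simp add: cis_conv_exp power2_eq_square diff_diff_eq)
  also have "\<dots> \<le> t\<^sup>2" by simp
  finally show ?thesis .
qed

text \<open>Differentiating the exponential brings down the factor
  \<open>- (2 * pi * \<i>) * (x \<bullet> b)\<close>, and the product of this factor with
  \<open>g\<close> is again rapid; hence the induction runs over all \<open>g\<close> at once. The
  quadratic remainder of \<open>cis\<close> supplies the domination needed under the
  integral.\<close>

lemma fourier_Ck_on: "rapid g \<Longrightarrow> Ck_on n UNIV (fourier g)"
proof (induction n arbitrary: g)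
  case 0 then show ?case by (simp add: fourier_continuous rapid_integrable)
next
  case (Suc n)
  have [measurable]: "g \<in> borel_measurable borel" using Suc.prems by (rule rapid_measurable)
  let ?D = "\<lambda>b x. complex_of_real (x \<bullet> b) * (- (2 * pi * \<i>) * g x)"
  have rD: "rapid (?D b)" for b
    using Suc.prems by (intro rapid_inner_mult rapid_cmult)
  show ?case
  proof (rule Ck_on_SucI[where D="\<lambda>b. fourier (?D b)"])
    fix \<xi> :: 'a
    have "((\<lambda>y. LINT x|lborel. g x * cis (- (2 * pi * (y \<bullet> x)))) has_derivative
       grad_map (\<lambda>b y. LINT x|lborel. ?D b x * cis (- (2 * pi * (\<xi> \<bullet> x)))) \<xi>) (at \<xi>)"
    proof (rule has_derivative_lebesgue_integral[where k="\<lambda>x. (2 * pi)\<^sup>2 * ((1 + norm x) ^ 2 * norm (g x))"])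
      show "integrable lborel (\<lambda>x. (2 * pi)\<^sup>2 * ((1 + norm x)\<^sup>2 * norm (g x)))"
        by (intro integrable_mult_right rapid_integrable_weight Suc.prems)
      show "integrable lborel (\<lambda>x. g x * cis (- (2 * pi * ((\<xi> + v) \<bullet> x))))" for v
        by (rule integrable_mult_cis[OF rapid_integrable[OF Suc.prems]]) measurable
      show "integrable lborel (\<lambda>x. ?D b x * cis (- (2 * pi * (\<xi> \<bullet> x))))" for b
        by (rule integrable_mult_cis[OF rapid_integrable[OF rD]]) measurable
    next
      fix v x :: 'a assume "norm v \<le> 1"
      define t where "t = - (2 * pi * (v \<bullet> x))"
      define e where "e = cis (- (2 * pi * (\<xi> \<bullet> x)))"
      have e: "norm e = 1" by (simp add: e_def)
      have "(\<Sum>b\<in>Basis. (v \<bullet> b) *\<^sub>R (?D b x * e)) = (\<Sum>b\<in>Basis. complex_of_real ((v \<bullet> b) * (x \<bullet> b)) * (- (2 * pi * \<i>) * g x * e))"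
        by (simp add: scaleR_conv_of_real mult_ac)
      also have "\<dots> = complex_of_real (v \<bullet> x) * (- (2 * pi * \<i>) * g x * e)"
        unfolding sum_distrib_right[symmetric] of_real_sum[symmetric] euclidean_inner[of v x] ..
      also have "\<dots> = g x * e * (\<i> * complex_of_real t)" by (simp add: t_def)
      finally have S: "(\<Sum>b\<in>Basis. (v \<bullet> b) *\<^sub>R (?D b x * e)) = g x * e * (\<i> * complex_of_real t)" .
      have "cis (- (2 * pi * ((\<xi> + v) \<bullet> x))) = e * cis t"
        by (simp add: e_def t_def cis_mult inner_add_left algebra_simps)
      then have "g x * cis (- (2 * pi * ((\<xi> + v) \<bullet> x))) - g x * e - (\<Sum>b\<in>Basis. (v \<bullet> b) *\<^sub>R (?D b x * e)) =
         g x * e * (cis t - 1 - \<i> * complex_of_real t)"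
        unfolding S by (simp add: algebra_simps)
      also have "norm \<dots> \<le> norm (g x) * t\<^sup>2"
        unfolding norm_mult e using norm_cis_remainder[of t] by (simp add: mult_left_mono)
      also have "\<dots> \<le> norm (g x) * (2 * pi * (norm v * (1 + norm x)))\<^sup>2"
      proof (intro mult_left_mono)
        have "\<bar>v \<bullet> x\<bar> \<le> norm v * norm x" by (rule Cauchy_Schwarz_ineq2)
        also have "\<dots> \<le> norm v * (1 + norm x)" by (intro mult_left_mono) auto
        finally have "\<bar>t\<bar> \<le> 2 * pi * (norm v * (1 + norm x))" by (simp add: t_def abs_mult)
        then show "t\<^sup>2 \<le> (2 * pi * (norm v * (1 + norm x)))\<^sup>2" by (rule power2_le_iff_abs_le[THEN iffD2, rotated]) auto
      qed auto
      finally show "norm (g x * cis (- (2 * pi * ((\<xi> + v) \<bullet> x))) - g x * cis (- (2 * pi * (\<xi> \<bullet> x))) -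
            (\<Sum>b\<in>Basis. (v \<bullet> b) *\<^sub>R (?D b x * cis (- (2 * pi * (\<xi> \<bullet> x)))))) \<le> (norm v)\<^sup>2 * ((2 * pi)\<^sup>2 * ((1 + norm x)\<^sup>2 * norm (g x)))"
        unfolding e_def power_mult_distrib by (simp only: mult_ac)
    qed
    then show "(fourier g has_derivative grad_map (\<lambda>b. fourier (?D b)) \<xi>) (at \<xi>)"
      by (simp add: fourier_cis[abs_def] grad_map_def[abs_def])
  qed (intro Suc.IH rD)
qed

text \<open>The Taylor remainder inherits the decay of the second derivatives: for
  \<open>norm v \<le> 1\<close> every point \<open>y\<close> of the segment satisfies
  \<open>1 + norm x \<le> 2 * (1 + norm y)\<close>, so evaluating the decay at \<open>x\<close>
  instead of \<open>y\<close> costs only the factor \<open>2 ^ m\<close>.\<close>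

lemma rapid_taylor:
  fixes h :: "'a::euclidean_space \<Rightarrow> complex"
  assumes D: "\<And>x. (h has_derivative grad_map D x) (at x)"
    and E: "\<And>b x. b \<in> Basis \<Longrightarrow> (D b has_derivative grad_map (E b) x) (at x)"
    and r: "\<And>b c. b \<in> Basis \<Longrightarrow> c \<in> Basis \<Longrightarrow> rapid (E b c)"
  obtains C where "C > 0" "\<And>v x. norm v \<le> 1 \<Longrightarrow> norm (h (x + v) - h x - grad_map D x v) \<le> (norm v)\<^sup>2 * (C * (1 + norm x) powr - real m)"
proof -
  have "\<exists>B>0. \<forall>x. norm (E b c x) \<le> B * (1 + norm x) powr - real m" if "b \<in> Basis" "c \<in> Basis" for b c
    using rapid_decay[OF r[OF that], of "real m"] by metis
  then obtain B where B: "\<And>b c. b \<in> Basis \<Longrightarrow> c \<in> Basis \<Longrightarrow> B b c > 0"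
    "\<And>b c x. b \<in> Basis \<Longrightarrow> c \<in> Basis \<Longrightarrow> norm (E b c x) \<le> B b c * (1 + norm x) powr - real m" by metis
  define B' where "B' = 1 + (\<Sum>b\<in>Basis. \<Sum>c\<in>Basis. B b c)"
  have BB: "B b c \<le> B'" if "b \<in> Basis" "c \<in> Basis" for b c
  proof -
    have "B b c \<le> (\<Sum>c\<in>Basis. B b c)" using that B by (intro member_le_sum) (auto intro: less_imp_le)
    also have "\<dots> \<le> (\<Sum>b\<in>Basis. \<Sum>c\<in>Basis. B b c)"
      using that less_imp_le[OF B(1)] by (intro member_le_sum[of b Basis "\<lambda>b. \<Sum>c\<in>Basis. B b c"]) (auto intro!: sum_nonneg)
    finally show ?thesis by (simp add: B'_def)
  qed
  have B'0: "B' > 0" unfolding B'_def using B by (intro add_pos_nonneg sum_nonneg) (auto intro: less_imp_le)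
  have "norm (h (x + v) - h x - grad_map D x v) \<le> (norm v)\<^sup>2 * (((real DIM('a))\<^sup>2 * (B' * 2 ^ m)) * (1 + norm x) powr - real m)"
    if v: "norm v \<le> 1" for v x
  proof -
    have "norm (h (x + v) - h x - grad_map D x (x + v - x)) \<le> (norm (x + v - x))\<^sup>2 * ((real DIM('a))\<^sup>2 * (B' * 2 ^ m * (1 + norm x) powr - real m))"
    proof (rule taylor_grad_map[where E=E])
      fix y and b c :: 'a assume y: "y \<in> closed_segment x (x + v)" and bc: "b \<in> Basis" "c \<in> Basis"
      have "norm (y - x) \<le> 1" using segment_bound(1)[OF y] v by simp
      then have "1 + norm x \<le> 2 * (1 + norm y)"
        using norm_triangle_ineq4[of y "y - x"] norm_ge_zero[of y] by (simp del: norm_ge_zero)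
      then have "(2 * (1 + norm y)) powr - real m \<le> (1 + norm x) powr - real m"
        by (intro powr_mono2') (auto simp: add_pos_nonneg)
      moreover have "(2 * (1 + norm y)) powr - real m = (1 + norm y) powr - real m / 2 ^ m"
      proof -
        have "(2 * (1 + norm y)) powr - real m = 2 powr - real m * (1 + norm y) powr - real m"
          by (rule powr_mult)
        then show ?thesis by (simp only:) (simp add: powr_minus powr_realpow inverse_eq_divide)
      qed
      ultimately have "(1 + norm y) powr - real m / 2 ^ m \<le> (1 + norm x) powr - real m"
        by (simp only:)
      then have "(1 + norm y) powr - real m \<le> 2 ^ m * (1 + norm x) powr - real m"
        by (subst (asm) pos_divide_le_eq) (simp_all add: mult.commute)
      then have "B' * (1 + norm y) powr - real m \<le> B' * (2 ^ m * (1 + norm x) powr - real m)"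
        using B'0 by (intro mult_left_mono) auto
      moreover have "norm (E b c y) \<le> B' * (1 + norm y) powr - real m"
        using B(2)[OF bc, of y] BB[OF bc] by (meson mult_right_mono order_trans powr_ge_zero)
      ultimately show "norm (E b c y) \<le> B' * 2 ^ m * (1 + norm x) powr - real m" by simp
    qed (use D E in auto)
    then show ?thesis by (simp add: mult_ac)
  qed
  then show ?thesis using B'0 by (intro that[of "(real DIM('a))\<^sup>2 * (B' * 2 ^ m)"]) auto
qed

text \<open>Integration by parts is replaced by differentiating at \<open>v = 0\<close> the integral
  of \<open>h (x + v)\<close> against the exponential. Under the integral sign this gives the
  transform of the partial derivatives; by translation the same integral is
  \<open>cis (2 * pi * (\<xi> \<bullet> v))\<close> times the transform of \<open>h\<close>.
  Uniqueness of the derivative identifies the two results.\<close>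

lemma fourier_deriv:
  fixes h :: "'a::euclidean_space \<Rightarrow> complex"
  assumes h: "test_function h" and D: "\<And>x. (h has_derivative grad_map D x) (at x)"
    and tD: "\<And>b. b \<in> Basis \<Longrightarrow> test_function (D b)" and b: "b \<in> Basis"
  shows "fourier (D b) \<xi> = 2 * pi * \<i> * complex_of_real (\<xi> \<bullet> b) * fourier h \<xi>"
proof -
  have "\<exists>E. (\<forall>x. (D b has_derivative grad_map E x) (at x)) \<and> (\<forall>c\<in>Basis. test_function (E c))" if "b \<in> Basis" for b
    using test_function_deriv[OF tD[OF that]] by metis
  then obtain E where E: "\<And>b x. b \<in> Basis \<Longrightarrow> (D b has_derivative grad_map (E b) x) (at x)"
    "\<And>b c. b \<in> Basis \<Longrightarrow> c \<in> Basis \<Longrightarrow> test_function (E b c)" by metis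
  let ?e = "\<lambda>x. cis (- (2 * pi * (\<xi> \<bullet> x)))"
  have hm [measurable]: "h \<in> borel_measurable borel" using rapid_measurable test_function_rapid h by blast
  obtain C where C: "C > 0" "\<And>v x. norm v \<le> 1 \<Longrightarrow> norm (h (x + v) - h x - grad_map D x v) \<le> (norm v)\<^sup>2 * (C * (1 + norm x) powr - real (DIM('a) + 1))"
    using rapid_taylor[OF D E(1) test_function_rapid[OF E(2)]] by metis
  have int: "integrable lborel (\<lambda>x. h (x + v) * ?e x)" for v
    using integrable_scale[of 1 h v] rapid_integrable[OF test_function_rapid[OF h]]
    by (intro integrable_mult_cis) auto
  have 1: "((\<lambda>v. LINT x|lborel. h (x + v) * ?e x) has_derivative
      grad_map (\<lambda>b y. LINT x|lborel. D b x * ?e x) 0) (at 0)"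
  proof (rule has_derivative_lebesgue_integral[where k="\<lambda>x. C * (1 + norm x) powr - real (DIM('a) + 1)"])
    show "integrable lborel (\<lambda>x. C * (1 + norm (x::'a)) powr - real (DIM('a) + 1))"
      by (intro integrable_mult_right integrable_weight) simp
    show "integrable lborel (\<lambda>x. D b x * ?e x)" if "b \<in> Basis" for b
      by (rule integrable_mult_cis[OF rapid_integrable[OF test_function_rapid[OF tD[OF that]]]]) measurable
    fix v x :: 'a assume v: "norm v \<le> 1"
    have "h (x + (0 + v)) * ?e x - h (x + 0) * ?e x - (\<Sum>b\<in>Basis. (v \<bullet> b) *\<^sub>R (D b x * ?e x)) = (h (x + v) - h x - grad_map D x v) * ?e x"
      by (simp add: grad_map_def algebra_simps sum_distrib_right sum_distrib_left)
    then show "norm (h (x + (0 + v)) * ?e x - h (x + 0) * ?e x - (\<Sum>b\<in>Basis. (v \<bullet> b) *\<^sub>R (D b x * ?e x))) \<le> (norm v)\<^sup>2 * (C * (1 + norm x) powr - real (DIM('a) + 1))"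
      using C(2)[OF v, of x] by (simp only: norm_mult norm_cis mult_1_right)
  qed (use int in auto)
  have eq: "(LINT x|lborel. h (x + v) * ?e x) = cis (2 * pi * (\<xi> \<bullet> v)) * fourier h \<xi>" for v
  proof -
    have "(LINT x|lborel. h (x + v) * ?e x) = (LINT x|lborel. h x * ?e (x - v))"
      using integral_translate[of "\<lambda>x. h x * ?e (x - v)" v] by simp
    also have "\<dots> = (LINT x|lborel. cis (2 * pi * (\<xi> \<bullet> v)) * (h x * ?e x))"
      by (simp add: cis_mult inner_diff_right algebra_simps)
    finally show ?thesis by (simp add: fourier_cis)
  qed
  have 2: "((\<lambda>v. cis (2 * pi * (\<xi> \<bullet> v)) * fourier h \<xi>) has_derivative
      (\<lambda>v. complex_of_real (2 * pi * (\<xi> \<bullet> v)) * \<i> * fourier h \<xi>)) (at 0)"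
  proof -
    have "((\<lambda>v. \<i> * complex_of_real (2 * pi * (\<xi> \<bullet> v))) has_derivative (\<lambda>v. \<i> * complex_of_real (2 * pi * (\<xi> \<bullet> v)))) (at 0)"
      by (intro bounded_linear_imp_has_derivative bounded_linear_const_mult bounded_linear_compose[OF bounded_linear_of_real]
            bounded_linear_inner_right)
    from has_derivative_mult_left[OF has_derivative_compose[OF this DERIV_exp[unfolded has_field_derivative_def]], of "fourier h \<xi>"]
    have "((\<lambda>v. exp (\<i> * complex_of_real (2 * pi * (\<xi> \<bullet> v))) * fourier h \<xi>) has_derivative
      (\<lambda>v. 1 * (\<i> * complex_of_real (2 * pi * (\<xi> \<bullet> v))) * fourier h \<xi>)) (at 0)"
      by simp
    then show ?thesis
      unfolding cis_conv_exp by (simp only: mult_1_left mult.commute[of \<i>])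
  qed
  from has_derivative_unique[OF 1[unfolded eq] 2]
  have "grad_map (\<lambda>b y. LINT x|lborel. D b x * ?e x) (0::'a) b = complex_of_real (2 * pi * (\<xi> \<bullet> b)) * \<i> * fourier h \<xi>"
    by metis
  then show ?thesis using b by (simp add: grad_map_Basis fourier_cis mult_ac)
qed

text \<open>Each power of \<open>norm \<xi>\<close> is paid for by one derivative: the norm is at
  most the sum of the coordinates, and a coordinate times the transform of \<open>h\<close> is, up
  to \<open>2 * pi * \<i>\<close>, the transform of a partial derivative, which is again a test
  function.\<close>

lemma fourier_test_function_rapid:
  assumes "test_function h" shows "rapid (fourier h)"
proof (rule rapidI)
  show "continuous_on UNIV (fourier h)"
    using assms by (intro fourier_continuous rapid_integrable test_function_rapid)
  fix N :: nat
  show "\<exists>B. \<forall>\<xi>. (1 + norm \<xi>) ^ N * norm (fourier h \<xi>) \<le> B"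
    using assms
  proof (induction N arbitrary: h)
    case 0 then show ?case using norm_fourier_le[of h] by auto
  next
    case (Suc N)
    obtain D where D: "\<And>x. (h has_derivative grad_map D x) (at x)" "\<And>b. b \<in> Basis \<Longrightarrow> test_function (D b)"
      using test_function_deriv[OF Suc.prems] by metis
    obtain B0 where B0: "\<And>\<xi>. (1 + norm \<xi>) ^ N * norm (fourier h \<xi>) \<le> B0" using Suc by blast
    have "\<forall>b\<in>Basis. \<exists>B. \<forall>\<xi>. (1 + norm \<xi>) ^ N * norm (fourier (D b) \<xi>) \<le> B" using Suc.IH D by blast
    then obtain B where B: "\<And>b \<xi>. b \<in> Basis \<Longrightarrow> (1 + norm \<xi>) ^ N * norm (fourier (D b) \<xi>) \<le> B b" by metis
    have "(1 + norm \<xi>) ^ Suc N * norm (fourier h \<xi>) \<le> B0 + (\<Sum>b\<in>Basis. B b)" for \<xi>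
    proof -
      have *: "\<bar>\<xi> \<bullet> b\<bar> * norm (fourier h \<xi>) \<le> norm (fourier (D b) \<xi>)" if "b \<in> Basis" for b
      proof -
        have "1 * (\<bar>\<xi> \<bullet> b\<bar> * norm (fourier h \<xi>)) \<le> (2 * pi) * (\<bar>\<xi> \<bullet> b\<bar> * norm (fourier h \<xi>))"
          using pi_gt3 by (intro mult_right_mono) auto
        then show ?thesis using fourier_deriv[OF Suc.prems D that, of \<xi>] by (simp add: norm_mult mult_ac)
      qed
      have "(1 + norm \<xi>) * norm (fourier h \<xi>) \<le> (1 + (\<Sum>b\<in>Basis. \<bar>\<xi> \<bullet> b\<bar>)) * norm (fourier h \<xi>)"
        by (intro mult_right_mono add_left_mono norm_le_l1) auto
      also have "\<dots> \<le> norm (fourier h \<xi>) + (\<Sum>b\<in>Basis. norm (fourier (D b) \<xi>))"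
        using sum_mono[of Basis "\<lambda>b. \<bar>\<xi> \<bullet> b\<bar> * norm (fourier h \<xi>)" "\<lambda>b. norm (fourier (D b) \<xi>)"] *
        by (simp add: algebra_simps sum_distrib_left)
      finally have "(1 + norm \<xi>) ^ N * ((1 + norm \<xi>) * norm (fourier h \<xi>)) \<le>
          (1 + norm \<xi>) ^ N * (norm (fourier h \<xi>) + (\<Sum>b\<in>Basis. norm (fourier (D b) \<xi>)))"
        by (intro mult_left_mono) auto
      also have "\<dots> = (1 + norm \<xi>) ^ N * norm (fourier h \<xi>) + (\<Sum>b\<in>Basis. (1 + norm \<xi>) ^ N * norm (fourier (D b) \<xi>))"
        by (simp add: algebra_simps sum_distrib_left)
      also have "\<dots> \<le> B0 + (\<Sum>b\<in>Basis. B b)" by (intro add_mono B0 sum_mono B)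
      finally show ?thesis by (simp add: mult_ac)
    qed
    then show ?case by blast
  qed
qed

lemma inverse_fourier_test_function_rapid: "test_function h \<Longrightarrow> rapid (inverse_fourier h)"
  using rapid_minus[OF fourier_test_function_rapid] by (simp add: inverse_fourier_eq_fourier[abs_def])

text \<open>Fubini for a product of two integrable functions and a kernel bounded by 1. With
  exponential kernels this is the multiplication formula behind both the inversion theorem and the
  convolution theorem.\<close>

lemma Fubini_kernel:
  fixes u :: "'a::euclidean_space \<Rightarrow> complex" and w :: "'b::euclidean_space \<Rightarrow> complex"
  assumes u: "integrable lborel u" and w: "integrable lborel w"
    and K: "(\<lambda>(x, y). K x y) \<in> borel_measurable (lborel \<Otimes>\<^sub>M lborel)" "\<And>x y. norm (K x y) \<le> 1"
  shows "(LINT x|lborel. u x * (LINT y|lborel. w y * K x y)) = (LINT y|lborel. w y * (LINT x|lborel. u x * K x y))"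
proof -
  have [measurable]: "u \<in> borel_measurable lborel" "w \<in> borel_measurable lborel" using u w by auto
  note K(1)[measurable]
  have Kx [measurable]: "K x \<in> borel_measurable lborel" for x
    using measurable_Pair2[OF K(1), of x] by simp
  have Ky [measurable]: "(\<lambda>x. K x y) \<in> borel_measurable lborel" for y
    using measurable_Pair1[OF K(1), of y] by simp
  have iy: "integrable lborel (\<lambda>y. w y * K x y)" for x
    by (rule Bochner_Integration.integrable_bound[OF w]) (use K(2) in \<open>auto simp: norm_mult mult_left_le\<close>)
  have "integrable (lborel \<Otimes>\<^sub>M lborel) (\<lambda>(x, y). u x * w y * K x y)"
  proof (rule lborel_pair.Fubini_integrable)
    show "(\<lambda>(x, y). u x * w y * K x y) \<in> borel_measurable (lborel \<Otimes>\<^sub>M lborel)"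
      by measurable
    have "(\<lambda>(x, y). norm (u x * w y * K x y)) \<in> borel_measurable (lborel \<Otimes>\<^sub>M lborel)"
      by measurable
    then have [measurable]: "(\<lambda>x. LINT y|lborel. norm (u x * w y * K x y)) \<in> borel_measurable lborel"
      by (rule lborel.borel_measurable_lebesgue_integral[of "\<lambda>x y. norm (u x * w y * K x y)"])
    have "integrable lborel (\<lambda>x. LINT y|lborel. norm (u x * w y * K x y))"
    proof (rule Bochner_Integration.integrable_bound)
      show "integrable lborel (\<lambda>x. norm (u x) * (LINT y|lborel. norm (w y)))"
        using u by (intro integrable_mult_left integrable_norm)
      show "AE x in lborel. norm (LINT y|lborel. norm (u x * w y * K x y)) \<le> norm (norm (u x) * (LINT y|lborel. norm (w y)))"
      proof (intro AE_I2)
        fix x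
        have "(LINT y|lborel. norm (u x * w y * K x y)) \<le> (LINT y|lborel. norm (u x) * norm (w y))"
          using iy[of x] w K(2)
          by (intro integral_mono) (auto simp: norm_mult mult.assoc intro!: integrable_mult_right mult_left_mono mult_left_le
             dest: integrable_norm)
        then show "norm (LINT y|lborel. norm (u x * w y * K x y)) \<le> norm (norm (u x) * (LINT y|lborel. norm (w y)))"
          by simp
      qed
    qed measurable
    then show "integrable lborel (\<lambda>x. LINT y|lborel. norm (case (x, y) of (x, y) \<Rightarrow> u x * w y * K x y))" by simp
    show "AE x in lborel. integrable lborel (\<lambda>y. case (x, y) of (x, y) \<Rightarrow> u x * w y * K x y)"
      using integrable_mult_right[OF iy] by (intro AE_I2) (simp add: mult.assoc)
  qed
  from lborel_pair.Fubini_integral[OF this]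
  have "(LINT y|lborel. LINT x|lborel. u x * w y * K x y) = (LINT x|lborel. LINT y|lborel. u x * w y * K x y)" .
  moreover have "(LINT y|lborel. LINT x|lborel. u x * w y * K x y) = (LINT y|lborel. LINT x|lborel. w y * (u x * K x y))"
    by (simp only: mult_ac)
  moreover have "(LINT x|lborel. LINT y|lborel. u x * w y * K x y) = (LINT x|lborel. LINT y|lborel. u x * (w y * K x y))"
    by (simp only: mult_ac)
  ultimately show ?thesis by (simp only: integral_mult_right_zero)
qed

section \<open>Gaussians and Fourier inversion\<close>

lemma gaussian_fourier_real:
  "integrable lborel (\<lambda>t. complex_of_real (exp (- t\<^sup>2 / 2)) * cis (s * t))"
  "(LINT t|lborel. complex_of_real (exp (- t\<^sup>2 / 2)) * cis (s * t)) = complex_of_real (sqrt (2 * pi) * exp (- s\<^sup>2 / 2))"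
proof -
  have eq: "complex_of_real (exp (- t\<^sup>2 / 2)) * cis (s * t) = complex_of_real (sqrt (2 * pi)) * (std_normal_density t *\<^sub>R iexp (s * t))" for t
    by (simp add: std_normal_density_def cis_conv_exp scaleR_conv_of_real)
  have i: "integrable lborel (\<lambda>t. std_normal_density t *\<^sub>R iexp (s * t))"
  proof (rule Bochner_Integration.integrable_bound)
    show "integrable lborel std_normal_density" by simp
  qed auto
  show "integrable lborel (\<lambda>t. complex_of_real (exp (- t\<^sup>2 / 2)) * cis (s * t))"
    unfolding eq using i by (rule integrable_mult_right)
  \<comment> \<open>The value of the integral is the characteristic function of the standard normal
    distribution.\<close>
  have "char std_normal_distribution s = (LINT t|lborel. std_normal_density t *\<^sub>R iexp (s * t))"
    unfolding char_def by (subst integral_density) auto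
  then show "(LINT t|lborel. complex_of_real (exp (- t\<^sup>2 / 2)) * cis (s * t)) = complex_of_real (sqrt (2 * pi) * exp (- s\<^sup>2 / 2))"
    unfolding eq integral_mult_right_zero by (simp add: char_std_normal_distribution)
qed

text \<open>Lebesgue measure is the image of a product of one-dimensional Lebesgue measures, so a
  product of functions of single coordinates integrates factor by factor.\<close>

lemma lborel_integrable_prod:
  fixes f :: "'a::euclidean_space \<Rightarrow> real \<Rightarrow> complex"
  assumes f: "\<And>b. b \<in> Basis \<Longrightarrow> integrable lborel (f b)"
  shows "integrable lborel (\<lambda>x. \<Prod>b\<in>Basis. f b (x \<bullet> b))" (is ?I)
    and "(LINT x|lborel. (\<Prod>b\<in>Basis. f b (x \<bullet> b))) = (\<Prod>b\<in>Basis. (LINT t|lborel. f b t))" (is ?E)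
proof -
  interpret product_sigma_finite "\<lambda>b::'a. lborel :: real measure" ..
  let ?P = "\<Pi>\<^sub>M b\<in>(Basis::'a set). (lborel :: real measure)"
  let ?T = "\<lambda>g::'a \<Rightarrow> real. \<Sum>b\<in>Basis. g b *\<^sub>R b"
  have fm [measurable]: "f b \<in> borel_measurable borel" if "b \<in> Basis" for b
    using borel_measurable_integrable[OF f[OF that]] by simp
  have [measurable]: "(\<lambda>x. \<Prod>b\<in>Basis. f b (x \<bullet> b)) \<in> borel_measurable borel"
    by (intro borel_measurable_prod measurable_compose[OF _ fm]) auto
  have T [measurable]: "?T \<in> measurable ?P borel" by measurable
  have inner: "?T g \<bullet> b = g b" if "b \<in> Basis" for g b
    using that by (simp add: inner_sum_left inner_Basis if_distrib cong: if_cong)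
  have eq: "(\<Prod>b\<in>Basis. f b (?T g \<bullet> b)) = (\<Prod>b\<in>Basis. f b (g b))" for g
    by (intro prod.cong) (auto simp only: inner)
  have "integrable ?P (\<lambda>g. \<Prod>b\<in>Basis. f b (g b))"
    using f by (intro product_integrable_prod) auto
  then show ?I
    by (subst lborel_eq[where 'a='a], subst integrable_distr_eq) (simp_all add: eq)
  have "(LINT x|lborel. (\<Prod>b\<in>Basis. f b (x \<bullet> b))) = (LINT g|?P. (\<Prod>b\<in>Basis. f b (g b)))"
    by (subst lborel_eq[where 'a='a], subst integral_distr) (simp_all add: eq)
  also have "\<dots> = (\<Prod>b\<in>Basis. (LINT t|lborel. f b t))"
    using f by (intro product_integral_prod) auto
  finally show ?E .
qed

lemma gaussian_fourier:
  fixes z :: "'a::euclidean_space"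
  shows "integrable lborel (\<lambda>x. complex_of_real (exp (- (norm x)\<^sup>2 / 2)) * cis (z \<bullet> x))"
    and "(LINT x|lborel. complex_of_real (exp (- (norm x)\<^sup>2 / 2)) * cis (z \<bullet> x)) =
        complex_of_real (sqrt (2 * pi) ^ DIM('a) * exp (- (norm z)\<^sup>2 / 2))"
proof -
  have nrm: "exp (- (norm x)\<^sup>2 / 2) = (\<Prod>b\<in>Basis. exp (- (x \<bullet> b)\<^sup>2 / 2))" for x :: 'a
  proof -
    have "(norm x)\<^sup>2 = (\<Sum>b\<in>Basis. (x \<bullet> b)\<^sup>2)"
      by (subst power2_norm_eq_inner, subst euclidean_inner) (simp add: power2_eq_square)
    then show ?thesis by (simp add: exp_sum[symmetric] sum_negf sum_divide_distrib)
  qed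
  have "cis (z \<bullet> x) = (\<Prod>b\<in>Basis. cis ((z \<bullet> b) * (x \<bullet> b)))" for x
    by (subst euclidean_inner) (simp add: cis_conv_exp exp_sum sum_distrib_left)
  then have eq: "complex_of_real (exp (- (norm x)\<^sup>2 / 2)) * cis (z \<bullet> x) =
      (\<Prod>b\<in>Basis. complex_of_real (exp (- (x \<bullet> b)\<^sup>2 / 2)) * cis ((z \<bullet> b) * (x \<bullet> b)))" for x
    by (simp only: nrm of_real_prod prod.distrib)
  note P = lborel_integrable_prod[of "\<lambda>b t. complex_of_real (exp (- t\<^sup>2 / 2)) * cis ((z \<bullet> b) * t)", OF gaussian_fourier_real(1)]
  show "integrable lborel (\<lambda>x. complex_of_real (exp (- (norm x)\<^sup>2 / 2)) * cis (z \<bullet> x))"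
    unfolding eq by (rule P(1))
  show "(LINT x|lborel. complex_of_real (exp (- (norm x)\<^sup>2 / 2)) * cis (z \<bullet> x)) =
        complex_of_real (sqrt (2 * pi) ^ DIM('a) * exp (- (norm z)\<^sup>2 / 2))"
    unfolding eq P(2) gaussian_fourier_real(2) nrm[of z] by (simp add: prod.distrib)
qed

text \<open>Gaussian summation. Inserting the factor \<open>G (c n *\<^sub>R \<xi>)\<close> does not
  affect the limit, because \<open>fourier g\<close> is integrable. By Fubini the regularised
  integral is an average of \<open>g\<close> around \<open>x\<close> against a Gaussian of width
  proportional to \<open>c n\<close>, and this tends to \<open>g x\<close> by continuity and
  boundedness.\<close>

lemma fourier_inversion:
  fixes g :: "'a::euclidean_space \<Rightarrow> complex"
  assumes cont: "continuous_on UNIV g" and bnd: "\<And>x. norm (g x) \<le> B"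
    and g: "integrable lborel g" and fg: "integrable lborel (fourier g)"
  shows "inverse_fourier (fourier g) = g"
proof
  fix x :: 'a
  let ?d = "DIM('a)"
  define c :: "nat \<Rightarrow> real" where "c n = 1 / (real n + 1)" for n
  have c0: "c n > 0" for n by (simp add: c_def)
  have c_lim: "c \<longlonglongrightarrow> 0" unfolding c_def[abs_def] by (rule lim_1_over_n[THEN LIMSEQ_Suc, simplified, unfolded add.commute[of 1]])
  define G :: "'a \<Rightarrow> complex" where "G \<xi> = complex_of_real (exp (- (norm \<xi>)\<^sup>2 / 2))" for \<xi>
  have [measurable]: "G \<in> borel_measurable borel" unfolding G_def by measurable
  have [measurable]: "g \<in> borel_measurable borel" using cont by (rule borel_measurable_continuous_onI)
  have [measurable]: "fourier g \<in> borel_measurable borel" using fg by auto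
  have G_le: "norm (G \<xi>) \<le> 1" for \<xi> by (simp add: G_def)
  have G_cont: "isCont G \<xi>" for \<xi> unfolding G_def by (intro continuous_intros) auto
  have G_int: "integrable lborel G" using gaussian_fourier(1)[of 0] by (simp add: G_def[abs_def])
  have G_total: "(LINT \<xi>|lborel. G \<xi>) = complex_of_real (sqrt (2 * pi) ^ ?d)"
    using gaussian_fourier(2)[of "0::'a"] by (simp add: G_def)
  define A where "A n = (LINT \<xi>|lborel. fourier g \<xi> * cis (2 * pi * (\<xi> \<bullet> x)) * G (c n *\<^sub>R \<xi>))" for n
  have A_lim: "A \<longlonglongrightarrow> inverse_fourier (fourier g) x"
    unfolding A_def inverse_fourier_cis
  proof (rule integral_dominated_convergence[where w="\<lambda>\<xi>. norm (fourier g \<xi>)"])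
    show "AE \<xi> in lborel. (\<lambda>n. fourier g \<xi> * cis (2 * pi * (\<xi> \<bullet> x)) * G (c n *\<^sub>R \<xi>)) \<longlonglongrightarrow> fourier g \<xi> * cis (2 * pi * (\<xi> \<bullet> x))"
    proof (intro AE_I2)
      fix \<xi> :: 'a
      have "(\<lambda>n. c n *\<^sub>R \<xi>) \<longlonglongrightarrow> 0" using tendsto_scaleR[OF c_lim tendsto_const[of \<xi>]] by simp
      then have "(\<lambda>n. G (c n *\<^sub>R \<xi>)) \<longlonglongrightarrow> G 0" by (rule isCont_tendsto_compose[OF G_cont])
      then have "(\<lambda>n. G (c n *\<^sub>R \<xi>)) \<longlonglongrightarrow> 1" by (simp add: G_def)
      from tendsto_mult[OF tendsto_const this]
      show "(\<lambda>n. fourier g \<xi> * cis (2 * pi * (\<xi> \<bullet> x)) * G (c n *\<^sub>R \<xi>)) \<longlonglongrightarrow> fourier g \<xi> * cis (2 * pi * (\<xi> \<bullet> x))"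
        by simp
    qed
    show "AE \<xi> in lborel. norm (fourier g \<xi> * cis (2 * pi * (\<xi> \<bullet> x)) * G (c n *\<^sub>R \<xi>)) \<le> norm (fourier g \<xi>)" for n
      using G_le by (simp add: norm_mult mult_left_le)
  qed (use fg in \<open>auto intro: integrable_norm\<close>)
  have A_eq: "A n = complex_of_real ((sqrt (2 * pi) / (2 * pi)) ^ ?d) * (LINT u|lborel. g (x - (c n / (2 * pi)) *\<^sub>R u) * G u)" for n
  proof -
    have c0n: "c n \<noteq> 0" using c0[of n] by simp
    have Gc: "integrable lborel (\<lambda>\<xi>. G (c n *\<^sub>R \<xi>))"
      using integrable_scale[OF c0n, of G 0] G_int by simp
    have "A n = (LINT \<xi>|lborel. (G (c n *\<^sub>R \<xi>) * cis (2 * pi * (\<xi> \<bullet> x))) * (LINT y|lborel. g y * cis (- (2 * pi * (\<xi> \<bullet> y)))))"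
      unfolding A_def by (simp only: fourier_cis mult_ac)
    also have "\<dots> = (LINT y|lborel. g y * (LINT \<xi>|lborel. (G (c n *\<^sub>R \<xi>) * cis (2 * pi * (\<xi> \<bullet> x))) * cis (- (2 * pi * (\<xi> \<bullet> y)))))"
      by (rule Fubini_kernel) (auto intro!: integrable_mult_cis Gc g)
    also have "\<dots> = (LINT y|lborel. g y * complex_of_real ((sqrt (2 * pi) / c n) ^ ?d) * G ((2 * pi / c n) *\<^sub>R (x - y)))"
    proof (intro Bochner_Integration.integral_cong refl)
      fix y
      let ?F = "\<lambda>\<xi>. (G (c n *\<^sub>R \<xi>) * cis (2 * pi * (\<xi> \<bullet> x))) * cis (- (2 * pi * (\<xi> \<bullet> y)))"
      have "(LINT \<xi>|lborel. ?F \<xi>) = (\<bar>1 / c n\<bar> ^ ?d) *\<^sub>R (LINT \<xi>|lborel. ?F ((1 / c n) *\<^sub>R \<xi> + 0))"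
        using c0n by (intro integral_scale) auto
      also have "(LINT \<xi>|lborel. ?F ((1 / c n) *\<^sub>R \<xi> + 0)) = (LINT \<xi>|lborel. G \<xi> * cis (((2 * pi / c n) *\<^sub>R (x - y)) \<bullet> \<xi>))"
        using c0n by (intro Bochner_Integration.integral_cong refl)
          (simp add: mult.assoc cis_mult inner_diff_left inner_diff_right inner_commute algebra_simps diff_divide_distrib)
      also have "\<dots> = complex_of_real (sqrt (2 * pi) ^ ?d) * G ((2 * pi / c n) *\<^sub>R (x - y))"
        unfolding G_def gaussian_fourier(2) by simp
      finally show "g y * (LINT \<xi>|lborel. ?F \<xi>) = g y * complex_of_real ((sqrt (2 * pi) / c n) ^ ?d) * G ((2 * pi / c n) *\<^sub>R (x - y))"
        using c0[of n] by (simp add: scaleR_conv_of_real power_divide)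
    qed
    \<comment> \<open>The substitution \<open>y = x - (c n / (2 * pi)) *\<^sub>R u\<close> moves the
      dependence on \<open>n\<close> from the Gaussian into the argument of \<open>g\<close>, where
      dominated convergence can be applied.\<close>
    also have "\<dots> = (\<bar>- (c n / (2 * pi))\<bar> ^ ?d) *\<^sub>R (LINT u|lborel. g (- (c n / (2 * pi)) *\<^sub>R u + x) * complex_of_real ((sqrt (2 * pi) / c n) ^ ?d) * G ((2 * pi / c n) *\<^sub>R (x - (- (c n / (2 * pi)) *\<^sub>R u + x))))"
      using c0n by (intro integral_scale) auto
    also have "\<dots> = (\<bar>- (c n / (2 * pi))\<bar> ^ ?d) *\<^sub>R (LINT u|lborel. complex_of_real ((sqrt (2 * pi) / c n) ^ ?d) * (g (x - (c n / (2 * pi)) *\<^sub>R u) * G u))"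
      using c0n by (simp add: mult_ac)
    also have "\<dots> = (\<bar>- (c n / (2 * pi))\<bar> ^ ?d) *\<^sub>R (complex_of_real ((sqrt (2 * pi) / c n) ^ ?d) * (LINT u|lborel. g (x - (c n / (2 * pi)) *\<^sub>R u) * G u))"
      by (simp only: integral_mult_right_zero)
    also have "\<dots> = complex_of_real ((sqrt (2 * pi) / (2 * pi)) ^ ?d) * (LINT u|lborel. g (x - (c n / (2 * pi)) *\<^sub>R u) * G u)"
      using c0[of n] by (simp add: scaleR_conv_of_real power_divide)
    finally show ?thesis .
  qed
  have "(\<lambda>n. LINT u|lborel. g (x - (c n / (2 * pi)) *\<^sub>R u) * G u) \<longlonglongrightarrow> (LINT u|lborel. g x * G u)"
  proof (rule integral_dominated_convergence[where w="\<lambda>u. \<bar>B\<bar> * norm (G u)"])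
    show "AE u in lborel. (\<lambda>n. g (x - (c n / (2 * pi)) *\<^sub>R u) * G u) \<longlonglongrightarrow> g x * G u"
    proof (intro AE_I2)
      fix u :: 'a
      have "(\<lambda>n. x - (c n / (2 * pi)) *\<^sub>R u) \<longlonglongrightarrow> x - (0 / (2 * pi)) *\<^sub>R u"
        by (intro tendsto_intros c_lim) simp
      then have "(\<lambda>n. x - (c n / (2 * pi)) *\<^sub>R u) \<longlonglongrightarrow> x" by simp
      moreover have "isCont g x" using cont by (simp add: continuous_on_eq_continuous_at)
      ultimately have "(\<lambda>n. g (x - (c n / (2 * pi)) *\<^sub>R u)) \<longlonglongrightarrow> g x" by (rule isCont_tendsto_compose[rotated])
      then show "(\<lambda>n. g (x - (c n / (2 * pi)) *\<^sub>R u) * G u) \<longlonglongrightarrow> g x * G u" by (intro tendsto_intros)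
    qed
    show "AE u in lborel. norm (g (x - (c n / (2 * pi)) *\<^sub>R u) * G u) \<le> \<bar>B\<bar> * norm (G u)" for n
      using bnd by (intro AE_I2) (auto simp: norm_mult intro!: mult_right_mono intro: order_trans[OF _ abs_ge_self])
    show "integrable lborel (\<lambda>u. \<bar>B\<bar> * norm (G u))" by (intro integrable_mult_right integrable_norm G_int)
  qed auto
  also have "(LINT u|lborel. g x * G u) = g x * complex_of_real (sqrt (2 * pi) ^ ?d)"
    by (simp add: G_total)
  finally have "A \<longlonglongrightarrow> complex_of_real ((sqrt (2 * pi) / (2 * pi)) ^ ?d) * (g x * complex_of_real (sqrt (2 * pi) ^ ?d))"
    unfolding A_eq[abs_def] by (intro tendsto_intros)
  also have "complex_of_real ((sqrt (2 * pi) / (2 * pi)) ^ ?d) * (g x * complex_of_real (sqrt (2 * pi) ^ ?d)) = g x"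
  proof -
    have "(sqrt (2 * pi) / (2 * pi)) ^ ?d * sqrt (2 * pi) ^ ?d = (sqrt (2 * pi) / (2 * pi) * sqrt (2 * pi)) ^ ?d"
      by (simp only: power_mult_distrib)
    also have "sqrt (2 * pi) / (2 * pi) * sqrt (2 * pi) = 1" by simp
    finally have "complex_of_real ((sqrt (2 * pi) / (2 * pi)) ^ ?d) * complex_of_real (sqrt (2 * pi) ^ ?d) = 1"
      by (simp only: of_real_mult[symmetric] power_one of_real_1)
    then show ?thesis by (simp only: mult.left_commute[of _ "g x"] mult_1_right)
  qed
  finally show "inverse_fourier (fourier g) x = g x"
    using A_lim LIMSEQ_unique by blast
qed

section \<open>Convolution of functions\<close>

definition cvl :: "('a::euclidean_space \<Rightarrow> complex) \<Rightarrow> ('a \<Rightarrow> complex) \<Rightarrow> 'a \<Rightarrow> complex" where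
  "cvl K g x = (LINT z|lborel. K z * g (x - z))"

lemma inverse_fourier_mult_fourier:
  assumes m: "integrable lborel m" and g: "integrable lborel g"
  shows "inverse_fourier (\<lambda>\<xi>. m \<xi> * fourier g \<xi>) = cvl (inverse_fourier m) g"
proof
  fix x :: 'a
  have [measurable]: "m \<in> borel_measurable borel" "g \<in> borel_measurable borel" using m g by auto
  have "integrable lborel m" by fact
  then have "continuous_on UNIV (\<lambda>x. fourier m (- x))"
    by (intro continuous_on_compose2[OF fourier_continuous]) (auto intro: continuous_intros)
  then have [measurable]: "inverse_fourier m \<in> borel_measurable borel"
    by (simp add: inverse_fourier_eq_fourier[abs_def] borel_measurable_continuous_onI)
  have "inverse_fourier (\<lambda>\<xi>. m \<xi> * fourier g \<xi>) x =
    (LINT \<xi>|lborel. (m \<xi> * cis (2 * pi * (\<xi> \<bullet> x))) * (LINT y|lborel. g y * cis (- (2 * pi * (\<xi> \<bullet> y)))))"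
    unfolding inverse_fourier_cis fourier_cis by (simp only: mult_ac)
  also have "\<dots> = (LINT y|lborel. g y * (LINT \<xi>|lborel. (m \<xi> * cis (2 * pi * (\<xi> \<bullet> x))) * cis (- (2 * pi * (\<xi> \<bullet> y)))))"
    by (rule Fubini_kernel) (auto intro!: integrable_mult_cis m g)
  also have "\<dots> = (LINT y|lborel. g y * inverse_fourier m (x - y))"
    unfolding inverse_fourier_cis by (simp add: mult.assoc cis_mult inner_diff_right algebra_simps)
  also have "\<dots> = (LINT y|lborel. g (x - y) * inverse_fourier m y)"
    using integral_reflect[of "\<lambda>y. g y * inverse_fourier m (x - y)" x] by simp
  finally show "inverse_fourier (\<lambda>\<xi>. m \<xi> * fourier g \<xi>) x = cvl (inverse_fourier m) g x"
    by (simp add: cvl_def mult.commute)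
qed

text \<open>Reflecting the integration variable turns this order of composition into the one of
  \<open>fourier_inversion\<close>, which applies since the transform of a test function is rapid,
  hence integrable.\<close>

lemma fourier_inverse_fourier:
  assumes "test_function h" shows "fourier (inverse_fourier h) = h"
proof
  fix \<xi>
  have "inverse_fourier (fourier h) = h"
    using assms test_function_bounded[OF assms]
    by (metis fourier_inversion rapid_continuous rapid_integrable test_function_rapid fourier_test_function_rapid)
  moreover have "fourier (inverse_fourier h) \<xi> = inverse_fourier (fourier h) \<xi>"
  proof -
    have [measurable]: "fourier h \<in> borel_measurable borel"
      using assms by (intro rapid_measurable fourier_test_function_rapid)
    have "fourier (inverse_fourier h) \<xi> = (LINT x|lborel. fourier h (0 - x) * cis (2 * pi * ((0 - x) \<bullet> \<xi>)))"
      by (simp add: fourier_cis[of "inverse_fourier h"] inverse_fourier_eq_fourier inner_commute)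
    also have "\<dots> = inverse_fourier (fourier h) \<xi>"
      unfolding inverse_fourier_cis
      by (rule integral_reflect[of "\<lambda>x. fourier h x * cis (2 * pi * (x \<bullet> \<xi>))" 0]) measurable
    finally show ?thesis .
  qed
  ultimately show "fourier (inverse_fourier h) \<xi> = h \<xi>" by simp
qed

section \<open>Convolution of tempered distributions with Schwartz functions\<close>

lemma dir_deriv_eqI:
  assumes "(h has_derivative grad_map D x) (at x)" "b \<in> Basis"
  shows "dir_deriv b h x = D b x"
  unfolding dir_deriv_def using frechet_derivative_at[OF assms(1)] assms(2) by (metis grad_map_Basis)

text \<open>A way to enter the Schwartz class without computing Frechet derivatives: a family
  indexed by multi-indices and closed under differentiation must consist of the iterated derivatives
  of its member at the empty list. It serves for linear combinations, affine substitutions and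
  superpositions, where the formula for the derivatives is wanted as well.\<close>

lemma schwartz_family:
  fixes F :: "'a::euclidean_space \<Rightarrow> complex"
  assumes F: "G [] = F"
    and deriv: "\<And>vs x. set vs \<subseteq> Basis \<Longrightarrow> (G vs has_derivative grad_map (\<lambda>b. G (b # vs)) x) (at x)"
    and decay: "\<And>N vs. set vs \<subseteq> Basis \<Longrightarrow> \<exists>B. \<forall>x. (1 + norm x) ^ N * norm (G vs x) \<le> B"
  shows "F \<in> schwartz" and "set vs \<subseteq> Basis \<Longrightarrow> iter_deriv vs F = G vs"
proof -
  have it: "iter_deriv vs F = G vs" if "set vs \<subseteq> Basis" for vs
    using that
  proof (induction vs)
    case Nil then show ?case by (simp add: F)
  next
    case (Cons b vs)
    then have "iter_deriv (b # vs) F = dir_deriv b (G vs)" by (simp add: iter_deriv_Cons)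
    also have "\<dots> = G (b # vs)"
      using dir_deriv_eqI[OF deriv[of vs]] Cons.prems by auto
    finally show ?case .
  qed
  have "smooth F" unfolding smooth_def
  proof safe
    fix vs :: "'a list" and x :: 'a assume "set vs \<subseteq> Basis"
    then show "iter_deriv vs F differentiable (at x)"
      using deriv[of vs x] it differentiableI by metis
  qed
  moreover have "bounded (range (\<lambda>x. (1 + norm x) ^ N *\<^sub>R iter_deriv vs F x))" if vs: "set vs \<subseteq> Basis" for N vs
  proof -
    obtain B where "\<And>x. (1 + norm x) ^ N * norm (G vs x) \<le> B" using decay[OF vs] by blast
    then show ?thesis unfolding bounded_iff it[OF vs] by (intro exI[of _ B]) (auto simp: norm_power abs_of_nonneg)
  qed
  ultimately show "F \<in> schwartz" unfolding schwartz_def by auto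
  show "set vs \<subseteq> Basis \<Longrightarrow> iter_deriv vs F = G vs" by (rule it)
qed

lemma schwartz_decay:
  assumes "F \<in> schwartz" "set vs \<subseteq> Basis"
  obtains B where "\<And>x. (1 + norm x) ^ N * norm (iter_deriv vs F x) \<le> B"
proof -
  have "bounded (range (\<lambda>x. (1 + norm x) ^ N *\<^sub>R iter_deriv vs F x))"
    using assms unfolding schwartz_def by blast
  then obtain B where "\<And>x. norm ((1 + norm x) ^ N *\<^sub>R iter_deriv vs F x) \<le> B"
    unfolding bounded_iff by blast
  then show ?thesis using that[of B] by (simp add: norm_power abs_of_nonneg)
qed

lemma schwartz_iter_derivative:
  assumes "F \<in> schwartz" "set vs \<subseteq> Basis"
  shows "(iter_deriv vs F has_derivative grad_map (\<lambda>b. iter_deriv (b # vs) F) x) (at x)"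
proof -
  have "iter_deriv vs F differentiable (at x)" using assms unfolding schwartz_def smooth_def by blast
  from differentiable_has_derivative_dir_deriv[OF this] show ?thesis by (simp add: iter_deriv_Cons)
qed

lemma schwartz_iter_deriv_rapid:
  assumes "F \<in> schwartz" "set vs \<subseteq> Basis" shows "rapid (iter_deriv vs F)"
proof (rule rapidI)
  show "continuous_on UNIV (iter_deriv vs F)"
    using schwartz_iter_derivative[OF assms] has_derivative_continuous
    by (blast intro: continuous_at_imp_continuous_on)
  show "\<exists>B. \<forall>x. (1 + norm x) ^ N * norm (iter_deriv vs F x) \<le> B" for N
    using schwartz_decay[OF assms] by metis
qed

lemma schwartz_rapid: "F \<in> schwartz \<Longrightarrow> rapid F"
  using schwartz_iter_deriv_rapid[of F "[]"] by simp

lemma schwartz_norm_le: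
  assumes "\<And>vs x. set vs \<subseteq> Basis \<Longrightarrow> length vs \<le> N \<Longrightarrow> (1 + norm x) ^ N * norm (iter_deriv vs F x) \<le> B"
  shows "schwartz_norm N F \<le> B"
  unfolding schwartz_norm_def
proof (rule cSUP_least)
  show "{vs. set vs \<subseteq> Basis \<and> length vs \<le> N} \<times> UNIV \<noteq> {}" by (auto intro: exI[of _ "[]"])
qed (use assms in auto)

text \<open>The supremum is taken in the reals, so it bounds its members only once the set is known
  to be bounded. There are finitely many lists of length at most \<open>N\<close>, and the sum of
  their individual bounds works for all of them.\<close>

lemma schwartz_norm_ge:
  fixes F :: "'a::euclidean_space \<Rightarrow> complex"
  assumes F: "F \<in> schwartz" and vs: "set vs \<subseteq> Basis" "length vs \<le> N"
  shows "(1 + norm x) ^ N * norm (iter_deriv vs F x) \<le> schwartz_norm N F"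
proof -
  let ?L = "{vs::'a list. set vs \<subseteq> Basis \<and> length vs \<le> N}"
  have fin: "finite ?L" by (rule finite_lists_length_le) simp
  have "\<forall>vs\<in>?L. \<exists>B. \<forall>x. (1 + norm x) ^ N * norm (iter_deriv vs F x) \<le> B"
    using schwartz_decay[OF F] by (metis (no_types, lifting) mem_Collect_eq)
  then obtain B where B: "\<And>vs x. vs \<in> ?L \<Longrightarrow> (1 + norm x) ^ N * norm (iter_deriv vs F x) \<le> B vs" by metis
  have "(1 + norm x) ^ N * norm (iter_deriv vs F x) \<le> (\<Sum>us\<in>?L. \<bar>B us\<bar>)" if "vs \<in> ?L" for vs x
    using B[OF that, of x] member_le_sum[OF that, of "\<lambda>us. \<bar>B us\<bar>"] fin by force
  then have bdd: "bdd_above ((\<lambda>(vs, x). (1 + norm x) ^ N * norm (iter_deriv vs F x)) ` (?L \<times> UNIV))"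
    by (intro bdd_aboveI[where M="\<Sum>us\<in>?L. \<bar>B us\<bar>"]) auto
  have "(case (vs, x) of (vs, x) \<Rightarrow> (1 + norm x) ^ N * norm (iter_deriv vs F x)) \<le> schwartz_norm N F"
    unfolding schwartz_norm_def by (rule cSUP_upper[OF _ bdd]) (use vs in auto)
  then show ?thesis by simp
qed

lemma schwartz_norm_nonneg: "F \<in> schwartz \<Longrightarrow> schwartz_norm N F \<ge> 0"
  using schwartz_norm_ge[of F "[]" N 0] by (smt (verit) norm_ge_zero mult_nonneg_nonneg zero_le_power
     list.size(3) empty_subsetI le0 set_empty2)

lemma schwartz_lincomb:
  fixes f g :: "'a::euclidean_space \<Rightarrow> complex"
  assumes f: "f \<in> schwartz" and g: "g \<in> schwartz"
  shows "(\<lambda>x. a * f x + c * g x) \<in> schwartz"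
    and "set vs \<subseteq> Basis \<Longrightarrow> iter_deriv vs (\<lambda>x. a * f x + c * g x) = (\<lambda>x. a * iter_deriv vs f x + c * iter_deriv vs g x)"
proof -
  let ?G = "\<lambda>vs x. a * iter_deriv vs f x + c * iter_deriv vs g x"
  have 1: "(?G vs has_derivative grad_map (\<lambda>b. ?G (b # vs)) x) (at x)" if vs: "set vs \<subseteq> Basis" for vs x
  proof -
    have "(?G vs has_derivative (\<lambda>v. a * grad_map (\<lambda>b. iter_deriv (b # vs) f) x v + c * grad_map (\<lambda>b. iter_deriv (b # vs) g) x v)) (at x)"
      using vs f g by (intro has_derivative_add has_derivative_mult_right schwartz_iter_derivative)
    then show ?thesis
      by (simp add: grad_map_def[abs_def] sum_distrib_left sum.distrib scaleR_add_right)
  qed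
  have 2: "\<exists>B. \<forall>x. (1 + norm x) ^ N * norm (?G vs x) \<le> B" if vs: "set vs \<subseteq> Basis" for N vs
  proof -
    obtain B where B: "\<And>x. (1 + norm x) ^ N * norm (iter_deriv vs f x) \<le> B" using schwartz_decay[OF f vs] by metis
    obtain E where E: "\<And>x. (1 + norm x) ^ N * norm (iter_deriv vs g x) \<le> E" using schwartz_decay[OF g vs] by metis
    have "(1 + norm x) ^ N * norm (?G vs x) \<le> norm a * B + norm c * E" for x
    proof -
      have "(1 + norm x) ^ N * norm (?G vs x) \<le> (1 + norm x) ^ N * (norm a * norm (iter_deriv vs f x) + norm c * norm (iter_deriv vs g x))"
        by (intro mult_left_mono) (auto intro: norm_triangle_le simp: norm_mult)
      also have "\<dots> = norm a * ((1 + norm x) ^ N * norm (iter_deriv vs f x)) + norm c * ((1 + norm x) ^ N * norm (iter_deriv vs g x))"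
        by (simp add: algebra_simps)
      also have "\<dots> \<le> norm a * B + norm c * E" by (intro add_mono mult_left_mono B E) auto
      finally show ?thesis .
    qed
    then show ?thesis by blast
  qed
  show "(\<lambda>x. a * f x + c * g x) \<in> schwartz"
    by (rule schwartz_family(1)[of ?G, OF _ 1 2]) simp_all
  show "set vs \<subseteq> Basis \<Longrightarrow> iter_deriv vs (\<lambda>x. a * f x + c * g x) = ?G vs"
    by (rule schwartz_family(2)[of ?G, OF _ 1 2]) simp_all
qed

lemma schwartz_zero: "(\<lambda>x::'a::euclidean_space. 0) \<in> schwartz"
  by (rule schwartz_family(1)[of "\<lambda>vs x. 0"]) (auto simp: grad_map_def[abs_def])

lemma schwartz_sum:
  "(\<And>i. i \<in> I \<Longrightarrow> f i \<in> schwartz) \<Longrightarrow> (\<lambda>x. \<Sum>i\<in>I. c i * f i x) \<in> schwartz"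
proof (induction I rule: infinite_finite_induct)
  case (insert i I)
  then show ?case using schwartz_lincomb(1)[of "f i" "\<lambda>x. \<Sum>i\<in>I. c i * f i x" "c i" 1] by simp
qed (auto simp: schwartz_zero)

lemma schwartz_affine:
  fixes f :: "'a::euclidean_space \<Rightarrow> complex"
  assumes f: "f \<in> schwartz" and r: "r \<noteq> 0"
  shows "(\<lambda>x. f (r *\<^sub>R x + t)) \<in> schwartz" (is ?A)
    and "set vs \<subseteq> Basis \<Longrightarrow> iter_deriv vs (\<lambda>x. f (r *\<^sub>R x + t)) = (\<lambda>x. complex_of_real r ^ length vs * iter_deriv vs f (r *\<^sub>R x + t))"
proof -
  let ?G = "\<lambda>vs x. complex_of_real r ^ length vs * iter_deriv vs f (r *\<^sub>R x + t)"
  have 1: "(?G vs has_derivative grad_map (\<lambda>b. ?G (b # vs)) x) (at x)" if vs: "set vs \<subseteq> Basis" for vs x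
  proof -
    have aff: "((\<lambda>x. r *\<^sub>R x + t) has_derivative (\<lambda>v. r *\<^sub>R v)) (at x)"
      by (auto intro!: derivative_eq_intros)
    have "(?G vs has_derivative (\<lambda>v. complex_of_real r ^ length vs * grad_map (\<lambda>b. iter_deriv (b # vs) f) (r *\<^sub>R x + t) (r *\<^sub>R v))) (at x)"
      by (rule has_derivative_mult_right[OF has_derivative_compose[OF aff schwartz_iter_derivative[OF f vs]]])
    then show ?thesis
      by (simp add: grad_map_def[abs_def] sum_distrib_left scaleR_conv_of_real mult_ac)
  qed
  have 2: "\<exists>B. \<forall>x. (1 + norm x) ^ N * norm (?G vs x) \<le> B" if vs: "set vs \<subseteq> Basis" for N vs
  proof -
    obtain B where B: "\<And>x. (1 + norm x) ^ N * norm (iter_deriv vs f x) \<le> B" using schwartz_decay[OF f vs] by metis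
    define c where "c = 1 + (1 + norm t) / \<bar>r\<bar>"
    have "(1 + norm x) ^ N * norm (?G vs x) \<le> \<bar>r\<bar> ^ length vs * (c ^ N * B)" for x
    proof -
      let ?y = "r *\<^sub>R x + t"
      have c1: "c \<ge> 1" by (simp add: c_def)
      have "norm x = norm ((1 / r) *\<^sub>R (?y - t))" using r by simp
      also have "\<dots> \<le> (norm ?y + norm t) / \<bar>r\<bar>"
        unfolding norm_scaleR using norm_triangle_ineq4[of ?y t] r by (simp add: divide_simps mult.commute)
      also have "\<dots> \<le> (1 + norm t) * (1 + norm ?y) / \<bar>r\<bar>"
      proof (rule divide_right_mono)
        have "0 \<le> norm t * norm ?y" by simp
        then show "norm ?y + norm t \<le> (1 + norm t) * (1 + norm ?y)" unfolding ring_distribs by linarith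
      qed simp
      finally have "norm x \<le> (1 + norm t) * (1 + norm ?y) / \<bar>r\<bar>" .
      moreover have "c * (1 + norm ?y) = 1 + norm ?y + (1 + norm t) * (1 + norm ?y) / \<bar>r\<bar>"
        by (simp add: c_def distrib_right)
      ultimately have "1 + norm x \<le> c * (1 + norm ?y)" using norm_ge_zero[of ?y] by linarith
      then have "(1 + norm x) ^ N * norm (?G vs x) \<le> (c * (1 + norm ?y)) ^ N * (\<bar>r\<bar> ^ length vs * norm (iter_deriv vs f ?y))"
        unfolding norm_mult norm_power norm_of_real by (intro mult_right_mono power_mono) auto
      also have "\<dots> = \<bar>r\<bar> ^ length vs * (c ^ N * ((1 + norm ?y) ^ N * norm (iter_deriv vs f ?y)))"
        by (simp add: power_mult_distrib)
      also have "\<dots> \<le> \<bar>r\<bar> ^ length vs * (c ^ N * B)"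
        using c1 by (intro mult_left_mono B) auto
      finally show ?thesis .
    qed
    then show ?thesis by blast
  qed
  show ?A by (rule schwartz_family(1)[of ?G, OF _ 1 2]) simp_all
  show "set vs \<subseteq> Basis \<Longrightarrow> iter_deriv vs (\<lambda>x. f (r *\<^sub>R x + t)) = ?G vs"
    by (rule schwartz_family(2)[of ?G, OF _ 1 2]) simp_all
qed

lemma schwartz_translate:
  fixes f :: "'a::euclidean_space \<Rightarrow> complex"
  assumes f: "f \<in> schwartz"
  shows "(\<lambda>x. f (x + t)) \<in> schwartz"
    and "set vs \<subseteq> Basis \<Longrightarrow> iter_deriv vs (\<lambda>x. f (x + t)) = (\<lambda>x. iter_deriv vs f (x + t))"
  using schwartz_affine[OF f, where r=1 and t=t] by simp_all

lemma schwartz_reflect: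
  fixes f :: "'a::euclidean_space \<Rightarrow> complex"
  assumes f: "f \<in> schwartz" shows "(\<lambda>x. f (t - x)) \<in> schwartz"
  using schwartz_affine(1)[OF f, where r="-1" and t=t] by simp

lemma schwartz_cmult: "f \<in> schwartz \<Longrightarrow> (\<lambda>x. c * f x) \<in> schwartz"
  using schwartz_lincomb(1)[of f f c 0] by simp

text \<open>Submultiplicativity of the polynomial weight. It is the means by which translations are
  absorbed, at the price of a weight in the translation parameter.\<close>

lemma weight_shift: "1 + norm y \<le> (1 + norm (y + z)) * (1 + norm (z::'a::real_normed_vector))"
proof -
  have "norm y \<le> norm (y + z) + norm z" using norm_triangle_ineq4[of "y + z" z] by simp
  moreover have "0 \<le> norm (y + z) * norm z" by simp
  ultimately show ?thesis unfolding ring_distribs by linarith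
qed

lemma schwartz_translate_bound:
  assumes f: "f \<in> schwartz" and vs: "set vs \<subseteq> Basis" "length vs \<le> N"
  shows "(1 + norm y) ^ N * norm (iter_deriv vs f (y + z)) \<le> schwartz_norm N f * (1 + norm z) ^ N"
proof -
  have "(1 + norm y) ^ N * norm (iter_deriv vs f (y + z)) \<le> ((1 + norm (y + z)) * (1 + norm z)) ^ N * norm (iter_deriv vs f (y + z))"
    by (intro mult_right_mono power_mono weight_shift) auto
  also have "\<dots> = (1 + norm (y + z)) ^ N * norm (iter_deriv vs f (y + z)) * (1 + norm z) ^ N"
    by (simp add: power_mult_distrib mult_ac)
  also have "\<dots> \<le> schwartz_norm N f * (1 + norm z) ^ N"
    by (intro mult_right_mono schwartz_norm_ge f vs) auto
  finally show ?thesis .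
qed

text \<open>Translation is Lipschitz as a map into the Schwartz class at the loss of one derivative,
  whence \<open>Suc N\<close> on the right. The mean value inequality is applied on a segment where
  the weight varies at most by the displayed power.\<close>

lemma schwartz_translate_diff_bound:
  fixes f :: "'a::euclidean_space \<Rightarrow> complex"
  assumes f: "f \<in> schwartz" and vs: "set vs \<subseteq> Basis" "length vs \<le> N"
  shows "(1 + norm y) ^ N * norm (iter_deriv vs f (y + z) - iter_deriv vs f (y + z'))
    \<le> DIM('a) * schwartz_norm (Suc N) f * norm (z - z') * (1 + norm z + norm z') ^ N"
proof -
  define S where "S = schwartz_norm (Suc N) f"
  have S0: "S \<ge> 0" unfolding S_def by (rule schwartz_norm_nonneg[OF f])
  have "norm (iter_deriv vs f (y + z) - iter_deriv vs f (y + z')) \<le>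
    real DIM('a) * (S * (1 + norm z + norm z') ^ N / (1 + norm y) ^ N) * norm (y + z - (y + z'))"
  proof (rule lipschitz_grad_map[where D="\<lambda>b. iter_deriv (b # vs) f"])
    fix u b :: 'a assume u: "u \<in> closed_segment (y + z') (y + z)" and b: "b \<in> Basis"
    define w where "w = u - y"
    have "w \<in> closed_segment z' z" using u unfolding w_def
      by (metis add_diff_cancel_left' closed_segment_translation_eq diff_add_cancel add.commute)
    then have w: "norm w \<le> norm z + norm z'"
    proof -
      assume "w \<in> closed_segment z' z"
      then obtain t where t: "0 \<le> t" "t \<le> 1" "w = (1 - t) *\<^sub>R z' + t *\<^sub>R z" by (auto simp: closed_segment_def)
      have "norm w \<le> (1 - t) * norm z' + t * norm z" using t by (simp add: norm_triangle_le)
      also have "\<dots> \<le> 1 * norm z' + 1 * norm z" using t by (intro add_mono mult_right_mono) auto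
      finally show ?thesis by simp
    qed
    have uw: "u = y + w" by (simp add: w_def)
    have "(1 + norm y) ^ N * norm (iter_deriv (b # vs) f (y + w)) \<le> (1 + norm w) ^ N * S"
    proof -
      have "(1 + norm y) ^ N * norm (iter_deriv (b # vs) f (y + w)) \<le> ((1 + norm (y + w)) * (1 + norm w)) ^ N * norm (iter_deriv (b # vs) f (y + w))"
        by (intro mult_right_mono power_mono weight_shift) auto
      also have "\<dots> = (1 + norm w) ^ N * ((1 + norm (y + w)) ^ N * norm (iter_deriv (b # vs) f (y + w)))"
        by (simp add: power_mult_distrib mult_ac)
      also have "\<dots> \<le> (1 + norm w) ^ N * ((1 + norm (y + w)) ^ Suc N * norm (iter_deriv (b # vs) f (y + w)))"
        by (intro mult_left_mono mult_right_mono power_increasing) auto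
      also have "\<dots> \<le> (1 + norm w) ^ N * S"
        unfolding S_def using vs b by (intro mult_left_mono schwartz_norm_ge f) auto
      finally show ?thesis .
    qed
    also have "\<dots> \<le> (1 + norm z + norm z') ^ N * S"
      using w S0 by (intro mult_right_mono power_mono) auto
    finally show "norm (iter_deriv (b # vs) f u) \<le> S * (1 + norm z + norm z') ^ N / (1 + norm y) ^ N"
      unfolding uw by (simp add: pos_le_divide_eq add_pos_nonneg mult_ac)
  qed (rule schwartz_iter_derivative[OF f vs(1)])
  then have "(1 + norm y) ^ N * norm (iter_deriv vs f (y + z) - iter_deriv vs f (y + z')) \<le>
    (1 + norm y) ^ N * (real DIM('a) * (S * (1 + norm z + norm z') ^ N / (1 + norm y) ^ N) * norm (z - z'))"
    by (intro mult_left_mono) auto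
  also have "\<dots> = DIM('a) * S * norm (z - z') * (1 + norm z + norm z') ^ N"
    using norm_ge_zero[of y] by (simp add: field_simps del: norm_ge_zero) 
  finally show ?thesis unfolding S_def .
qed

lemma norm_weight_mult: "norm (complex_of_real ((1 + norm y) ^ N) * c) = (1 + norm y) ^ N * norm c"
  unfolding norm_mult norm_of_real by (simp add: abs_of_nonneg)

section \<open>Tempered distributions and integrals of translates\<close>

lemma tempered_bound:
  fixes u :: "('a::euclidean_space \<Rightarrow> complex) \<Rightarrow> complex"
  assumes u: "u \<in> tempered_distributions"
  obtains N C where "C \<ge> 0" "\<And>f. f \<in> schwartz \<Longrightarrow> norm (u f) \<le> C * schwartz_norm N f"
proof -
  have hom: "u (\<lambda>x. c * f x) = c * u f" if "f \<in> schwartz" for c f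
    using u that unfolding tempered_distributions_def by blast
  have "\<exists>N. \<exists>\<delta>>0. \<forall>f\<in>schwartz. schwartz_norm N f < \<delta> \<longrightarrow> norm (u f) < 1"
    using u zero_less_one unfolding tempered_distributions_def by blast
  then obtain N \<delta> where d: "\<delta> > 0" "\<And>f. f \<in> schwartz \<Longrightarrow> schwartz_norm N f < \<delta> \<Longrightarrow> norm (u f) < 1" by blast
  have scale: "schwartz_norm N (\<lambda>x. complex_of_real r * f x) \<le> r * schwartz_norm N f" if f: "f \<in> schwartz" and "r \<ge> 0"
    for f :: "'a \<Rightarrow> complex" and r
  proof (rule schwartz_norm_le)
    fix vs :: "'a list" and x assume vs: "set vs \<subseteq> Basis" "length vs \<le> N"
    have "iter_deriv vs (\<lambda>x. complex_of_real r * f x) x = complex_of_real r * iter_deriv vs f x"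
      using schwartz_lincomb(2)[OF f f vs(1), of "complex_of_real r" 0] by simp
    then have "(1 + norm x) ^ N * norm (iter_deriv vs (\<lambda>x. complex_of_real r * f x) x) = r * ((1 + norm x) ^ N * norm (iter_deriv vs f x))"
      using \<open>r \<ge> 0\<close> by (simp add: norm_mult)
    also have "\<dots> \<le> r * schwartz_norm N f"
      using \<open>r \<ge> 0\<close> by (intro mult_left_mono schwartz_norm_ge f vs) auto
    finally show "(1 + norm x) ^ N * norm (iter_deriv vs (\<lambda>x. complex_of_real r * f x) x) \<le> r * schwartz_norm N f" .
  qed
  have key: "r * norm (u f) < 1" if f: "f \<in> schwartz" and r: "r \<ge> 0" "r * schwartz_norm N f < \<delta>" for f r
  proof -
    have "norm (u (\<lambda>x. complex_of_real r * f x)) < 1"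
      using r scale[OF f r(1)] by (intro d(2) schwartz_cmult f) auto
    then show ?thesis using r(1) by (simp add: hom[OF f] norm_mult)
  qed
  have "norm (u f) \<le> 2 / \<delta> * schwartz_norm N f" if f: "f \<in> schwartz" for f
  \<comment> \<open>If the norm vanishes, every multiple of \<open>f\<close> stays below \<delta>,
    which forces \<open>u f = 0\<close>. Otherwise \<open>f\<close> is rescaled to norm \<delta>/2,
    which is the origin of the constant 2/\<delta>.\<close>
  proof (cases "schwartz_norm N f = 0")
    case True
    have "norm (u f) = 0"
    proof (rule ccontr)
      assume "norm (u f) \<noteq> 0"
      then show False using key[OF f, of "1 / norm (u f)"] True d(1) by simp
    qed
    then show ?thesis using True by simp
  next
    case False
    then have pos: "schwartz_norm N f > 0" using schwartz_norm_nonneg[OF f, of N] by simp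
    have "\<delta> / (2 * schwartz_norm N f) * norm (u f) < 1"
      using pos d(1) by (intro key f) (auto simp: field_simps)
    then show ?thesis using pos d(1) by (simp add: field_simps)
  qed
  then show ?thesis using d(1) by (intro that[of "2 / \<delta>" N]) auto
qed

lemma tempered_lincomb:
  assumes "u \<in> tempered_distributions" "f \<in> schwartz" "g \<in> schwartz"
  shows "u (\<lambda>x. a * f x + c * g x) = a * u f + c * u g"
proof -
  have add: "\<And>f g. f \<in> schwartz \<Longrightarrow> g \<in> schwartz \<Longrightarrow> u (\<lambda>x. f x + g x) = u f + u g"
    and mul: "\<And>c f. f \<in> schwartz \<Longrightarrow> u (\<lambda>x. c * f x) = c * u f"
    using assms(1) unfolding tempered_distributions_def by blast+
  show ?thesis
    using add[OF schwartz_cmult[OF assms(2), of a] schwartz_cmult[OF assms(3), of c]] mul assms by simp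
qed

lemma tempered_sum:
  assumes "u \<in> tempered_distributions"
  shows "(\<And>i. i \<in> I \<Longrightarrow> f i \<in> schwartz) \<Longrightarrow> u (\<lambda>x. \<Sum>i\<in>I. c i * f i x) = (\<Sum>i\<in>I. c i * u (f i))"
proof (induction I rule: infinite_finite_induct)
  case (insert i I)
  then show ?case
    using tempered_lincomb[OF assms, of "f i" "\<lambda>x. \<Sum>i\<in>I. c i * f i x" "c i" 1] schwartz_sum[of I f c] by simp
next
  case empty
  show ?case using tempered_lincomb[OF assms schwartz_zero schwartz_zero, of 0 0] by simp
next
  case infinite
  then show ?case using tempered_lincomb[OF assms schwartz_zero schwartz_zero, of 0 0] by simp
qed

lemma integrable_mult_schwartz_translate:
  fixes \<sigma> :: "'a::euclidean_space \<Rightarrow> 'a"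
  assumes K: "rapid K" and f: "f \<in> schwartz" and vs: "set vs \<subseteq> Basis" and [measurable]: "\<sigma> \<in> borel_measurable borel"
  shows "integrable lborel (\<lambda>z. K z * iter_deriv vs f (y + \<sigma> z))"
proof -
  have [measurable]: "K \<in> borel_measurable borel" "iter_deriv vs f \<in> borel_measurable borel"
    using K f vs by (auto intro: rapid_measurable schwartz_iter_deriv_rapid)
  obtain B where B: "\<And>x. norm (iter_deriv vs f x) \<le> B"
    using rapid_bounded[OF schwartz_iter_deriv_rapid[OF f vs]] by metis
  show ?thesis
  proof (rule Bochner_Integration.integrable_bound)
    show "integrable lborel (\<lambda>z. B * norm (K z))"
      by (intro integrable_mult_right integrable_norm rapid_integrable K)
    show "AE z in lborel. norm (K z * iter_deriv vs f (y + \<sigma> z)) \<le> norm (B * norm (K z))"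
      using B by (intro AE_I2) (auto simp: norm_mult abs_mult mult.commute[of B]
          intro!: mult_left_mono intro: order_trans[OF _ abs_ge_self])
  qed measurable
qed

text \<open>The map \<sigma> is kept general because two cases are compared later: the identity and
  simple functions approximating it. The factor 2 is the growth bound that comes with such an
  approximating sequence.\<close>

lemma superposition_schwartz:
  fixes \<sigma> :: "'a::euclidean_space \<Rightarrow> 'a"
  assumes K: "rapid K" and f: "f \<in> schwartz" and \<sigma>m [measurable]: "\<sigma> \<in> borel_measurable borel"
    and \<sigma>: "\<And>z. norm (\<sigma> z) \<le> 2 * norm z"
  shows "(\<lambda>y. LINT z|lborel. K z * f (y + \<sigma> z)) \<in> schwartz"
    and "set vs \<subseteq> Basis \<Longrightarrow> iter_deriv vs (\<lambda>y. LINT z|lborel. K z * f (y + \<sigma> z)) =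
      (\<lambda>y. LINT z|lborel. K z * iter_deriv vs f (y + \<sigma> z))"
proof -
  have Km [measurable]: "K \<in> borel_measurable borel" using K by (rule rapid_measurable)
  let ?G = "\<lambda>vs y. LINT z|lborel. K z * iter_deriv vs f (y + \<sigma> z)"
  have 1: "(?G vs has_derivative grad_map (\<lambda>b. ?G (b # vs)) y) (at y)" if vs: "set vs \<subseteq> Basis" for vs y
  proof -
    have "rapid (iter_deriv (c # b # vs) f)" if "b \<in> Basis" "c \<in> Basis" for b c
      using vs that by (intro schwartz_iter_deriv_rapid f) auto
    moreover have "(iter_deriv (b # vs) f has_derivative grad_map (\<lambda>c. iter_deriv (c # b # vs) f) x) (at x)" if "b \<in> Basis" for b x
      using vs that by (intro schwartz_iter_derivative f) auto
    ultimately obtain C where C: "C > 0" "\<And>v x. norm v \<le> 1 \<Longrightarrow>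
        norm (iter_deriv vs f (x + v) - iter_deriv vs f x - grad_map (\<lambda>b. iter_deriv (b # vs) f) x v) \<le> (norm v)\<^sup>2 * (C * (1 + norm x) powr - real 0)"
      using rapid_taylor[of "iter_deriv vs f" "\<lambda>b. iter_deriv (b # vs) f" "\<lambda>b c. iter_deriv (c # b # vs) f" 0]
        schwartz_iter_derivative[OF f vs] by blast
    have "(?G vs has_derivative grad_map (\<lambda>b _. ?G (b # vs) y) y) (at y)"
    proof (rule has_derivative_lebesgue_integral[where k="\<lambda>z. C * norm (K z)"])
      show "integrable lborel (\<lambda>z. C * norm (K z))"
        by (intro integrable_mult_right integrable_norm rapid_integrable K)
      show "integrable lborel (\<lambda>z. K z * iter_deriv vs f (y + v + \<sigma> z))" for v
        using integrable_mult_schwartz_translate[OF K f vs \<sigma>m] .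
      show "integrable lborel (\<lambda>z. K z * iter_deriv (b # vs) f (y + \<sigma> z))" if "b \<in> Basis" for b
        using integrable_mult_schwartz_translate[OF K f _ \<sigma>m, of "b # vs"] vs that by simp
      fix v z :: 'a assume v: "norm v \<le> 1"
      have eq: "K z * iter_deriv vs f (y + v + \<sigma> z) - K z * iter_deriv vs f (y + \<sigma> z) - (\<Sum>b\<in>Basis. (v \<bullet> b) *\<^sub>R (K z * iter_deriv (b # vs) f (y + \<sigma> z))) =
         K z * (iter_deriv vs f ((y + \<sigma> z) + v) - iter_deriv vs f (y + \<sigma> z) - grad_map (\<lambda>b. iter_deriv (b # vs) f) (y + \<sigma> z) v)"
        by (simp add: grad_map_def algebra_simps sum_distrib_left)
      have "norm (iter_deriv vs f ((y + \<sigma> z) + v) - iter_deriv vs f (y + \<sigma> z) - grad_map (\<lambda>b. iter_deriv (b # vs) f) (y + \<sigma> z) v) \<le> (norm v)\<^sup>2 * C"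
        using C(2)[OF v, of "y + \<sigma> z"] by (simp add: add_nonneg_eq_0_iff)
      from mult_left_mono[OF this norm_ge_zero[of "K z"]]
      show "norm (K z * iter_deriv vs f (y + v + \<sigma> z) - K z * iter_deriv vs f (y + \<sigma> z) - (\<Sum>b\<in>Basis. (v \<bullet> b) *\<^sub>R (K z * iter_deriv (b # vs) f (y + \<sigma> z)))) \<le> (norm v)\<^sup>2 * (C * norm (K z))"
        unfolding eq norm_mult by (simp only: mult_ac)
    qed
    then show ?thesis by (simp add: grad_map_def[abs_def])
  qed
  have 2: "\<exists>B. \<forall>y. (1 + norm y) ^ N * norm (?G vs y) \<le> B" if vs: "set vs \<subseteq> Basis" for N vs
  proof -
    \<comment> \<open>The index of the norm bounds two things at once, the power of the weight and
      the order of the derivative.\<close>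
    define S where "S = schwartz_norm (N + length vs) f"
    define M where "M = N + length vs"
    have S0: "S \<ge> 0" unfolding S_def by (rule schwartz_norm_nonneg[OF f])
    have "(1 + norm y) ^ N * norm (?G vs y) \<le> (LINT z|lborel. S * 2 ^ M * ((1 + norm z) ^ M * norm (K z)))" for y
    proof -
      have "(1 + norm y) ^ N * norm (?G vs y) \<le> (1 + norm y) ^ M * norm (?G vs y)"
        unfolding M_def by (intro mult_right_mono power_increasing) auto
      also have "\<dots> = norm (LINT z|lborel. complex_of_real ((1 + norm y) ^ M) * (K z * iter_deriv vs f (y + \<sigma> z)))"
        unfolding integral_mult_right_zero norm_weight_mult ..
      also have "\<dots> \<le> (LINT z|lborel. S * 2 ^ M * ((1 + norm z) ^ M * norm (K z)))"
      proof (rule Bochner_Integration.integral_norm_bound_integral)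
        show "integrable lborel (\<lambda>z. complex_of_real ((1 + norm y) ^ M) * (K z * iter_deriv vs f (y + \<sigma> z)))"
          by (intro integrable_mult_right integrable_mult_schwartz_translate K f vs \<sigma>m)
        show "integrable lborel (\<lambda>z. S * 2 ^ M * ((1 + norm z) ^ M * norm (K z)))"
          by (intro integrable_mult_right rapid_integrable_weight K)
        fix z
        have "norm (complex_of_real ((1 + norm y) ^ M) * (K z * iter_deriv vs f (y + \<sigma> z))) =
           norm (K z) * ((1 + norm y) ^ M * norm (iter_deriv vs f (y + \<sigma> z)))"
          by (subst norm_weight_mult) (simp only: norm_mult mult_ac)
        also have "\<dots> \<le> norm (K z) * (S * (1 + norm (\<sigma> z)) ^ M)"
          unfolding S_def M_def by (intro mult_left_mono schwartz_translate_bound f vs) auto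
        also have "\<dots> \<le> norm (K z) * (S * (2 * (1 + norm z)) ^ M)"
          using \<sigma>[of z] S0 by (intro mult_left_mono power_mono) auto
        finally show "norm (complex_of_real ((1 + norm y) ^ M) * (K z * iter_deriv vs f (y + \<sigma> z))) \<le> S * 2 ^ M * ((1 + norm z) ^ M * norm (K z))"
          unfolding power_mult_distrib by (simp only: mult_ac)
      qed
      finally show ?thesis .
    qed
    then show ?thesis by blast
  qed
  show "(\<lambda>y. LINT z|lborel. K z * f (y + \<sigma> z)) \<in> schwartz"
    by (rule schwartz_family(1)[of ?G, OF _ 1 2]) simp_all
  show "set vs \<subseteq> Basis \<Longrightarrow> iter_deriv vs (\<lambda>y. LINT z|lborel. K z * f (y + \<sigma> z)) = ?G vs"
    by (rule schwartz_family(2)[of ?G, OF _ 1 2]) simp_all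
qed

lemma integral_simple_compose:
  fixes s :: "'a::euclidean_space \<Rightarrow> 'a" and H :: "'a \<Rightarrow> complex"
  assumes s: "simple_function lborel s" and K: "integrable lborel K"
  shows "(LINT z|lborel. K z * H (s z)) = (\<Sum>v\<in>range s. (LINT z|lborel. K z * indicator (s -` {v}) z) * H v)"
proof -
  have fin: "finite (range s)" using simple_functionD(1)[OF s] by simp
  have ms: "s -` {v} \<in> sets lborel" for v using simple_functionD(2)[OF s, of "{v}"] by simp
  have int: "integrable lborel (\<lambda>z. K z * indicator (s -` {v}) z)" for v
  proof -
    have "(\<lambda>z. K z * indicator (s -` {v}) z) = (\<lambda>z. indicator (s -` {v}) z *\<^sub>R K z)"
      by (auto simp: indicator_def)
    then show ?thesis using integrable_mult_indicator[OF ms[of v] K] by simp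
  qed
  have "K z * H (s z) = (\<Sum>v\<in>range s. (K z * indicator (s -` {v}) z) * H v)" for z
  proof -
    have "(\<Sum>v\<in>range s. (K z * indicator (s -` {v}) z) * H v) = (\<Sum>v\<in>range s. if v = s z then K z * H v else 0)"
      by (intro sum.cong) (auto simp: indicator_def)
    then show ?thesis using fin by simp
  qed
  then show ?thesis
    using int by (simp add: Bochner_Integration.integral_sum)
qed

text \<open>The functional is moved under the integral by replacing the integration variable by simple
  functions \<open>s\<^sub>i\<close> converging to the identity, for which the integral is a finite sum.\<close>

lemma tempered_superposition:
  fixes u :: "('a::euclidean_space \<Rightarrow> complex) \<Rightarrow> complex"
  assumes u: "u \<in> tempered_distributions" and K: "rapid K" and f: "f \<in> schwartz"
  shows "u (\<lambda>y. LINT z|lborel. K z * f (y + z)) = (LINT z|lborel. K z * u (\<lambda>y. f (y + z)))"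
    and "continuous_on UNIV (\<lambda>z. u (\<lambda>y. f (y + z)))"
    and "\<exists>C N. \<forall>z. norm (u (\<lambda>y. f (y + z))) \<le> C * (1 + norm z) ^ N"
proof -
  define F where "F z = u (\<lambda>y. f (y + z))" for z
  obtain N C where C: "C \<ge> 0" "\<And>f. f \<in> schwartz \<Longrightarrow> norm (u f) \<le> C * schwartz_norm N f"
    using tempered_bound[OF u] by metis
  define S where "S = schwartz_norm N f"
  define S' where "S' = DIM('a) * schwartz_norm (Suc N) f"
  have S0: "S \<ge> 0" "S' \<ge> 0" using schwartz_norm_nonneg[OF f] by (auto simp: S_def S'_def)
  have F_bnd: "norm (F z) \<le> C * S * (1 + norm z) ^ N" for z
  proof -
    have "norm (F z) \<le> C * schwartz_norm N (\<lambda>y. f (y + z))"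
      unfolding F_def by (intro C schwartz_translate f)
    also have "\<dots> \<le> C * (S * (1 + norm z) ^ N)"
      unfolding S_def by (intro mult_left_mono C schwartz_norm_le) (simp add: schwartz_translate(2)[OF f] schwartz_translate_bound[OF f])
    finally show ?thesis by simp
  qed
  \<comment> \<open>The Lipschitz bound for translates, passed through \<open>u\<close>; it gives
    the continuity of \<open>F\<close>.\<close>
  have F_lip: "norm (F z - F z') \<le> C * (S' * norm (z - z') * (1 + norm z + norm z') ^ N)" for z z'
  proof -
    have "F z - F z' = u (\<lambda>y. 1 * f (y + z) + (-1) * f (y + z'))"
      unfolding F_def by (subst tempered_lincomb[OF u schwartz_translate(1)[OF f] schwartz_translate(1)[OF f]]) simp
    also have "norm \<dots> \<le> C * schwartz_norm N (\<lambda>y. 1 * f (y + z) + (-1) * f (y + z'))"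
      by (intro C schwartz_lincomb schwartz_translate f)
    also have "\<dots> \<le> C * (S' * norm (z - z') * (1 + norm z + norm z') ^ N)"
    proof (intro mult_left_mono C schwartz_norm_le)
      fix vs :: "'a list" and x assume vs: "set vs \<subseteq> Basis" "length vs \<le> N"
      have "iter_deriv vs (\<lambda>y. 1 * f (y + z) + (-1) * f (y + z')) x = iter_deriv vs f (x + z) - iter_deriv vs f (x + z')"
        by (subst schwartz_lincomb(2)[OF schwartz_translate(1)[OF f] schwartz_translate(1)[OF f] vs(1)])
          (simp add: schwartz_translate(2)[OF f vs(1)])
      then show "(1 + norm x) ^ N * norm (iter_deriv vs (\<lambda>y. 1 * f (y + z) + (-1) * f (y + z')) x) \<le> S' * norm (z - z') * (1 + norm z + norm z') ^ N"
        using schwartz_translate_diff_bound[OF f vs] by (simp add: S'_def)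
    qed
    finally show ?thesis .
  qed
  have F_cont: "continuous_on UNIV F"
    unfolding continuous_on_sequentially
  proof safe
    fix X and z :: 'a assume X: "X \<longlonglongrightarrow> z"
    have "(\<lambda>n. C * (S' * norm (X n - z) * (1 + norm (X n) + norm z) ^ N)) \<longlonglongrightarrow> C * (S' * norm (z - z) * (1 + norm z + norm z) ^ N)"
      using X by (intro tendsto_intros)
    then have lim: "(\<lambda>n. C * (S' * norm (X n - z) * (1 + norm (X n) + norm z) ^ N)) \<longlonglongrightarrow> 0" by simp
    have "(\<lambda>n. F (X n) - F z) \<longlonglongrightarrow> 0"
      by (rule Lim_null_comparison[OF always_eventually[OF allI[OF F_lip]] lim])
    then show "(F \<circ> X) \<longlonglongrightarrow> F z" by (simp add: LIM_zero_iff o_def)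
  qed
  have [measurable]: "F \<in> borel_measurable borel" "K \<in> borel_measurable borel"
    using F_cont K by (auto intro: borel_measurable_continuous_onI rapid_measurable)
  show "continuous_on UNIV (\<lambda>z. u (\<lambda>y. f (y + z)))" using F_cont by (simp add: F_def[abs_def])
  show "\<exists>C N. \<forall>z. norm (u (\<lambda>y. f (y + z))) \<le> C * (1 + norm z) ^ N"
    using F_bnd unfolding F_def by blast
  \<comment> \<open>The approximating sequence is taken with base point 0, so that
    \<open>s i x\<close> has norm at most \<open>2 * norm x\<close>, as
    \<open>superposition_schwartz\<close> demands.\<close>
  have "(\<lambda>x::'a. x) \<in> borel_measurable lborel" by simp
  from borel_measurable_implies_sequence_metric[OF this, of 0]
  have "\<exists>s. (\<forall>i. simple_function lborel (s i)) \<and> (\<forall>x. (\<lambda>i. s i x) \<longlonglongrightarrow> (x::'a)) \<and> (\<forall>i x. norm (s i x) \<le> 2 * norm x)"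
    by simp
  then obtain s :: "nat \<Rightarrow> 'a \<Rightarrow> 'a" where s: "\<And>i. simple_function lborel (s i)" "\<And>x. (\<lambda>i. s i x) \<longlonglongrightarrow> x" "\<And>i x. norm (s i x) \<le> 2 * norm x"
    by blast
  have sm [measurable]: "s i \<in> borel_measurable borel" for i
    using borel_measurable_simple_function[OF s(1)] by simp
  let ?T = "\<lambda>\<sigma> y. LINT z|lborel. K z * f (y + \<sigma> z)"
  have T: "?T (s i) \<in> schwartz" "?T (\<lambda>z. z) \<in> schwartz" for i
    by (rule superposition_schwartz[OF K f], use s in simp_all)+
  have uT: "u (?T (s i)) = (LINT z|lborel. K z * F (s i z))" for i
  proof -
    have "?T (s i) = (\<lambda>y. \<Sum>v\<in>range (s i). (LINT z|lborel. K z * indicator (s i -` {v}) z) * f (y + v))"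
      by (intro ext integral_simple_compose s rapid_integrable K)
    then have "u (?T (s i)) = (\<Sum>v\<in>range (s i). (LINT z|lborel. K z * indicator (s i -` {v}) z) * F v)"
      unfolding F_def by (simp add: tempered_sum[OF u] schwartz_translate[OF f])
    then show ?thesis using integral_simple_compose[OF s(1)[of i] rapid_integrable[OF K], of F] by simp
  qed
  have lim1: "(\<lambda>i. LINT z|lborel. K z * F (s i z)) \<longlonglongrightarrow> (LINT z|lborel. K z * F z)"
  proof (rule integral_dominated_convergence[where w="\<lambda>z. C * S * 2 ^ N * ((1 + norm z) ^ N * norm (K z))"])
    show "AE z in lborel. (\<lambda>i. K z * F (s i z)) \<longlonglongrightarrow> K z * F z"
    proof (intro AE_I2)
      fix z
      have "isCont F z" using F_cont by (simp add: continuous_on_eq_continuous_at)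
      from tendsto_mult[OF tendsto_const isCont_tendsto_compose[OF this s(2)]]
      show "(\<lambda>i. K z * F (s i z)) \<longlonglongrightarrow> K z * F z" .
    qed
    show "integrable lborel (\<lambda>z. C * S * 2 ^ N * ((1 + norm z) ^ N * norm (K z)))"
      by (intro integrable_mult_right rapid_integrable_weight K)
    show "AE z in lborel. norm (K z * F (s i z)) \<le> C * S * 2 ^ N * ((1 + norm z) ^ N * norm (K z))" for i
    proof (intro AE_I2)
      fix z
      have "norm (F (s i z)) \<le> C * S * (1 + norm (s i z)) ^ N" by (rule F_bnd)
      also have "\<dots> \<le> C * S * (2 * (1 + norm z)) ^ N"
        using s(3)[of i z] C S0 by (intro mult_left_mono power_mono) auto
      finally have "norm (K z) * norm (F (s i z)) \<le> norm (K z) * (C * S * (2 * (1 + norm z)) ^ N)"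
        by (intro mult_left_mono) auto
      then show "norm (K z * F (s i z)) \<le> C * S * 2 ^ N * ((1 + norm z) ^ N * norm (K z))"
        unfolding norm_mult power_mult_distrib by (simp only: mult_ac)
    qed
  qed auto
  \<comment> \<open>Up to the constant of \<open>u\<close>, this bounds the error of replacing the
    identity by \<open>s i\<close>: the Lipschitz estimate for translates integrated against the
    kernel. It tends to 0 by dominated convergence.\<close>
  define e where "e i = (LINT z|lborel. norm (K z) * (S' * norm (z - s i z) * (1 + norm z + norm (s i z)) ^ N))" for i
  have dom: "norm (K z) * (S' * norm (z - s i z) * (1 + norm z + norm (s i z)) ^ N) \<le> S' * 3 ^ Suc N * ((1 + norm z) ^ Suc N * norm (K z))" for i z
  proof -
    have "norm (z - s i z) \<le> norm z + norm (s i z)" by (rule norm_triangle_ineq4)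
    also have "\<dots> \<le> norm z + 2 * norm z" by (intro add_left_mono s(3))
    also have "\<dots> \<le> 3 * (1 + norm z)" by simp
    finally have "norm (z - s i z) \<le> 3 * (1 + norm z)" .
    moreover have "(1 + norm z + norm (s i z)) ^ N \<le> (3 * (1 + norm z)) ^ N"
    proof (rule power_mono)
      have "1 + norm z + norm (s i z) \<le> 1 + norm z + 2 * norm z" by (intro add_left_mono s(3))
      also have "\<dots> \<le> 3 * (1 + norm z)" by simp
      finally show "1 + norm z + norm (s i z) \<le> 3 * (1 + norm z)" .
    qed simp
    ultimately have "norm (K z) * (S' * norm (z - s i z) * (1 + norm z + norm (s i z)) ^ N) \<le> norm (K z) * (S' * (3 * (1 + norm z)) * (3 * (1 + norm z)) ^ N)"
      using S0 by (intro mult_left_mono mult_mono) auto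
    then show ?thesis unfolding power_Suc power_mult_distrib by (simp only: mult_ac)
  qed
  have dom_int: "integrable lborel (\<lambda>z. S' * 3 ^ Suc N * ((1 + norm z) ^ Suc N * norm (K z)))"
    by (intro integrable_mult_right rapid_integrable_weight K)
  have "e \<longlonglongrightarrow> (LINT z|(lborel::'a measure). 0)"
    unfolding e_def[abs_def]
  proof (rule integral_dominated_convergence[OF _ _ dom_int])
    show "AE z in lborel. (\<lambda>i. norm (K z) * (S' * norm (z - s i z) * (1 + norm z + norm (s i z)) ^ N)) \<longlonglongrightarrow> 0"
    proof (intro AE_I2)
      fix z
      have "(\<lambda>i. norm (K z) * (S' * norm (z - s i z) * (1 + norm z + norm (s i z)) ^ N)) \<longlonglongrightarrow> norm (K z) * (S' * norm (z - z) * (1 + norm z + norm z) ^ N)"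
        by (intro tendsto_intros s(2))
      then show "(\<lambda>i. norm (K z) * (S' * norm (z - s i z) * (1 + norm z + norm (s i z)) ^ N)) \<longlonglongrightarrow> 0" by simp
    qed
    show "AE z in lborel. norm (norm (K z) * (S' * norm (z - s i z) * (1 + norm z + norm (s i z)) ^ N)) \<le> S' * 3 ^ Suc N * ((1 + norm z) ^ Suc N * norm (K z))" for i
    proof (intro AE_I2)
      fix z
      have "norm (norm (K z) * (S' * norm (z - s i z) * (1 + norm z + norm (s i z)) ^ N)) = norm (K z) * (S' * norm (z - s i z) * (1 + norm z + norm (s i z)) ^ N)"
        using S0 unfolding real_norm_def by (intro abs_of_nonneg mult_nonneg_nonneg) auto
      then show "norm (norm (K z) * (S' * norm (z - s i z) * (1 + norm z + norm (s i z)) ^ N)) \<le> S' * 3 ^ Suc N * ((1 + norm z) ^ Suc N * norm (K z))"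
        using dom[of z i] by (simp only:)
    qed
  qed auto
  then have e_lim: "e \<longlonglongrightarrow> 0" by simp
  have e_int: "integrable lborel (\<lambda>z. norm (K z) * (S' * norm (z - s i z) * (1 + norm z + norm (s i z)) ^ N))" for i
  proof (rule Bochner_Integration.integrable_bound[OF dom_int])
    show "AE z in lborel. norm (norm (K z) * (S' * norm (z - s i z) * (1 + norm z + norm (s i z)) ^ N)) \<le> norm (S' * 3 ^ Suc N * ((1 + norm z) ^ Suc N * norm (K z)))"
    proof (intro AE_I2)
      fix z
      have "norm (norm (K z) * (S' * norm (z - s i z) * (1 + norm z + norm (s i z)) ^ N)) = norm (K z) * (S' * norm (z - s i z) * (1 + norm z + norm (s i z)) ^ N)"
        using S0 unfolding real_norm_def by (intro abs_of_nonneg mult_nonneg_nonneg) auto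
      also have "\<dots> \<le> S' * 3 ^ Suc N * ((1 + norm z) ^ Suc N * norm (K z))" by (rule dom)
      also have "\<dots> \<le> norm (S' * 3 ^ Suc N * ((1 + norm z) ^ Suc N * norm (K z)))" unfolding real_norm_def by (rule abs_ge_self)
      finally show "norm (norm (K z) * (S' * norm (z - s i z) * (1 + norm z + norm (s i z)) ^ N)) \<le> norm (S' * 3 ^ Suc N * ((1 + norm z) ^ Suc N * norm (K z)))" .
    qed
  qed measurable
  have diff: "norm (u (?T (\<lambda>z. z)) - u (?T (s i))) \<le> C * e i" for i
  proof -
    have "u (?T (\<lambda>z. z)) - u (?T (s i)) = u (\<lambda>y. 1 * ?T (\<lambda>z. z) y + (-1) * ?T (s i) y)"
      by (subst tempered_lincomb[OF u T(2) T(1)]) simp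
    also have "norm \<dots> \<le> C * schwartz_norm N (\<lambda>y. 1 * ?T (\<lambda>z. z) y + (-1) * ?T (s i) y)"
      by (intro C schwartz_lincomb T)
    also have "\<dots> \<le> C * e i"
    proof (intro mult_left_mono C schwartz_norm_le)
      fix vs :: "'a list" and y assume vs: "set vs \<subseteq> Basis" "length vs \<le> N"
      have i1: "integrable lborel (\<lambda>z. K z * iter_deriv vs f (y + z))" "integrable lborel (\<lambda>z. K z * iter_deriv vs f (y + s i z))"
        using integrable_mult_schwartz_translate[OF K f vs(1), of "\<lambda>z. z"] integrable_mult_schwartz_translate[OF K f vs(1) sm] by auto
      have "iter_deriv vs (\<lambda>y. 1 * ?T (\<lambda>z. z) y + (-1) * ?T (s i) y) y = iter_deriv vs (?T (\<lambda>z. z)) y - iter_deriv vs (?T (s i)) y"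
        by (subst schwartz_lincomb(2)[OF T(2) T(1) vs(1)]) simp
      also have "\<dots> = (LINT z|lborel. K z * iter_deriv vs f (y + z)) - (LINT z|lborel. K z * iter_deriv vs f (y + s i z))"
        using superposition_schwartz(2)[OF K f, of "\<lambda>z. z"] superposition_schwartz(2)[OF K f sm s(3)] vs by simp
      also have "\<dots> = (LINT z|lborel. K z * (iter_deriv vs f (y + z) - iter_deriv vs f (y + s i z)))"
        using i1 by (simp add: right_diff_distrib)
      finally have eq: "iter_deriv vs (\<lambda>y. 1 * ?T (\<lambda>z. z) y + (-1) * ?T (s i) y) y = (LINT z|lborel. K z * (iter_deriv vs f (y + z) - iter_deriv vs f (y + s i z)))" .
      have "(1 + norm y) ^ N * norm (iter_deriv vs (\<lambda>y. 1 * ?T (\<lambda>z. z) y + (-1) * ?T (s i) y) y) =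
         norm (LINT z|lborel. complex_of_real ((1 + norm y) ^ N) * (K z * (iter_deriv vs f (y + z) - iter_deriv vs f (y + s i z))))"
        unfolding eq integral_mult_right_zero norm_weight_mult ..
      also have "\<dots> \<le> e i"
        unfolding e_def
      proof (rule Bochner_Integration.integral_norm_bound_integral[OF _ e_int])
        show "integrable lborel (\<lambda>z. complex_of_real ((1 + norm y) ^ N) * (K z * (iter_deriv vs f (y + z) - iter_deriv vs f (y + s i z))))"
          using i1 by (intro integrable_mult_right) (simp add: right_diff_distrib)
        fix z
        have "norm (complex_of_real ((1 + norm y) ^ N) * (K z * (iter_deriv vs f (y + z) - iter_deriv vs f (y + s i z)))) =
          norm (K z) * ((1 + norm y) ^ N * norm (iter_deriv vs f (y + z) - iter_deriv vs f (y + s i z)))"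
          by (subst norm_weight_mult) (simp only: norm_mult mult_ac)
        also have "\<dots> \<le> norm (K z) * (S' * norm (z - s i z) * (1 + norm z + norm (s i z)) ^ N)"
          unfolding S'_def by (intro mult_left_mono schwartz_translate_diff_bound f vs) auto
        finally show "norm (complex_of_real ((1 + norm y) ^ N) * (K z * (iter_deriv vs f (y + z) - iter_deriv vs f (y + s i z)))) \<le> \<dots>" .
      qed
      finally show "(1 + norm y) ^ N * norm (iter_deriv vs (\<lambda>y. 1 * ?T (\<lambda>z. z) y + (-1) * ?T (s i) y) y) \<le> e i" .
    qed
    finally show ?thesis .
  qed
  have "(\<lambda>i. C * e i) \<longlonglongrightarrow> C * 0" by (intro tendsto_intros e_lim)
  then have "(\<lambda>i. C * e i) \<longlonglongrightarrow> 0" by simp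
  then have "(\<lambda>i. u (?T (\<lambda>z. z)) - u (?T (s i))) \<longlonglongrightarrow> 0"
    by (rule Lim_null_comparison[OF always_eventually[OF allI[OF diff]]])
  from tendsto_diff[OF tendsto_const[of "u (?T (\<lambda>z. z))"] this]
  have "(\<lambda>i. u (?T (s i))) \<longlonglongrightarrow> u (?T (\<lambda>z. z))" by simp
  then have "u (?T (\<lambda>z. z)) = (LINT z|lborel. K z * F z)"
    using lim1 unfolding uT by (rule LIMSEQ_unique)
  then show "u (\<lambda>y. LINT z|lborel. K z * f (y + z)) = (LINT z|lborel. K z * u (\<lambda>y. f (y + z)))"
    by (simp add: F_def)
qed

lemma cvl_schwartz:
  assumes "rapid K" "g \<in> schwartz" shows "(\<lambda>y. cvl K g (x - y)) \<in> schwartz"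
proof -
  have "(\<lambda>y. LINT z|lborel. K z * (\<lambda>w. g (x - w)) (y + z)) \<in> schwartz"
    by (rule superposition_schwartz(1)[OF assms(1) schwartz_reflect[OF assms(2)]]) auto
  then show ?thesis by (simp add: cvl_def diff_diff_eq)
qed

lemma conv_cvl:
  assumes "u \<in> tempered_distributions" "rapid K" "g \<in> schwartz"
  shows "conv (cvl K g) u x = (LINT z|lborel. K z * conv g u (x - z))"
  using tempered_superposition(1)[OF assms(1,2) schwartz_reflect[OF assms(3), of x]]
  by (simp add: conv_def cvl_def diff_diff_eq add.commute)

lemma conv_continuous:
  assumes "u \<in> tempered_distributions" "g \<in> schwartz"
  shows "continuous_on UNIV (conv g u)"
proof -
  \<comment> \<open>The zero kernel instantiates \<open>tempered_superposition\<close>, of which the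
    continuity statement is taken.\<close>
  have "rapid (\<lambda>x::'a. 0)" by (auto intro!: rapidI)
  from tempered_superposition(2)[OF assms(1) this schwartz_reflect[OF assms(2), of 0]]
  have "continuous_on UNIV (\<lambda>z. u (\<lambda>y. g (0 - (y + z))))" .
  from continuous_on_compose2[OF this, of UNIV uminus]
  have "continuous_on UNIV (\<lambda>x. u (\<lambda>y. g (0 - (y + - x))))"
    by (simp add: continuous_on_minus continuous_on_id)
  then show ?thesis by (simp add: conv_def[abs_def])
qed

lemma conv_growth:
  assumes "u \<in> tempered_distributions" "g \<in> schwartz"
  obtains B m where "B > 0" "\<And>x. norm (conv g u x) \<le> B * (1 + norm x) ^ m"
proof -
  have "rapid (\<lambda>x::'a. 0)" by (auto intro!: rapidI)
  from tempered_superposition(3)[OF assms(1) this schwartz_reflect[OF assms(2), of 0]]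
  obtain B m where B: "\<And>z. norm (u (\<lambda>y. g (0 - (y + z)))) \<le> B * (1 + norm z) ^ m" by blast
  have "norm (conv g u x) \<le> (\<bar>B\<bar> + 1) * (1 + norm x) ^ m" for x
  proof -
    have "norm (conv g u x) \<le> B * (1 + norm x) ^ m"
      using B[of "- x"] by (simp add: conv_def)
    also have "\<dots> \<le> (\<bar>B\<bar> + 1) * (1 + norm x) ^ m" by (intro mult_right_mono) auto
    finally show ?thesis .
  qed
  then show ?thesis by (intro that[of "\<bar>B\<bar> + 1"]) auto
qed

section \<open>The Peetre inequality\<close>

lemma weight_quotient:
  fixes x z w :: "'a::euclidean_space"
  assumes "l > 0"
  shows "(1 + norm (x - z)) powr - l \<le> (1 + norm (x - (z - w))) powr - l * (1 + norm w) powr l"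
proof -
  have "1 + norm (x - (z - w)) \<le> (1 + norm (x - z)) * (1 + norm w)"
    using weight_shift[of "x - z + w" "- w"] by (simp add: algebra_simps)
  then have "(1 + norm (x - (z - w))) powr l \<le> ((1 + norm (x - z)) * (1 + norm w)) powr l"
    using assms by (intro powr_mono2) auto
  also have "\<dots> = (1 + norm (x - z)) powr l * (1 + norm w) powr l" by (rule powr_mult)
  finally show ?thesis
    by (simp add: powr_minus divide_simps add_nonneg_eq_0_iff mult.commute split: if_splits)
qed

text \<open>For small \<open>t\<close> the first summand can be absorbed into the left side of an
  estimate for \<open>P\<close>, while the second is linear in \<open>a powr p\<close>. If
  \<open>a\<close> exceeds \<open>t * P\<close>, then it lies between \<open>t * P\<close> and
  \<open>P\<close>, and \<open>a powr (1 - p)\<close> is bounded by its value at the upper end when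
  \<open>p \<le> 1\<close> and at the lower end otherwise; so small and large \<open>p\<close> are
  covered by one formula.\<close>

lemma convex_split:
  fixes a P t p :: real
  assumes "0 \<le> a" "a \<le> P" "0 < P" "0 < t" "0 < p"
  shows "a \<le> t * P + max 1 (t powr (1 - p)) * P powr (1 - p) * a powr p"
proof (cases "a \<le> t * P")
  case True then show ?thesis by (simp add: add_increasing2)
next
  case False
  then have a: "a > t * P" and a0: "a > 0" using assms by (auto intro: less_le_trans[of 0 "t * P"])
  have "a = a powr (1 - p) * a powr p" using a0 by (simp add: powr_add[symmetric])
  also have "\<dots> \<le> (max 1 (t powr (1 - p)) * P powr (1 - p)) * a powr p"
  proof (intro mult_right_mono)
    show "a powr (1 - p) \<le> max 1 (t powr (1 - p)) * P powr (1 - p)"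
    proof (cases "p \<le> 1")
      case True
      then have "a powr (1 - p) \<le> 1 * P powr (1 - p)" using assms by (simp add: powr_mono2)
      also have "\<dots> \<le> max 1 (t powr (1 - p)) * P powr (1 - p)" by (intro mult_right_mono) auto
      finally show ?thesis .
    next
      case False
      then have "a powr (1 - p) \<le> (t * P) powr (1 - p)" using a a0 assms by (intro powr_mono2') auto
      also have "\<dots> = t powr (1 - p) * P powr (1 - p)" by (rule powr_mult)
      also have "\<dots> \<le> max 1 (t powr (1 - p)) * P powr (1 - p)" by (intro mult_right_mono) auto
      finally show ?thesis .
    qed
  qed auto
  finally show ?thesis using assms by (simp add: add_increasing)
qed

text \<open>Bounding \<open>P = sup\<^sub>z \<bar>g z\<bar> (1 + \<bar>x - z\<bar>)\<^sup>-\<^sup>l\<close> through the reproducing formula gives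
  \<open>P \<le> P/2 + c P\<^bsup>1-p\<^esup> I\<close>, so finiteness of \<open>P\<close> has to be known in advance.\<close>

lemma peetre_a_priori:
  fixes \<eta> :: "'a::euclidean_space \<Rightarrow> complex"
  assumes \<eta>: "rapid \<eta>" and p: "p > 0" and l: "l > 0"
  obtains C where "C > 0"
    "\<And>g K x y. continuous_on UNIV g \<Longrightarrow> (\<And>z. norm (g z) \<le> K * (1 + norm z) powr l) \<Longrightarrow>
      (\<And>x. g x = (LINT z|lborel. \<eta> z * g (x - z))) \<Longrightarrow> integrable lborel (\<lambda>u. norm (g u) powr p) \<Longrightarrow>
      norm (g (x - y)) powr p \<le> C * (1 + norm y) powr (l * p) * (LINT u|lborel. (1 + norm (x - u)) powr - (l * p) * norm (g u) powr p)"
proof -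
  have [measurable]: "\<eta> \<in> borel_measurable borel" using \<eta> by (rule rapid_measurable)
  define A where "A = (LINT w|lborel. (1 + norm w) powr l * norm (\<eta> w))"
  have A0: "A \<ge> 0" unfolding A_def by (intro integral_nonneg_AE) auto
  obtain B where B: "B > 0" "\<And>w. norm (\<eta> w) \<le> B * (1 + norm w) powr - l"
    using rapid_decay[OF \<eta>] by metis
  \<comment> \<open>Chosen so that \<open>t * A \<le> 1 / 2\<close>, where \<open>A\<close> is the
    weighted integral of the kernel. In the other summand the weighted kernel is replaced by its
    pointwise bound \<open>B\<close>.\<close>
  define t where "t = 1 / (2 * (A + 1))"
  have t0: "t > 0" using A0 by (simp add: t_def)
  define c where "c = max 1 (t powr (1 - p))"
  have c0: "c > 0" by (simp add: c_def)
  define C where "C = 2 * (c * B)"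
  have C0: "C > 0" using c0 B by (simp add: C_def)
  show ?thesis
  proof (rule that[OF C0])
    fix g :: "'a \<Rightarrow> complex" and K x y
    assume gc: "continuous_on UNIV g" and gK: "\<And>z. norm (g z) \<le> K * (1 + norm z) powr l"
      and rep: "\<And>x. g x = (LINT z|lborel. \<eta> z * g (x - z))" and gi: "integrable lborel (\<lambda>u. norm (g u) powr p)"
    have [measurable]: "g \<in> borel_measurable borel" using gc by (rule borel_measurable_continuous_onI)
    define v where "v z = norm (g z) * (1 + norm (x - z)) powr - l" for z
    have [measurable]: "v \<in> borel_measurable borel" unfolding v_def by measurable
    have v0: "v z \<ge> 0" for z by (simp add: v_def)
    have vp: "v z powr p = (1 + norm (x - z)) powr - (l * p) * norm (g z) powr p" for z
      by (simp add: v_def powr_mult powr_powr mult.commute)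
    have vpi: "integrable lborel (\<lambda>z. v z powr p)"
    proof (rule Bochner_Integration.integrable_bound[OF gi])
      show "AE z in lborel. norm (v z powr p) \<le> norm (norm (g z) powr p)"
      proof (intro AE_I2)
        fix z
        have "(1 + norm (x - z)) powr - (l * p) \<le> (1 + norm (x - z)) powr 0"
          using l p by (intro powr_mono) auto
        then have "(1 + norm (x - z)) powr - (l * p) \<le> 1" by (simp add: add_nonneg_eq_0_iff)
        then show "norm (v z powr p) \<le> norm (norm (g z) powr p)" unfolding vp by (simp add: mult_left_le_one_le)
      qed
    qed measurable
    define I where "I = (LINT z|lborel. v z powr p)"
    \<comment> \<open>Here the growth hypothesis with the very exponent \<open>l\<close> enters: it
      makes the supremum \<open>P\<close> finite, so that \<open>P / 2\<close> may be subtracted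
      below.\<close>
    have vbd: "v z \<le> \<bar>K\<bar> * (1 + norm x) powr l" for z
    proof -
      have "norm (g z) \<le> \<bar>K\<bar> * (1 + norm z) powr l" using gK[of z] by (rule order_trans) (intro mult_right_mono, auto)
      also have "\<dots> \<le> \<bar>K\<bar> * ((1 + norm (x - z)) powr l * (1 + norm x) powr l)"
      proof (intro mult_left_mono)
        have "1 + norm z \<le> (1 + norm (x - z)) * (1 + norm x)"
          using weight_shift[of z "- x"] by (simp add: norm_minus_commute)
        then have "(1 + norm z) powr l \<le> ((1 + norm (x - z)) * (1 + norm x)) powr l"
          using l by (intro powr_mono2) auto
        then show "(1 + norm z) powr l \<le> (1 + norm (x - z)) powr l * (1 + norm x) powr l" by (simp only: powr_mult)
      qed auto
      finally have "v z \<le> (\<bar>K\<bar> * ((1 + norm (x - z)) powr l * (1 + norm x) powr l)) * (1 + norm (x - z)) powr - l"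
        unfolding v_def by (intro mult_right_mono) auto
      also have "\<dots> = \<bar>K\<bar> * (1 + norm x) powr l * ((1 + norm (x - z)) powr l * (1 + norm (x - z)) powr - l)" by (simp only: mult_ac)
      also have "(1 + norm (x - z)) powr l * (1 + norm (x - z)) powr - l = 1"
        by (simp add: powr_add[symmetric] add_nonneg_eq_0_iff)
      finally show ?thesis by simp
    qed
    define P where "P = (SUP z. v z)"
    have bdd: "bdd_above (range v)" using vbd by (intro bdd_aboveI[where M="\<bar>K\<bar> * (1 + norm x) powr l"]) auto
    have vP: "v z \<le> P" for z unfolding P_def by (rule cSUP_upper[OF _ bdd]) simp
    have P0: "P \<ge> 0" using v0 vP order_trans by blast
    have "P powr p \<le> C * I"
    proof (cases "P = 0")
      case True
      then show ?thesis using p C0 by (simp add: I_def integral_nonneg_AE)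
    next
      case False
      then have Ppos: "P > 0" using P0 by simp
      have "v z \<le> P / 2 + c * B * P powr (1 - p) * I" for z
      proof -
        define h where "h w = (1 + norm w) powr l * norm (\<eta> w)" for w
        have h0: "h w \<ge> 0" for w by (simp add: h_def)
        have hB: "h w \<le> B" for w
        proof -
          have "h w \<le> (1 + norm w) powr l * (B * (1 + norm w) powr - l)"
            unfolding h_def using B by (intro mult_left_mono) auto
          also have "\<dots> = B * ((1 + norm w) powr l * (1 + norm w) powr - l)" by (simp only: mult_ac)
          also have "\<dots> = B" by (simp add: powr_add[symmetric] add_nonneg_eq_0_iff)
          finally show ?thesis .
        qed
        have hi: "integrable lborel h" unfolding h_def[abs_def] by (rule rapid_integrable_powr[OF \<eta>])
        have [measurable]: "h \<in> borel_measurable borel" unfolding h_def by measurable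
        have shift: "integrable lborel (\<lambda>w. v (z - w) powr p)" "(LINT w|lborel. v (z - w) powr p) = I"
        proof -
          show "integrable lborel (\<lambda>w. v (z - w) powr p)"
            using integrable_reflect[of "\<lambda>w. v w powr p" z] vpi by simp
          have "complex_of_real (LINT w|lborel. v (z - w) powr p) = complex_of_real I"
            unfolding I_def integral_complex_of_real[symmetric]
            by (rule integral_reflect[of "\<lambda>w. complex_of_real (v w powr p)"]) measurable
          then show "(LINT w|lborel. v (z - w) powr p) = I" by simp
        qed
        have pt: "norm (complex_of_real ((1 + norm (x - z)) powr - l) * (\<eta> w * g (z - w))) \<le> t * P * h w + c * P powr (1 - p) * B * v (z - w) powr p" for w
        proof -
          have "norm (complex_of_real ((1 + norm (x - z)) powr - l) * (\<eta> w * g (z - w))) = (1 + norm (x - z)) powr - l * (norm (\<eta> w) * norm (g (z - w)))"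
            by (simp add: norm_mult)
          also have "\<dots> \<le> ((1 + norm (x - (z - w))) powr - l * (1 + norm w) powr l) * (norm (\<eta> w) * norm (g (z - w)))"
            by (intro mult_right_mono weight_quotient l) auto
          also have "\<dots> = h w * v (z - w)" unfolding h_def v_def by (simp only: mult_ac)
          also have "\<dots> \<le> h w * (t * P + c * P powr (1 - p) * v (z - w) powr p)"
            unfolding c_def using convex_split[OF v0 vP Ppos t0 p] by (intro mult_left_mono h0) auto
          also have "\<dots> = t * P * h w + c * P powr (1 - p) * h w * v (z - w) powr p" by (simp add: algebra_simps)
          also have "\<dots> \<le> t * P * h w + c * P powr (1 - p) * B * v (z - w) powr p"
            using c0 by (intro add_left_mono mult_right_mono mult_left_mono hB) auto
          finally show ?thesis .
        qed
        have ri: "integrable lborel (\<lambda>w. t * P * h w + c * P powr (1 - p) * B * v (z - w) powr p)"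
          by (intro Bochner_Integration.integrable_add integrable_mult_right hi shift)
        have "v z = norm (complex_of_real ((1 + norm (x - z)) powr - l) * g z)"
          by (simp add: v_def norm_mult)
        also have "\<dots> = norm (LINT w|lborel. complex_of_real ((1 + norm (x - z)) powr - l) * (\<eta> w * g (z - w)))"
          by (subst rep) simp
        also have "\<dots> \<le> (LINT w|lborel. t * P * h w + c * P powr (1 - p) * B * v (z - w) powr p)"
        proof (rule Bochner_Integration.integral_norm_bound_integral[OF _ ri pt])
          show "integrable lborel (\<lambda>w. complex_of_real ((1 + norm (x - z)) powr - l) * (\<eta> w * g (z - w)))"
          proof (rule Bochner_Integration.integrable_bound[OF ri])
            show "AE w in lborel. norm (complex_of_real ((1 + norm (x - z)) powr - l) * (\<eta> w * g (z - w))) \<le> norm (t * P * h w + c * P powr (1 - p) * B * v (z - w) powr p)"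
              using order_trans[OF pt abs_ge_self] by (intro AE_I2) (simp only: real_norm_def)
          qed measurable
        qed
        also have "\<dots> = t * P * A + c * P powr (1 - p) * B * I"
          using hi shift by (simp add: A_def h_def[abs_def])
        also have "\<dots> \<le> P / 2 + c * B * P powr (1 - p) * I"
        proof -
          have "t * A \<le> 1 / 2" using A0 by (simp add: t_def divide_simps)
          then have "(t * A) * P \<le> (1 / 2) * P" by (intro mult_right_mono P0)
          then show ?thesis by (simp add: mult_ac)
        qed
        finally show ?thesis .
      qed
      then have "P \<le> P / 2 + c * B * P powr (1 - p) * I" unfolding P_def by (intro cSUP_least) auto
      then have "P \<le> C * I * P powr (1 - p)" by (simp add: C_def mult_ac)
      \<comment> \<open>Multiplication by \<open>P powr (p - 1)\<close> cancels the power of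
        \<open>P\<close> on the right; this is where \<open>P > 0\<close> is needed.\<close>
      then have "P powr (p - 1) * P \<le> P powr (p - 1) * (C * I * P powr (1 - p))" by (intro mult_left_mono) auto
      also have "\<dots> = C * I * (P powr (p - 1) * P powr (1 - p))" by (simp only: mult_ac)
      also have "P powr (p - 1) * P powr (1 - p) = 1" using Ppos by (simp add: powr_add[symmetric])
      also have "P powr (p - 1) * P = P powr p" using Ppos by (simp add: powr_mult_base mult.commute)
      finally show ?thesis by simp
    qed
    moreover have "v (x - y) powr p \<le> P powr p" using vP v0 p by (intro powr_mono2) auto
    ultimately have "v (x - y) powr p \<le> C * I" by simp
    then have "(1 + norm y) powr - (l * p) * norm (g (x - y)) powr p \<le> C * I" by (simp add: vp)
    then have "(1 + norm y) powr (l * p) * ((1 + norm y) powr - (l * p) * norm (g (x - y)) powr p) \<le> (1 + norm y) powr (l * p) * (C * I)"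
      by (intro mult_left_mono) auto
    moreover have e: "(1 + norm y) powr (l * p) * ((1 + norm y) powr - (l * p) * norm (g (x - y)) powr p) = norm (g (x - y)) powr p"
      by (simp add: mult.assoc[symmetric] powr_add[symmetric] add_nonneg_eq_0_iff)
    ultimately have "norm (g (x - y)) powr p \<le> (1 + norm y) powr (l * p) * (C * I)" by (simp only: e)
    then show "norm (g (x - y)) powr p \<le> C * (1 + norm y) powr (l * p) * (LINT u|lborel. (1 + norm (x - u)) powr - (l * p) * norm (g u) powr p)"
      unfolding I_def vp by (simp only: mult_ac)
  qed
qed

text \<open>The a priori bound of \<open>peetre_a_priori\<close> is first obtained with an exponent depending on
  \<open>g\<close>; this makes \<open>g\<close> bounded, whence the inequality for every exponent with a constant
  independent of \<open>g\<close>.\<close>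

lemma peetre_unit:
  fixes \<eta> :: "'a::euclidean_space \<Rightarrow> complex"
  assumes \<eta>: "rapid \<eta>" and p: "p > 0" and l: "l > 0"
  obtains C where "C > 0"
    "\<And>g K m x y. continuous_on UNIV g \<Longrightarrow> (\<And>z. norm (g z) \<le> K * (1 + norm z) ^ m) \<Longrightarrow>
      (\<And>x. g x = (LINT z|lborel. \<eta> z * g (x - z))) \<Longrightarrow> integrable lborel (\<lambda>u. norm (g u) powr p) \<Longrightarrow>
      norm (g (x - y)) powr p \<le> C * (1 + norm y) powr (l * p) * (LINT u|lborel. (1 + norm (x - u)) powr - (l * p) * norm (g u) powr p)"
proof -
  obtain C where C: "C > 0"
    "\<And>g K x y. continuous_on UNIV g \<Longrightarrow> (\<And>z. norm (g z) \<le> K * (1 + norm z) powr l) \<Longrightarrow>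
      (\<And>x. g x = (LINT z|lborel. \<eta> z * g (x - z))) \<Longrightarrow> integrable lborel (\<lambda>u. norm (g u) powr p) \<Longrightarrow>
      norm (g (x - y)) powr p \<le> C * (1 + norm y) powr (l * p) * (LINT u|lborel. (1 + norm (x - u)) powr - (l * p) * norm (g u) powr p)"
    using peetre_a_priori[OF \<eta> p l] by blast
  show ?thesis
  proof (rule that[OF C(1)])
    fix g :: "'a \<Rightarrow> complex" and K x y and m :: nat
    assume gc: "continuous_on UNIV g" and gK: "\<And>z. norm (g z) \<le> K * (1 + norm z) ^ m"
      and rep: "\<And>x. g x = (LINT z|lborel. \<eta> z * g (x - z))" and gi: "integrable lborel (\<lambda>u. norm (g u) powr p)"
    have [measurable]: "g \<in> borel_measurable borel" using gc by (rule borel_measurable_continuous_onI)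
    \<comment> \<open>A positive exponent large enough for the polynomial growth of
      \<open>g\<close>. The constant \<open>D\<close> obtained for it depends on \<open>g\<close>
      through \<open>m\<close>, but serves only to show that \<open>g\<close> is bounded.\<close>
    define k where "k = real m + 1"
    have k: "k > 0" by (simp add: k_def)
    obtain D where D: "D > 0"
    "\<And>g K x y. continuous_on UNIV g \<Longrightarrow> (\<And>z. norm (g z) \<le> K * (1 + norm z) powr k) \<Longrightarrow>
      (\<And>x. g x = (LINT z|lborel. \<eta> z * g (x - z))) \<Longrightarrow> integrable lborel (\<lambda>u. norm (g u) powr p) \<Longrightarrow>
      norm (g (x - y)) powr p \<le> D * (1 + norm y) powr (k * p) * (LINT u|lborel. (1 + norm (x - u)) powr - (k * p) * norm (g u) powr p)"
      using peetre_a_priori[OF \<eta> p k] by blast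
    have gk: "norm (g z) \<le> \<bar>K\<bar> * (1 + norm z) powr k" for z
    proof -
      have "(1 + norm z) ^ m = (1 + norm z) powr real m" by (simp add: powr_realpow add_pos_nonneg)
      also have "\<dots> \<le> (1 + norm z) powr k" unfolding k_def by (intro powr_mono) auto
      finally have "\<bar>K\<bar> * (1 + norm z) ^ m \<le> \<bar>K\<bar> * (1 + norm z) powr k" by (intro mult_left_mono) auto
      moreover have "K * (1 + norm z) ^ m \<le> \<bar>K\<bar> * (1 + norm z) ^ m" by (intro mult_right_mono) auto
      ultimately show ?thesis using gK[of z] by linarith
    qed
    define J where "J = (LINT u|lborel. norm (g u) powr p)"
    have "norm (g z) \<le> (D * J) powr (1 / p) * (1 + norm z) powr l" for z
    proof -
      \<comment> \<open>With \<open>y = 0\<close>, bounding the weight by 1 turns the inequality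
        into a bound of the supremum of \<open>g\<close> by its p-th power integral.\<close>
      have "norm (g (z - 0)) powr p \<le> D * (1 + norm (0::'a)) powr (k * p) * (LINT u|lborel. (1 + norm (z - u)) powr - (k * p) * norm (g u) powr p)"
        by (rule D(2)[OF gc gk rep gi])
      also have "\<dots> = D * (LINT u|lborel. (1 + norm (z - u)) powr - (k * p) * norm (g u) powr p)" by simp
      also have "\<dots> \<le> D * J"
        unfolding J_def
      proof (intro mult_left_mono integral_mono')
        fix u
        have "(1 + norm (z - u)) powr - (k * p) \<le> (1 + norm (z - u)) powr 0"
          using k p by (intro powr_mono) auto
        then have "(1 + norm (z - u)) powr - (k * p) \<le> 1" by (simp add: add_nonneg_eq_0_iff)
        then show "(1 + norm (z - u)) powr - (k * p) * norm (g u) powr p \<le> norm (g u) powr p" by (simp add: mult_left_le_one_le)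
      qed (use gi D(1) in auto)
      finally have "norm (g z) powr p \<le> D * J" by simp
      then have "(norm (g z) powr p) powr (1 / p) \<le> (D * J) powr (1 / p)" using p by (intro powr_mono2) auto
      then have "norm (g z) \<le> (D * J) powr (1 / p) * 1" using p by (simp add: powr_powr)
      also have "\<dots> \<le> (D * J) powr (1 / p) * (1 + norm z) powr l"
        using l by (intro mult_left_mono ge_one_powr_ge_zero) auto
      finally show ?thesis .
    qed
    from C(2)[OF gc this rep gi]
    show "norm (g (x - y)) powr p \<le> C * (1 + norm y) powr (l * p) * (LINT u|lborel. (1 + norm (x - u)) powr - (l * p) * norm (g u) powr p)" .
  qed
qed

text \<open>The function \<open>g (x / s)\<close> is reproduced by the undilated kernel, so the case
  of unit scale applies to it. Its constant is that of the unit scale and therefore the same for all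
  \<open>s\<close>.\<close>

lemma peetre:
  fixes \<eta> :: "'a::euclidean_space \<Rightarrow> complex"
  assumes \<eta>: "rapid \<eta>" and p: "p > 0" and l: "l > 0"
  obtains C where "C > 0"
    "\<And>g K m s x y. s > 0 \<Longrightarrow> continuous_on UNIV g \<Longrightarrow> (\<And>z. norm (g z) \<le> K * (1 + norm z) ^ m) \<Longrightarrow>
      (\<And>x. g x = (LINT z|lborel. complex_of_real (s ^ DIM('a)) * \<eta> (s *\<^sub>R z) * g (x - z))) \<Longrightarrow>
      integrable lborel (\<lambda>u. norm (g u) powr p) \<Longrightarrow>
      ennreal (norm (g (x - y)) powr p) \<le> ennreal (C * (1 + s * norm y) powr (l * p)) *
        (\<integral>\<^sup>+u. ennreal (s ^ DIM('a) * (1 + s * norm (x - u)) powr - (l * p) * norm (g u) powr p) \<partial>lborel)"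
proof -
  obtain C where C: "C > 0"
    "\<And>g K m x y. continuous_on UNIV g \<Longrightarrow> (\<And>z. norm (g z) \<le> K * (1 + norm z) ^ m) \<Longrightarrow>
      (\<And>x. g x = (LINT z|lborel. \<eta> z * g (x - z))) \<Longrightarrow> integrable lborel (\<lambda>u. norm (g u) powr p) \<Longrightarrow>
      norm (g (x - y)) powr p \<le> C * (1 + norm y) powr (l * p) * (LINT u|lborel. (1 + norm (x - u)) powr - (l * p) * norm (g u) powr p)"
    using peetre_unit[OF \<eta> p l] by blast
  have [measurable]: "\<eta> \<in> borel_measurable borel" using \<eta> by (rule rapid_measurable)
  show ?thesis
  proof (rule that[OF C(1)])
    fix g :: "'a \<Rightarrow> complex" and K s x y and m :: nat
    assume s: "s > 0" and gc: "continuous_on UNIV g" and gK: "\<And>z. norm (g z) \<le> K * (1 + norm z) ^ m"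
      and rep: "\<And>x. g x = (LINT z|lborel. complex_of_real (s ^ DIM('a)) * \<eta> (s *\<^sub>R z) * g (x - z))"
      and gi: "integrable lborel (\<lambda>u. norm (g u) powr p)"
    have [measurable]: "g \<in> borel_measurable borel" using gc by (rule borel_measurable_continuous_onI)
    define G where "G x = g ((1 / s) *\<^sub>R x)" for x
    have [measurable]: "G \<in> borel_measurable borel" unfolding G_def by measurable
    have "continuous_on UNIV (\<lambda>x::'a. (1 / s) *\<^sub>R x)" by (intro continuous_intros)
    from continuous_on_compose2[OF gc this] have Gc: "continuous_on UNIV G" by (simp add: G_def[abs_def])
    have GK: "norm (G z) \<le> \<bar>K\<bar> * (1 + 1 / s) ^ m * (1 + norm z) ^ m" for z
    proof -
      have "norm (G z) \<le> K * (1 + norm ((1 / s) *\<^sub>R z)) ^ m" unfolding G_def by (rule gK)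
      also have "\<dots> \<le> \<bar>K\<bar> * (1 + norm ((1 / s) *\<^sub>R z)) ^ m" by (intro mult_right_mono) auto
      also have "\<dots> \<le> \<bar>K\<bar> * ((1 + 1 / s) * (1 + norm z)) ^ m"
      proof (intro mult_left_mono power_mono)
        have "norm ((1 / s) *\<^sub>R z) = norm z / s" using s by simp
        moreover have "(1 + 1 / s) * (1 + norm z) = 1 + norm z + 1 / s + norm z / s" by (simp add: distrib_left distrib_right)
        ultimately show "1 + norm ((1 / s) *\<^sub>R z) \<le> (1 + 1 / s) * (1 + norm z)" using s by simp
      qed auto
      finally show ?thesis by (simp add: power_mult_distrib mult_ac)
    qed
    have Grep: "G x = (LINT z|lborel. \<eta> z * G (x - z))" for x
    proof -
      have "(LINT z|lborel. \<eta> z * G (x - z)) = \<bar>s\<bar> ^ DIM('a) *\<^sub>R (LINT z|lborel. \<eta> (s *\<^sub>R z + 0) * G (x - (s *\<^sub>R z + 0)))"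
        using s by (intro integral_scale) auto
      also have "\<dots> = (LINT z|lborel. complex_of_real (s ^ DIM('a)) * (\<eta> (s *\<^sub>R z + 0) * G (x - (s *\<^sub>R z + 0))))"
        using s by (simp add: scaleR_conv_of_real)
      also have "\<dots> = (LINT z|lborel. complex_of_real (s ^ DIM('a)) * \<eta> (s *\<^sub>R z) * g ((1 / s) *\<^sub>R x - z))"
        using s by (intro Bochner_Integration.integral_cong refl) (simp add: G_def scaleR_diff_right mult.assoc)
      also have "\<dots> = G x" unfolding G_def by (rule rep[symmetric])
      finally show ?thesis ..
    qed
    have Gi: "integrable lborel (\<lambda>u. norm (G u) powr p)"
      using integrable_scale[of "1 / s" "\<lambda>u. norm (g u) powr p" 0] s gi by (simp add: G_def)
    define w where "w u = (1 + norm (s *\<^sub>R x - u)) powr - (l * p) * norm (G u) powr p" for u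
    have [measurable]: "w \<in> borel_measurable borel" unfolding w_def by measurable
    have wi: "integrable lborel w"
    proof (rule Bochner_Integration.integrable_bound[OF Gi])
      show "AE u in lborel. norm (w u) \<le> norm (norm (G u) powr p)"
      proof (intro AE_I2)
        fix u
        have "(1 + norm (s *\<^sub>R x - u)) powr - (l * p) \<le> (1 + norm (s *\<^sub>R x - u)) powr 0"
          using l p by (intro powr_mono) auto
        then have "(1 + norm (s *\<^sub>R x - u)) powr - (l * p) \<le> 1" by (simp add: add_nonneg_eq_0_iff)
        then show "norm (w u) \<le> norm (norm (G u) powr p)" unfolding w_def by (simp add: mult_left_le_one_le)
      qed
    qed measurable
    have "norm (g (x - y)) powr p = norm (G (s *\<^sub>R x - s *\<^sub>R y)) powr p"
      using s by (simp add: G_def scaleR_diff_right)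
    also have "\<dots> \<le> C * (1 + norm (s *\<^sub>R y)) powr (l * p) * (LINT u|lborel. w u)"
      unfolding w_def by (rule C(2)[OF Gc GK Grep Gi])
    finally have "ennreal (norm (g (x - y)) powr p) \<le> ennreal (C * (1 + s * norm y) powr (l * p) * (LINT u|lborel. w u))"
      using s by (intro ennreal_leI) simp
    also have "\<dots> = ennreal (C * (1 + s * norm y) powr (l * p)) * ennreal (LINT u|lborel. w u)"
      using C(1) by (intro ennreal_mult') auto
    also have "ennreal (LINT u|lborel. w u) = (\<integral>\<^sup>+u. ennreal (w u) \<partial>lborel)"
      by (intro nn_integral_eq_integral[symmetric] wi) (auto simp: w_def)
    also have "\<dots> = ennreal (\<bar>s\<bar> ^ DIM('a)) * (\<integral>\<^sup>+u. ennreal (w (s *\<^sub>R u + 0)) \<partial>lborel)"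
      using s by (intro nn_integral_scale) auto
    also have "\<dots> = (\<integral>\<^sup>+u. ennreal (\<bar>s\<bar> ^ DIM('a)) * ennreal (w (s *\<^sub>R u + 0)) \<partial>lborel)"
      by (rule nn_integral_cmult[symmetric]) measurable
    also have "\<dots> = (\<integral>\<^sup>+u. ennreal (s ^ DIM('a) * (1 + s * norm (x - u)) powr - (l * p) * norm (g u) powr p) \<partial>lborel)"
    proof (intro nn_integral_cong)
      fix u
      have "norm (s *\<^sub>R x - s *\<^sub>R u) = s * norm (x - u)" using s by (simp add: scaleR_diff_right[symmetric])
      then show "ennreal (\<bar>s\<bar> ^ DIM('a)) * ennreal (w (s *\<^sub>R u + 0)) = ennreal (s ^ DIM('a) * (1 + s * norm (x - u)) powr - (l * p) * norm (g u) powr p)"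
        using s by (simp add: w_def G_def ennreal_mult'[symmetric] mult.assoc)
    qed
    finally show "ennreal (norm (g (x - y)) powr p) \<le> ennreal (C * (1 + s * norm y) powr (l * p)) *
        (\<integral>\<^sup>+u. ennreal (s ^ DIM('a) * (1 + s * norm (x - u)) powr - (l * p) * norm (g u) powr p) \<partial>lborel)" .
  qed
qed

text \<open>Tonelli and translation invariance: the kernel
  \<open>s ^ DIM('a) * (1 + s * norm x) powr - m\<close> is a dilate whose integral does not depend
  on \<open>s\<close>.\<close>

lemma nn_integral_peetre_average:
  fixes g :: "'a::euclidean_space \<Rightarrow> complex"
  assumes [measurable]: "g \<in> borel_measurable borel" and s: "s > 0"
  shows "(\<lambda>x. \<integral>\<^sup>+u. ennreal (s ^ DIM('a) * (1 + s * norm (x - u)) powr - m * norm (g u) powr p) \<partial>lborel) \<in> borel_measurable borel"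
    and "(\<integral>\<^sup>+x. (\<integral>\<^sup>+u. ennreal (s ^ DIM('a) * (1 + s * norm (x - u)) powr - m * norm (g u) powr p) \<partial>lborel) \<partial>lborel) =
      (\<integral>\<^sup>+x. ennreal ((1 + norm x) powr - m) \<partial>(lborel :: 'a measure)) * (\<integral>\<^sup>+u. ennreal (norm (g u) powr p) \<partial>lborel)"
proof -
  let ?F = "\<lambda>x u. ennreal (s ^ DIM('a) * (1 + s * norm (x - u)) powr - m * norm (g u) powr p)"
  have M: "(\<lambda>(x, u). ?F x u) \<in> borel_measurable (lborel \<Otimes>\<^sub>M lborel)" by measurable
  show "(\<lambda>x. \<integral>\<^sup>+u. ?F x u \<partial>lborel) \<in> borel_measurable borel"
    using lborel.borel_measurable_nn_integral[OF M] by simp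
  have "(\<integral>\<^sup>+x. (\<integral>\<^sup>+u. ?F x u \<partial>lborel) \<partial>lborel) = (\<integral>\<^sup>+u. (\<integral>\<^sup>+x. ?F x u \<partial>lborel) \<partial>lborel)"
    by (rule lborel_pair.Fubini'[OF M, symmetric])
  also have "\<dots> = (\<integral>\<^sup>+u. (\<integral>\<^sup>+x. ennreal ((1 + norm x) powr - m) \<partial>(lborel :: 'a measure)) * ennreal (norm (g u) powr p) \<partial>lborel)"
  proof (intro nn_integral_cong)
    fix u
    have "(\<integral>\<^sup>+x. ?F x u \<partial>lborel) = (\<integral>\<^sup>+x. ennreal (s ^ DIM('a)) * ennreal ((1 + norm (s *\<^sub>R x + - (s *\<^sub>R u))) powr - m) * ennreal (norm (g u) powr p) \<partial>lborel)"
    proof (intro nn_integral_cong)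
      fix x
      have "norm (s *\<^sub>R x + - (s *\<^sub>R u)) = s * norm (x - u)" using s by (simp add: scaleR_diff_right[symmetric])
      then show "?F x u = ennreal (s ^ DIM('a)) * ennreal ((1 + norm (s *\<^sub>R x + - (s *\<^sub>R u))) powr - m) * ennreal (norm (g u) powr p)"
        using s by (simp add: ennreal_mult'[symmetric])
    qed
    also have "\<dots> = (\<integral>\<^sup>+x. ennreal (s ^ DIM('a)) * ennreal ((1 + norm (s *\<^sub>R x + - (s *\<^sub>R u))) powr - m) \<partial>lborel) * ennreal (norm (g u) powr p)"
      by (rule nn_integral_multc) measurable
    also have "(\<integral>\<^sup>+x. ennreal (s ^ DIM('a)) * ennreal ((1 + norm (s *\<^sub>R x + - (s *\<^sub>R u))) powr - m) \<partial>lborel) =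
        ennreal (s ^ DIM('a)) * (\<integral>\<^sup>+x. ennreal ((1 + norm (s *\<^sub>R x + - (s *\<^sub>R u))) powr - m) \<partial>lborel)"
      by (rule nn_integral_cmult) measurable
    also have "ennreal (s ^ DIM('a)) = ennreal (\<bar>s\<bar> ^ DIM('a))" using s by simp
    also have "ennreal (\<bar>s\<bar> ^ DIM('a)) * (\<integral>\<^sup>+x. ennreal ((1 + norm (s *\<^sub>R x + - (s *\<^sub>R u))) powr - m) \<partial>lborel) = (\<integral>\<^sup>+x. ennreal ((1 + norm x) powr - m) \<partial>(lborel :: 'a measure))"
      using s by (intro nn_integral_scale[symmetric]) auto
    finally show "(\<integral>\<^sup>+x. ?F x u \<partial>lborel) = (\<integral>\<^sup>+x. ennreal ((1 + norm x) powr - m) \<partial>(lborel :: 'a measure)) * ennreal (norm (g u) powr p)" .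
  qed
  also have "\<dots> = (\<integral>\<^sup>+x. ennreal ((1 + norm x) powr - m) \<partial>(lborel :: 'a measure)) * (\<integral>\<^sup>+u. ennreal (norm (g u) powr p) \<partial>lborel)"
    by (rule nn_integral_cmult) measurable
  finally show "(\<integral>\<^sup>+x. (\<integral>\<^sup>+u. ?F x u \<partial>lborel) \<partial>lborel) = (\<integral>\<^sup>+x. ennreal ((1 + norm x) powr - m) \<partial>(lborel :: 'a measure)) * (\<integral>\<^sup>+u. ennreal (norm (g u) powr p) \<partial>lborel)" .
qed

section \<open>Fourier resolutions and dyadic dilates\<close>

text \<open>The dual functions have Fourier transform \<beta> times the conjugate of
  \<open>fourier (\<phi> k)\<close>, divided by the sum of the squared moduli. The denominator does
  not vanish on \<open>S\<close>, hence not on an open neighbourhood of it, and outside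
  \<open>S\<close> the factor \<beta> is zero; so the quotient extends by zero to a test
  function.\<close>

lemma fourier_resolution:
  fixes \<phi> :: "'k \<Rightarrow> 'a::euclidean_space \<Rightarrow> complex"
  assumes \<phi>: "\<And>k. k \<in> K \<Longrightarrow> rapid (\<phi> k)"
    and \<beta>: "\<And>n. Ck_on n UNIV \<beta>" and S: "closed S" "bounded S" "\<And>x. x \<notin> S \<Longrightarrow> \<beta> x = 0"
    and ne: "\<And>x. x \<in> S \<Longrightarrow> \<exists>k\<in>K. fourier (\<phi> k) x \<noteq> 0" and fin: "finite K"
  obtains \<theta> where "\<And>k. k \<in> K \<Longrightarrow> rapid (\<theta> k)" "\<And>x. (\<Sum>k\<in>K. fourier (\<theta> k) x * fourier (\<phi> k) x) = \<beta> x"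
proof -
  define G where "G x = (\<Sum>k\<in>K. fourier (\<phi> k) x * cnj (fourier (\<phi> k) x))" for x
  have f: "Ck_on n UNIV (fourier (\<phi> k))" if "k \<in> K" for n k using that by (intro fourier_Ck_on \<phi>)
  have G: "Ck_on n UNIV G" for n unfolding G_def by (intro Ck_on_sum Ck_on_mult Ck_on_cnj f)
  define U where "U = {x. G x \<noteq> 0}"
  have U: "open U" unfolding U_def
    by (intro open_Collect_neq Ck_on_continuous[OF G] continuous_on_const)
  have SU: "S \<subseteq> U"
  proof
    fix x assume "x \<in> S"
    then obtain k where k: "k \<in> K" "fourier (\<phi> k) x \<noteq> 0" using ne by blast
    have "G x = complex_of_real (\<Sum>k\<in>K. (norm (fourier (\<phi> k) x))\<^sup>2)"
      by (simp add: G_def complex_norm_square[symmetric])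
    moreover have "(\<Sum>k\<in>K. (norm (fourier (\<phi> k) x))\<^sup>2) > 0"
      using k fin by (intro sum_pos2[of K k]) auto
    ultimately show "x \<in> U" unfolding U_def by (metis mem_Collect_eq of_real_eq_0_iff less_irrefl)
  qed
  define h where "h k x = \<beta> x * inverse (G x) * cnj (fourier (\<phi> k) x)" for k x
  have h: "test_function (h k)" if k: "k \<in> K" for k
    unfolding test_function_def
  proof (intro conjI allI)
    fix n
    have sub: "U \<subseteq> UNIV" by simp
    have "Ck_on n U (h k)" unfolding h_def
      by (intro Ck_on_mult Ck_on_inverse Ck_on_cnj Ck_on_mono[OF \<beta> sub] Ck_on_mono[OF G sub] Ck_on_mono[OF f[OF k] sub]) (simp add: U_def)
    then show "Ck_on n UNIV (h k)" by (rule Ck_on_zero_extend[OF U S(1) SU]) (simp add: h_def S(3))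
  next
    obtain R where R: "\<And>x. x \<in> S \<Longrightarrow> norm x \<le> R" using S(2) unfolding bounded_iff by blast
    have "h k x = 0" if "R < norm x" for x
      using that R[of x] S(3)[of x] by (cases "x \<in> S") (auto simp: h_def)
    then show "\<exists>R. \<forall>x. R < norm x \<longrightarrow> h k x = 0" by blast
  qed
  show ?thesis
  proof (rule that[of "\<lambda>k. inverse_fourier (h k)"])
    show "rapid (inverse_fourier (h k))" if "k \<in> K" for k
      by (rule inverse_fourier_test_function_rapid[OF h[OF that]])
    fix x
    have "(\<Sum>k\<in>K. fourier (inverse_fourier (h k)) x * fourier (\<phi> k) x) = (\<Sum>k\<in>K. \<beta> x * inverse (G x) * (fourier (\<phi> k) x * cnj (fourier (\<phi> k) x)))"
      by (intro sum.cong refl) (simp add: fourier_inverse_fourier h h_def)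
    also have "\<dots> = \<beta> x * inverse (G x) * G x" by (simp add: G_def sum_distrib_left)
    also have "\<dots> = \<beta> x" using SU S(3)[of x] by (cases "x \<in> S") (auto simp: U_def)
    finally show "(\<Sum>k\<in>K. fourier (inverse_fourier (h k)) x * fourier (\<phi> k) x) = \<beta> x" .
  qed
qed

text \<open>Where \<open>m\<close> does not vanish the resolution sums to 1, so \<open>m\<close>
  splits into the products of \<open>m\<close>, \<open>fourier (\<theta> k)\<close> and
  \<open>fourier (\<phi> k)\<close>. On the space side these are iterated convolutions, and the
  distribution only meets the functions \<open>\<phi> k\<close>.\<close>

lemma conv_resolution:
  assumes u: "u \<in> tempered_distributions" and m: "test_function m" and fin: "finite K"
    and \<phi>: "\<And>k. k \<in> K \<Longrightarrow> \<phi> k \<in> schwartz" and \<theta>: "\<And>k. k \<in> K \<Longrightarrow> rapid (\<theta> k)"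
    and res: "\<And>\<xi>. m \<xi> \<noteq> 0 \<Longrightarrow> (\<Sum>k\<in>K. fourier (\<theta> k) \<xi> * fourier (\<phi> k) \<xi>) = 1"
  shows "\<And>k. k \<in> K \<Longrightarrow> rapid (cvl (inverse_fourier m) (\<theta> k))"
    and "conv (inverse_fourier m) u x = (\<Sum>k\<in>K. LINT z|lborel. cvl (inverse_fourier m) (\<theta> k) z * conv (\<phi> k) u (x - z))"
proof -
  have t1: "test_function (\<lambda>\<xi>. m \<xi> * fourier (\<theta> k) \<xi>)" if "k \<in> K" for k
    using that by (intro test_function_mult m fourier_Ck_on \<theta>)
  have t2: "test_function (\<lambda>\<xi>. m \<xi> * fourier (\<theta> k) \<xi> * fourier (\<phi> k) \<xi>)" if "k \<in> K" for k
    using that by (intro test_function_mult t1 fourier_Ck_on schwartz_rapid \<phi>)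
  have mi: "integrable lborel m" by (intro rapid_integrable test_function_rapid m)
  have c1: "inverse_fourier (\<lambda>\<xi>. m \<xi> * fourier (\<theta> k) \<xi>) = cvl (inverse_fourier m) (\<theta> k)" if "k \<in> K" for k
    using that by (intro inverse_fourier_mult_fourier mi rapid_integrable \<theta>)
  have r: "rapid (cvl (inverse_fourier m) (\<theta> k))" if "k \<in> K" for k
    using inverse_fourier_test_function_rapid[OF t1[OF that]] c1[OF that] by simp
  then show "\<And>k. k \<in> K \<Longrightarrow> rapid (cvl (inverse_fourier m) (\<theta> k))" .
  have c2: "inverse_fourier (\<lambda>\<xi>. m \<xi> * fourier (\<theta> k) \<xi> * fourier (\<phi> k) \<xi>) = cvl (cvl (inverse_fourier m) (\<theta> k)) (\<phi> k)" if "k \<in> K" for k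
    using that inverse_fourier_mult_fourier[OF rapid_integrable[OF test_function_rapid[OF t1[OF that]]] rapid_integrable[OF schwartz_rapid[OF \<phi>[OF that]]]]
    by (simp add: c1)
  have "inverse_fourier m y = (\<Sum>k\<in>K. 1 * cvl (cvl (inverse_fourier m) (\<theta> k)) (\<phi> k) y)" for y
  proof -
    have eq: "m \<xi> = (\<Sum>k\<in>K. m \<xi> * fourier (\<theta> k) \<xi> * fourier (\<phi> k) \<xi>)" for \<xi>
      using res[of \<xi>] by (cases "m \<xi> = 0") (simp_all add: mult.assoc sum_distrib_left[symmetric])
    have "inverse_fourier m y = (LINT \<xi>|lborel. (\<Sum>k\<in>K. (m \<xi> * fourier (\<theta> k) \<xi> * fourier (\<phi> k) \<xi>) * cis (2 * pi * (\<xi> \<bullet> y))))"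
      unfolding inverse_fourier_cis by (subst eq) (simp add: sum_distrib_right)
    also have "\<dots> = (\<Sum>k\<in>K. inverse_fourier (\<lambda>\<xi>. m \<xi> * fourier (\<theta> k) \<xi> * fourier (\<phi> k) \<xi>) y)"
      unfolding inverse_fourier_cis
      by (intro Bochner_Integration.integral_sum integrable_mult_cis rapid_integrable test_function_rapid t2) auto
    finally show ?thesis by (simp add: c2)
  qed
  then have "conv (inverse_fourier m) u x = u (\<lambda>y. \<Sum>k\<in>K. 1 * cvl (cvl (inverse_fourier m) (\<theta> k)) (\<phi> k) (x - y))"
    unfolding conv_def by (simp only:)
  also have "\<dots> = (\<Sum>k\<in>K. 1 * u (\<lambda>y. cvl (cvl (inverse_fourier m) (\<theta> k)) (\<phi> k) (x - y)))"
    by (intro tempered_sum[OF u] cvl_schwartz r \<phi>)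
  also have "\<dots> = (\<Sum>k\<in>K. LINT z|lborel. cvl (inverse_fourier m) (\<theta> k) z * conv (\<phi> k) u (x - z))"
    using conv_cvl[OF u r \<phi>] by (intro sum.cong refl) (simp add: conv_def)
  finally show "conv (inverse_fourier m) u x = (\<Sum>k\<in>K. LINT z|lborel. cvl (inverse_fourier m) (\<theta> k) z * conv (\<phi> k) u (x - z))" .
qed

lemma rapid_nn_integral_weight:
  assumes "rapid g" "s \<ge> 0" "l \<ge> 0"
  shows "(\<integral>\<^sup>+x. ennreal ((1 + s * norm x) powr l * norm (g x)) \<partial>lborel) < \<infinity>"
proof -
  have [measurable]: "g \<in> borel_measurable borel" using assms by (intro rapid_measurable)
  have "(\<integral>\<^sup>+x. ennreal ((1 + s * norm x) powr l * norm (g x)) \<partial>lborel) \<le> (\<integral>\<^sup>+x. ennreal ((1 + s) powr l * ((1 + norm x) powr l * norm (g x))) \<partial>lborel)"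
  proof (intro nn_integral_mono ennreal_leI)
    fix x :: 'a
    have "0 \<le> s + norm x" using assms by simp
    then have "1 + s * norm x \<le> (1 + s) * (1 + norm x)" by (simp add: algebra_simps)
    then have "(1 + s * norm x) powr l \<le> ((1 + s) * (1 + norm x)) powr l"
      using assms by (intro powr_mono2) auto
    then have "(1 + s * norm x) powr l \<le> (1 + s) powr l * (1 + norm x) powr l" by (simp only: powr_mult)
    from mult_right_mono[OF this norm_ge_zero[of "g x"]]
    show "(1 + s * norm x) powr l * norm (g x) \<le> (1 + s) powr l * ((1 + norm x) powr l * norm (g x))"
      by (simp only: mult.assoc)
  qed
  also have "\<dots> = ennreal (LINT x|lborel. (1 + s) powr l * ((1 + norm x) powr l * norm (g x)))"
    by (intro nn_integral_eq_integral integrable_mult_right rapid_integrable_powr assms) auto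
  also have "\<dots> < \<infinity>" by simp
  finally show ?thesis .
qed

text \<open>The weight is submultiplicative, so the weighted integral norm is submultiplicative
  under convolution, just as the unweighted one.\<close>

lemma weighted_young:
  fixes T g :: "'a::euclidean_space \<Rightarrow> complex"
  assumes T: "rapid T" and g: "rapid g" and s: "s \<ge> 0" and l: "l \<ge> 0"
  shows "(\<integral>\<^sup>+z. ennreal ((1 + s * norm z) powr l * norm (cvl T g z)) \<partial>lborel) \<le>
    (\<integral>\<^sup>+z. ennreal ((1 + s * norm z) powr l * norm (T z)) \<partial>lborel) * (\<integral>\<^sup>+z. ennreal ((1 + s * norm z) powr l * norm (g z)) \<partial>lborel)"
proof -
  have [measurable]: "T \<in> borel_measurable borel" "g \<in> borel_measurable borel" using T g by (auto intro: rapid_measurable)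
  let ?w = "\<lambda>x::'a. (1 + s * norm x) powr l"
  let ?F = "\<lambda>z y. ennreal (?w y * norm (T y)) * ennreal (?w (z - y) * norm (g (z - y)))"
  have "(\<integral>\<^sup>+z. ennreal (?w z * norm (cvl T g z)) \<partial>lborel) \<le> (\<integral>\<^sup>+z. (\<integral>\<^sup>+y. ?F z y \<partial>lborel) \<partial>lborel)"
  proof (intro nn_integral_mono)
    fix z
    obtain B where B: "\<And>x. norm (g x) \<le> B" using rapid_bounded[OF g] by metis
    have i: "integrable lborel (\<lambda>y. T y * g (z - y))"
    proof (rule Bochner_Integration.integrable_bound)
      show "integrable lborel (\<lambda>y. B * norm (T y))" by (intro integrable_mult_right integrable_norm rapid_integrable T)
      show "AE y in lborel. norm (T y * g (z - y)) \<le> norm (B * norm (T y))"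
      proof (intro AE_I2)
        fix y
        have "norm (T y * g (z - y)) \<le> B * norm (T y)" unfolding norm_mult using mult_left_mono[OF B[of "z - y"] norm_ge_zero[of "T y"]] by (simp only: mult.commute)
        then show "norm (T y * g (z - y)) \<le> norm (B * norm (T y))" by simp
      qed
    qed measurable
    have "ennreal (?w z * norm (cvl T g z)) = ennreal (?w z) * ennreal (norm (cvl T g z))" by (rule ennreal_mult') simp
    also have "\<dots> \<le> ennreal (?w z) * (\<integral>\<^sup>+y. norm (T y * g (z - y)) \<partial>lborel)"
      unfolding cvl_def by (intro mult_left_mono integral_norm_bound_ennreal i) simp
    also have "\<dots> = (\<integral>\<^sup>+y. ennreal (?w z) * ennreal (norm (T y * g (z - y))) \<partial>lborel)"
      by (rule nn_integral_cmult[symmetric]) measurable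
    also have "\<dots> \<le> (\<integral>\<^sup>+y. ?F z y \<partial>lborel)"
    proof (intro nn_integral_mono)
      fix y
      have "norm z \<le> norm y + norm (z - y)" using norm_triangle_ineq[of y "z - y"] by simp
      then have "s * norm z \<le> s * norm y + s * norm (z - y)" using s by (metis distrib_left mult_left_mono)
      moreover have "0 \<le> (s * norm y) * (s * norm (z - y))" using s by simp
      ultimately have "1 + s * norm z \<le> (1 + s * norm y) * (1 + s * norm (z - y))" unfolding ring_distribs by linarith
      then have "?w z \<le> ((1 + s * norm y) * (1 + s * norm (z - y))) powr l"
        using s l by (intro powr_mono2) auto
      then have "?w z \<le> ?w y * ?w (z - y)" by (simp only: powr_mult)
      then have "?w z * (norm (T y) * norm (g (z - y))) \<le> (?w y * ?w (z - y)) * (norm (T y) * norm (g (z - y)))"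
        by (intro mult_right_mono) auto
      then have "ennreal (?w z * (norm (T y) * norm (g (z - y)))) \<le> ennreal ((?w y * norm (T y)) * (?w (z - y) * norm (g (z - y))))"
        by (intro ennreal_leI) (simp only: mult_ac)
      then show "ennreal (?w z) * ennreal (norm (T y * g (z - y))) \<le> ?F z y"
        by (simp add: ennreal_mult'[symmetric] norm_mult)
    qed
    finally show "ennreal (?w z * norm (cvl T g z)) \<le> (\<integral>\<^sup>+y. ?F z y \<partial>lborel)" .
  qed
  also have "\<dots> = (\<integral>\<^sup>+y. (\<integral>\<^sup>+z. ?F z y \<partial>lborel) \<partial>lborel)"
    by (rule lborel_pair.Fubini'[symmetric]) measurable
  also have "\<dots> = (\<integral>\<^sup>+y. ennreal (?w y * norm (T y)) * (\<integral>\<^sup>+z. ennreal (?w z * norm (g z)) \<partial>lborel) \<partial>lborel)"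
  proof (intro nn_integral_cong)
    fix y
    have "(\<integral>\<^sup>+z. ?F z y \<partial>lborel) = ennreal (?w y * norm (T y)) * (\<integral>\<^sup>+z. ennreal (?w (z + - y) * norm (g (z + - y))) \<partial>lborel)"
      by (subst nn_integral_cmult) auto
    also have "(\<integral>\<^sup>+z. ennreal (?w (z + - y) * norm (g (z + - y))) \<partial>lborel) = (\<integral>\<^sup>+z. ennreal (?w z * norm (g z)) \<partial>lborel)"
      by (rule nn_integral_translate) measurable
    finally show "(\<integral>\<^sup>+z. ?F z y \<partial>lborel) = ennreal (?w y * norm (T y)) * (\<integral>\<^sup>+z. ennreal (?w z * norm (g z)) \<partial>lborel)" .
  qed
  also have "\<dots> = (\<integral>\<^sup>+z. ennreal (?w z * norm (T z)) \<partial>lborel) * (\<integral>\<^sup>+z. ennreal (?w z * norm (g z)) \<partial>lborel)"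
    by (rule nn_integral_multc) measurable
  finally show ?thesis .
qed

text \<open>A kernel in weighted integral norm pairs with a function dominated by the same weight.
  By \<open>weighted_young\<close> only the weighted norms of the multiplier kernel
  (\<open>a\<close>) and of the dual functions (\<open>b\<close>) enter, and these are what must be
  controlled uniformly in the scale.\<close>

lemma conv_resolution_bound:
  assumes u: "u \<in> tempered_distributions" and m: "test_function m" and fin: "finite K"
    and \<phi>: "\<And>k. k \<in> K \<Longrightarrow> \<phi> k \<in> schwartz" and \<theta>: "\<And>k. k \<in> K \<Longrightarrow> rapid (\<theta> k)"
    and res: "\<And>\<xi>. m \<xi> \<noteq> 0 \<Longrightarrow> (\<Sum>k\<in>K. fourier (\<theta> k) \<xi> * fourier (\<phi> k) \<xi>) = 1"
    and s: "s \<ge> 0" and l: "l \<ge> 0"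
    and P: "\<And>k z. k \<in> K \<Longrightarrow> norm (conv (\<phi> k) u (x - z)) \<le> P k * (1 + s * norm z) powr l"
    and T: "(\<integral>\<^sup>+z. ennreal ((1 + s * norm z) powr l * norm (inverse_fourier m z)) \<partial>lborel) \<le> ennreal a" "a \<ge> 0"
    and th: "\<And>k. k \<in> K \<Longrightarrow> (\<integral>\<^sup>+z. ennreal ((1 + s * norm z) powr l * norm (\<theta> k z)) \<partial>lborel) \<le> ennreal b" "b \<ge> 0"
  shows "norm (conv (inverse_fourier m) u x) \<le> a * b * (\<Sum>k\<in>K. P k)"
proof -
  note R = conv_resolution[OF u m fin \<phi> \<theta> res]
  have P0: "P k \<ge> 0" if "k \<in> K" for k
    using order_trans[OF norm_ge_zero P[OF that, of 0]] by simp
  have "norm (LINT z|lborel. cvl (inverse_fourier m) (\<theta> k) z * conv (\<phi> k) u (x - z)) \<le> a * b * P k" if k: "k \<in> K" for k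
  proof -
    have rk: "rapid (cvl (inverse_fourier m) (\<theta> k))" by (rule R(1)[OF _ _ _ k]) (use \<phi> \<theta> res in auto)
    have [measurable]: "cvl (inverse_fourier m) (\<theta> k) \<in> borel_measurable borel" by (rule rapid_measurable[OF rk])
    have cc: "continuous_on UNIV (conv (\<phi> k) u)" by (rule conv_continuous[OF u \<phi>[OF k]])
    have [measurable]: "conv (\<phi> k) u \<in> borel_measurable borel" using cc by (rule borel_measurable_continuous_onI)
    let ?f = "\<lambda>z. cvl (inverse_fourier m) (\<theta> k) z * conv (\<phi> k) u (x - z)"
    have "(\<integral>\<^sup>+z. norm (?f z) \<partial>lborel) \<le> (\<integral>\<^sup>+z. ennreal (P k) * ennreal ((1 + s * norm z) powr l * norm (cvl (inverse_fourier m) (\<theta> k) z)) \<partial>lborel)"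
    proof (intro nn_integral_mono)
      fix z
      have "norm (?f z) \<le> P k * ((1 + s * norm z) powr l * norm (cvl (inverse_fourier m) (\<theta> k) z))"
        using mult_left_mono[OF P[OF k, of z] norm_ge_zero[of "cvl (inverse_fourier m) (\<theta> k) z"]] by (simp add: norm_mult mult_ac)
      then show "ennreal (norm (?f z)) \<le> ennreal (P k) * ennreal ((1 + s * norm z) powr l * norm (cvl (inverse_fourier m) (\<theta> k) z))"
        using P0[OF k] by (simp add: ennreal_mult'[symmetric] ennreal_leI)
    qed
    also have "\<dots> = ennreal (P k) * (\<integral>\<^sup>+z. ennreal ((1 + s * norm z) powr l * norm (cvl (inverse_fourier m) (\<theta> k) z)) \<partial>lborel)"
      by (rule nn_integral_cmult) measurable
    also have "\<dots> \<le> ennreal (P k) * (ennreal a * ennreal b)"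
      by (intro mult_left_mono order_trans[OF weighted_young[OF inverse_fourier_test_function_rapid[OF m] \<theta>[OF k] s l]] mult_mono T th k) auto
    also have "\<dots> = ennreal (a * b * P k)" using T(2) th(2) P0[OF k] by (simp add: ennreal_mult'[symmetric] mult_ac)
    finally have nn: "(\<integral>\<^sup>+z. norm (?f z) \<partial>lborel) \<le> ennreal (a * b * P k)" .
    have fi: "integrable lborel ?f"
      by (rule integrableI_bounded) (use nn in \<open>auto intro: le_less_trans\<close>)
    have "ennreal (norm (LINT z|lborel. ?f z)) \<le> ennreal (a * b * P k)"
      using integral_norm_bound_ennreal[OF fi] nn by (rule order_trans)
    then show ?thesis using T(2) th(2) P0[OF k] by (simp add: ennreal_le_iff)
  qed
  then have "norm (\<Sum>k\<in>K. LINT z|lborel. cvl (inverse_fourier m) (\<theta> k) z * conv (\<phi> k) u (x - z)) \<le> (\<Sum>k\<in>K. a * b * P k)"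
    by (rule sum_norm_le)
  then show ?thesis unfolding sum_distrib_left using R(2)[of x] \<phi> \<theta> res by simp
qed

lemma test_function_Ck_on: "test_function h \<Longrightarrow> Ck_on n UNIV h"
  unfolding test_function_def by blast

lemma sum_delta_mult: "(\<Sum>m\<in>UNIV. (if i = m then c m else 0) * f m) = c i * (f (i::'d::finite) :: real)"
proof -
  have "(\<Sum>m\<in>UNIV. (if i = m then c m else 0) * f m) = (\<Sum>m\<in>UNIV. if i = m then c i * f i else 0)"
    by (intro sum.cong) auto
  then show ?thesis by simp
qed

lemma power_mult_swap: "(a ^ m) ^ n = (a::'a::monoid_mult) ^ (n * m)"
  by (simp add: power_mult[symmetric] mult.commute)

section \<open>Dyadic dilates\<close>

lemma dyadic_dilate_add:
  fixes g :: "real^'d \<Rightarrow> complex"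
  shows "dyadic_dilate (m + k) g = dyadic_dilate m (dyadic_dilate k g)"
proof
  fix x :: "real^'d"
  have "(2::real) ^ (m + k) = 2 ^ k * 2 ^ m" by (simp add: power_add)
  then have 1: "(2::real) ^ (m + k) *\<^sub>R x = 2 ^ k *\<^sub>R (2 ^ m *\<^sub>R x)" by (simp only: scaleR_scaleR)
  have 2: "(2::complex) ^ (CARD('d) * (m + k)) = 2 ^ (CARD('d) * m) * 2 ^ (CARD('d) * k)"
    by (simp only: distrib_left power_add)
  show "dyadic_dilate (m + k) g x = dyadic_dilate m (dyadic_dilate k g) x"
    unfolding dyadic_dilate_def 1 2 by (rule mult.assoc)
qed

lemma dyadic_dilate_schwartz:
  assumes "g \<in> schwartz" shows "dyadic_dilate \<nu> g \<in> schwartz"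
proof -
  have "(\<lambda>x. g (2 ^ \<nu> *\<^sub>R x)) \<in> schwartz"
  proof -
    have "(2::real) ^ \<nu> \<noteq> 0" by simp
    from schwartz_affine(1)[OF assms this, where t=0] show ?thesis by (simp only: add_0_right)
  qed
  then show ?thesis unfolding dyadic_dilate_def by (rule schwartz_cmult)
qed

lemma dyadic_dilate_rapid:
  assumes "rapid g" shows "rapid (dyadic_dilate \<nu> g)"
proof -
  have "norm x \<le> 1 * norm (2 ^ \<nu> *\<^sub>R x)" for x :: "real^'a"
    using mult_right_mono[of 1 "2 ^ \<nu>" "norm x"] by simp
  then have "rapid (\<lambda>x. g (2 ^ \<nu> *\<^sub>R x))"
    by (intro rapid_compose[OF assms, where C=1]) (auto intro!: continuous_intros)
  then show ?thesis unfolding dyadic_dilate_def by (rule rapid_cmult)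
qed

lemma fourier_dyadic_dilate:
  fixes g :: "real^'d \<Rightarrow> complex"
  assumes [measurable]: "g \<in> borel_measurable borel"
  shows "fourier (dyadic_dilate \<nu> g) \<xi> = fourier g ((1 / 2 ^ \<nu>) *\<^sub>R \<xi>)"
proof -
  have "fourier g ((1 / 2 ^ \<nu>) *\<^sub>R \<xi>) = (\<bar>2 ^ \<nu>\<bar> ^ DIM(real^'d)) *\<^sub>R (LINT x|lborel. g (2 ^ \<nu> *\<^sub>R x + 0) * cis (- (2 * pi * (((1 / 2 ^ \<nu>) *\<^sub>R \<xi>) \<bullet> (2 ^ \<nu> *\<^sub>R x + 0)))))"
    unfolding fourier_cis by (intro integral_scale) auto
  also have "\<dots> = 2 ^ (CARD('d) * \<nu>) * (LINT x|lborel. g (2 ^ \<nu> *\<^sub>R x) * cis (- (2 * pi * (\<xi> \<bullet> x))))"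
    using power_mult_swap[of "2::complex" \<nu> "CARD('d)"] by (simp add: scaleR_conv_of_real[where 'a=complex])
  finally show ?thesis by (simp add: fourier_cis dyadic_dilate_def mult.assoc)
qed

text \<open>Dilating function and weight together is a change of variables. Hence the dual functions
  of a dilated resolution obey the same weighted bound as the original ones.\<close>

lemma nn_integral_dyadic_dilate_weight:
  fixes g :: "real^'d \<Rightarrow> complex"
  assumes [measurable]: "g \<in> borel_measurable borel"
  shows "(\<integral>\<^sup>+x. ennreal ((1 + 2 ^ \<nu> * norm x) powr l * norm (dyadic_dilate \<nu> g x)) \<partial>lborel) =
    (\<integral>\<^sup>+x. ennreal ((1 + norm x) powr l * norm (g x)) \<partial>lborel)"
proof -
  have "(\<integral>\<^sup>+x. ennreal ((1 + norm x) powr l * norm (g x)) \<partial>lborel) =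
     ennreal (\<bar>2 ^ \<nu>\<bar> ^ DIM(real^'d)) * (\<integral>\<^sup>+x. ennreal ((1 + norm (2 ^ \<nu> *\<^sub>R x + 0)) powr l * norm (g (2 ^ \<nu> *\<^sub>R x + 0))) \<partial>lborel)"
    by (intro nn_integral_scale) auto
  also have "\<dots> = (\<integral>\<^sup>+x. ennreal (\<bar>2 ^ \<nu>\<bar> ^ DIM(real^'d)) * ennreal ((1 + norm (2 ^ \<nu> *\<^sub>R x + 0)) powr l * norm (g (2 ^ \<nu> *\<^sub>R x + 0))) \<partial>lborel)"
    by (rule nn_integral_cmult[symmetric]) measurable
  also have "\<dots> = (\<integral>\<^sup>+x. ennreal ((1 + 2 ^ \<nu> * norm x) powr l * norm (dyadic_dilate \<nu> g x)) \<partial>lborel)"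
  proof (rule nn_integral_cong)
    fix x :: "real^'d"
    have 1: "norm (dyadic_dilate \<nu> g x) = 2 ^ (CARD('d) * \<nu>) * norm (g (2 ^ \<nu> *\<^sub>R x))"
      unfolding dyadic_dilate_def norm_mult norm_power by simp
    have 2: "\<bar>2 ^ \<nu>\<bar> ^ DIM(real^'d) = (2::real) ^ (CARD('d) * \<nu>)" using power_mult_swap[of "2::real" \<nu> "CARD('d)"] by simp
    have 3: "norm (2 ^ \<nu> *\<^sub>R x + 0) = 2 ^ \<nu> * norm x" by simp
    have "ennreal (2 ^ (CARD('d) * \<nu>)) * ennreal ((1 + 2 ^ \<nu> * norm x) powr l * norm (g (2 ^ \<nu> *\<^sub>R x))) =
      ennreal (2 ^ (CARD('d) * \<nu>) * ((1 + 2 ^ \<nu> * norm x) powr l * norm (g (2 ^ \<nu> *\<^sub>R x))))"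
      by (rule ennreal_mult'[symmetric]) simp
    then show "ennreal (\<bar>2 ^ \<nu>\<bar> ^ DIM(real^'d)) * ennreal ((1 + norm (2 ^ \<nu> *\<^sub>R x + 0)) powr l * norm (g (2 ^ \<nu> *\<^sub>R x + 0))) =
      ennreal ((1 + 2 ^ \<nu> * norm x) powr l * norm (dyadic_dilate \<nu> g x))"
      unfolding 1 2 3 by (simp only: add_0_right mult.left_commute)
  qed
  finally show ?thesis ..
qed

lemma dyadic_dilate_cvl:
  fixes g h :: "real^'d \<Rightarrow> complex"
  assumes [measurable]: "g \<in> borel_measurable borel" "h \<in> borel_measurable borel"
  shows "dyadic_dilate \<nu> (cvl g h) = cvl (dyadic_dilate \<nu> g) (dyadic_dilate \<nu> h)"
proof
  fix x
  have "cvl g h (2 ^ \<nu> *\<^sub>R x) = (\<bar>2 ^ \<nu>\<bar> ^ DIM(real^'d)) *\<^sub>R (LINT z|lborel. g (2 ^ \<nu> *\<^sub>R z + 0) * h (2 ^ \<nu> *\<^sub>R x - (2 ^ \<nu> *\<^sub>R z + 0)))"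
    unfolding cvl_def by (intro integral_scale) auto
  also have "\<dots> = 2 ^ (CARD('d) * \<nu>) * (LINT z|lborel. g (2 ^ \<nu> *\<^sub>R z) * h (2 ^ \<nu> *\<^sub>R (x - z)))"
    using power_mult_swap[of "2::complex" \<nu> "CARD('d)"] by (simp add: scaleR_conv_of_real[where 'a=complex] scaleR_diff_right)
  finally have "dyadic_dilate \<nu> (cvl g h) x = 2 ^ (CARD('d) * \<nu>) * (2 ^ (CARD('d) * \<nu>) * (LINT z|lborel. g (2 ^ \<nu> *\<^sub>R z) * h (2 ^ \<nu> *\<^sub>R (x - z))))"
    by (simp add: dyadic_dilate_def)
  also have "\<dots> = (LINT z|lborel. 2 ^ (CARD('d) * \<nu>) * (2 ^ (CARD('d) * \<nu>) * (g (2 ^ \<nu> *\<^sub>R z) * h (2 ^ \<nu> *\<^sub>R (x - z)))))"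
    by (simp only: integral_mult_right_zero)
  also have "\<dots> = cvl (dyadic_dilate \<nu> g) (dyadic_dilate \<nu> h) x"
    unfolding cvl_def dyadic_dilate_def by (simp only: mult_ac)
  finally show "dyadic_dilate \<nu> (cvl g h) x = cvl (dyadic_dilate \<nu> g) (dyadic_dilate \<nu> h) x" .
qed

section \<open>Cutoff functions and reproducing kernels\<close>

definition cube_bump :: "(real^'d \<Rightarrow> complex) \<Rightarrow> bool" where
  "cube_bump \<beta> \<longleftrightarrow> test_function \<beta> \<and> (\<forall>x. (\<forall>i. \<bar>x $ i\<bar> \<le> 1/8) \<longrightarrow> \<beta> x = 1) \<and> (\<forall>x i. 1/4 < \<bar>x $ i\<bar> \<longrightarrow> \<beta> x = 0)"

lemma supp_zero: "supp f \<subseteq> A \<Longrightarrow> x \<notin> A \<Longrightarrow> f x = 0"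
  unfolding supp_def using closure_subset[of "{x. f x \<noteq> 0}"] by blast

lemma norm_le_CARD:
  fixes x :: "real^'d"
  assumes "\<And>i. \<bar>x $ i\<bar> \<le> r" shows "norm x \<le> real CARD('d) * r"
proof -
  have "norm x \<le> (\<Sum>i\<in>UNIV. \<bar>x $ i\<bar>)" by (rule norm_le_l1_cart)
  also have "\<dots> \<le> real CARD('d) * r" using assms by (intro sum_bounded_above) auto
  finally show ?thesis .
qed

lemma test_function_if_cube:
  fixes h :: "real^'d \<Rightarrow> complex"
  assumes "\<And>n. Ck_on n UNIV h" "\<And>x i. r < \<bar>x $ i\<bar> \<Longrightarrow> h x = 0"
  shows "test_function h"
proof -
  have "h x = 0" if "real CARD('d) * r < norm x" for x
  proof -
    have "\<not> (\<forall>i. \<bar>x $ i\<bar> \<le> r)" using norm_le_CARD[of x r] that by auto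
    then obtain i where "r < \<bar>x $ i\<bar>" by (auto simp: not_le)
    then show "h x = 0" by (rule assms(2))
  qed
  then show ?thesis unfolding test_function_def using assms(1) by blast
qed

lemma coarse_generator_test_function:
  assumes "coarse_generator \<psi>1h \<psi>2h \<Psi>h"
  shows "test_function \<Psi>h" "\<And>x i. 1/4 < \<bar>x $ i\<bar> \<Longrightarrow> \<Psi>h x = 0"
proof -
  show *: "\<Psi>h x = 0" if "1/4 < \<bar>x $ i\<bar>" for x i
    using assms that by (intro supp_zero[of \<Psi>h "{\<xi>. \<forall>i. \<bar>\<xi> $ i\<bar> \<le> 1/4}"]) (auto simp: coarse_generator_def not_le)
  show "test_function \<Psi>h"
    using assms * by (intro test_function_if_cube[where r="1/4"] smooth_Ck_on) (auto simp: coarse_generator_def)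
qed

text \<open>Only the modulus of \<open>\<Psi>h\<close> is prescribed on the small cube, so the
  product with the conjugate is taken to obtain the value 1 there.\<close>

lemma coarse_generator_cube_bump:
  assumes "coarse_generator \<psi>1h \<psi>2h \<Psi>h"
  shows "cube_bump (\<lambda>\<xi>. \<Psi>h \<xi> * cnj (\<Psi>h \<xi>))"
proof -
  note t = coarse_generator_test_function(1)[OF assms]
  have "\<Psi>h x * cnj (\<Psi>h x) = 1" if "\<And>i. \<bar>x $ i\<bar> \<le> 1/8" for x
    using assms that by (simp add: coarse_generator_def R_cube_def complex_norm_square[symmetric])
  moreover have "test_function (\<lambda>\<xi>. \<Psi>h \<xi> * cnj (\<Psi>h \<xi>))"
    by (rule test_function_mult[OF t Ck_on_cnj[OF test_function_Ck_on[OF t]]])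
  ultimately show ?thesis
    unfolding cube_bump_def using coarse_generator_test_function(2)[OF assms] by (metis mult_zero_left)
qed

lemma test_function_scale:
  assumes "test_function h" "c > 0" shows "test_function (\<lambda>x. h (c *\<^sub>R x))"
proof -
  obtain R where R: "\<And>x. R < norm x \<Longrightarrow> h x = 0" using assms unfolding test_function_def by blast
  have "h (c *\<^sub>R x) = 0" if "R / c < norm x" for x
    using that assms by (intro R) (simp add: divide_less_eq mult.commute)
  moreover have "Ck_on n UNIV (\<lambda>x. h (c *\<^sub>R x))" for n
    by (rule Ck_on_linear_compose[OF bounded_linear_scaleR_right[of c], where V=UNIV]) (use assms in \<open>auto simp: test_function_def\<close>)
  ultimately show ?thesis unfolding test_function_def by blast
qed

text \<open>The multiplier \<open>\<beta> ((1/16) *\<^sub>R \<xi>)\<close> equals 1 on the ball of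
  radius 2, since the factor 1/16 takes it into the cube of half side 1/8. It therefore leaves
  \<open>fourier g\<close> unchanged, and its inverse transform is the reproducing kernel.\<close>

lemma band_limited_reproducing:
  fixes \<beta> :: "real^'d \<Rightarrow> complex"
  assumes \<beta>: "cube_bump \<beta>"
  obtains \<eta> :: "real^'d \<Rightarrow> complex" where "rapid \<eta>" "\<And>g. rapid g \<Longrightarrow> (\<And>\<xi>. 2 < norm \<xi> \<Longrightarrow> fourier g \<xi> = 0) \<Longrightarrow> cvl \<eta> g = g"
proof -
  let ?m = "\<lambda>\<xi>. \<beta> ((1/16) *\<^sub>R \<xi>)"
  have m: "test_function ?m" using \<beta> by (intro test_function_scale) (auto simp: cube_bump_def)
  show ?thesis
  proof (rule that[OF inverse_fourier_test_function_rapid[OF m]])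
    fix g :: "real^'d \<Rightarrow> complex" assume g: "rapid g" and supp: "\<And>\<xi>. 2 < norm \<xi> \<Longrightarrow> fourier g \<xi> = 0"
    have t: "test_function (fourier g)" unfolding test_function_def using fourier_Ck_on[OF g] supp by blast
    have "?m \<xi> * fourier g \<xi> = fourier g \<xi>" for \<xi>
    proof (cases "norm \<xi> \<le> 2")
      case True
      then have "\<bar>((1/16) *\<^sub>R \<xi>) $ i\<bar> \<le> 1/8" for i
        using component_le_norm_cart[of \<xi> i] by (simp add: abs_mult)
      then have "?m \<xi> = 1" using \<beta> unfolding cube_bump_def by blast
      then show ?thesis by simp
    qed (simp add: supp)
    then have e: "(\<lambda>\<xi>. ?m \<xi> * fourier g \<xi>) = fourier g" by (intro ext)
    have "cvl (inverse_fourier ?m) g = inverse_fourier (\<lambda>\<xi>. ?m \<xi> * fourier g \<xi>)"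
      by (rule inverse_fourier_mult_fourier[OF rapid_integrable[OF test_function_rapid[OF m]] rapid_integrable[OF g], symmetric])
    also have "\<dots> = inverse_fourier (fourier g)" by (simp only: e)
    also have "\<dots> = g"
    proof -
      obtain B where "\<And>x. norm (g x) \<le> B" using rapid_bounded[OF g] by metis
      then show ?thesis
        by (rule fourier_inversion[OF rapid_continuous[OF g] _ rapid_integrable[OF g] rapid_integrable[OF test_function_rapid[OF t]]])
    qed
    finally show "cvl (inverse_fourier ?m) g = g" .
  qed
qed

section \<open>Shear matrices and their change of variables\<close>

lemma matrix_inv_eqI:
  fixes A B :: "'a::semiring_1^'n^'n"
  assumes "A ** B = mat 1" "B ** A = mat 1" shows "matrix_inv A = B"
proof -
  have "A ** matrix_inv A = mat 1 \<and> matrix_inv A ** A = mat 1"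
    unfolding matrix_inv_def by (rule someI[of _ B]) (use assms in auto)
  then show ?thesis by (metis assms matrix_mul_assoc matrix_mul_lid matrix_mul_rid)
qed

lemma diag_mat_mult:
  fixes a b :: "'d::finite \<Rightarrow> real"
  shows "(\<chi> i k. if i = k then a i else 0) ** (\<chi> i k. if i = k then b i else 0) = (\<chi> i k. if i = k then a i * b i else 0)"
proof -
  have "(\<Sum>k\<in>UNIV. (if i = k then a i else 0) * (if k = m then b k else 0)) = (if i = m then a i * b i else 0)" for i m
  proof -
    have "(\<Sum>k\<in>UNIV. (if i = k then a i else 0) * (if k = m then b k else 0)) = (\<Sum>k\<in>UNIV. if i = k then (if i = m then a i * b i else 0) else 0)"
      by (intro sum.cong) auto
    then show ?thesis by simp
  qed
  then show ?thesis by (simp add: matrix_matrix_mult_def vec_eq_iff)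
qed

lemma mat_pow_matrix_inv_A_mat:
  "mat_pow (matrix_inv (A_mat \<dd>)) j = (\<chi> i k. if i = k then (if i = \<dd> then 1 / 4 ^ j else 1 / 2 ^ j) else 0)"
proof -
  have inv: "matrix_inv (A_mat \<dd>) = (\<chi> i k. if i = k then (if i = \<dd> then 1 / 4 else 1 / 2) else 0)"
    by (rule matrix_inv_eqI) (simp_all only: A_mat_def diag_mat_mult, auto simp: mat_def vec_eq_iff)
  show ?thesis
  proof (induction j)
    case 0 then show ?case by (auto simp: mat_pow_def mat_def vec_eq_iff)
  next
    case (Suc j)
    have "mat_pow (matrix_inv (A_mat \<dd>)) (Suc j) = matrix_inv (A_mat \<dd>) ** mat_pow (matrix_inv (A_mat \<dd>)) j"
      by (simp add: mat_pow_def)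
    also have "\<dots> = (\<chi> i k. if i = k then (if i = \<dd> then 1 / 4 ^ Suc j else 1 / 2 ^ Suc j) else 0)"
      unfolding Suc unfolding inv diag_mat_mult by (auto simp: vec_eq_iff)
    finally show ?case .
  qed
qed

lemma shear_mat_entry:
  "shear_mat \<dd> j l $ i $ k = (if i = \<dd> then 1 / 4 ^ j else 1 / 2 ^ j) * (if i = k then 1 else if i = \<dd> then - real_of_int (l $ k) else 0)"
proof -
  have "shear_mat \<dd> j l $ i $ k = (\<Sum>m\<in>UNIV. (if i = m then (if i = \<dd> then 1 / 4 ^ j else 1 / 2 ^ j) else 0) * (B_mat \<dd> (- l) $ m $ k))"
    by (simp only: shear_mat_def mat_pow_matrix_inv_A_mat matrix_matrix_mult_def vec_lambda_beta)
  then show ?thesis by (simp only: sum_delta_mult) (simp add: B_mat_def)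
qed

lemma shear_mat_mult_component:
  "(shear_mat \<dd> j l *v x) $ i = (if i = \<dd> then (x $ \<dd> - (\<Sum>k\<in>UNIV - {\<dd>}. real_of_int (l $ k) * x $ k)) / 4 ^ j else x $ i / 2 ^ j)"
proof (cases "i = \<dd>")
  case True
  have "(shear_mat \<dd> j l *v x) $ \<dd> = (\<Sum>k\<in>UNIV. shear_mat \<dd> j l $ \<dd> $ k * x $ k)"
    by (simp add: matrix_vector_mult_def)
  also have "\<dots> = shear_mat \<dd> j l $ \<dd> $ \<dd> * x $ \<dd> + (\<Sum>k\<in>UNIV - {\<dd>}. shear_mat \<dd> j l $ \<dd> $ k * x $ k)"
    by (subst sum.remove[of _ \<dd>]) auto
  also have "(\<Sum>k\<in>UNIV - {\<dd>}. shear_mat \<dd> j l $ \<dd> $ k * x $ k) = (\<Sum>k\<in>UNIV - {\<dd>}. - (real_of_int (l $ k) * x $ k) / 4 ^ j)"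
    by (intro sum.cong) (auto simp: shear_mat_entry)
  also have "\<dots> = - (\<Sum>k\<in>UNIV - {\<dd>}. real_of_int (l $ k) * x $ k) / 4 ^ j"
    by (simp add: sum_negf[symmetric] sum_divide_distrib)
  finally show ?thesis using True by (simp add: shear_mat_entry diff_divide_distrib)
next
  case False
  have "(shear_mat \<dd> j l *v x) $ i = (\<Sum>k\<in>UNIV. shear_mat \<dd> j l $ i $ k * x $ k)"
    by (simp add: matrix_vector_mult_def)
  also have "\<dots> = (\<Sum>k\<in>UNIV. if i = k then x $ k / 2 ^ j else 0)"
    using False by (intro sum.cong refl) (simp add: shear_mat_entry)
  finally show ?thesis using False by simp
qed

lemma mult_shear_mat_component:
  "(\<xi> v* shear_mat \<dd> j l) $ k = (if k = \<dd> then \<xi> $ \<dd> / 4 ^ j else \<xi> $ k / 2 ^ j - real_of_int (l $ k) * \<xi> $ \<dd> / 4 ^ j)"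
proof -
  have "(\<xi> v* shear_mat \<dd> j l) $ k = (\<Sum>i\<in>UNIV. shear_mat \<dd> j l $ i $ k * \<xi> $ i)"
    by (simp add: vector_matrix_mult_def mult.commute)
  also have "\<dots> = (\<Sum>i\<in>UNIV. (if i = k then (if k = \<dd> then 1 / 4 ^ j else 1 / 2 ^ j) * \<xi> $ k else 0) + (if i = \<dd> then (if k = \<dd> then 0 else - real_of_int (l $ k) * \<xi> $ \<dd> / 4 ^ j) else 0))"
    by (intro sum.cong) (auto simp: shear_mat_entry)
  also have "\<dots> = (if k = \<dd> then 1 / 4 ^ j else 1 / 2 ^ j) * \<xi> $ k + (if k = \<dd> then 0 else - real_of_int (l $ k) * \<xi> $ \<dd> / 4 ^ j)"
    by (simp add: sum.distrib)
  finally show ?thesis by auto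
qed

text \<open>Averaging over translations along \<open>e\<close> turns the shear into a translation of the averaging
  parameter.\<close>

lemma nn_integral_shear:
  fixes e w :: "'a::euclidean_space"
  assumes we: "w \<bullet> e = 0" and f: "f \<in> borel_measurable borel"
  shows "(\<integral>\<^sup>+x. f (x + (w \<bullet> x) *\<^sub>R e) \<partial>lborel) = (\<integral>\<^sup>+x. f x \<partial>lborel)"
proof -
  \<comment> \<open>A density of total mass 1 on the line, so that averaging over \<open>t\<close>
    does not change the integral.\<close>
  define r :: "real \<Rightarrow> ennreal" where "r = indicator {0..1}"
  have r: "r \<in> borel_measurable borel" by (simp add: r_def)
  note [measurable] = r f
  have r1: "(\<integral>\<^sup>+t. r (t + c) \<partial>lborel) = 1" for c
  proof -
    have "(\<integral>\<^sup>+t. r (t + c) \<partial>lborel) = (\<integral>\<^sup>+t. r t \<partial>lborel)" by (rule nn_integral_translate[OF r])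
    then show ?thesis by (simp add: r_def)
  qed
  let ?S = "\<lambda>x. x + (w \<bullet> x) *\<^sub>R e"
  have "(\<integral>\<^sup>+x. f (?S x) \<partial>lborel) = (\<integral>\<^sup>+t. r (t + 0) \<partial>lborel) * (\<integral>\<^sup>+x. f (?S x) \<partial>lborel)"
    by (simp only: r1 mult_1_left)
  also have "\<dots> = (\<integral>\<^sup>+t. r (t + 0) * (\<integral>\<^sup>+x. f (?S x) \<partial>lborel) \<partial>lborel)"
    by (rule nn_integral_multc[symmetric]) measurable
  also have "\<dots> = (\<integral>\<^sup>+t. (\<integral>\<^sup>+x. r t * f (?S x + t *\<^sub>R e) \<partial>lborel) \<partial>lborel)"
  proof (rule nn_integral_cong)
    fix t :: real
    have "(\<integral>\<^sup>+x. f (?S x) \<partial>lborel) = (\<integral>\<^sup>+x. f (?S (x + t *\<^sub>R e)) \<partial>lborel)"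
      by (rule nn_integral_translate[of "\<lambda>x. f (?S x)", symmetric]) measurable
    also have "\<dots> = (\<integral>\<^sup>+x. f (?S x + t *\<^sub>R e) \<partial>lborel)"
      by (simp add: inner_add_right we add_ac)
    finally have "r (t + 0) * (\<integral>\<^sup>+x. f (?S x) \<partial>lborel) = r t * (\<integral>\<^sup>+x. f (?S x + t *\<^sub>R e) \<partial>lborel)" by simp
    also have "\<dots> = (\<integral>\<^sup>+x. r t * f (?S x + t *\<^sub>R e) \<partial>lborel)"
      by (rule nn_integral_cmult[symmetric]) measurable
    finally show "r (t + 0) * (\<integral>\<^sup>+x. f (?S x) \<partial>lborel) = (\<integral>\<^sup>+x. r t * f (?S x + t *\<^sub>R e) \<partial>lborel)" .
  qed
  also have "\<dots> = (\<integral>\<^sup>+x. (\<integral>\<^sup>+t. r t * f (?S x + t *\<^sub>R e) \<partial>lborel) \<partial>lborel)"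
    by (rule lborel_pair.Fubini') measurable
  \<comment> \<open>For fixed \<open>x\<close> the displacement \<open>w \<bullet> x\<close> is a
    constant and can be moved from the argument of \<open>f\<close> to that of \<open>r\<close>,
    which is harmless because \<open>r\<close> integrates to 1 after any translation.\<close>
  also have "\<dots> = (\<integral>\<^sup>+x. (\<integral>\<^sup>+t. r (t + - (w \<bullet> x)) * f (x + t *\<^sub>R e) \<partial>lborel) \<partial>lborel)"
  proof (rule nn_integral_cong)
    fix x
    have "(\<integral>\<^sup>+t. r t * f (?S x + t *\<^sub>R e) \<partial>lborel) = (\<integral>\<^sup>+t. r (t + - (w \<bullet> x)) * f (?S x + (t + - (w \<bullet> x)) *\<^sub>R e) \<partial>lborel)"
      by (rule nn_integral_translate[of "\<lambda>t. r t * f (?S x + t *\<^sub>R e)", symmetric]) measurable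
    moreover have "?S x + (t + - (w \<bullet> x)) *\<^sub>R e = x + t *\<^sub>R e" for t by (simp add: scaleR_left_diff_distrib)
    ultimately show "(\<integral>\<^sup>+t. r t * f (?S x + t *\<^sub>R e) \<partial>lborel) = (\<integral>\<^sup>+t. r (t + - (w \<bullet> x)) * f (x + t *\<^sub>R e) \<partial>lborel)"
      by (simp only:)
  qed
  also have "\<dots> = (\<integral>\<^sup>+t. (\<integral>\<^sup>+x. r (t + - (w \<bullet> x)) * f (x + t *\<^sub>R e) \<partial>lborel) \<partial>lborel)"
    by (rule lborel_pair.Fubini'[symmetric]) measurable
  also have "\<dots> = (\<integral>\<^sup>+t. (\<integral>\<^sup>+x. r (t + - (w \<bullet> x)) * f x \<partial>lborel) \<partial>lborel)"
  proof (rule nn_integral_cong)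
    fix t :: real
    have "(\<integral>\<^sup>+x. r (t + - (w \<bullet> x)) * f x \<partial>lborel) = (\<integral>\<^sup>+x. r (t + - (w \<bullet> (x + t *\<^sub>R e))) * f (x + t *\<^sub>R e) \<partial>lborel)"
      by (rule nn_integral_translate[of "\<lambda>x. r (t + - (w \<bullet> x)) * f x", symmetric]) measurable
    then show "(\<integral>\<^sup>+x. r (t + - (w \<bullet> x)) * f (x + t *\<^sub>R e) \<partial>lborel) = (\<integral>\<^sup>+x. r (t + - (w \<bullet> x)) * f x \<partial>lborel)"
      by (simp add: inner_add_right we)
  qed
  also have "\<dots> = (\<integral>\<^sup>+x. (\<integral>\<^sup>+t. r (t + - (w \<bullet> x)) * f x \<partial>lborel) \<partial>lborel)"
    by (rule lborel_pair.Fubini') measurable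
  also have "\<dots> = (\<integral>\<^sup>+x. (\<integral>\<^sup>+t. r (t + - (w \<bullet> x)) \<partial>lborel) * f x \<partial>lborel)"
  proof (rule nn_integral_cong)
    fix x
    show "(\<integral>\<^sup>+t. r (t + - (w \<bullet> x)) * f x \<partial>lborel) = (\<integral>\<^sup>+t. r (t + - (w \<bullet> x)) \<partial>lborel) * f x"
      by (rule nn_integral_multc) measurable
  qed
  also have "\<dots> = (\<integral>\<^sup>+x. f x \<partial>lborel)" by (simp only: r1 mult_1_left)
  finally show ?thesis .
qed

lemma lborel_diag:
  fixes a :: "'d::finite \<Rightarrow> real"
  assumes "\<And>i. a i \<noteq> 0"
  shows "(lborel :: (real^'d) measure) = density (distr lborel borel (\<lambda>x. \<chi> i. a i * x $ i)) (\<lambda>_. ennreal (\<Prod>i\<in>UNIV. \<bar>a i\<bar>))"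
proof -
  have B: "(Basis :: (real^'d) set) = (\<lambda>i. axis i 1) ` UNIV" by (auto simp: Basis_vec_def)
  have inj: "inj (\<lambda>i::'d. axis i (1::real))" by (auto simp: inj_def axis_eq_axis)
  define c :: "real^'d \<Rightarrow> real" where "c b = (\<Sum>i\<in>UNIV. a i * b $ i)" for b
  have c: "c (axis i 1) = a i" for i
    by (simp add: c_def axis_def if_distrib[of "\<lambda>x. _ * x"] cong: if_cong)
  have T: "0 + (\<Sum>j\<in>Basis. (c j * (x \<bullet> j)) *\<^sub>R j) = (\<chi> i. a i * x $ i)" for x :: "real^'d"
  proof -
    have "(\<Sum>j\<in>Basis. (c j * (x \<bullet> j)) *\<^sub>R j) = (\<Sum>i\<in>UNIV. (a i * x $ i) *\<^sub>R axis i 1)"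
      unfolding B by (subst sum.reindex[OF inj]) (simp add: c inner_axis)
    also have "\<dots> = (\<chi> i. a i * x $ i)"
      by (simp add: vec_eq_iff axis_def if_distrib[of "\<lambda>x. _ * x"] cong: if_cong)
    finally show ?thesis by simp
  qed
  have "(\<Prod>j\<in>(Basis :: (real^'d) set). \<bar>c j\<bar>) = (\<Prod>i\<in>UNIV. \<bar>a i\<bar>)"
    unfolding B by (subst prod.reindex[OF inj]) (simp add: c)
  moreover have "c j \<noteq> 0" if "j \<in> Basis" for j using that assms by (auto simp: B c)
  from lborel_affine_euclidean[of c 0, OF this]
  have "(lborel :: (real^'d) measure) = density (distr lborel borel (\<lambda>x. \<chi> i. a i * x $ i)) (\<lambda>_. ennreal (\<Prod>j\<in>(Basis :: (real^'d) set). \<bar>c j\<bar>))"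
    unfolding T .
  ultimately show ?thesis by (simp only:)
qed

text \<open>The shear factor arises from the identity by adding to one row a combination of the
  others, so its determinant is 1 and only the diagonal factor counts.\<close>

lemma det_shear_mat:
  fixes l :: "int^'d"
  shows "det (shear_mat \<dd> j l) = (\<Prod>i\<in>UNIV. if i = \<dd> then 1 / 4 ^ j else 1 / 2 ^ j)"
proof -
  let ?x = "\<Sum>k\<in>UNIV - {\<dd>}. (- real_of_int (l $ k)) *s row k (mat 1 :: real^'d^'d)"
  have row: "row k (mat 1 :: real^'d^'d) $ i = (if i = k then 1 else 0)" for k i
    by (auto simp: row_def mat_def)
  have x: "?x $ k = (if k = \<dd> then 0 else - real_of_int (l $ k))" for k
    by (simp add: sum_component row if_distrib[of "\<lambda>x. _ * x"] sum_negf cong: if_cong)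
  define X where "X = ?x"
  have X: "X $ k = (if k = \<dd> then 0 else - real_of_int (l $ k))" for k
    unfolding X_def by (rule x)
  have "(\<chi> k. if k = \<dd> then row \<dd> (mat 1) + X else row k (mat 1)) = B_mat \<dd> (- l)"
    by (auto simp: vec_eq_iff B_mat_def X row)
  moreover have "X \<in> vec.span {row k (mat 1 :: real^'d^'d) |k. k \<noteq> \<dd>}"
    unfolding X_def by (intro vec.span_sum vec.span_scale vec.span_base) auto
  ultimately have "det (B_mat \<dd> (- l)) = det (mat 1 :: real^'d^'d)"
    using det_row_span[of X "mat 1 :: real^'d^'d" \<dd>] by simp
  then have "det (B_mat \<dd> (- l)) = 1" by simp
  moreover have "det (mat_pow (matrix_inv (A_mat \<dd>)) j) = (\<Prod>i\<in>UNIV. if i = \<dd> then 1 / 4 ^ j else 1 / 2 ^ j)"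
    unfolding mat_pow_matrix_inv_A_mat by (subst det_diagonal) auto
  ultimately show ?thesis by (simp add: shear_mat_def det_mul)
qed

lemma det_shear_mat_pos: "det (shear_mat \<dd> j l) > 0"
  unfolding det_shear_mat by (intro prod_pos) auto

text \<open>The matrix acts as a shear \<open>x + (w \<bullet> x) *\<^sub>R axis \<dd> 1\<close>
  with \<open>w\<close> orthogonal to \<open>axis \<dd> 1\<close>, followed by a diagonal scaling.
  The shear preserves integrals and the scaling contributes the determinant. In this form the
  abstract change of variables applies.\<close>

lemma lborel_shear_mat:
  fixes l :: "int^'d"
  shows "(lborel :: (real^'d) measure) = density (distr lborel borel ((*v) (shear_mat \<dd> j l))) (\<lambda>_. ennreal \<bar>det (shear_mat \<dd> j l)\<bar>)"
proof -
  define a :: "'d \<Rightarrow> real" where "a i = (if i = \<dd> then 1 / 4 ^ j else 1 / 2 ^ j)" for i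
  define D where "D x = (\<chi> i. a i * x $ i)" for x :: "real^'d"
  define w :: "real^'d" where "w = (\<chi> k. if k = \<dd> then 0 else - real_of_int (l $ k))"
  let ?M = "(*v) (shear_mat \<dd> j l)"
  have a0: "a i > 0" for i by (simp add: a_def)
  have det: "ennreal \<bar>det (shear_mat \<dd> j l)\<bar> = ennreal (\<Prod>i\<in>UNIV. \<bar>a i\<bar>)"
    using a0 by (simp add: det_shear_mat a_def[symmetric] abs_prod)
  have [measurable]: "?M \<in> borel_measurable borel"
    by (intro borel_measurable_continuous_onI linear_continuous_on) (simp add: matrix_vector_mul_bounded_linear)
  have [measurable]: "D \<in> borel_measurable borel"
    unfolding D_def by (intro borel_measurable_continuous_onI continuous_intros)
  have "a i \<noteq> 0" for i using a0[of i] by simp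
  from lborel_diag[of a, OF this]
  have lD: "lborel = density (distr lborel borel D) (\<lambda>_. ennreal (\<Prod>i\<in>UNIV. \<bar>a i\<bar>))"
    by (simp only: D_def[abs_def])
  have we: "w \<bullet> axis \<dd> 1 = 0" by (simp add: inner_axis w_def)
  have wx: "w \<bullet> x = - (\<Sum>k\<in>UNIV - {\<dd>}. real_of_int (l $ k) * x $ k)" for x
    unfolding inner_vec_def by (subst sum.remove[of _ \<dd>]) (auto simp: w_def sum_negf[symmetric] intro!: sum.cong)
  have M: "shear_mat \<dd> j l *v x = D (x + (w \<bullet> x) *\<^sub>R axis \<dd> 1)" for x
    by (simp add: vec_eq_iff shear_mat_mult_component D_def a_def wx axis_def)
  show ?thesis
  proof (rule measure_eqI)
    fix A :: "(real^'d) set" assume "A \<in> sets lborel"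
    then have [measurable]: "A \<in> sets borel" by simp
    have "emeasure lborel A = (\<integral>\<^sup>+x. indicator A x \<partial>lborel)" by simp
    also have "\<dots> = ennreal (\<Prod>i\<in>UNIV. \<bar>a i\<bar>) * (\<integral>\<^sup>+x. indicator A (D x) \<partial>lborel)"
      by (rule nn_integral_density_distr[OF lD]) measurable
    also have "(\<integral>\<^sup>+x. indicator A (D x) \<partial>lborel) = (\<integral>\<^sup>+x. indicator A (D (x + (w \<bullet> x) *\<^sub>R axis \<dd> 1)) \<partial>lborel)"
      by (rule nn_integral_shear[OF we, symmetric]) measurable
    also have "\<dots> = (\<integral>\<^sup>+x. indicator A (shear_mat \<dd> j l *v x) \<partial>lborel)" by (simp only: M)
    finally have lA: "emeasure lborel A = ennreal (\<Prod>i\<in>UNIV. \<bar>a i\<bar>) * (\<integral>\<^sup>+x. indicator A (shear_mat \<dd> j l *v x) \<partial>lborel)" .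
    show "emeasure lborel A = emeasure (density (distr lborel borel ?M) (\<lambda>_. ennreal \<bar>det (shear_mat \<dd> j l)\<bar>)) A"
    proof -
      have "emeasure (distr lborel borel ?M) A = (\<integral>\<^sup>+x. indicator A x \<partial>distr lborel borel ?M)" by simp
      also have "\<dots> = (\<integral>\<^sup>+x. indicator A (shear_mat \<dd> j l *v x) \<partial>lborel)" by (rule nn_integral_distr) measurable
      finally have "emeasure (distr lborel borel ?M) A = (\<integral>\<^sup>+x. indicator A (shear_mat \<dd> j l *v x) \<partial>lborel)" .
      then have "emeasure lborel A = ennreal (\<Prod>i\<in>UNIV. \<bar>a i\<bar>) * emeasure (distr lborel borel ?M) A"
        by (simp only: lA)
      also have "\<dots> = emeasure (density (distr lborel borel ?M) (\<lambda>_. ennreal \<bar>det (shear_mat \<dd> j l)\<bar>)) A"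
        unfolding det by (rule emeasure_density_const[symmetric]) simp
      finally show ?thesis .
    qed
  qed (simp only: sets_density sets_distr sets_lborel)
qed

section \<open>Shearlet kernels\<close>

lemma shearlet_hat_support:
  fixes \<xi> :: "real^'d"
  assumes g: "shearlet_generators \<psi>1h \<psi>2h" and ne: "shearlet_hat \<psi>1h \<psi>2h \<dd> \<xi> \<noteq> 0"
  shows "1/16 \<le> \<bar>\<xi> $ \<dd>\<bar>" "\<bar>\<xi> $ \<dd>\<bar> \<le> 1/2" "\<bar>\<xi> $ i\<bar> \<le> \<bar>\<xi> $ \<dd>\<bar>"
proof -
  have s1: "supp \<psi>1h \<subseteq> {-1/2 .. -1/16} \<union> {1/16 .. 1/2}" and s2: "supp \<psi>2h \<subseteq> {-1 .. 1}"
    using g by (simp_all add: shearlet_generators_def)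
  have n1: "\<psi>1h (\<xi> $ \<dd>) \<noteq> 0" and n2: "(\<Prod>i\<in>UNIV - {\<dd>}. \<psi>2h (\<xi> $ i / \<xi> $ \<dd>)) \<noteq> 0"
    using ne by (auto simp: shearlet_hat_def)
  have "\<xi> $ \<dd> \<in> {-1/2 .. -1/16} \<union> {1/16 .. 1/2}" using n1 supp_zero[OF s1] by blast
  then show a: "1/16 \<le> \<bar>\<xi> $ \<dd>\<bar>" "\<bar>\<xi> $ \<dd>\<bar> \<le> 1/2" by auto
  show "\<bar>\<xi> $ i\<bar> \<le> \<bar>\<xi> $ \<dd>\<bar>"
  proof (cases "i = \<dd>")
    case False
    then have "\<psi>2h (\<xi> $ i / \<xi> $ \<dd>) \<noteq> 0" using n2 by simp
    then have "\<xi> $ i / \<xi> $ \<dd> \<in> {-1..1}" using supp_zero[OF s2] by blast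
    then have "- 1 \<le> \<xi> $ i / \<xi> $ \<dd>" "\<xi> $ i / \<xi> $ \<dd> \<le> 1" by auto
    then have "\<bar>\<xi> $ i / \<xi> $ \<dd>\<bar> \<le> 1" by (intro abs_leI) linarith+
    then show ?thesis using a(1) by (simp add: abs_divide divide_le_eq split: if_splits)
  qed simp
qed

text \<open>The quotients of coordinates are smooth only where \<open>\<xi> $ \<dd>\<close> is
  nonzero. The first factor vanishes unless \<open>\<bar>\<xi> $ \<dd>\<bar>\<close> is at least
  1/16, a closed set inside that region, so extension by zero applies.\<close>

lemma shearlet_hat_test_function:
  fixes \<dd> :: "'d::finite"
  assumes g: "shearlet_generators \<psi>1h \<psi>2h"
  shows "test_function (shearlet_hat \<psi>1h \<psi>2h \<dd>)"
proof (rule test_function_if_cube[where r="1/2"])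
  fix n
  let ?U = "{\<xi>::real^'d. \<xi> $ \<dd> \<noteq> 0}"
  have C1: "Ck_on n UNIV \<psi>1h" and C2: "Ck_on n UNIV \<psi>2h"
    using g by (auto simp: shearlet_generators_def intro: smooth_Ck_on)
  have lin: "Ck_on n ?U (\<lambda>\<xi>. complex_of_real (\<xi> $ i))" for i
    by (rule Ck_on_linear[OF bounded_linear_vec_nth])
  have "Ck_on n ?U (\<lambda>\<xi>. complex_of_real (\<xi> $ i) * inverse (complex_of_real (\<xi> $ \<dd>)))" for i
    by (intro Ck_on_mult Ck_on_inverse lin) simp
  then have q: "Ck_on n ?U (\<lambda>\<xi>. complex_of_real (\<xi> $ i / \<xi> $ \<dd>))" for i
    by (simp add: divide_inverse)
  have "Ck_on n ?U (shearlet_hat \<psi>1h \<psi>2h \<dd>)"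
    unfolding shearlet_hat_def
    by (rule Ck_on_mult[OF Ck_on_real_compose[OF C1 lin] Ck_on_prod[OF Ck_on_real_compose[OF C2 q]]])
  then show "Ck_on n UNIV (shearlet_hat \<psi>1h \<psi>2h \<dd>)"
  proof (rule Ck_on_zero_extend[rotated 3])
    show "open ?U" by (intro open_Collect_neq continuous_intros)
    show "closed {\<xi>::real^'d. 1/16 \<le> \<bar>\<xi> $ \<dd>\<bar>}" by (intro closed_Collect_le continuous_intros)
    show "{\<xi>::real^'d. 1/16 \<le> \<bar>\<xi> $ \<dd>\<bar>} \<subseteq> ?U" by auto
    show "shearlet_hat \<psi>1h \<psi>2h \<dd> \<xi> = 0" if "\<xi> \<notin> {\<xi>::real^'d. 1/16 \<le> \<bar>\<xi> $ \<dd>\<bar>}" for \<xi>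
      using shearlet_hat_support(1)[OF g, of \<dd> \<xi>] that by blast
  qed
next
  fix \<xi> :: "real^'d" and i assume "1/2 < \<bar>\<xi> $ i\<bar>"
  then show "shearlet_hat \<psi>1h \<psi>2h \<dd> \<xi> = 0"
    using shearlet_hat_support(2,3)[OF g, of \<dd> \<xi>] by (metis not_le order_trans)
qed

lemma matrix_inv_mult_vec:
  fixes M :: "real^'d^'d"
  assumes "det M \<noteq> 0" shows "matrix_inv M *v (M *v x) = x" "M *v (matrix_inv M *v x) = x"
proof -
  have "\<exists>B. M ** B = mat 1 \<and> B ** M = mat 1"
    using assms invertible_det_nz[of M] unfolding invertible_def by blast
  then have "M ** matrix_inv M = mat 1 \<and> matrix_inv M ** M = mat 1"
    unfolding matrix_inv_def by (rule someI_ex)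
  then show "matrix_inv M *v (M *v x) = x" "M *v (matrix_inv M *v x) = x"
    by (simp_all add: matrix_vector_mul_assoc)
qed

lemma continuous_on_matrix_vector: "continuous_on UNIV ((*v) (M :: real^'d^'d))"
  by (rule linear_continuous_on[OF matrix_vector_mul_bounded_linear])

lemma matrix_vector_measurable [measurable]: "(*v) (M :: real^'d^'d) \<in> borel_measurable borel"
  by (rule borel_measurable_continuous_onI[OF continuous_on_matrix_vector])

lemma cnj_measurable [measurable]: "cnj \<in> borel_measurable borel"
  by (intro borel_measurable_continuous_onI continuous_intros)

lemma fourier_tilde:
  fixes g :: "real^'d \<Rightarrow> complex"
  assumes [measurable]: "g \<in> borel_measurable borel"
  shows "fourier (tilde g) \<xi> = cnj (fourier g \<xi>)"
proof -
  have "fourier (tilde g) \<xi> = (LINT x|lborel. cnj (g (0 - x)) * cis (2 * pi * (\<xi> \<bullet> (0 - x))))"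
    by (simp add: fourier_cis tilde_def)
  also have "\<dots> = (LINT x|lborel. cnj (g x) * cis (2 * pi * (\<xi> \<bullet> x)))"
    by (rule integral_reflect[of "\<lambda>x. cnj (g x) * cis (2 * pi * (\<xi> \<bullet> x))" 0]) measurable
  also have "\<dots> = (LINT x|lborel. cnj (g x * cis (- (2 * pi * (\<xi> \<bullet> x)))))"
    by (simp add: cis_cnj)
  also have "\<dots> = cnj (fourier g \<xi>)" unfolding fourier_cis by (rule Bochner_Integration.integral_cnj)
  finally show ?thesis .
qed

text \<open>The normalisation of the dilate cancels the Jacobian, and moving the matrix across the
  inner product makes it act on the frequency as a row vector from the right.\<close>

lemma fourier_mat_dilate:
  fixes l :: "int^'d"
  assumes [measurable]: "g \<in> borel_measurable borel"
  shows "fourier (mat_dilate (shear_mat \<dd> j l) g) \<xi> = fourier g (\<xi> v* shear_mat \<dd> j l)"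
proof -
  let ?M = "shear_mat \<dd> j l"
  have d: "det ?M > 0" by (rule det_shear_mat_pos)
  have [measurable]: "mat_dilate ?M g \<in> borel_measurable borel" unfolding mat_dilate_def by measurable
  have "fourier (mat_dilate ?M g) \<xi> = \<bar>det ?M\<bar> *\<^sub>R (LINT x|lborel. mat_dilate ?M g (?M *v x) * cis (- (2 * pi * (\<xi> \<bullet> (?M *v x)))))"
    unfolding fourier_cis by (rule integral_density_distr[OF lborel_shear_mat]) auto
  also have "\<dots> = \<bar>det ?M\<bar> *\<^sub>R (LINT x|lborel. complex_of_real (inverse \<bar>det ?M\<bar>) * (g x * cis (- (2 * pi * ((\<xi> v* ?M) \<bullet> x)))))"
    using d by (simp add: mat_dilate_def matrix_inv_mult_vec dot_lmul_matrix mult.assoc)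
  also have "\<dots> = \<bar>det ?M\<bar> *\<^sub>R (complex_of_real (inverse \<bar>det ?M\<bar>) * fourier g (\<xi> v* ?M))"
    by (simp only: fourier_cis integral_mult_right_zero)
  also have "\<dots> = fourier g (\<xi> v* ?M)"
    using d by (simp add: scaleR_conv_of_real[where 'a=complex])
  finally show ?thesis .
qed

text \<open>The shear entries, of size up to \<open>2 ^ j\<close>, occur only in the row that is
  divided by \<open>4 ^ j\<close>; so every row contracts by \<open>2 ^ j\<close> up to the
  dimension.\<close>

lemma norm_shear_mat_mult_le:
  fixes l :: "int^'d"
  assumes "\<And>i. \<bar>l $ i\<bar> \<le> 2 ^ j"
  shows "norm (shear_mat \<dd> j l *v x) \<le> real CARD('d) * (real CARD('d) * norm x / 2 ^ j)"
proof (rule norm_le_CARD)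
  fix i
  have c1: "1 \<le> real CARD('d)" by (simp add: Suc_le_eq)
  show "\<bar>(shear_mat \<dd> j l *v x) $ i\<bar> \<le> real CARD('d) * norm x / 2 ^ j"
  proof (cases "i = \<dd>")
    case False
    have "\<bar>x $ i\<bar> \<le> 1 * norm x" using component_le_norm_cart[of x i] by simp
    also have "\<dots> \<le> real CARD('d) * norm x" using c1 by (intro mult_right_mono) auto
    finally show ?thesis using False by (simp add: shear_mat_mult_component divide_right_mono abs_divide)
  next
    case True
    have t: "\<bar>real_of_int (l $ k) * x $ k\<bar> \<le> 2 ^ j * norm x" for k
    proof -
      have "\<bar>real_of_int (l $ k)\<bar> \<le> 2 ^ j" using assms[of k] by (metis of_int_abs of_int_le_iff of_int_numeral of_int_power)
      then show ?thesis unfolding abs_mult by (intro mult_mono component_le_norm_cart) auto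
    qed
    have "\<bar>\<Sum>k\<in>UNIV - {\<dd>}. real_of_int (l $ k) * x $ k\<bar> \<le> (\<Sum>k\<in>UNIV - {\<dd>}. 2 ^ j * norm x)"
      by (rule order_trans[OF sum_abs sum_mono[OF t]])
    also have "\<dots> = (real CARD('d) - 1) * (2 ^ j * norm x)" by (simp add: card_Diff_singleton of_nat_diff Suc_le_eq)
    finally have s: "\<bar>\<Sum>k\<in>UNIV - {\<dd>}. real_of_int (l $ k) * x $ k\<bar> \<le> (real CARD('d) - 1) * (2 ^ j * norm x)" .
    have "norm x \<le> 2 ^ j * norm x" using mult_right_mono[of 1 "2 ^ j" "norm x"] by simp
    then have "\<bar>x $ \<dd> - (\<Sum>k\<in>UNIV - {\<dd>}. real_of_int (l $ k) * x $ k)\<bar> \<le> 2 ^ j * norm x + (real CARD('d) - 1) * (2 ^ j * norm x)"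
      using s component_le_norm_cart[of x \<dd>] by linarith
    also have "\<dots> = real CARD('d) * norm x * 2 ^ j" by (simp add: algebra_simps)
    finally have "\<bar>x $ \<dd> - (\<Sum>k\<in>UNIV - {\<dd>}. real_of_int (l $ k) * x $ k)\<bar> / 4 ^ j \<le> real CARD('d) * norm x * 2 ^ j / 4 ^ j"
      by (intro divide_right_mono) auto
    also have "real CARD('d) * norm x * 2 ^ j / 4 ^ j = real CARD('d) * norm x / 2 ^ j"
    proof -
      have "(4::real) ^ j = 2 ^ j * 2 ^ j" by (simp add: power_mult_distrib[symmetric])
      then show ?thesis by simp
    qed
    finally show ?thesis using True by (simp add: shear_mat_mult_component abs_divide)
  qed
qed

definition shear_kernel :: "(real \<Rightarrow> complex) \<Rightarrow> (real \<Rightarrow> complex) \<Rightarrow> 'd::finite \<Rightarrow> nat \<Rightarrow> int^'d \<Rightarrow> real^'d \<Rightarrow> complex" where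
  "shear_kernel \<psi>1h \<psi>2h \<dd> j l = mat_dilate (shear_mat \<dd> j l) (tilde (shearlet \<psi>1h \<psi>2h \<dd>))"

text \<open>The Fourier transform of \<open>shear_kernel\<close>; the conjugate stems from
  \<open>tilde\<close>.\<close>

definition shear_symbol :: "(real \<Rightarrow> complex) \<Rightarrow> (real \<Rightarrow> complex) \<Rightarrow> 'd::finite \<Rightarrow> nat \<Rightarrow> int^'d \<Rightarrow> real^'d \<Rightarrow> complex" where
  "shear_symbol \<psi>1h \<psi>2h \<dd> j l \<xi> = cnj (shearlet_hat \<psi>1h \<psi>2h \<dd> (\<xi> v* shear_mat \<dd> j l))"

text \<open>Component \<dd> is merely divided by \<open>4 ^ j\<close>, so it lies between
  \<open>4 ^ j / 16\<close> and \<open>4 ^ j / 2\<close>. For another component the support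
  condition bounds its distance from the sheared value by
  \<open>\<bar>\<xi> $ \<dd>\<bar> / 4 ^ j\<close>; together with the shear this gives
  \<open>\<bar>\<xi> $ k\<bar> \<le> 2 * \<bar>\<xi> $ \<dd>\<bar>\<close>.\<close>

lemma shear_symbol_support:
  fixes l :: "int^'d"
  assumes g: "shearlet_generators \<psi>1h \<psi>2h" and l: "\<And>i. \<bar>l $ i\<bar> \<le> 2 ^ j"
    and ne: "shear_symbol \<psi>1h \<psi>2h \<dd> j l \<xi> \<noteq> 0"
  shows "4 ^ j / 16 \<le> \<bar>\<xi> $ \<dd>\<bar>" "\<bar>\<xi> $ k\<bar> \<le> 4 ^ j"
proof -
  let ?z = "\<xi> v* shear_mat \<dd> j l"
  have "shearlet_hat \<psi>1h \<psi>2h \<dd> ?z \<noteq> 0" using ne by (simp add: shear_symbol_def)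
  note S = shearlet_hat_support[OF g this]
  have zd: "?z $ \<dd> = \<xi> $ \<dd> / 4 ^ j" by (simp add: mult_shear_mat_component)
  have p4: "(0::real) < 4 ^ j" and p2: "(1::real) \<le> 2 ^ j" by simp_all
  show "4 ^ j / 16 \<le> \<bar>\<xi> $ \<dd>\<bar>"
    using S(1) p4 unfolding zd abs_divide by (simp add: le_divide_eq mult.commute)
  have u: "\<bar>\<xi> $ \<dd>\<bar> \<le> 4 ^ j / 2"
    using S(2) p4 unfolding zd abs_divide by (simp add: divide_le_eq mult.commute)
  show "\<bar>\<xi> $ k\<bar> \<le> 4 ^ j"
  proof (cases "k = \<dd>")
    case True then show ?thesis using u p4 by simp
  next
    case False
    let ?a = "\<bar>\<xi> $ \<dd>\<bar> / 4 ^ j"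
    have "\<bar>\<xi> $ k / 2 ^ j - real_of_int (l $ k) * \<xi> $ \<dd> / 4 ^ j\<bar> \<le> ?a"
      using S(3)[of k] False unfolding zd by (simp add: mult_shear_mat_component abs_divide)
    moreover have "\<bar>real_of_int (l $ k) * \<xi> $ \<dd> / 4 ^ j\<bar> \<le> 2 ^ j * ?a"
    proof -
      have "\<bar>real_of_int (l $ k)\<bar> \<le> 2 ^ j" using l[of k] by (metis of_int_abs of_int_le_iff of_int_numeral of_int_power)
      then have "\<bar>real_of_int (l $ k)\<bar> * ?a \<le> 2 ^ j * ?a" by (intro mult_right_mono) auto
      then show ?thesis by (simp add: abs_mult abs_divide)
    qed
    ultimately have "\<bar>\<xi> $ k / 2 ^ j\<bar> \<le> ?a + 2 ^ j * ?a"
      using abs_triangle_ineq[of "\<xi> $ k / 2 ^ j - real_of_int (l $ k) * \<xi> $ \<dd> / 4 ^ j" "real_of_int (l $ k) * \<xi> $ \<dd> / 4 ^ j"]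
      by (simp only: diff_add_cancel)
    also have "\<dots> \<le> 2 ^ j * ?a + 2 ^ j * ?a"
    proof (rule add_right_mono)
      have "1 * ?a \<le> 2 ^ j * ?a" by (rule mult_right_mono[OF p2]) simp
      then show "?a \<le> 2 ^ j * ?a" by simp
    qed
    finally have "\<bar>\<xi> $ k\<bar> / 2 ^ j \<le> 2 ^ j * (2 * ?a)" by (simp add: abs_divide mult_ac)
    then have "\<bar>\<xi> $ k\<bar> \<le> 2 ^ j * (2 ^ j * (2 * ?a))" by (simp add: divide_le_eq mult.commute)
    also have "\<dots> = 2 * \<bar>\<xi> $ \<dd>\<bar>"
    proof -
      have "(4::real) ^ j = 2 ^ j * 2 ^ j" by (simp add: power_mult_distrib[symmetric])
      then show ?thesis by simp
    qed
    finally show ?thesis using u by simp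
  qed
qed

lemma shear_symbol_test_function:
  fixes l :: "int^'d"
  assumes g: "shearlet_generators \<psi>1h \<psi>2h" and l: "\<And>i. \<bar>l $ i\<bar> \<le> 2 ^ j"
  shows "test_function (shear_symbol \<psi>1h \<psi>2h \<dd> j l)"
proof (rule test_function_if_cube[where r="4 ^ j"])
  fix n
  have bl: "bounded_linear (\<lambda>\<xi>::real^'d. \<xi> v* shear_mat \<dd> j l)"
    unfolding transpose_matrix_vector[symmetric] by (rule matrix_vector_mul_bounded_linear)
  show "Ck_on n UNIV (shear_symbol \<psi>1h \<psi>2h \<dd> j l)"
    unfolding shear_symbol_def[abs_def]
    by (rule Ck_on_cnj, rule Ck_on_linear_compose[OF bl test_function_Ck_on[OF shearlet_hat_test_function[OF g]]]) simp
next
  fix \<xi> :: "real^'d" and i assume "4 ^ j < \<bar>\<xi> $ i\<bar>"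
  then show "shear_symbol \<psi>1h \<psi>2h \<dd> j l \<xi> = 0"
    using shear_symbol_support(2)[OF g l, of \<dd> \<xi> i] by (metis not_le)
qed

lemma shearlet_rapid: "shearlet_generators \<psi>1h \<psi>2h \<Longrightarrow> rapid (shearlet \<psi>1h \<psi>2h \<dd>)"
  unfolding shearlet_def by (rule inverse_fourier_test_function_rapid[OF shearlet_hat_test_function])

lemma tilde_rapid: "rapid g \<Longrightarrow> rapid (tilde g)"
  unfolding tilde_def by (rule rapid_cnj[OF rapid_minus])

text \<open>This puts the shearlet coefficient into the form of a Fourier multiplier with a test
  function as symbol, which is what \<open>conv_resolution_bound\<close> treats.\<close>

lemma shear_kernel_inverse_fourier:
  fixes l :: "int^'d"
  assumes g: "shearlet_generators \<psi>1h \<psi>2h" and l: "\<And>i. \<bar>l $ i\<bar> \<le> 2 ^ j"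
  shows "shear_kernel \<psi>1h \<psi>2h \<dd> j l = inverse_fourier (shear_symbol \<psi>1h \<psi>2h \<dd> j l)"
proof -
  let ?M = "shear_mat \<dd> j l" and ?T = "shear_kernel \<psi>1h \<psi>2h \<dd> j l"
  let ?t = "tilde (shearlet \<psi>1h \<psi>2h \<dd>)"
  have d: "det ?M > 0" by (rule det_shear_mat_pos)
  have t: "rapid ?t" by (rule tilde_rapid[OF shearlet_rapid[OF g]])
  have [measurable]: "shearlet \<psi>1h \<psi>2h \<dd> \<in> borel_measurable borel" by (rule rapid_measurable[OF shearlet_rapid[OF g]])
  have tm [measurable]: "?t \<in> borel_measurable borel" by (rule rapid_measurable[OF t])
  have T: "?T x = complex_of_real (inverse \<bar>det ?M\<bar>) * ?t (matrix_inv ?M *v x)" for x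
    by (simp add: shear_kernel_def mat_dilate_def)
  have Tm: "?T \<in> borel_measurable borel" unfolding T[abs_def] by measurable
  have f: "fourier ?T = shear_symbol \<psi>1h \<psi>2h \<dd> j l"
  proof
    fix \<xi>
    have "fourier ?T \<xi> = cnj (fourier (shearlet \<psi>1h \<psi>2h \<dd>) (\<xi> v* ?M))"
      unfolding shear_kernel_def fourier_mat_dilate[OF tm] by (rule fourier_tilde) measurable
    also have "fourier (shearlet \<psi>1h \<psi>2h \<dd>) = shearlet_hat \<psi>1h \<psi>2h \<dd>"
      unfolding shearlet_def by (rule fourier_inverse_fourier[OF shearlet_hat_test_function[OF g]])
    finally show "fourier ?T \<xi> = shear_symbol \<psi>1h \<psi>2h \<dd> j l \<xi>" by (simp only: shear_symbol_def)
  qed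
  obtain B where B: "\<And>x. norm (?t x) \<le> B" using rapid_bounded[OF t] by metis
  have "inverse_fourier (fourier ?T) = ?T"
  proof (rule fourier_inversion)
    show "continuous_on UNIV ?T" unfolding T[abs_def]
      by (intro continuous_on_mult continuous_on_const continuous_on_compose2[OF rapid_continuous[OF t] continuous_on_matrix_vector]) auto
    show "norm (?T x) \<le> \<bar>inverse \<bar>det ?M\<bar>\<bar> * B" for x
      unfolding T norm_mult norm_of_real by (intro mult_left_mono B) auto
    have "integrable lborel (\<lambda>x. ?T (?M *v x))"
      unfolding T using d by (simp add: matrix_inv_mult_vec rapid_integrable[OF t])
    then show "integrable lborel ?T"
      using integrable_density_distr[OF lborel_shear_mat[where \<dd>=\<dd> and j=j and l=l] matrix_vector_measurable Tm] d by simp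
    show "integrable lborel (fourier ?T)"
      unfolding f by (rule rapid_integrable[OF test_function_rapid[OF shear_symbol_test_function[OF g l]]])
  qed
  then show ?thesis by (simp only: f)
qed

text \<open>After the change of variables the weight is evaluated at the sheared point. With
  \<open>s \<le> 4 ^ j\<close> and the contraction by \<open>2 ^ j\<close>, the product
  \<open>s * norm\<close> grows by at most \<open>2 ^ j\<close> times the squared dimension. This is
  the source of the loss \<open>(2 ^ j) powr r\<close>; the remaining integral depends neither on
  the scale nor on the shear.\<close>

lemma shear_kernel_weight:
  fixes l :: "int^'d"
  assumes g: "shearlet_generators \<psi>1h \<psi>2h" and l: "\<And>i. \<bar>l $ i\<bar> \<le> 2 ^ j"
    and s: "0 \<le> s" "s \<le> 4 ^ j" and r: "0 \<le> r"
  shows "(\<integral>\<^sup>+x. ennreal ((1 + s * norm x) powr r * norm (shear_kernel \<psi>1h \<psi>2h \<dd> j l x)) \<partial>lborel) \<le>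
    ennreal ((2 ^ j) powr r) * (\<integral>\<^sup>+x. ennreal ((1 + (real CARD('d))\<^sup>2 * norm x) powr r * norm (tilde (shearlet \<psi>1h \<psi>2h \<dd>) x)) \<partial>lborel)"
proof -
  let ?M = "shear_mat \<dd> j l" and ?T = "shear_kernel \<psi>1h \<psi>2h \<dd> j l"
  let ?t = "tilde (shearlet \<psi>1h \<psi>2h \<dd>)"
  have d: "det ?M > 0" by (rule det_shear_mat_pos)
  have t: "rapid ?t" by (rule tilde_rapid[OF shearlet_rapid[OF g]])
  have tm [measurable]: "?t \<in> borel_measurable borel" by (rule rapid_measurable[OF t])
  have T: "?T x = complex_of_real (inverse \<bar>det ?M\<bar>) * ?t (matrix_inv ?M *v x)" for x
    by (simp add: shear_kernel_def mat_dilate_def)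
  have [measurable]: "?T \<in> borel_measurable borel" unfolding T[abs_def] by measurable
  have "(\<integral>\<^sup>+x. ennreal ((1 + s * norm x) powr r * norm (?T x)) \<partial>lborel) =
      ennreal \<bar>det ?M\<bar> * (\<integral>\<^sup>+x. ennreal ((1 + s * norm (?M *v x)) powr r * norm (?T (?M *v x))) \<partial>lborel)"
    by (rule nn_integral_density_distr[OF lborel_shear_mat]) measurable
  also have "\<dots> = (\<integral>\<^sup>+x. ennreal \<bar>det ?M\<bar> * ennreal ((1 + s * norm (?M *v x)) powr r * norm (?T (?M *v x))) \<partial>lborel)"
    by (rule nn_integral_cmult[symmetric]) measurable
  also have "\<dots> \<le> (\<integral>\<^sup>+x. ennreal ((2 ^ j) powr r) * ennreal ((1 + (real CARD('d))\<^sup>2 * norm x) powr r * norm (?t x)) \<partial>lborel)"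
  proof (rule nn_integral_mono)
    fix x :: "real^'d"
    have e: "\<bar>det ?M\<bar> * ((1 + s * norm (?M *v x)) powr r * norm (?T (?M *v x))) = (1 + s * norm (?M *v x)) powr r * norm (?t x)"
      unfolding T norm_mult norm_of_real using d by (simp add: matrix_inv_mult_vec)
    have "s * norm (?M *v x) \<le> 4 ^ j * (real CARD('d) * (real CARD('d) * norm x / 2 ^ j))"
      using s by (intro mult_mono norm_shear_mat_mult_le l) auto
    also have "\<dots> = 2 ^ j * ((real CARD('d))\<^sup>2 * norm x)"
    proof -
      have "(4::real) ^ j = 2 ^ j * 2 ^ j" by (simp add: power_mult_distrib[symmetric])
      then show ?thesis by (simp add: power2_eq_square)
    qed
    finally have le: "s * norm (?M *v x) \<le> 2 ^ j * ((real CARD('d))\<^sup>2 * norm x)" .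
    have "1 + s * norm (?M *v x) \<le> 2 ^ j * (1 + (real CARD('d))\<^sup>2 * norm x)"
    proof -
      have "(1::real) \<le> 2 ^ j" by simp
      from add_mono[OF this le] show ?thesis unfolding distrib_left mult_1_right .
    qed
    then have "(1 + s * norm (?M *v x)) powr r \<le> (2 ^ j * (1 + (real CARD('d))\<^sup>2 * norm x)) powr r"
      using s r by (intro powr_mono2) auto
    then have "(1 + s * norm (?M *v x)) powr r \<le> (2 ^ j) powr r * (1 + (real CARD('d))\<^sup>2 * norm x) powr r"
      by (simp only: powr_mult)
    from mult_right_mono[OF this norm_ge_zero[of "?t x"]]
    have "ennreal (\<bar>det ?M\<bar> * ((1 + s * norm (?M *v x)) powr r * norm (?T (?M *v x)))) \<le> ennreal ((2 ^ j) powr r * ((1 + (real CARD('d))\<^sup>2 * norm x) powr r * norm (?t x)))"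
      unfolding e by (intro ennreal_leI) (simp only: mult.assoc)
    then show "ennreal \<bar>det ?M\<bar> * ennreal ((1 + s * norm (?M *v x)) powr r * norm (?T (?M *v x))) \<le> ennreal ((2 ^ j) powr r) * ennreal ((1 + (real CARD('d))\<^sup>2 * norm x) powr r * norm (?t x))"
      by (simp only: ennreal_mult'[OF abs_ge_zero] ennreal_mult'[OF powr_ge_zero])
  qed
  also have "\<dots> = ennreal ((2 ^ j) powr r) * (\<integral>\<^sup>+x. ennreal ((1 + (real CARD('d))\<^sup>2 * norm x) powr r * norm (?t x)) \<partial>lborel)"
    by (rule nn_integral_cmult) measurable
  finally show ?thesis .
qed

lemma dyadic_scale_exists:
  fixes r :: real
  assumes "1 \<le> r" "r \<le> 2 ^ n"
  obtains k where "k \<le> n" "3 / 5 \<le> r / 2 ^ k" "r / 2 ^ k \<le> 5 / 3"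
proof -
  have ex: "r / 2 ^ n \<le> 5 / 3" using assms by (simp add: divide_le_eq)
  define k where "k = (LEAST k. r / 2 ^ k \<le> 5 / 3)"
  have k: "r / 2 ^ k \<le> 5 / 3" unfolding k_def using ex by (rule LeastI)
  have kn: "k \<le> n" unfolding k_def using ex by (rule Least_le)
  have "3 / 5 \<le> r / 2 ^ k"
  proof (cases k)
    case 0 then show ?thesis using assms by simp
  next
    case (Suc m)
    then have "\<not> r / 2 ^ m \<le> 5 / 3" unfolding k_def by (intro not_less_Least) simp
    then have "5 / 3 * 2 ^ m < r" by (simp add: field_simps not_le)
    then have "3 / 5 * 2 ^ Suc m \<le> r" using zero_less_power[of "2::real" m] by (simp only: power_Suc) linarith
    then show ?thesis unfolding Suc by (subst pos_le_divide_eq) simp_all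
  qed
  then show ?thesis using that k kn by blast
qed

section \<open>Comparison of the frequency decompositions\<close>

text \<open>One index type for all dyadic pieces: \<open>None\<close> stands for the low frequency
  function, which is given the same scale 1 as \<open>Some 0\<close>.\<close>

definition band :: "(real^'d \<Rightarrow> complex) \<Rightarrow> (real^'d \<Rightarrow> complex) \<Rightarrow> nat option \<Rightarrow> real^'d \<Rightarrow> complex" where
  "band \<Phi> \<phi> \<kappa> = (case \<kappa> of None \<Rightarrow> \<Phi> | Some \<nu> \<Rightarrow> dyadic_dilate \<nu> \<phi>)"

definition band_scale :: "nat option \<Rightarrow> real" where
  "band_scale \<kappa> = (case \<kappa> of None \<Rightarrow> 1 | Some \<nu> \<Rightarrow> 2 ^ \<nu>)"

text \<open>Shearlets of scale \<open>j\<close> live at frequencies between \<open>2\<^bsup>2j-4\<^esup>\<close> and a multiple of \<open>2\<^bsup>2j\<^esup>\<close>. For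
  \<open>j \<le> 2\<close> the truncated subtraction gives level 0, and the low frequency function is included.\<close>

definition base_level :: "nat \<Rightarrow> nat" where "base_level j = 2 * j - 6"

definition window :: "nat \<Rightarrow> nat \<Rightarrow> nat option set" where
  "window n j = (if j \<le> 2 then {None} else {}) \<union> Some ` {base_level j..base_level j + n}"

lemma finite_window [simp]: "finite (window n j)" by (simp add: window_def)

lemma card_window: "card (window n j) \<le> n + 2"
proof -
  have "card (window n j) \<le> card (if j \<le> 2 then {None :: nat option} else {}) + card (Some ` {base_level j..base_level j + n})"
    unfolding window_def by (rule card_Un_le)
  also have "\<dots> \<le> 1 + (n + 1)" by (intro add_mono) (auto simp: card_image)
  finally show ?thesis by simp
qed

lemma band_scale_window:
  assumes "\<kappa> \<in> window n j" shows "band_scale \<kappa> \<le> 2 ^ n * 2 ^ base_level j" "1 \<le> band_scale \<kappa>"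
proof -
  show "1 \<le> band_scale \<kappa>" by (cases \<kappa>) (simp_all add: band_scale_def)
  show "band_scale \<kappa> \<le> 2 ^ n * 2 ^ base_level j"
  proof (cases \<kappa>)
    case None
    have "(1::real) \<le> 2 ^ (n + base_level j)" by simp
    then show ?thesis using None by (simp add: band_scale_def power_add)
  next
    case (Some \<nu>)
    then have "\<nu> \<le> n + base_level j" using assms by (auto simp: window_def split: if_splits)
    then have "(2::real) ^ \<nu> \<le> 2 ^ (n + base_level j)" by (intro power_increasing) auto
    then show ?thesis using Some by (simp add: band_scale_def power_add)
  qed
qed

lemma dyadic_pairD:
  assumes "dyadic_pair \<Phi> \<phi>"
  shows "\<Phi> \<in> schwartz" "\<phi> \<in> schwartz" "2 < norm \<xi> \<Longrightarrow> fourier \<Phi> \<xi> = 0" "2 < norm \<xi> \<Longrightarrow> fourier \<phi> \<xi> = 0"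
    "3/5 \<le> norm \<xi> \<Longrightarrow> norm \<xi> \<le> 5/3 \<Longrightarrow> fourier \<phi> \<xi> \<noteq> 0" "norm \<xi> \<le> 5/3 \<Longrightarrow> fourier \<Phi> \<xi> \<noteq> 0"
proof -
  have s: "supp (fourier \<phi>) \<subseteq> {\<xi>. 1/2 \<le> norm \<xi> \<and> norm \<xi> \<le> 2}" "supp (fourier \<Phi>) \<subseteq> {\<xi>. norm \<xi> \<le> 2}"
    using assms by (simp_all only: dyadic_pair_def)
  obtain c where c: "c > 0" "\<forall>\<xi>. 3/5 \<le> norm \<xi> \<and> norm \<xi> \<le> 5/3 \<longrightarrow> norm (fourier \<phi> \<xi>) \<ge> c"
    "\<forall>\<xi>. norm \<xi> \<le> 5/3 \<longrightarrow> norm (fourier \<Phi> \<xi>) \<ge> c"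
    using assms unfolding dyadic_pair_def by blast
  show "\<Phi> \<in> schwartz" "\<phi> \<in> schwartz" using assms by (simp_all only: dyadic_pair_def)
  show "2 < norm \<xi> \<Longrightarrow> fourier \<Phi> \<xi> = 0" using supp_zero[OF s(2), of \<xi>] by simp
  show "2 < norm \<xi> \<Longrightarrow> fourier \<phi> \<xi> = 0" using supp_zero[OF s(1), of \<xi>] by simp
  show "fourier \<phi> \<xi> \<noteq> 0" if "3/5 \<le> norm \<xi>" "norm \<xi> \<le> 5/3"
    using c(1) c(2)[rule_format, of \<xi>] that by auto
  show "fourier \<Phi> \<xi> \<noteq> 0" if "norm \<xi> \<le> 5/3"
    using c(1) c(3)[rule_format, of \<xi>] that by auto
qed

lemma band_schwartz: "dyadic_pair \<Phi> \<phi> \<Longrightarrow> band \<Phi> \<phi> \<kappa> \<in> schwartz"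
  by (cases \<kappa>) (simp_all add: band_def dyadic_pairD dyadic_dilate_schwartz)

lemma fourier_band_Some:
  assumes "dyadic_pair \<Phi> \<phi>"
  shows "fourier (band \<Phi> \<phi> (Some (k + b))) \<xi> = fourier (band \<Phi> \<phi> (Some k)) ((1 / 2 ^ b) *\<^sub>R \<xi>)"
proof -
  have "dyadic_dilate k \<phi> \<in> borel_measurable borel"
    using assms by (intro rapid_measurable dyadic_dilate_rapid schwartz_rapid dyadic_pairD)
  then show ?thesis
    unfolding band_def option.case add.commute[of k b] dyadic_dilate_add by (rule fourier_dyadic_dilate)
qed

lemma fourier_band_ne:
  fixes \<phi> :: "real^'d \<Rightarrow> complex"
  assumes dp: "dyadic_pair \<Phi> \<phi>" and \<xi>: "1 \<le> norm \<xi>" "norm \<xi> \<le> 2 ^ n"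
  shows "\<exists>k\<in>{0..n}. fourier (band \<Phi> \<phi> (Some k)) \<xi> \<noteq> 0"
proof -
  obtain k where k: "k \<le> n" "3 / 5 \<le> norm \<xi> / 2 ^ k" "norm \<xi> / 2 ^ k \<le> 5 / 3"
    using dyadic_scale_exists[OF \<xi>] by metis
  have "fourier (band \<Phi> \<phi> (Some k)) \<xi> = fourier \<phi> ((1 / 2 ^ k) *\<^sub>R \<xi>)"
    using dp unfolding band_def option.case
    by (intro fourier_dyadic_dilate rapid_measurable schwartz_rapid dyadic_pairD)
  moreover have "fourier \<phi> ((1 / 2 ^ k) *\<^sub>R \<xi>) \<noteq> 0"
    by (rule dyadic_pairD(5)[OF dp]) (use k(2,3) in simp_all)
  ultimately have "fourier (band \<Phi> \<phi> (Some k)) \<xi> \<noteq> 0" by simp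
  then show ?thesis using k(1) by auto
qed

text \<open>Origin of the window length: the cutoff
  \<open>\<beta> ((1 / 512) *\<^sub>R \<xi>)\<close> lives on the cube of half side 128, which is 2
  to the power 7, and the dimension is crudely bounded by a power of 2 with itself as
  exponent.\<close>

lemma norm_le_window:
  fixes \<xi> :: "real^'d"
  assumes "\<And>i. \<bar>\<xi> $ i\<bar> \<le> 128" shows "norm \<xi> \<le> 2 ^ (7 + CARD('d))"
proof -
  have "norm \<xi> \<le> real CARD('d) * 128" by (rule norm_le_CARD[OF assms])
  also have "real CARD('d) \<le> 2 ^ CARD('d)" using of_nat_less_two_power[of "CARD('d)", where 'a=real] by simp
  finally show ?thesis by (simp add: power_add)
qed

text \<open>The bump scaled by 512 is 1 on the cube of half side 64, which contains the symbols of
  the scales up to 2 and that of the coarse generator. On its support either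
  \<open>norm \<xi> \<ge> 1\<close> and some dilate of \<phi> is active, or the transform of \<Phi>
  is nonzero.\<close>

lemma low_resolution:
  fixes \<phi> :: "real^'d \<Rightarrow> complex"
  assumes dp: "dyadic_pair \<Phi> \<phi>" and \<beta>: "cube_bump \<beta>"
  obtains \<theta> :: "nat option \<Rightarrow> real^'d \<Rightarrow> complex" where
    "\<And>\<kappa>. \<kappa> \<in> insert None (Some ` {0..7 + CARD('d)}) \<Longrightarrow> rapid (\<theta> \<kappa>)"
    "\<And>\<xi>. (\<Sum>\<kappa>\<in>insert None (Some ` {0..7 + CARD('d)}). fourier (\<theta> \<kappa>) \<xi> * fourier (band \<Phi> \<phi> \<kappa>) \<xi>) = \<beta> ((1 / 512) *\<^sub>R \<xi>)"
proof (rule fourier_resolution[where \<phi>="band \<Phi> \<phi>" and K="insert None (Some ` {0..7 + CARD('d)})" and \<beta>="\<lambda>\<xi>. \<beta> ((1 / 512) *\<^sub>R \<xi>)"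
      and S="{\<xi>. \<forall>i. \<bar>\<xi> $ i\<bar> \<le> 128}"])
  let ?S = "{\<xi>::real^'d. \<forall>i. \<bar>\<xi> $ i\<bar> \<le> 128}"
  show "rapid (band \<Phi> \<phi> \<kappa>)" for \<kappa> by (rule schwartz_rapid[OF band_schwartz[OF dp]])
  have t: "test_function \<beta>" using \<beta> by (simp add: cube_bump_def)
  show "Ck_on n UNIV (\<lambda>\<xi>. \<beta> ((1 / 512) *\<^sub>R \<xi>))" for n
    by (rule test_function_Ck_on[OF test_function_scale[OF t]]) simp
  have "?S = (\<Inter>i. {\<xi>. \<bar>\<xi> $ i\<bar> \<le> 128})" by auto
  also have "closed \<dots>" by (intro closed_INT ballI closed_Collect_le continuous_intros)
  finally show "closed ?S" .
  show "bounded ?S" unfolding bounded_iff using norm_le_window by blast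
  show "\<beta> ((1 / 512) *\<^sub>R \<xi>) = 0" if nS: "\<xi> \<notin> ?S" for \<xi>
  proof -
    obtain i where "128 < \<bar>\<xi> $ i\<bar>" using nS by (auto simp: not_le)
    then have "1/4 < \<bar>((1 / 512) *\<^sub>R \<xi>) $ i\<bar>" by (simp add: abs_mult)
    then show ?thesis using \<beta> unfolding cube_bump_def by blast
  qed
  show "\<exists>\<kappa>\<in>insert None (Some ` {0..7 + CARD('d)}). fourier (band \<Phi> \<phi> \<kappa>) \<xi> \<noteq> 0" if "\<xi> \<in> ?S" for \<xi>
  proof (cases "1 \<le> norm \<xi>")
    case True
    have "norm \<xi> \<le> 2 ^ (7 + CARD('d))" using that by (intro norm_le_window) auto
    from fourier_band_ne[OF dp True this] show ?thesis by auto
  next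
    case False
    then have "fourier \<Phi> \<xi> \<noteq> 0" by (intro dyadic_pairD(6)[OF dp]) simp
    then show ?thesis by (intro bexI[of _ None]) (auto simp: band_def)
  qed
qed (use that in auto)

text \<open>Subtracting the bump scaled by 8 removes the cube of half side 1, and with it the unit
  ball, so that \<Phi> can be left out. This matters because dilates of \<phi> can be dilated
  further, whereas \<Phi> belongs to a single scale. The difference is 1 as soon as all coordinates
  are at most 64 and one exceeds 2 in modulus.\<close>

lemma high_resolution:
  fixes \<phi> :: "real^'d \<Rightarrow> complex"
  assumes dp: "dyadic_pair \<Phi> \<phi>" and \<beta>: "cube_bump \<beta>"
  obtains \<theta> :: "nat \<Rightarrow> real^'d \<Rightarrow> complex" where
    "\<And>k. k \<in> {0..7 + CARD('d)} \<Longrightarrow> rapid (\<theta> k)"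
    "\<And>\<xi>. (\<Sum>k\<in>{0..7 + CARD('d)}. fourier (\<theta> k) \<xi> * fourier (band \<Phi> \<phi> (Some k)) \<xi>) = \<beta> ((1 / 512) *\<^sub>R \<xi>) + (- 1) * \<beta> ((1 / 8) *\<^sub>R \<xi>)"
proof (rule fourier_resolution[where \<phi>="\<lambda>k. band \<Phi> \<phi> (Some k)" and K="{0..7 + CARD('d)}" and \<beta>="\<lambda>\<xi>. \<beta> ((1 / 512) *\<^sub>R \<xi>) + (- 1) * \<beta> ((1 / 8) *\<^sub>R \<xi>)"
      and S="{\<xi>. \<forall>i. \<bar>\<xi> $ i\<bar> \<le> 128} \<inter> {\<xi>. 1 \<le> norm \<xi>}"])
  let ?S = "{\<xi>::real^'d. \<forall>i. \<bar>\<xi> $ i\<bar> \<le> 128} \<inter> {\<xi>. 1 \<le> norm \<xi>}"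
  show "rapid (band \<Phi> \<phi> (Some k))" for k by (rule schwartz_rapid[OF band_schwartz[OF dp]])
  have t: "test_function \<beta>" using \<beta> by (simp add: cube_bump_def)
  have C: "Ck_on n UNIV (\<lambda>\<xi>. \<beta> (c *\<^sub>R \<xi>))" if "c > 0" for n c
    by (rule test_function_Ck_on[OF test_function_scale[OF t that]])
  show "Ck_on n UNIV (\<lambda>\<xi>. \<beta> ((1 / 512) *\<^sub>R \<xi>) + (- 1) * \<beta> ((1 / 8) *\<^sub>R \<xi>))" for n
    by (rule Ck_on_add[OF C Ck_on_mult[OF Ck_on_const C]]) simp_all
  have "{\<xi>::real^'d. \<forall>i. \<bar>\<xi> $ i\<bar> \<le> 128} = (\<Inter>i. {\<xi>. \<bar>\<xi> $ i\<bar> \<le> 128})" by auto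
  also have "closed \<dots>" by (intro closed_INT ballI closed_Collect_le continuous_intros)
  finally show "closed ?S" by (intro closed_Int closed_Collect_le continuous_intros)
  have "norm \<xi> \<le> 2 ^ (7 + CARD('d))" if "\<xi> \<in> ?S" for \<xi> using that by (intro norm_le_window) auto
  then show "bounded ?S" unfolding bounded_iff by blast
  have one: "\<beta> \<zeta> = 1" if "\<And>i. \<bar>\<zeta> $ i\<bar> \<le> 1/8" for \<zeta> using \<beta> that unfolding cube_bump_def by blast
  have zero: "\<beta> \<zeta> = 0" if "1/4 < \<bar>\<zeta> $ i\<bar>" for \<zeta> i using \<beta> that unfolding cube_bump_def by blast
  show "\<beta> ((1 / 512) *\<^sub>R \<xi>) + (- 1) * \<beta> ((1 / 8) *\<^sub>R \<xi>) = 0" if "\<xi> \<notin> ?S" for \<xi>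
  proof (cases "\<exists>i. 128 < \<bar>\<xi> $ i\<bar>")
    case True
    then obtain i where "128 < \<bar>\<xi> $ i\<bar>" by blast
    then have "\<beta> ((1 / 512) *\<^sub>R \<xi>) = 0" "\<beta> ((1 / 8) *\<^sub>R \<xi>) = 0" by (auto intro!: zero[of _ i] simp: abs_mult)
    then show ?thesis by simp
  next
    case False
    then have n1: "norm \<xi> < 1" using that by (auto simp: not_less not_le)
    have c: "\<bar>\<xi> $ i\<bar> \<le> 1" for i using component_le_norm_cart[of \<xi> i] n1 by linarith
    have "\<beta> ((1 / 512) *\<^sub>R \<xi>) = 1"
      by (rule one) (use c in \<open>simp add: abs_mult order_trans[OF c]\<close>)
    moreover have "\<beta> ((1 / 8) *\<^sub>R \<xi>) = 1"
      by (rule one) (use c in \<open>simp add: abs_mult\<close>)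
    ultimately show ?thesis by simp
  qed
  show "\<exists>k\<in>{0..7 + CARD('d)}. fourier (band \<Phi> \<phi> (Some k)) \<xi> \<noteq> 0" if "\<xi> \<in> ?S" for \<xi>
    using that by (intro fourier_band_ne[OF dp] norm_le_window) auto
qed (use that in auto)

lemma finite_ennreal_bound:
  assumes "finite K" "\<And>k. k \<in> K \<Longrightarrow> f k < (\<infinity>::ennreal)"
  obtains B where "B > 0" "\<And>k. k \<in> K \<Longrightarrow> f k \<le> ennreal B"
proof -
  have fin: "(\<Sum>k\<in>K. f k) < \<infinity>" using assms by (induction K) auto
  have "f k \<le> ennreal (enn2real (\<Sum>k\<in>K. f k) + 1)" if "k \<in> K" for k
  proof -
    have "f k \<le> (\<Sum>k\<in>K. f k)" using that assms(1) by (intro member_le_sum) auto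
    also have "\<dots> = ennreal (enn2real (\<Sum>k\<in>K. f k))" using fin by simp
    also have "\<dots> \<le> ennreal (enn2real (\<Sum>k\<in>K. f k) + 1)" by (intro ennreal_leI) simp
    finally show ?thesis .
  qed
  then show ?thesis by (intro that[of "enn2real (\<Sum>k\<in>K. f k) + 1"]) (auto simp: add_nonneg_pos)
qed

lemma sum_window_high:
  assumes "3 \<le> j"
  shows "(\<Sum>\<kappa>\<in>window n j. f \<kappa>) = (\<Sum>k\<in>{0..n}. f (Some (k + base_level j)))"
proof -
  have "(\<Sum>\<kappa>\<in>window n j. f \<kappa>) = (\<Sum>\<nu>\<in>{base_level j..base_level j + n}. f (Some \<nu>))"
    using assms by (simp add: window_def sum.reindex)
  also have "\<dots> = (\<Sum>\<nu>\<in>{0 + base_level j..n + base_level j}. f (Some \<nu>))" by (simp add: add.commute)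
  also have "\<dots> = (\<Sum>k\<in>{0..n}. f (Some (k + base_level j)))" by (rule sum.shift_bounds_cl_nat_ivl)
  finally show ?thesis .
qed

lemma window_low: "j \<le> 2 \<Longrightarrow> window n j = insert None (Some ` {0..n})"
  by (simp add: window_def base_level_def)

text \<open>The constant is the same for all scales: up to scale 2 the dual functions are a fixed
  finite family, and above they are dilates of another one, with unchanged weighted norms. The
  function \<open>P\<close> is any majorant of Peetre type at the point \<open>x\<close>. The coarse
  term is treated as a multiplier at scale 0.\<close>

lemma window_bound:
  fixes \<phi> :: "real^'d \<Rightarrow> complex"
  assumes dp: "dyadic_pair \<Phi> \<phi>" and sg: "shearlet_generators \<psi>1h \<psi>2h" and cg: "coarse_generator \<psi>1h \<psi>2h \<Psi>h"
    and l: "l \<ge> 0"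
  obtains C where "C > 0"
    "\<And>u x P \<dd> j L. u \<in> tempered_distributions \<Longrightarrow> (\<dd>, j, L) \<in> shear_index \<Longrightarrow>
      (\<And>\<kappa> z. norm (conv (band \<Phi> \<phi> \<kappa>) u (x - z)) \<le> P \<kappa> * (1 + band_scale \<kappa> * norm z) powr l) \<Longrightarrow>
      norm (conv (shear_kernel \<psi>1h \<psi>2h \<dd> j L) u x) \<le> C * (2 ^ j) powr l * (\<Sum>\<kappa>\<in>window (7 + CARD('d)) j. P \<kappa>)"
    "\<And>u x P. u \<in> tempered_distributions \<Longrightarrow>
      (\<And>\<kappa> z. norm (conv (band \<Phi> \<phi> \<kappa>) u (x - z)) \<le> P \<kappa> * (1 + band_scale \<kappa> * norm z) powr l) \<Longrightarrow>
      norm (conv (inverse_fourier \<Psi>h) u x) \<le> C * (\<Sum>\<kappa>\<in>window (7 + CARD('d)) 0. P \<kappa>)"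
proof -
  define n where "n = 7 + CARD('d)"
  obtain \<beta> :: "real^'d \<Rightarrow> complex" where \<beta>: "cube_bump \<beta>" using coarse_generator_cube_bump[OF cg] by blast
  have one: "\<beta> \<zeta> = 1" if "\<And>i. \<bar>\<zeta> $ i\<bar> \<le> 1/8" for \<zeta> using \<beta> that unfolding cube_bump_def by blast
  have zero: "\<beta> \<zeta> = 0" if "1/4 < \<bar>\<zeta> $ i\<bar>" for \<zeta> i using \<beta> that unfolding cube_bump_def by blast
  obtain \<theta>0 where \<theta>0: "\<And>\<kappa>. \<kappa> \<in> insert None (Some ` {0..n}) \<Longrightarrow> rapid (\<theta>0 \<kappa>)"
    "\<And>\<xi>. (\<Sum>\<kappa>\<in>insert None (Some ` {0..n}). fourier (\<theta>0 \<kappa>) \<xi> * fourier (band \<Phi> \<phi> \<kappa>) \<xi>) = \<beta> ((1 / 512) *\<^sub>R \<xi>)"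
    using low_resolution[OF dp \<beta>] unfolding n_def by blast
  obtain \<theta>1 where \<theta>1: "\<And>k. k \<in> {0..n} \<Longrightarrow> rapid (\<theta>1 k)"
    "\<And>\<xi>. (\<Sum>k\<in>{0..n}. fourier (\<theta>1 k) \<xi> * fourier (band \<Phi> \<phi> (Some k)) \<xi>) = \<beta> ((1 / 512) *\<^sub>R \<xi>) + (- 1) * \<beta> ((1 / 8) *\<^sub>R \<xi>)"
    using high_resolution[OF dp \<beta>] unfolding n_def by blast
  have fin0: "(\<integral>\<^sup>+z. ennreal ((1 + 1 * norm z) powr l * norm (\<theta>0 \<kappa> z)) \<partial>lborel) < \<infinity>" if "\<kappa> \<in> insert None (Some ` {0..n})" for \<kappa>
    by (rule rapid_nn_integral_weight[OF \<theta>0(1)[OF that] _ l]) simp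
  obtain B0 where B0: "B0 > 0" "\<And>\<kappa>. \<kappa> \<in> insert None (Some ` {0..n}) \<Longrightarrow> (\<integral>\<^sup>+z. ennreal ((1 + 1 * norm z) powr l * norm (\<theta>0 \<kappa> z)) \<partial>lborel) \<le> ennreal B0"
    by (rule finite_ennreal_bound[of "insert None (Some ` {0..n})", OF _ fin0]) auto
  have fin1: "(\<integral>\<^sup>+z. ennreal ((1 + 1 * norm z) powr l * norm (\<theta>1 k z)) \<partial>lborel) < \<infinity>" if "k \<in> {0..n}" for k
    by (rule rapid_nn_integral_weight[OF \<theta>1(1)[OF that] _ l]) simp
  obtain B1 where B1: "B1 > 0" "\<And>k. k \<in> {0..n} \<Longrightarrow> (\<integral>\<^sup>+z. ennreal ((1 + 1 * norm z) powr l * norm (\<theta>1 k z)) \<partial>lborel) \<le> ennreal B1"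
    by (rule finite_ennreal_bound[of "{0..n}", OF _ fin1]) auto
  have finA: "(\<integral>\<^sup>+x. ennreal ((1 + (real CARD('d))\<^sup>2 * norm x) powr l * norm (tilde (shearlet \<psi>1h \<psi>2h \<dd>) x)) \<partial>lborel) < \<infinity>" for \<dd> :: 'd
    by (rule rapid_nn_integral_weight[OF tilde_rapid[OF shearlet_rapid[OF sg]] _ l]) simp
  obtain A where A: "A > 0" "\<And>\<dd>::'d. (\<integral>\<^sup>+x. ennreal ((1 + (real CARD('d))\<^sup>2 * norm x) powr l * norm (tilde (shearlet \<psi>1h \<psi>2h \<dd>) x)) \<partial>lborel) \<le> ennreal A"
    by (rule finite_ennreal_bound[of UNIV "\<lambda>\<dd>::'d. (\<integral>\<^sup>+x. ennreal ((1 + (real CARD('d))\<^sup>2 * norm x) powr l * norm (tilde (shearlet \<psi>1h \<psi>2h \<dd>) x)) \<partial>lborel)"]) (auto simp only: finA finite UNIV_I)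
  have t\<Psi>: "test_function \<Psi>h" by (rule coarse_generator_test_function[OF cg])
  have finE: "(\<integral>\<^sup>+x. ennreal ((1 + 1 * norm x) powr l * norm (inverse_fourier \<Psi>h x)) \<partial>lborel) < \<infinity>"
    by (rule rapid_nn_integral_weight[OF inverse_fourier_test_function_rapid[OF t\<Psi>] _ l]) simp
  define E where "E = enn2real (\<integral>\<^sup>+x. ennreal ((1 + 1 * norm x) powr l * norm (inverse_fourier \<Psi>h x)) \<partial>lborel)"
  have E: "(\<integral>\<^sup>+x. ennreal ((1 + 1 * norm x) powr l * norm (inverse_fourier \<Psi>h x)) \<partial>lborel) \<le> ennreal E" "E \<ge> 0"
    unfolding E_def using finE by simp_all
  define B where "B = max B0 B1"
  have B: "B > 0" "ennreal B0 \<le> ennreal B" "ennreal B1 \<le> ennreal B" using B0(1) B1(1) by (auto simp: B_def intro: ennreal_leI)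
  \<comment> \<open>\<open>A\<close> bounds the shearlet kernels, \<open>E\<close> the coarse
    kernel, \<open>B\<close> the dual functions; the power of \<open>2 ^ n\<close> is the price for
    replacing all band scales of a window by the one of its base level.\<close>
  define C where "C = max A E * B * (2 ^ n) powr l"
  have C: "C > 0" using A(1) B(1) by (auto simp: C_def less_max_iff_disj)
  have bnd: "norm (conv (band \<Phi> \<phi> \<kappa>) u (x - z)) \<le> (P \<kappa> * (2 ^ n) powr l) * (1 + 2 ^ base_level j * norm z) powr l"
    if P: "\<And>\<kappa> z. norm (conv (band \<Phi> \<phi> \<kappa>) u (x - z)) \<le> P \<kappa> * (1 + band_scale \<kappa> * norm z) powr l"
      and \<kappa>: "\<kappa> \<in> window n j" for u x P \<kappa> j and z :: "real^'d"
  proof -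
    have P0: "P \<kappa> \<ge> 0" using order_trans[OF norm_ge_zero P[of \<kappa> 0]] by simp
    have "band_scale \<kappa> * norm z \<le> (2 ^ n * 2 ^ base_level j) * norm z"
      by (intro mult_right_mono band_scale_window \<kappa>) simp
    then have "1 + band_scale \<kappa> * norm z \<le> 2 ^ n * (1 + 2 ^ base_level j * norm z)"
      using one_le_power[of "2::real" n] add_mono[of 1 "2 ^ n" "band_scale \<kappa> * norm z" "(2 ^ n * 2 ^ base_level j) * norm z"]
      by (simp only: distrib_left mult_1_right mult.assoc)
    then have "(1 + band_scale \<kappa> * norm z) powr l \<le> (2 ^ n * (1 + 2 ^ base_level j * norm z)) powr l"
      using l band_scale_window(2)[OF \<kappa>] by (intro powr_mono2) auto
    then have "(1 + band_scale \<kappa> * norm z) powr l \<le> (2 ^ n) powr l * (1 + 2 ^ base_level j * norm z) powr l"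
      by (simp only: powr_mult)
    from mult_left_mono[OF this P0] show ?thesis using P[of \<kappa> z] by (simp only: mult.assoc)
  qed
  \<comment> \<open>The condition \<open>ml\<close> places the rescaled support of \<open>m\<close>
    where the larger bump is 1; for scales from 3 on, \<open>mh\<close> places it where the
    subtracted bump vanishes.\<close>
  have main: "norm (conv (inverse_fourier m) u x) \<le> a * B * (\<Sum>\<kappa>\<in>window n j. P \<kappa> * (2 ^ n) powr l)"
    if u: "u \<in> tempered_distributions" and m: "test_function m"
      and P: "\<And>\<kappa> z. norm (conv (band \<Phi> \<phi> \<kappa>) u (x - z)) \<le> P \<kappa> * (1 + band_scale \<kappa> * norm z) powr l"
      and a: "(\<integral>\<^sup>+z. ennreal ((1 + 2 ^ base_level j * norm z) powr l * norm (inverse_fourier m z)) \<partial>lborel) \<le> ennreal a" "a \<ge> 0"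
      and ml: "\<And>\<xi> i. m \<xi> \<noteq> 0 \<Longrightarrow> \<bar>\<xi> $ i\<bar> \<le> 64 * 2 ^ base_level j"
      and mh: "\<And>\<xi>. m \<xi> \<noteq> 0 \<Longrightarrow> 3 \<le> j \<Longrightarrow> \<exists>i. 2 * 2 ^ base_level j < \<bar>\<xi> $ i\<bar>"
    for u x P j a and m :: "real^'d \<Rightarrow> complex"
  proof (cases "j \<le> 2")
    case True
    then have W: "window n j = insert None (Some ` {0..n})" by (rule window_low)
    have b0: "(2::real) ^ base_level j = 1" using True by (simp add: base_level_def)
    show ?thesis
    proof (rule conv_resolution_bound[OF u m finite_window band_schwartz[OF dp], where \<theta>=\<theta>0 and s="2 ^ base_level j" and l=l])
      show "rapid (\<theta>0 \<kappa>)" if "\<kappa> \<in> window n j" for \<kappa> using \<theta>0(1) that unfolding W .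
      show "(\<Sum>\<kappa>\<in>window n j. fourier (\<theta>0 \<kappa>) \<xi> * fourier (band \<Phi> \<phi> \<kappa>) \<xi>) = 1" if "m \<xi> \<noteq> 0" for \<xi>
        unfolding W \<theta>0(2)
      proof (rule one)
        show "\<bar>((1 / 512) *\<^sub>R \<xi>) $ i\<bar> \<le> 1 / 8" for i using ml[OF that, of i] by (simp add: b0 abs_mult)
      qed
      show "norm (conv (band \<Phi> \<phi> \<kappa>) u (x - z)) \<le> (P \<kappa> * (2 ^ n) powr l) * (1 + 2 ^ base_level j * norm z) powr l" if "\<kappa> \<in> window n j" for \<kappa> z
        by (rule bnd[OF P that])
      show "(\<integral>\<^sup>+z. ennreal ((1 + 2 ^ base_level j * norm z) powr l * norm (\<theta>0 \<kappa> z)) \<partial>lborel) \<le> ennreal B" if "\<kappa> \<in> window n j" for \<kappa>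
        using order_trans[OF B0(2) B(2)] that unfolding W b0 by blast
    qed (use a l B(1) in auto)
  next
    case False
    then have j3: "3 \<le> j" by simp
    define b where "b = base_level j"
    \<comment> \<open>The unit scale dual functions, dilated by the base level; the index is shifted
      back by \<open>b\<close> because the window begins there.\<close>
    define \<theta> where "\<theta> \<kappa> = dyadic_dilate b (\<theta>1 (the \<kappa> - b))" for \<kappa>
    have W: "\<exists>k. \<kappa> = Some (k + b) \<and> k \<in> {0..n}" if \<kappa>: "\<kappa> \<in> window n j" for \<kappa>
    proof -
      obtain \<nu> where \<nu>: "\<kappa> = Some \<nu>" "b \<le> \<nu>" "\<nu> \<le> b + n" using \<kappa> False by (auto simp: window_def b_def)
      then show ?thesis by (intro exI[of _ "\<nu> - b"]) auto
    qed
    have rt: "rapid (\<theta> \<kappa>)" if \<kappa>: "\<kappa> \<in> window n j" for \<kappa>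
    proof -
      obtain k where "\<kappa> = Some (k + b)" "k \<in> {0..n}" using W[OF \<kappa>] by blast
      then show ?thesis unfolding \<theta>_def by (intro dyadic_dilate_rapid \<theta>1(1)) simp
    qed
    show ?thesis
    proof (rule conv_resolution_bound[OF u m finite_window band_schwartz[OF dp] rt, where s="2 ^ base_level j" and l=l])
      fix \<xi> assume mx: "m \<xi> \<noteq> 0"
      let ?\<zeta> = "(1 / 2 ^ b) *\<^sub>R \<xi>"
      have "(\<Sum>\<kappa>\<in>window n j. fourier (\<theta> \<kappa>) \<xi> * fourier (band \<Phi> \<phi> \<kappa>) \<xi>) =
        (\<Sum>k\<in>{0..n}. fourier (\<theta> (Some (k + b))) \<xi> * fourier (band \<Phi> \<phi> (Some (k + b))) \<xi>)"
        unfolding b_def by (rule sum_window_high[OF j3])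
      also have "\<dots> = (\<Sum>k\<in>{0..n}. fourier (\<theta>1 k) ?\<zeta> * fourier (band \<Phi> \<phi> (Some k)) ?\<zeta>)"
        by (intro sum.cong refl arg_cong2[where f="(*)"] fourier_band_Some[OF dp])
          (simp add: \<theta>_def fourier_dyadic_dilate rapid_measurable \<theta>1(1))
      also have "\<dots> = \<beta> ((1 / 512) *\<^sub>R ?\<zeta>) + (- 1) * \<beta> ((1 / 8) *\<^sub>R ?\<zeta>)" by (rule \<theta>1(2))
      also have "\<beta> ((1 / 512) *\<^sub>R ?\<zeta>) = 1"
      proof (rule one)
        show "\<bar>((1 / 512) *\<^sub>R ?\<zeta>) $ i\<bar> \<le> 1 / 8" for i
          using ml[OF mx, of i] by (simp add: abs_mult b_def divide_le_eq)
      qed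
      also have "\<beta> ((1 / 8) *\<^sub>R ?\<zeta>) = 0"
      proof -
        obtain i where "2 * 2 ^ b < \<bar>\<xi> $ i\<bar>" using mh[OF mx j3] unfolding b_def by blast
        then show ?thesis by (intro zero[of _ i]) (simp add: abs_mult less_divide_eq)
      qed
      finally show "(\<Sum>\<kappa>\<in>window n j. fourier (\<theta> \<kappa>) \<xi> * fourier (band \<Phi> \<phi> \<kappa>) \<xi>) = 1" by simp
    next
      show "norm (conv (band \<Phi> \<phi> \<kappa>) u (x - z)) \<le> (P \<kappa> * (2 ^ n) powr l) * (1 + 2 ^ base_level j * norm z) powr l" if "\<kappa> \<in> window n j" for \<kappa> z
        by (rule bnd[OF P that])
      fix \<kappa> assume "\<kappa> \<in> window n j"
      then obtain k where k: "\<kappa> = Some (k + b)" "k \<in> {0..n}" using W by blast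
      have "(\<integral>\<^sup>+z. ennreal ((1 + 2 ^ b * norm z) powr l * norm (\<theta> \<kappa> z)) \<partial>lborel) = (\<integral>\<^sup>+z. ennreal ((1 + norm z) powr l * norm (\<theta>1 k z)) \<partial>lborel)"
        unfolding \<theta>_def k(1) option.sel add_diff_cancel_right'
        by (rule nn_integral_dyadic_dilate_weight[OF rapid_measurable[OF \<theta>1(1)[OF k(2)]]])
      also have "\<dots> \<le> ennreal B" using order_trans[OF B1(2)[OF k(2)] B(3)] by simp
      finally show "(\<integral>\<^sup>+z. ennreal ((1 + 2 ^ base_level j * norm z) powr l * norm (\<theta> \<kappa> z)) \<partial>lborel) \<le> ennreal B"
        unfolding b_def .
    qed (use a l B(1) in auto)
  qed
  have fold: "a * B * (\<Sum>\<kappa>\<in>window n j. P \<kappa> * (2 ^ n) powr l) = a * (B * (2 ^ n) powr l * (\<Sum>\<kappa>\<in>window n j. P \<kappa>))" for a j and P :: "nat option \<Rightarrow> real"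
    unfolding sum_distrib_right[symmetric] by (simp only: mult_ac)
  show ?thesis
  proof (rule that[OF C])
    fix u :: "(real^'d \<Rightarrow> complex) \<Rightarrow> complex" and x P and \<dd> :: 'd and j L
    assume u: "u \<in> tempered_distributions" and i: "(\<dd>, j, L) \<in> shear_index"
      and P: "\<And>\<kappa> z. norm (conv (band \<Phi> \<phi> \<kappa>) u (x - z)) \<le> P \<kappa> * (1 + band_scale \<kappa> * norm z) powr l"
    have P0: "P \<kappa> \<ge> 0" for \<kappa> using order_trans[OF norm_ge_zero P[of \<kappa> 0]] by simp
    have L: "\<bar>L $ k\<bar> \<le> 2 ^ j" for k using i by (simp add: shear_index_def)
    have b4: "(2::real) ^ base_level j \<le> 4 ^ j"
    proof -
      have "(2::real) ^ base_level j \<le> 2 ^ (2 * j)" by (intro power_increasing) (auto simp: base_level_def)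
      then show ?thesis by (simp add: power_mult)
    qed
    have e4: "(4::real) ^ j \<le> 64 * 2 ^ base_level j"
    proof -
      have "(2::real) ^ (2 * j) \<le> 2 ^ (6 + base_level j)" by (intro power_increasing) (auto simp: base_level_def)
      then show ?thesis by (simp add: power_mult power_add)
    qed
    \<comment> \<open>From scale 3 on the subtraction in \<open>base_level\<close> is not truncated,
      so the bound becomes an equality; the lower frequency bound needs this.\<close>
    have e4': "(4::real) ^ j = 64 * 2 ^ base_level j" if "3 \<le> j"
    proof -
      have "2 * j = 6 + base_level j" using that by (simp add: base_level_def)
      then have "(2::real) ^ (2 * j) = 2 ^ (6 + base_level j)" by simp
      then show ?thesis by (simp add: power_mult power_add)
    qed
    let ?m = "shear_symbol \<psi>1h \<psi>2h \<dd> j L"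
    have "norm (conv (inverse_fourier ?m) u x) \<le> ((2 ^ j) powr l * A) * B * (\<Sum>\<kappa>\<in>window n j. P \<kappa> * (2 ^ n) powr l)"
    proof (rule main[OF u shear_symbol_test_function[OF sg L] P])
      have "(\<integral>\<^sup>+z. ennreal ((1 + 2 ^ base_level j * norm z) powr l * norm (inverse_fourier ?m z)) \<partial>lborel) \<le>
        ennreal ((2 ^ j) powr l) * (\<integral>\<^sup>+x. ennreal ((1 + (real CARD('d))\<^sup>2 * norm x) powr l * norm (tilde (shearlet \<psi>1h \<psi>2h \<dd>) x)) \<partial>lborel)"
        unfolding shear_kernel_inverse_fourier[OF sg L, symmetric]
        by (rule shear_kernel_weight[OF sg L _ b4 l]) simp
      also have "\<dots> \<le> ennreal ((2 ^ j) powr l) * ennreal A" by (intro mult_left_mono A) simp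
      also have "\<dots> = ennreal ((2 ^ j) powr l * A)" by (rule ennreal_mult'[symmetric]) simp
      finally show "(\<integral>\<^sup>+z. ennreal ((1 + 2 ^ base_level j * norm z) powr l * norm (inverse_fourier ?m z)) \<partial>lborel) \<le> ennreal ((2 ^ j) powr l * A)" .
      show "0 \<le> (2 ^ j) powr l * A" using A(1) by simp
    next
      fix \<xi> i assume "?m \<xi> \<noteq> 0"
      from shear_symbol_support(2)[OF sg L this, of i] e4 show "\<bar>\<xi> $ i\<bar> \<le> 64 * 2 ^ base_level j" by (rule order_trans)
    next
      fix \<xi> assume "?m \<xi> \<noteq> 0" and j3: "3 \<le> j"
      \<comment> \<open>The lower bound \<open>4 ^ j / 16\<close> is four times the base frequency,
        strictly above the factor 2 up to which the subtracted bump may be nonzero.\<close>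
      from shear_symbol_support(1)[OF sg L this(1)] have "4 * 2 ^ base_level j \<le> \<bar>\<xi> $ \<dd>\<bar>" unfolding e4'[OF j3] by simp
      then have "2 * 2 ^ base_level j < \<bar>\<xi> $ \<dd>\<bar>" using zero_less_power[of "2::real" "base_level j"] by linarith
      then show "\<exists>i. 2 * 2 ^ base_level j < \<bar>\<xi> $ i\<bar>" by blast
    qed
    also have "\<dots> = A * ((2 ^ j) powr l * (B * (2 ^ n) powr l * (\<Sum>\<kappa>\<in>window n j. P \<kappa>)))" unfolding fold by (simp only: mult_ac)
    also have "\<dots> \<le> max A E * ((2 ^ j) powr l * (B * (2 ^ n) powr l * (\<Sum>\<kappa>\<in>window n j. P \<kappa>)))"
      using B(1) P0 by (intro mult_right_mono mult_nonneg_nonneg sum_nonneg) auto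
    finally show "norm (conv (shear_kernel \<psi>1h \<psi>2h \<dd> j L) u x) \<le> C * (2 ^ j) powr l * (\<Sum>\<kappa>\<in>window (7 + CARD('d)) j. P \<kappa>)"
      unfolding shear_kernel_inverse_fourier[OF sg L] C_def n_def[symmetric] by (simp only: mult_ac)
  next
    fix u :: "(real^'d \<Rightarrow> complex) \<Rightarrow> complex" and x P
    assume u: "u \<in> tempered_distributions"
      and P: "\<And>\<kappa> z. norm (conv (band \<Phi> \<phi> \<kappa>) u (x - z)) \<le> P \<kappa> * (1 + band_scale \<kappa> * norm z) powr l"
    have P0: "P \<kappa> \<ge> 0" for \<kappa> using order_trans[OF norm_ge_zero P[of \<kappa> 0]] by simp
    have b0: "(2::real) ^ base_level 0 = 1" by (simp add: base_level_def)
    have "norm (conv (inverse_fourier \<Psi>h) u x) \<le> E * B * (\<Sum>\<kappa>\<in>window n 0. P \<kappa> * (2 ^ n) powr l)"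
    proof (rule main[OF u t\<Psi> P])
      show "(\<integral>\<^sup>+z. ennreal ((1 + 2 ^ base_level 0 * norm z) powr l * norm (inverse_fourier \<Psi>h z)) \<partial>lborel) \<le> ennreal E"
        unfolding b0 by (rule E(1))
      show "\<bar>\<xi> $ i\<bar> \<le> 64 * 2 ^ base_level 0" if "\<Psi>h \<xi> \<noteq> 0" for \<xi> i
      proof -
        have "\<not> 1/4 < \<bar>\<xi> $ i\<bar>" using coarse_generator_test_function(2)[OF cg] that by blast
        then show ?thesis unfolding b0 by linarith
      qed
    qed (use E in simp_all)
    also have "\<dots> = E * (B * (2 ^ n) powr l * (\<Sum>\<kappa>\<in>window n 0. P \<kappa>))" by (rule fold)
    also have "\<dots> \<le> max A E * (B * (2 ^ n) powr l * (\<Sum>\<kappa>\<in>window n 0. P \<kappa>))"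
      using B(1) P0 by (intro mult_right_mono mult_nonneg_nonneg sum_nonneg) auto
    finally show "norm (conv (inverse_fourier \<Psi>h) u x) \<le> C * (\<Sum>\<kappa>\<in>window (7 + CARD('d)) 0. P \<kappa>)"
      unfolding C_def n_def[symmetric] by (simp only: mult_ac)
  qed
qed

section \<open>The discrete and integral quasi-norms\<close>

lemma epowr_ennreal: "0 \<le> x \<Longrightarrow> epowr (ennreal x) a = ennreal (x powr a)"
  by (simp add: epowr_def)

lemma epowr_top [simp]: "epowr top a = top"
  by (simp add: epowr_def)

lemma epowr_one [simp]: "epowr x 1 = x"
  by (cases x) (simp_all add: epowr_ennreal)

lemma epowr_less_top: "x < top \<Longrightarrow> epowr x a < top"
  by (auto simp: epowr_def)

lemma epowr_mono:
  assumes "x \<le> y" "0 \<le> a" shows "epowr x a \<le> epowr y a"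
proof (cases y)
  case (real s)
  then obtain r where "x = ennreal r" "0 \<le> r" using assms(1) by (cases x) (auto simp: top_unique)
  then show ?thesis using real assms by (auto simp: epowr_ennreal intro!: ennreal_leI powr_mono2)
qed simp

lemma epowr_epowr: "epowr (epowr x a) b = epowr x (a * b)"
  by (cases x) (simp_all add: epowr_ennreal powr_powr)

text \<open>The infinite cases agree with the convention that infinity times 0 is 0, because a
  positive power of 0 is 0.\<close>

lemma epowr_mult:
  assumes "a > 0" shows "epowr (x * y) a = epowr x a * epowr y a"
proof -
  have T: "epowr (top * z) a = top * epowr z a" for z
  proof (cases z)
    case (real r)
    show ?thesis
    proof (cases "r = 0")
      case True
      have "epowr 0 a = 0" using epowr_ennreal[of 0 a] by simp
      then show ?thesis using real True by simp
    next
      case False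
      then have "top * ennreal r = top" "top * ennreal (r powr a) = top" using real by (simp_all add: ennreal_top_mult)
      then show ?thesis using real by (simp add: epowr_ennreal)
    qed
  qed simp
  show ?thesis
  proof (cases x)
    case (real r)
    note r = this
    show ?thesis
    proof (cases y)
      case (real s)
      then show ?thesis using r by (simp add: epowr_ennreal ennreal_mult[symmetric] powr_mult)
    next
      case top
      then show ?thesis using assms T[of x] by (simp add: mult.commute)
    qed
  next
    case top
    then show ?thesis using T[of y] by simp
  qed
qed

lemma Lp_norm_powr: "p > 0 \<Longrightarrow> epowr (Lp_norm p F) p = (\<integral>\<^sup>+x. epowr (F x) p \<partial>lborel)"
  by (simp add: Lp_norm_def epowr_epowr)

text \<open>Estimates are made on integrals of p-th powers, which add up for every positive
  \<open>p\<close>; the triangle inequality, which fails for small \<open>p\<close>, is thereby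
  avoided. This returns to the quasi-norm at the end.\<close>

lemma Lp_norm_le:
  assumes p: "p > 0" and "(\<integral>\<^sup>+x. epowr (F x) p \<partial>lborel) \<le> K * epowr N p"
  shows "Lp_norm p F \<le> epowr K (1 / p) * N"
proof -
  have "Lp_norm p F \<le> epowr (K * epowr N p) (1 / p)"
    unfolding Lp_norm_def by (rule epowr_mono[OF assms(2)]) (use p in simp)
  also have "\<dots> = epowr K (1 / p) * N" using p by (simp add: epowr_mult epowr_epowr)
  finally show ?thesis .
qed

lemma epowr_le_cancel:
  assumes "epowr a p \<le> epowr b p" "p > 0" shows "a \<le> b"
  using epowr_mono[OF assms(1), of "1 / p"] assms(2) by (simp add: epowr_epowr)

lemma lq_component_le:
  assumes i: "i \<in> I" and q: "q > 0" shows "a i \<le> lq_norm q I a"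
proof (cases "q = \<infinity>")
  case True
  then show ?thesis using i by (simp add: lq_norm_def SUP_upper)
next
  case False
  define r where "r = enn2real q"
  have r: "r > 0" using q False by (simp add: r_def enn2real_positive_iff less_top)
  have "epowr (a i) r = (\<Sum>i\<in>{i}. epowr (a i) r)" by simp
  also have "\<dots> \<le> (SUP F\<in>{F. finite F \<and> F \<subseteq> I}. \<Sum>i\<in>F. epowr (a i) r)"
    by (rule SUP_upper) (use i in simp)
  also have "\<dots> = infsum (\<lambda>i. epowr (a i) r) I" by (rule nonneg_infsum_complete[symmetric]) simp
  finally have "epowr (epowr (a i) r) (1 / r) \<le> epowr (infsum (\<lambda>i. epowr (a i) r) I) (1 / r)"
    by (rule epowr_mono) (use r in simp)
  then show ?thesis using r False by (simp add: epowr_epowr lq_norm_def r_def)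
qed

text \<open>Homogeneity for a factor common to all indices. In the application \<open>c\<close>
  carries the decay in the scale, and \<open>z\<close> carries the whole dependence on the
  point.\<close>

lemma lq_norm_mult_le:
  assumes q: "q > 0" and a: "\<And>i. i \<in> I \<Longrightarrow> a i \<le> c i * z"
  shows "lq_norm q I a \<le> lq_norm q I c * z"
proof (cases "q = \<infinity>")
  case True
  have "(SUP i\<in>I. a i) \<le> (SUP i\<in>I. c i * z)" by (rule SUP_mono) (use a in auto)
  also have "\<dots> = (SUP i\<in>I. c i) * z" by (rule SUP_mult_right_ennreal[symmetric])
  finally show ?thesis using True by (simp add: lq_norm_def)
next
  case False
  define r where "r = enn2real q"
  have r: "r > 0" using q False by (simp add: r_def enn2real_positive_iff less_top)
  have S: "infsum (\<lambda>i. epowr (a i) r) I = (SUP F\<in>{F. finite F \<and> F \<subseteq> I}. \<Sum>i\<in>F. epowr (a i) r)" for a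
    by (rule nonneg_infsum_complete) simp
  have "infsum (\<lambda>i. epowr (a i) r) I \<le> infsum (\<lambda>i. epowr (c i) r) I * epowr z r"
    unfolding S SUP_mult_right_ennreal
  proof (rule SUP_mono)
    fix F assume F: "F \<in> {F. finite F \<and> F \<subseteq> I}"
    have "(\<Sum>i\<in>F. epowr (a i) r) \<le> (\<Sum>i\<in>F. epowr (c i * z) r)"
      by (intro sum_mono epowr_mono a) (use F r in auto)
    also have "\<dots> = (\<Sum>i\<in>F. epowr (c i) r) * epowr z r" using r by (simp add: epowr_mult sum_distrib_right)
    finally show "\<exists>m\<in>{F. finite F \<and> F \<subseteq> I}. (\<Sum>i\<in>F. epowr (a i) r) \<le> (\<Sum>i\<in>m. epowr (c i) r) * epowr z r"
      using F by blast
  qed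
  then have "epowr (infsum (\<lambda>i. epowr (a i) r) I) (1 / r) \<le> epowr (infsum (\<lambda>i. epowr (c i) r) I * epowr z r) (1 / r)"
    by (rule epowr_mono) (use r in simp)
  also have "\<dots> = epowr (infsum (\<lambda>i. epowr (c i) r) I) (1 / r) * z" using r by (simp add: epowr_mult epowr_epowr)
  finally show ?thesis using False by (simp add: lq_norm_def r_def)
qed

text \<open>A shear parameter is determined by its entries off position \<dd>, each taking
  \<open>2 * 2 ^ j + 1\<close> values, which is at most \<open>3 * 2 ^ j\<close>.\<close>

lemma card_shears:
  fixes \<dd> :: "'d::finite" and j :: nat
  defines "S \<equiv> {l::int^'d. l $ \<dd> = 0 \<and> (\<forall>i. \<bar>l $ i\<bar> \<le> 2 ^ j)}"
  shows "finite S" "real (card S) \<le> (3 * 2 ^ j) ^ (CARD('d) - 1)"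
proof -
  let ?f = "\<lambda>l::int^'d. restrict (($) l) (UNIV - {\<dd>})"
  let ?P = "PiE (UNIV - {\<dd>}) (\<lambda>_. {- (2 ^ j)..2 ^ j :: int})"
  have inj: "inj_on ?f S"
  proof (rule inj_onI)
    fix k l assume kl: "k \<in> S" "l \<in> S" and eq: "?f k = ?f l"
    show "k = l" unfolding vec_eq_iff
    proof
      fix i show "k $ i = l $ i"
        using kl fun_cong[OF eq, of i] by (cases "i = \<dd>") (simp_all add: S_def)
    qed
  qed
  have "- (2 ^ j) \<le> l $ i \<and> l $ i \<le> 2 ^ j" if "l \<in> S" for l i
  proof -
    have "\<bar>l $ i\<bar> \<le> 2 ^ j" using that by (simp add: S_def)
    then show ?thesis by linarith
  qed
  then have sub: "?f ` S \<subseteq> ?P" by (intro image_subsetI restrict_PiE_iff[THEN iffD2] ballI) simp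
  have P: "finite ?P" by (intro finite_PiE) auto
  show "finite S" using finite_imageD[OF finite_subset[OF sub P] inj] .
  have c: "card {- (2 ^ j)..2 ^ j :: int} = 2 * 2 ^ j + 1" by (simp add: nat_add_distrib nat_power_eq nat_mult_distrib)
  have "real (card S) \<le> real (card ?P)" using card_inj_on_le[OF inj sub P] by simp
  also have "\<dots> = (2 * 2 ^ j + 1) ^ (CARD('d) - 1)" by (simp add: card_PiE c card_Diff_singleton)
  also have "\<dots> \<le> (3 * 2 ^ j) ^ (CARD('d) - 1)" by (rule power_mono) simp_all
  finally show "real (card S) \<le> (3 * 2 ^ j) ^ (CARD('d) - 1)" .
qed

text \<open>For finite \<open>q\<close> the q-th power of the weight contains the factor
  \<open>2 powr (- j * (d - 1))\<close>, which cancels the number of shears at scale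
  \<open>j\<close>; the rest is geometric because of \<delta>. For infinite \<open>q\<close> the
  reciprocal is 0 and the weights are at most 1.\<close>

lemma lq_norm_shear_weight:
  assumes q: "q > 0" and \<delta>: "\<delta> > 0"
  shows "lq_norm q (shear_index :: ('d::finite \<times> nat \<times> (int^'d)) set)
    (\<lambda>(\<dd>, j, l). ennreal (2 powr (- real j * ((real CARD('d) - 1) * enn2real (1 / q) + \<delta>)))) < top"
proof (cases "q = \<infinity>")
  case True
  have "2 powr (- real j * ((real CARD('d) - 1) * enn2real (1 / q) + \<delta>)) \<le> 1" for j
    using powr_mono[of "- real j * ((real CARD('d) - 1) * enn2real (1 / q) + \<delta>)" 0 2] \<delta> True by simp
  then have "lq_norm q (shear_index :: ('d \<times> nat \<times> (int^'d)) set)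
    (\<lambda>(\<dd>, j, l). ennreal (2 powr (- real j * ((real CARD('d) - 1) * enn2real (1 / q) + \<delta>)))) \<le> 1"
    unfolding lq_norm_def using True by (auto intro!: SUP_least)
  then show ?thesis by (rule order.strict_trans1) simp
next
  case False
  define r where "r = enn2real q"
  have r: "r > 0" using q False by (simp add: r_def enn2real_positive_iff less_top)
  have "q = ennreal r" using False by (simp add: r_def less_top)
  then have rq: "enn2real (1 / q) = 1 / r" using r by (simp add: divide_ennreal flip: ennreal_1)
  define w where "w j = 2 powr (- real j * ((real CARD('d) - 1) + \<delta> * r))" for j
  define \<rho> where "\<rho> = 2 powr (- \<delta> * r)"
  have \<rho>: "0 < \<rho>" "\<rho> < 1" using r \<delta> powr_less_mono[of "- \<delta> * r" 0 2] by (simp_all add: \<rho>_def)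
  define S where "S \<dd> j = {l::int^'d. l $ \<dd> = 0 \<and> (\<forall>i. \<bar>l $ i\<bar> \<le> 2 ^ j)}" for \<dd> j
  define M where "M = real CARD('d) * (3 ^ (CARD('d) - 1) * (\<Sum>j. \<rho> ^ j))"
  have w: "epowr (ennreal (2 powr (- real j * ((real CARD('d) - 1) * enn2real (1 / q) + \<delta>)))) r = ennreal (w j)" for j
  proof -
    have "- real j * ((real CARD('d) - 1) * (1 / r) + \<delta>) * r = - real j * ((real CARD('d) - 1) + \<delta> * r)"
      using r by (simp add: field_simps)
    then show ?thesis by (simp only: rq epowr_ennreal[OF powr_ge_zero] powr_powr w_def)
  qed
  have w0: "0 \<le> w j" for j by (simp add: w_def)
  have cw: "real (card (S \<dd> j)) * w j \<le> 3 ^ (CARD('d) - 1) * \<rho> ^ j" for \<dd> j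
  proof -
    have c1: "real (CARD('d) - 1) = real CARD('d) - 1" by (simp add: of_nat_diff Suc_leI)
    have "real (card (S \<dd> j)) * w j \<le> (3 * 2 ^ j) ^ (CARD('d) - 1) * w j"
      unfolding S_def by (rule mult_right_mono[OF card_shears(2) w0])
    also have "\<dots> = 3 ^ (CARD('d) - 1) * ((2 ^ j) ^ (CARD('d) - 1) * w j)" by (simp only: power_mult_distrib mult.assoc)
    also have "((2::real) ^ j) ^ (CARD('d) - 1) = 2 powr (real j * (real CARD('d) - 1))"
      by (simp only: c1[symmetric] of_nat_mult[symmetric] power_mult[symmetric]) (rule powr_realpow[symmetric], simp)
    also have "\<dots> * w j = 2 powr (real j * (- \<delta> * r))"
      by (simp add: w_def powr_add[symmetric] algebra_simps)
    also have "\<dots> = \<rho> ^ j" by (simp add: \<rho>_def powr_realpow[symmetric] powr_powr mult.commute)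
    finally show ?thesis .
  qed
  have M: "(\<Sum>i\<in>F. ennreal (w (fst (snd i)))) \<le> ennreal M" if F: "finite F" "F \<subseteq> shear_index" for F :: "('d \<times> nat \<times> (int^'d)) set"
  proof -
    \<comment> \<open>A finite set of indices reaches only finitely many scales, so it lies in a
      block that can be summed scale by scale.\<close>
    obtain J where J: "(\<lambda>i. fst (snd i)) ` F \<subseteq> {..J}" using finite_nat_iff_bounded_le[of "(\<lambda>i. fst (snd i)) ` F"] F(1) by blast
    let ?G = "SIGMA \<dd>:UNIV. SIGMA j:{..J}. S \<dd> j"
    have fS: "finite (S \<dd> j)" for \<dd> j unfolding S_def by (rule card_shears(1))
    have "F \<subseteq> ?G" using F(2) J by (auto simp: shear_index_def S_def)
    then have "(\<Sum>i\<in>F. w (fst (snd i))) \<le> (\<Sum>i\<in>?G. w (fst (snd i)))"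
      by (intro sum_mono2 finite_SigmaI finite fS w0) auto
    also have "\<dots> = (\<Sum>\<dd>\<in>UNIV. \<Sum>i\<in>(SIGMA j:{..J}. S \<dd> j). w (fst i))"
      by (subst sum.Sigma) (auto intro!: sum.cong simp: fS)
    also have "\<dots> = (\<Sum>\<dd>\<in>UNIV. \<Sum>j\<le>J. real (card (S \<dd> j)) * w j)"
      by (intro sum.cong refl, subst sum.Sigma[symmetric, where g="\<lambda>j l. w j", unfolded case_prod_beta]) (auto simp: fS)
    also have "\<dots> \<le> (\<Sum>\<dd>\<in>(UNIV::'d set). \<Sum>j\<le>J. 3 ^ (CARD('d) - 1) * \<rho> ^ j)" by (intro sum_mono cw)
    also have "\<dots> = real CARD('d) * (3 ^ (CARD('d) - 1) * (\<Sum>j\<le>J. \<rho> ^ j))" by (simp add: sum_distrib_left)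
    also have "\<dots> \<le> M" unfolding M_def
      using \<rho> by (intro mult_left_mono sum_le_suminf summable_geometric) auto
    finally show ?thesis by (simp add: sum_ennreal w0 ennreal_leI)
  qed
  have "infsum (\<lambda>i. ennreal (w (fst (snd i)))) (shear_index :: ('d \<times> nat \<times> (int^'d)) set) \<le> ennreal M"
    unfolding nonneg_infsum_complete[of _ "\<lambda>i. ennreal (w (fst (snd i)))", OF zero_le] by (rule SUP_least) (use M in blast)
  also have "\<dots> < top" by simp
  finally have "epowr (infsum (\<lambda>i. ennreal (w (fst (snd i)))) (shear_index :: ('d \<times> nat \<times> (int^'d)) set)) (1 / r) < top"
    by (rule epowr_less_top)
  then show ?thesis using False by (simp only: lq_norm_def r_def[symmetric] case_prod_beta w if_False)
qed

section \<open>The embedding\<close>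

text \<open>Comparing all terms with the largest one works for every positive exponent, below and
  above 1 alike.\<close>

lemma powr_sum_le:
  assumes "finite K" "p > 0" "\<And>k. k \<in> K \<Longrightarrow> 0 \<le> a k"
  shows "(\<Sum>k\<in>K. a k) powr p \<le> real (card K) powr p * (\<Sum>k\<in>K. a k powr p)"
proof (cases "K = {}")
  case False
  define M where "M = Max (a ` K)"
  have "M \<in> a ` K" unfolding M_def using assms(1) False by (intro Max_in) auto
  then obtain m where m: "m \<in> K" "a m = M" by auto
  have "(\<Sum>k\<in>K. a k) \<le> (\<Sum>k\<in>K. M)" by (intro sum_mono) (simp add: M_def assms(1))
  then have "(\<Sum>k\<in>K. a k) powr p \<le> (real (card K) * M) powr p"
    using assms by (intro powr_mono2 sum_nonneg) auto
  also have "\<dots> = real (card K) powr p * a m powr p" by (simp add: powr_mult m)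
  also have "\<dots> \<le> real (card K) powr p * (\<Sum>k\<in>K. a k powr p)"
    by (intro mult_left_mono member_le_sum m assms(1)) auto
  finally show ?thesis .
qed simp

text \<open>The transforms of both generators vanish outside the ball of radius 2, so one kernel
  \<eta> reproduces both, and its dilates reproduce the dilates of \<phi>. With a single \<eta> the
  Peetre constant is the same for all bands.\<close>

lemma band_reproducing:
  fixes \<phi> :: "real^'d \<Rightarrow> complex"
  assumes dp: "dyadic_pair \<Phi> \<phi>" and \<beta>: "cube_bump (\<beta> :: real^'d \<Rightarrow> complex)"
  obtains \<eta> :: "real^'d \<Rightarrow> complex" where "rapid \<eta>"
    "\<And>u \<kappa> x. u \<in> tempered_distributions \<Longrightarrow> conv (band \<Phi> \<phi> \<kappa>) u x =
      (LINT z|lborel. complex_of_real (band_scale \<kappa> ^ DIM(real^'d)) * \<eta> (band_scale \<kappa> *\<^sub>R z) * conv (band \<Phi> \<phi> \<kappa>) u (x - z))"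
proof -
  obtain \<eta> :: "real^'d \<Rightarrow> complex" where \<eta>: "rapid \<eta>"
    "\<And>g. rapid g \<Longrightarrow> (\<And>\<xi>. 2 < norm \<xi> \<Longrightarrow> fourier g \<xi> = 0) \<Longrightarrow> cvl \<eta> g = g"
    using band_limited_reproducing[OF \<beta>] by blast
  note D = dyadic_pairD[OF dp]
  have \<Phi>: "cvl \<eta> \<Phi> = \<Phi>" by (rule \<eta>(2)[OF schwartz_rapid[OF D(1)] D(3)])
  have \<phi>: "cvl \<eta> \<phi> = \<phi>" by (rule \<eta>(2)[OF schwartz_rapid[OF D(2)] D(4)])
  show ?thesis
  proof (rule that[OF \<eta>(1)])
    fix u :: "(real^'d \<Rightarrow> complex) \<Rightarrow> complex" and \<kappa> x assume u: "u \<in> tempered_distributions"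
    show "conv (band \<Phi> \<phi> \<kappa>) u x =
      (LINT z|lborel. complex_of_real (band_scale \<kappa> ^ DIM(real^'d)) * \<eta> (band_scale \<kappa> *\<^sub>R z) * conv (band \<Phi> \<phi> \<kappa>) u (x - z))"
    proof (cases \<kappa>)
      case None
      show ?thesis using conv_cvl[OF u \<eta>(1) D(1), of x] unfolding \<Phi> None by (simp add: band_def band_scale_def)
    next
      case (Some \<nu>)
      have dil: "dyadic_dilate \<nu> \<eta> z = complex_of_real (band_scale (Some \<nu>) ^ DIM(real^'d)) * \<eta> (band_scale (Some \<nu>) *\<^sub>R z)" for z
        by (simp add: dyadic_dilate_def band_scale_def power_mult_swap[of 2 \<nu> "CARD('d)"])
      have "dyadic_dilate \<nu> \<phi> = cvl (dyadic_dilate \<nu> \<eta>) (dyadic_dilate \<nu> \<phi>)"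
        using dyadic_dilate_cvl[OF rapid_measurable[OF \<eta>(1)] rapid_measurable[OF schwartz_rapid[OF D(2)]], of \<nu>] unfolding \<phi> .
      then have "conv (dyadic_dilate \<nu> \<phi>) u x = conv (cvl (dyadic_dilate \<nu> \<eta>) (dyadic_dilate \<nu> \<phi>)) u x" by (rule arg_cong)
      also have "\<dots> = (LINT z|lborel. dyadic_dilate \<nu> \<eta> z * conv (dyadic_dilate \<nu> \<phi>) u (x - z))"
        by (rule conv_cvl[OF u dyadic_dilate_rapid[OF \<eta>(1)] dyadic_dilate_schwartz[OF D(2)]])
      finally show ?thesis unfolding Some band_def option.case dil .
    qed
  qed
qed

text \<open>The right side of the Peetre inequality at the scale of the band: an average whose
  kernel has an integral independent of the band.\<close>

definition band_average ::
  "(real^'d \<Rightarrow> complex) \<Rightarrow> (real^'d \<Rightarrow> complex) \<Rightarrow> real \<Rightarrow> real \<Rightarrow> ((real^'d \<Rightarrow> complex) \<Rightarrow> complex) \<Rightarrow> nat option \<Rightarrow> real^'d \<Rightarrow> ennreal" where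
  "band_average \<Phi> \<phi> l p u \<kappa> x =
    (\<integral>\<^sup>+y. ennreal (band_scale \<kappa> ^ DIM(real^'d) * (1 + band_scale \<kappa> * norm (x - y)) powr - (l * p) *
      norm (conv (band \<Phi> \<phi> \<kappa>) u y) powr p) \<partial>lborel)"

lemma band_scale_pos: "0 < band_scale \<kappa>" by (cases \<kappa>) (simp_all add: band_scale_def)

lemma conv_band_measurable:
  assumes "dyadic_pair \<Phi> \<phi>" "u \<in> tempered_distributions"
  shows "conv (band \<Phi> \<phi> \<kappa>) u \<in> borel_measurable borel"
  by (rule borel_measurable_continuous_onI[OF conv_continuous[OF assms(2) band_schwartz[OF assms(1)]]])

text \<open>The weight is at most 1. Finiteness is what allows the passage to
  \<open>enn2real\<close>, in which the majorants \<open>P\<close> of \<open>window_bound\<close>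
  are expressed.\<close>

lemma band_average_finite:
  assumes i: "integrable lborel (\<lambda>x. norm (conv (band \<Phi> \<phi> \<kappa>) u x) powr p)" and lp: "0 \<le> l * p"
  shows "band_average \<Phi> \<phi> l p u \<kappa> (x :: real^'d) < top"
proof -
  have "band_average \<Phi> \<phi> l p u \<kappa> x \<le> (\<integral>\<^sup>+y. ennreal (norm (band_scale \<kappa> ^ DIM(real^'d) * norm (conv (band \<Phi> \<phi> \<kappa>) u y) powr p)) \<partial>lborel)"
    unfolding band_average_def
  proof (rule nn_integral_mono)
    fix y :: "real^'d"
    have b: "0 \<le> band_scale \<kappa> * norm (x - y)" using band_scale_pos[of \<kappa>] by simp
    have "(1 + band_scale \<kappa> * norm (x - y)) powr - (l * p) \<le> (1 + band_scale \<kappa> * norm (x - y)) powr 0"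
      using b lp by (intro powr_mono) auto
    also have "\<dots> = 1" using b by simp
    finally have "band_scale \<kappa> ^ DIM(real^'d) * (1 + band_scale \<kappa> * norm (x - y)) powr - (l * p) * norm (conv (band \<Phi> \<phi> \<kappa>) u y) powr p \<le>
       band_scale \<kappa> ^ DIM(real^'d) * 1 * norm (conv (band \<Phi> \<phi> \<kappa>) u y) powr p"
      using band_scale_pos[of \<kappa>] by (intro mult_right_mono mult_left_mono) auto
    then show "ennreal (band_scale \<kappa> ^ DIM(real^'d) * (1 + band_scale \<kappa> * norm (x - y)) powr - (l * p) * norm (conv (band \<Phi> \<phi> \<kappa>) u y) powr p) \<le>
        ennreal (norm (band_scale \<kappa> ^ DIM(real^'d) * norm (conv (band \<Phi> \<phi> \<kappa>) u y) powr p))"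
      using band_scale_pos[of \<kappa>] by (intro ennreal_leI) simp
  qed
  also have "\<dots> < top"
    using integrable_mult_right[OF i, of "band_scale \<kappa> ^ DIM(real^'d)"] unfolding integrable_iff_bounded by simp
  finally show ?thesis .
qed

lemma band_bound:
  fixes \<phi> :: "real^'d \<Rightarrow> complex"
  assumes dp: "dyadic_pair \<Phi> \<phi>" and \<beta>: "cube_bump (\<beta> :: real^'d \<Rightarrow> complex)" and p: "p > 0" and l: "l > 0"
  obtains C where "C > 0"
    "\<And>u \<kappa> x z. u \<in> tempered_distributions \<Longrightarrow> integrable lborel (\<lambda>x. norm (conv (band \<Phi> \<phi> \<kappa>) u x) powr p) \<Longrightarrow>
      norm (conv (band \<Phi> \<phi> \<kappa>) u (x - z)) \<le> (C * enn2real (band_average \<Phi> \<phi> l p u \<kappa> x)) powr (1 / p) * (1 + band_scale \<kappa> * norm z) powr l"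
proof -
  obtain \<eta> :: "real^'d \<Rightarrow> complex" where \<eta>: "rapid \<eta>" "\<And>u \<kappa> x. u \<in> tempered_distributions \<Longrightarrow> conv (band \<Phi> \<phi> \<kappa>) u x =
      (LINT z|lborel. complex_of_real (band_scale \<kappa> ^ DIM(real^'d)) * \<eta> (band_scale \<kappa> *\<^sub>R z) * conv (band \<Phi> \<phi> \<kappa>) u (x - z))"
    by (rule band_reproducing[OF dp \<beta>]) blast
  obtain C where C: "C > 0" and pe: "\<And>g K m s x y. s > 0 \<Longrightarrow> continuous_on UNIV g \<Longrightarrow> (\<And>z. norm (g z) \<le> K * (1 + norm z) ^ m) \<Longrightarrow>
      (\<And>x. g x = (LINT z|lborel. complex_of_real (s ^ DIM(real^'d)) * \<eta> (s *\<^sub>R z) * g (x - z))) \<Longrightarrow>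
      integrable lborel (\<lambda>u. norm (g u) powr p) \<Longrightarrow>
      ennreal (norm (g (x - y)) powr p) \<le> ennreal (C * (1 + s * norm y) powr (l * p)) *
        (\<integral>\<^sup>+u. ennreal (s ^ DIM(real^'d) * (1 + s * norm (x - u)) powr - (l * p) * norm (g u) powr p) \<partial>lborel)"
    by (rule peetre[OF \<eta>(1) p l]) blast
  show ?thesis
  proof (rule that[OF C])
    fix u :: "(real^'d \<Rightarrow> complex) \<Rightarrow> complex" and \<kappa> and x z :: "real^'d"
    assume u: "u \<in> tempered_distributions" and i: "integrable lborel (\<lambda>x. norm (conv (band \<Phi> \<phi> \<kappa>) u x) powr p)"
    let ?I = "band_average \<Phi> \<phi> l p u \<kappa> x" and ?w = "1 + band_scale \<kappa> * norm z"
    have w: "0 \<le> ?w" using band_scale_pos[of \<kappa>] by (intro add_nonneg_nonneg mult_nonneg_nonneg) auto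
    have I: "?I = ennreal (enn2real ?I)" using band_average_finite[OF i] p l by simp
    obtain K m where K: "\<And>x. norm (conv (band \<Phi> \<phi> \<kappa>) u x) \<le> K * (1 + norm x) ^ m"
      by (rule conv_growth[OF u band_schwartz[OF dp]]) blast
    have "ennreal (norm (conv (band \<Phi> \<phi> \<kappa>) u (x - z)) powr p) \<le> ennreal (C * ?w powr (l * p)) * ?I"
      unfolding band_average_def
      by (rule pe[OF band_scale_pos conv_continuous[OF u band_schwartz[OF dp]] K \<eta>(2)[OF u] i])
    also have "\<dots> = ennreal (C * ?w powr (l * p) * enn2real ?I)" using C by (subst I) (simp add: ennreal_mult)
    finally have "norm (conv (band \<Phi> \<phi> \<kappa>) u (x - z)) powr p \<le> C * ?w powr (l * p) * enn2real ?I"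
      using C by (subst (asm) ennreal_le_iff) auto
    then have "(norm (conv (band \<Phi> \<phi> \<kappa>) u (x - z)) powr p) powr (1 / p) \<le> (C * ?w powr (l * p) * enn2real ?I) powr (1 / p)"
      using p by (intro powr_mono2) auto
    also have "(norm (conv (band \<Phi> \<phi> \<kappa>) u (x - z)) powr p) powr (1 / p) = norm (conv (band \<Phi> \<phi> \<kappa>) u (x - z))"
      using p by (simp add: powr_powr)
    also have "C * ?w powr (l * p) * enn2real ?I = (C * enn2real ?I) * ?w powr (l * p)" by (simp only: mult_ac)
    also have "\<dots> powr (1 / p) = (C * enn2real ?I) powr (1 / p) * ?w powr l"
      using p by (simp only: powr_mult powr_powr) simp
    finally show "norm (conv (band \<Phi> \<phi> \<kappa>) u (x - z)) \<le> (C * enn2real ?I) powr (1 / p) * ?w powr l" .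
  qed
qed

lemma sum_band_bound:
  assumes i: "\<And>\<kappa>. integrable lborel (\<lambda>x. norm (conv (band \<Phi> \<phi> \<kappa>) u x) powr p)" and p: "p > 0" and l: "l > 0" and C: "C > 0" and a: "a > 0"
    and t: "t \<ge> 0" "t \<le> a * (\<Sum>\<kappa>\<in>window n j. (C * enn2real (band_average \<Phi> \<phi> l p u \<kappa> (x::real^'d))) powr (1 / p))"
  shows "ennreal (t powr p) \<le> ennreal ((real n + 2) powr p * C * a powr p) * (\<Sum>\<kappa>\<in>window n j. band_average \<Phi> \<phi> l p u \<kappa> x)"
proof -
  let ?I = "\<lambda>\<kappa>. enn2real (band_average \<Phi> \<phi> l p u \<kappa> x)"
  have "t powr p \<le> (a * (\<Sum>\<kappa>\<in>window n j. (C * ?I \<kappa>) powr (1 / p))) powr p"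
    using t p by (intro powr_mono2) auto
  also have "\<dots> = a powr p * (\<Sum>\<kappa>\<in>window n j. (C * ?I \<kappa>) powr (1 / p)) powr p" by (rule powr_mult)
  also have "\<dots> \<le> a powr p * (real (card (window n j)) powr p * (\<Sum>\<kappa>\<in>window n j. ((C * ?I \<kappa>) powr (1 / p)) powr p))"
    by (intro mult_left_mono powr_sum_le p) auto
  also have "(\<Sum>\<kappa>\<in>window n j. ((C * ?I \<kappa>) powr (1 / p)) powr p) = C * (\<Sum>\<kappa>\<in>window n j. ?I \<kappa>)"
    using p C by (simp add: powr_powr sum_distrib_left)
  \<comment> \<open>The cardinality of the window is at most \<open>n + 2\<close>, whatever the
    scale.\<close>
  also have "a powr p * (real (card (window n j)) powr p * (C * (\<Sum>\<kappa>\<in>window n j. ?I \<kappa>))) \<le>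
    a powr p * ((real n + 2) powr p * (C * (\<Sum>\<kappa>\<in>window n j. ?I \<kappa>)))"
    using C p card_window[of n j] by (intro mult_left_mono mult_right_mono powr_mono2 mult_nonneg_nonneg sum_nonneg) auto
  finally have "ennreal (t powr p) \<le> ennreal ((real n + 2) powr p * C * a powr p * (\<Sum>\<kappa>\<in>window n j. ?I \<kappa>))"
    by (intro ennreal_leI) (simp only: mult_ac)
  also have "\<dots> = ennreal ((real n + 2) powr p * C * a powr p) * ennreal (\<Sum>\<kappa>\<in>window n j. ?I \<kappa>)"
    using C by (intro ennreal_mult) (auto intro!: sum_nonneg)
  also have "ennreal (\<Sum>\<kappa>\<in>window n j. ?I \<kappa>) = (\<Sum>\<kappa>\<in>window n j. ennreal (?I \<kappa>))" by (rule sum_ennreal[symmetric]) simp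
  also have "\<dots> = (\<Sum>\<kappa>\<in>window n j. band_average \<Phi> \<phi> l p u \<kappa> x)"
    using band_average_finite[OF i] p l by (intro sum.cong) auto
  finally show ?thesis .
qed

lemma shear_pointwise:
  fixes \<phi> :: "real^'d \<Rightarrow> complex"
  assumes dp: "dyadic_pair \<Phi> \<phi>" and sg: "shearlet_generators \<psi>1h \<psi>2h" and cg: "coarse_generator \<psi>1h \<psi>2h \<Psi>h"
    and p: "p > 0" and l: "l > 0"
  obtains D where "D > 0"
    "\<And>u x \<dd> j L. u \<in> tempered_distributions \<Longrightarrow> (\<And>\<kappa>. integrable lborel (\<lambda>x. norm (conv (band \<Phi> \<phi> \<kappa>) u x) powr p)) \<Longrightarrow>
      (\<dd>, j, L) \<in> shear_index \<Longrightarrow>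
      ennreal (norm (conv (shear_kernel \<psi>1h \<psi>2h \<dd> j L) u x) powr p) \<le>
        ennreal (D * 2 powr (real j * l * p)) * (\<Sum>\<kappa>\<in>window (7 + CARD('d)) j. band_average \<Phi> \<phi> l p u \<kappa> x)"
    "\<And>u x. u \<in> tempered_distributions \<Longrightarrow> (\<And>\<kappa>. integrable lborel (\<lambda>x. norm (conv (band \<Phi> \<phi> \<kappa>) u x) powr p)) \<Longrightarrow>
      ennreal (norm (conv (inverse_fourier \<Psi>h) u x) powr p) \<le>
        ennreal D * (\<Sum>\<kappa>\<in>window (7 + CARD('d)) 0. band_average \<Phi> \<phi> l p u \<kappa> x)"
proof -
  obtain \<beta> :: "real^'d \<Rightarrow> complex" where \<beta>: "cube_bump \<beta>" using coarse_generator_cube_bump[OF cg] by blast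
  obtain C where C: "C > 0" and bb: "\<And>u \<kappa> x z. u \<in> tempered_distributions \<Longrightarrow> integrable lborel (\<lambda>x. norm (conv (band \<Phi> \<phi> \<kappa>) u x) powr p) \<Longrightarrow>
      norm (conv (band \<Phi> \<phi> \<kappa>) u (x - z)) \<le> (C * enn2real (band_average \<Phi> \<phi> l p u \<kappa> x)) powr (1 / p) * (1 + band_scale \<kappa> * norm z) powr l"
    by (rule band_bound[OF dp \<beta> p l]) blast
  have l0: "l \<ge> 0" using l by simp
  obtain A where A: "A > 0" and w1: "\<And>u x P \<dd> j L. u \<in> tempered_distributions \<Longrightarrow> (\<dd>, j, L) \<in> shear_index \<Longrightarrow>
      (\<And>\<kappa> z. norm (conv (band \<Phi> \<phi> \<kappa>) u (x - z)) \<le> P \<kappa> * (1 + band_scale \<kappa> * norm z) powr l) \<Longrightarrow>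
      norm (conv (shear_kernel \<psi>1h \<psi>2h \<dd> j L) u x) \<le> A * (2 ^ j) powr l * (\<Sum>\<kappa>\<in>window (7 + CARD('d)) j. P \<kappa>)"
    and w2: "\<And>u x P. u \<in> tempered_distributions \<Longrightarrow>
      (\<And>\<kappa> z. norm (conv (band \<Phi> \<phi> \<kappa>) u (x - z)) \<le> P \<kappa> * (1 + band_scale \<kappa> * norm z) powr l) \<Longrightarrow>
      norm (conv (inverse_fourier \<Psi>h) u x) \<le> A * (\<Sum>\<kappa>\<in>window (7 + CARD('d)) 0. P \<kappa>)"
    by (rule window_bound[OF dp sg cg l0]) blast
  define D where "D = (real (7 + CARD('d)) + 2) powr p * C * A powr p"
  have D: "D > 0" using A C unfolding D_def by (intro mult_pos_pos) auto
  show ?thesis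
  proof (rule that[OF D])
    fix u :: "(real^'d \<Rightarrow> complex) \<Rightarrow> complex" and x and \<dd> :: 'd and j L
    assume u: "u \<in> tempered_distributions" and i: "\<And>\<kappa>. integrable lborel (\<lambda>x. norm (conv (band \<Phi> \<phi> \<kappa>) u x) powr p)"
      and ix: "(\<dd>, j, L) \<in> shear_index"
    have "ennreal (norm (conv (shear_kernel \<psi>1h \<psi>2h \<dd> j L) u x) powr p) \<le>
        ennreal ((real (7 + CARD('d)) + 2) powr p * C * (A * (2 ^ j) powr l) powr p) * (\<Sum>\<kappa>\<in>window (7 + CARD('d)) j. band_average \<Phi> \<phi> l p u \<kappa> x)"
      by (rule sum_band_bound[OF i p l C _ norm_ge_zero w1[OF u ix bb[OF u i]]]) (use A in simp)
    also have "(A * (2 ^ j) powr l) powr p = A powr p * 2 powr (real j * l * p)"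
      by (simp only: powr_mult powr_powr powr_realpow[symmetric] zero_less_numeral)
    also have "(real (7 + CARD('d)) + 2) powr p * C * (A powr p * 2 powr (real j * l * p)) = D * 2 powr (real j * l * p)"
      unfolding D_def by (simp only: mult.assoc)
    finally show "ennreal (norm (conv (shear_kernel \<psi>1h \<psi>2h \<dd> j L) u x) powr p) \<le>
        ennreal (D * 2 powr (real j * l * p)) * (\<Sum>\<kappa>\<in>window (7 + CARD('d)) j. band_average \<Phi> \<phi> l p u \<kappa> x)" .
  next
    fix u :: "(real^'d \<Rightarrow> complex) \<Rightarrow> complex" and x
    assume u: "u \<in> tempered_distributions" and i: "\<And>\<kappa>. integrable lborel (\<lambda>x. norm (conv (band \<Phi> \<phi> \<kappa>) u x) powr p)"
    show "ennreal (norm (conv (inverse_fourier \<Psi>h) u x) powr p) \<le>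
        ennreal D * (\<Sum>\<kappa>\<in>window (7 + CARD('d)) 0. band_average \<Phi> \<phi> l p u \<kappa> x)"
      unfolding D_def by (rule sum_band_bound[OF i p l C A norm_ge_zero w2[OF u bb[OF u i]]])
  qed
qed

text \<open>Every band of the window at scale \<open>j\<close> has a frequency within
  \<open>n + 6\<close> octaves of \<open>2 ^ (2 * j)\<close>: the base level differs from
  \<open>2 * j\<close> by at most 6, and the low frequency function occurs only for
  \<open>j \<le> 2\<close>. The sign of \<open>a\<close> is arbitrary, whence the modulus.\<close>

lemma band_scale_window_powr:
  assumes "\<kappa> \<in> window n j"
  shows "2 powr (2 * real j * a) * band_scale \<kappa> powr - a \<le> 2 powr ((real n + 6) * \<bar>a\<bar>)"
proof -
  have b: "base_level j \<le> 2 * j" "2 * j \<le> base_level j + 6" by (simp_all add: base_level_def)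
  obtain \<nu> :: nat where \<nu>: "band_scale \<kappa> = 2 powr real \<nu>" "\<bar>2 * real j - real \<nu>\<bar> \<le> real n + 6"
  proof (cases \<kappa>)
    case None
    then have "j \<le> 2" using assms by (auto simp: window_def split: if_splits)
    then show ?thesis using None by (intro that[of 0]) (simp_all add: band_scale_def)
  next
    case (Some \<nu>)
    then have "base_level j \<le> \<nu>" "\<nu> \<le> base_level j + n" using assms by (auto simp: window_def split: if_splits)
    then have "2 * real j - real \<nu> \<le> real n + 6" "real \<nu> - 2 * real j \<le> real n + 6" using b by linarith+
    then have "\<bar>2 * real j - real \<nu>\<bar> \<le> real n + 6" by linarith
    moreover have "band_scale \<kappa> = 2 powr real \<nu>" using Some by (simp add: band_scale_def powr_realpow)
    ultimately show ?thesis by (intro that)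
  qed
  have "2 powr (2 * real j * a) * band_scale \<kappa> powr - a = 2 powr ((2 * real j - real \<nu>) * a)"
    unfolding \<nu>(1) powr_powr powr_add[symmetric] by (simp add: algebra_simps)
  also have "\<dots> \<le> 2 powr (\<bar>2 * real j - real \<nu>\<bar> * \<bar>a\<bar>)"
    by (intro powr_mono) (simp_all add: abs_mult[symmetric])
  also have "\<dots> \<le> 2 powr ((real n + 6) * \<bar>a\<bar>)" by (intro powr_mono mult_right_mono \<nu>(2)) auto
  finally show ?thesis .
qed

text \<open>A single component is bounded by the inner norm, whatever \<open>q\<close> is. The
  summation over the levels is given away here; the spare exponent \<delta> pays for it
  later.\<close>

lemma band_norm_le:
  fixes \<phi> :: "real^'d \<Rightarrow> complex"
  assumes dp: "dyadic_pair \<Phi> \<phi>" and p: "p > 0" and q: "q > 0" and u: "u \<in> tempered_distributions"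
  shows "(\<integral>\<^sup>+x. ennreal (norm (conv (band \<Phi> \<phi> \<kappa>) u x) powr p) \<partial>lborel) \<le>
    ennreal (band_scale \<kappa> powr - (\<alpha> * p)) * epowr (TL_norm \<Phi> \<phi> \<alpha> q p u) p"
proof (cases \<kappa>)
  case None
  have "(\<integral>\<^sup>+x. ennreal (norm (conv \<Phi> u x) powr p) \<partial>lborel) = epowr (Lp_norm p (\<lambda>x. ennreal (norm (conv \<Phi> u x)))) p"
    using p by (simp add: Lp_norm_powr epowr_ennreal)
  also have "\<dots> \<le> epowr (TL_norm \<Phi> \<phi> \<alpha> q p u) p"
    using p unfolding TL_norm_def by (intro epowr_mono) auto
  finally show ?thesis unfolding None by (simp add: band_def band_scale_def)
next
  case (Some \<nu>)
  let ?g = "conv (band \<Phi> \<phi> \<kappa>) u"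
  have g: "?g = conv (dyadic_dilate \<nu> \<phi>) u" unfolding Some band_def by simp
  have [measurable]: "?g \<in> borel_measurable borel" by (rule conv_band_measurable[OF dp u])
  let ?F = "\<lambda>x. lq_norm q UNIV (\<lambda>\<nu>. ennreal (2 powr (real \<nu> * \<alpha>) * norm (conv (dyadic_dilate \<nu> \<phi>) u x)))"
  have "ennreal (2 powr (real \<nu> * \<alpha> * p)) * (\<integral>\<^sup>+x. ennreal (norm (?g x) powr p) \<partial>lborel) =
      (\<integral>\<^sup>+x. ennreal (2 powr (real \<nu> * \<alpha> * p)) * ennreal (norm (?g x) powr p) \<partial>lborel)"
    by (rule nn_integral_cmult[symmetric]) measurable
  also have "\<dots> \<le> (\<integral>\<^sup>+x. epowr (?F x) p \<partial>lborel)"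
  proof (rule nn_integral_mono)
    fix x
    have "ennreal (2 powr (real \<nu> * \<alpha> * p)) * ennreal (norm (?g x) powr p) = epowr (ennreal (2 powr (real \<nu> * \<alpha>) * norm (?g x))) p"
      by (simp only: epowr_ennreal[OF mult_nonneg_nonneg[OF powr_ge_zero norm_ge_zero]] powr_mult powr_powr ennreal_mult[OF powr_ge_zero powr_ge_zero])
    also have "\<dots> \<le> epowr (?F x) p"
      unfolding g using p by (intro epowr_mono lq_component_le[where a="\<lambda>\<nu>. ennreal (2 powr (real \<nu> * \<alpha>) * norm (conv (dyadic_dilate \<nu> \<phi>) u x))"] q) auto
    finally show "ennreal (2 powr (real \<nu> * \<alpha> * p)) * ennreal (norm (?g x) powr p) \<le> epowr (?F x) p" .
  qed
  also have "\<dots> = epowr (Lp_norm p ?F) p" by (rule Lp_norm_powr[OF p, symmetric])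
  also have "\<dots> \<le> epowr (TL_norm \<Phi> \<phi> \<alpha> q p u) p"
    using p unfolding TL_norm_def by (intro epowr_mono) auto
  finally have "ennreal (2 powr - (real \<nu> * \<alpha> * p)) * (ennreal (2 powr (real \<nu> * \<alpha> * p)) * (\<integral>\<^sup>+x. ennreal (norm (?g x) powr p) \<partial>lborel)) \<le>
    ennreal (2 powr - (real \<nu> * \<alpha> * p)) * epowr (TL_norm \<Phi> \<phi> \<alpha> q p u) p"
    by (rule mult_left_mono) simp
  also have "ennreal (2 powr - (real \<nu> * \<alpha> * p)) * (ennreal (2 powr (real \<nu> * \<alpha> * p)) * (\<integral>\<^sup>+x. ennreal (norm (?g x) powr p) \<partial>lborel)) =
      ennreal (2 powr - (real \<nu> * \<alpha> * p) * 2 powr (real \<nu> * \<alpha> * p)) * (\<integral>\<^sup>+x. ennreal (norm (?g x) powr p) \<partial>lborel)"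
    by (simp add: ennreal_mult mult.assoc)
  also have "2 powr - (real \<nu> * \<alpha> * p) * 2 powr (real \<nu> * \<alpha> * p) = 1" by (simp add: powr_add[symmetric])
  also have "2 powr - (real \<nu> * \<alpha> * p) = band_scale \<kappa> powr - (\<alpha> * p)"
    unfolding Some band_scale_def option.case powr_realpow[OF zero_less_numeral, symmetric] powr_powr by (simp add: mult.assoc)
  finally show ?thesis by simp
qed

lemma band_integrable:
  fixes \<phi> :: "real^'d \<Rightarrow> complex"
  assumes dp: "dyadic_pair \<Phi> \<phi>" and p: "p > 0" and q: "q > 0" and u: "u \<in> TL_space \<Phi> \<phi> \<alpha> q p"
  shows "integrable lborel (\<lambda>x. norm (conv (band \<Phi> \<phi> \<kappa>) u x) powr p)"
proof (rule integrableI_nonneg)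
  have ut: "u \<in> tempered_distributions" and N: "TL_norm \<Phi> \<phi> \<alpha> q p u < top" using u by (simp_all add: TL_space_def)
  have [measurable]: "conv (band \<Phi> \<phi> \<kappa>) u \<in> borel_measurable borel" by (rule conv_band_measurable[OF dp ut])
  show "(\<lambda>x. norm (conv (band \<Phi> \<phi> \<kappa>) u x) powr p) \<in> borel_measurable lborel" by measurable
  have "(\<integral>\<^sup>+x. ennreal (norm (conv (band \<Phi> \<phi> \<kappa>) u x) powr p) \<partial>lborel) \<le>
    ennreal (band_scale \<kappa> powr - (\<alpha> * p)) * epowr (TL_norm \<Phi> \<phi> \<alpha> q p u) p" by (rule band_norm_le[OF dp p q ut])
  also have "\<dots> < \<infinity>" using epowr_less_top[OF N] by (simp add: ennreal_mult_less_top)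
  finally show "(\<integral>\<^sup>+x. ennreal (norm (conv (band \<Phi> \<phi> \<kappa>) u x) powr p) \<partial>lborel) < \<infinity>" .
qed simp

lemma band_average_measurable:
  assumes "dyadic_pair \<Phi> \<phi>" "u \<in> tempered_distributions"
  shows "band_average \<Phi> \<phi> l p u \<kappa> \<in> borel_measurable borel"
  unfolding band_average_def[abs_def]
  by (rule nn_integral_peetre_average(1)[OF conv_band_measurable[OF assms] band_scale_pos])

lemma window_average_integral:
  fixes \<phi> :: "real^'d \<Rightarrow> complex"
  assumes dp: "dyadic_pair \<Phi> \<phi>" and p: "p > 0" and q: "q > 0" and u: "u \<in> tempered_distributions"
  shows "ennreal (2 powr (2 * real j * (\<alpha> * p))) * (\<integral>\<^sup>+x. (\<Sum>\<kappa>\<in>window n j. band_average \<Phi> \<phi> l p u \<kappa> x) \<partial>lborel) \<le>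
    (of_nat (n + 2) * ennreal (2 powr ((real n + 6) * \<bar>\<alpha> * p\<bar>)) * (\<integral>\<^sup>+x. ennreal ((1 + norm x) powr - (l * p)) \<partial>(lborel :: (real^'d) measure))) *
      epowr (TL_norm \<Phi> \<phi> \<alpha> q p u) p"
proof -
  let ?W = "\<integral>\<^sup>+x. ennreal ((1 + norm x) powr - (l * p)) \<partial>(lborel :: (real^'d) measure)"
  let ?N = "epowr (TL_norm \<Phi> \<phi> \<alpha> q p u) p"
  let ?c = "ennreal (2 powr (2 * real j * (\<alpha> * p)))" and ?b = "ennreal (2 powr ((real n + 6) * \<bar>\<alpha> * p\<bar>))"
  have m: "band_average \<Phi> \<phi> l p u \<kappa> \<in> borel_measurable lborel" for \<kappa>
    using band_average_measurable[OF dp u] by simp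
  have le: "?c * (\<integral>\<^sup>+x. band_average \<Phi> \<phi> l p u \<kappa> x \<partial>lborel) \<le> ?b * ?W * ?N" if \<kappa>: "\<kappa> \<in> window n j" for \<kappa>
  proof -
    let ?s = "ennreal (band_scale \<kappa> powr - (\<alpha> * p))"
    have "(\<integral>\<^sup>+x. band_average \<Phi> \<phi> l p u \<kappa> x \<partial>lborel) = ?W * (\<integral>\<^sup>+x. ennreal (norm (conv (band \<Phi> \<phi> \<kappa>) u x) powr p) \<partial>lborel)"
      unfolding band_average_def by (rule nn_integral_peetre_average(2)[OF conv_band_measurable[OF dp u] band_scale_pos])
    also have "\<dots> \<le> ?W * (?s * ?N)" by (intro mult_left_mono band_norm_le[OF dp p q u]) simp
    finally have "?c * (\<integral>\<^sup>+x. band_average \<Phi> \<phi> l p u \<kappa> x \<partial>lborel) \<le> ?c * (?W * (?s * ?N))" by (rule mult_left_mono) simp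
    also have "\<dots> = (?c * ?s) * (?W * ?N)" by (simp only: mult_ac)
    also have "?c * ?s = ennreal (2 powr (2 * real j * (\<alpha> * p)) * band_scale \<kappa> powr - (\<alpha> * p))"
      by (rule ennreal_mult[symmetric]) simp_all
    also have "\<dots> * (?W * ?N) \<le> ?b * (?W * ?N)"
      by (intro mult_right_mono ennreal_leI band_scale_window_powr[OF \<kappa>]) simp
    finally show ?thesis by (simp only: mult.assoc)
  qed
  have "?c * (\<integral>\<^sup>+x. (\<Sum>\<kappa>\<in>window n j. band_average \<Phi> \<phi> l p u \<kappa> x) \<partial>lborel) = (\<Sum>\<kappa>\<in>window n j. ?c * (\<integral>\<^sup>+x. band_average \<Phi> \<phi> l p u \<kappa> x \<partial>lborel))"
    by (simp only: nn_integral_sum[OF m] sum_distrib_left)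
  also have "\<dots> \<le> (\<Sum>\<kappa>\<in>window n j. ?b * ?W * ?N)" by (rule sum_mono[OF le])
  also have "\<dots> = of_nat (card (window n j)) * (?b * ?W * ?N)" by simp
  also have "\<dots> \<le> of_nat (n + 2) * (?b * ?W * ?N)" by (intro mult_right_mono of_nat_mono card_window) simp
  finally show ?thesis by (simp only: mult.assoc)
qed

theorem theorem7p6:
  fixes \<Phi> \<phi> \<Psi>h :: "real^'d \<Rightarrow> complex"
    and \<psi>1h \<psi>2h :: "real \<Rightarrow> complex"
    and \<alpha>1 \<alpha>2 p lam :: real and q :: ennreal
  assumes "CARD('d) \<ge> 2"
    and "dyadic_pair \<Phi> \<phi>"
    and "shearlet_generators \<psi>1h \<psi>2h"
    and "coarse_generator \<psi>1h \<psi>2h \<Psi>h"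
    and "0 < q" and "0 < p"
    and "lam > real CARD('d) * max 1 (max (enn2real (1 / q)) (1 / p))"
    and "(real CARD('d) + 1) * \<alpha>2 + (real CARD('d) - 1) * enn2real (1 / q) + lam \<le> 2 * \<alpha>1"
  shows "embeds (TL_space \<Phi> \<phi> \<alpha>1 q p) (TL_norm \<Phi> \<phi> \<alpha>1 q p)
                (shear_TL_space \<psi>1h \<psi>2h \<Psi>h \<alpha>2 q p) (shear_TL_norm \<psi>1h \<psi>2h \<Psi>h \<alpha>2 q p)"
proof -
  note dp = assms(2) and sg = assms(3) and cg = assms(4) and q = assms(5) and p = assms(6)
  define d where "d = real CARD('d)"
  define n where "n = 7 + CARD('d)"
  define r where "r = enn2real (1 / q)"
  define m where "m = d * max 1 (max r (1 / p))"
  \<comment> \<open>The midpoint between the threshold and \<open>lam\<close>. The gap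
    \<open>lam - l\<close> then equals \<open>2 * \<delta>\<close>: one \<delta> makes the weights
    over shears summable in the inner norm, the other makes the sum over scales geometric.\<close>
  define l where "l = (m + lam) / 2"
  define \<delta> where "\<delta> = (lam - m) / 4"
  have d: "d \<ge> 1" by (simp add: d_def Suc_leI)
  have ml: "m < lam" using assms(7) by (simp add: m_def d_def r_def)
  have \<delta>: "\<delta> > 0" and l\<delta>: "l + 2 * \<delta> = lam" and lm: "m < l" using ml by (simp_all add: \<delta>_def l_def field_simps)
  have "d * 1 \<le> m" "d * (1 / p) \<le> m" unfolding m_def using d by (intro mult_left_mono; simp)+
  then have l: "l > 0" and "d * (1 / p) < l" using lm d by linarith+
  \<comment> \<open>The condition under which the Peetre weight with exponent \<open>l * p\<close>
    is integrable.\<close>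
  then have lp: "d < l * p" using p by (simp add: field_simps)
  \<comment> \<open>Balance of exponents per scale. On the left are the growth of the coefficient
    weight and the loss of the Peetre bound; on the right is the smoothness of \<open>f\<close>,
    reduced by the two uses of \<delta> and by the number of shears.\<close>
  have gap: "(d + 1) * \<alpha>2 + l \<le> 2 * \<alpha>1 - \<delta> - ((d - 1) * r + \<delta>)"
    using assms(8) l\<delta> by (simp add: d_def r_def)
  obtain D where D: "D > 0" and pw1: "\<And>u x \<dd> j L. u \<in> tempered_distributions \<Longrightarrow> (\<And>\<kappa>. integrable lborel (\<lambda>x. norm (conv (band \<Phi> \<phi> \<kappa>) u x) powr p)) \<Longrightarrow>
      (\<dd>, j, L) \<in> shear_index \<Longrightarrow>
      ennreal (norm (conv (shear_kernel \<psi>1h \<psi>2h \<dd> j L) u x) powr p) \<le>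
        ennreal (D * 2 powr (real j * l * p)) * (\<Sum>\<kappa>\<in>window n j. band_average \<Phi> \<phi> l p u \<kappa> x)"
    and pw2: "\<And>u x. u \<in> tempered_distributions \<Longrightarrow> (\<And>\<kappa>. integrable lborel (\<lambda>x. norm (conv (band \<Phi> \<phi> \<kappa>) u x) powr p)) \<Longrightarrow>
      ennreal (norm (conv (inverse_fourier \<Psi>h) u x) powr p) \<le>
        ennreal D * (\<Sum>\<kappa>\<in>window n 0. band_average \<Phi> \<phi> l p u \<kappa> x)"
    unfolding n_def by (rule shear_pointwise[OF dp sg cg p l]) blast
  define V where "V = of_nat (n + 2) * ennreal (2 powr ((real n + 6) * \<bar>\<alpha>1 * p\<bar>)) * (\<integral>\<^sup>+x. ennreal ((1 + norm x) powr - (l * p)) \<partial>(lborel :: (real^'d) measure))"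
  have "(\<integral>\<^sup>+x. ennreal ((1 + norm x) powr - (l * p)) \<partial>(lborel :: (real^'d) measure)) < top"
    using nn_integral_weight_finite[where 'a="real^'d", of "l * p"] lp by (simp add: d_def)
  then have V: "V < top" unfolding V_def by (simp add: ennreal_mult_less_top of_nat_less_top)
  define \<rho> where "\<rho> = 2 powr - (\<delta> * p)"
  have \<rho>: "0 < \<rho>" "\<rho> < 1" using p \<delta> powr_less_mono[of "- (\<delta> * p)" 0 2] by (simp_all add: \<rho>_def)
  define G where "G = (\<Sum>j. ennreal (\<rho> ^ j))"
  have "G = ennreal (\<Sum>j. \<rho> ^ j)" unfolding G_def using \<rho> by (intro suminf_ennreal2 summable_geometric) auto
  then have G: "G < top" by simp
  define c where "c j = ennreal (2 powr (- real j * ((d - 1) * r + \<delta>)))" for j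
  define Lc where "Lc = lq_norm q (shear_index :: ('d \<times> nat \<times> (int^'d)) set) (\<lambda>(\<dd>, j, L). c j)"
  have Lc: "Lc < top" unfolding Lc_def c_def r_def d_def by (rule lq_norm_shear_weight[OF q \<delta>])
  \<comment> \<open>One summand for the coarse term and one for the shearlet coefficients; both
    quasi-norms are sums of two such parts.\<close>
  define K where "K = epowr (ennreal D * V) (1 / p) + epowr (epowr Lc p * (ennreal D * (G * V))) (1 / p)"
  have K: "K < top" unfolding K_def using V G epowr_less_top[OF Lc, of p]
    by (simp add: epowr_less_top ennreal_mult_less_top)
  have main: "shear_TL_norm \<psi>1h \<psi>2h \<Psi>h \<alpha>2 q p f \<le> K * TL_norm \<Phi> \<phi> \<alpha>1 q p f" if f: "f \<in> TL_space \<Phi> \<phi> \<alpha>1 q p" for f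
  proof -
    let ?N = "TL_norm \<Phi> \<phi> \<alpha>1 q p f"
    have u: "f \<in> tempered_distributions" using f by (simp add: TL_space_def)
    have i: "integrable lborel (\<lambda>x. norm (conv (band \<Phi> \<phi> \<kappa>) f x) powr p)" for \<kappa> by (rule band_integrable[OF dp p q f])
    define S where "S j x = (\<Sum>\<kappa>\<in>window n j. band_average \<Phi> \<phi> l p f \<kappa> x)" for j x
    have Sm [measurable]: "S j \<in> borel_measurable borel" for j
      unfolding S_def[abs_def] by (intro borel_measurable_sum band_average_measurable[OF dp u])
    have Si: "ennreal (2 powr (2 * real j * (\<alpha>1 * p))) * (\<integral>\<^sup>+x. S j x \<partial>lborel) \<le> V * epowr ?N p" for j
      unfolding S_def V_def by (rule window_average_integral[OF dp p q u])
    have "Lp_norm p (\<lambda>x. ennreal (norm (conv (inverse_fourier \<Psi>h) f x))) \<le> epowr (ennreal D * V) (1 / p) * ?N"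
    proof (rule Lp_norm_le[OF p])
      have "(\<integral>\<^sup>+x. epowr (ennreal (norm (conv (inverse_fourier \<Psi>h) f x))) p \<partial>lborel) \<le> (\<integral>\<^sup>+x. ennreal D * S 0 x \<partial>lborel)"
      proof (rule nn_integral_mono)
        show "epowr (ennreal (norm (conv (inverse_fourier \<Psi>h) f x))) p \<le> ennreal D * S 0 x" for x
          unfolding epowr_ennreal[OF norm_ge_zero] S_def by (rule pw2[OF u i])
      qed
      also have "\<dots> = ennreal D * (\<integral>\<^sup>+x. S 0 x \<partial>lborel)" by (rule nn_integral_cmult) measurable
      also have "\<dots> \<le> ennreal D * (V * epowr ?N p)" using Si[of 0] by (intro mult_left_mono) simp_all
      finally show "(\<integral>\<^sup>+x. epowr (ennreal (norm (conv (inverse_fourier \<Psi>h) f x))) p \<partial>lborel) \<le> ennreal D * V * epowr ?N p"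
        by (simp only: mult.assoc)
    qed
    moreover
    let ?t = "\<lambda>\<dd> j L x. ennreal (Q_vol TYPE('d) j powr (- \<alpha>2) * norm (conv (shear_kernel \<psi>1h \<psi>2h \<dd> j L) f x))"
    have "Lp_norm p (\<lambda>x. lq_norm q shear_index (\<lambda>(\<dd>, j, L). ?t \<dd> j L x)) \<le> epowr (epowr Lc p * (ennreal D * (G * V))) (1 / p) * ?N"
    proof (rule Lp_norm_le[OF p])
      \<comment> \<open>The sum over all scales dominates the contribution of each one, so it is a
        factor independent of the index that leaves the inner norm; in the integral of p-th powers
        it splits into the single scales.\<close>
      define Z where "Z x = (\<Sum>j. ennreal (2 powr (real j * ((2 * \<alpha>1 - \<delta>) * p))) * S j x)" for x
      have Zm [measurable]: "Z \<in> borel_measurable borel" unfolding Z_def[abs_def] by measurable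
      have Z_ge: "ennreal (2 powr (real j * ((2 * \<alpha>1 - \<delta>) * p))) * S j x \<le> Z x" for j x
        using sum_le_suminf[of "\<lambda>j. ennreal (2 powr (real j * ((2 * \<alpha>1 - \<delta>) * p))) * S j x" "{j}"] by (simp add: Z_def)
      have t_le: "?t \<dd> j L x \<le> c j * epowr (ennreal D * Z x) (1 / p)" if ix: "(\<dd>, j, L) \<in> shear_index" for \<dd> j L x
      proof (rule epowr_le_cancel[OF _ p])
        \<comment> \<open>Exponents of the p-th powers: \<open>?e\<close> from the weight in
          \<open>Q_vol\<close>, \<open>?a\<close> from \<open>c j\<close>, \<open>?b\<close> from
          the summand of \<open>Z\<close>. The inequality \<open>gap\<close> says that
          \<open>?a + ?b\<close> dominates \<open>?e\<close> plus the Peetre loss.\<close>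
        let ?e = "real j * ((d + 1) * \<alpha>2 * p)" and ?a = "- real j * ((d - 1) * r + \<delta>) * p" and ?b = "real j * ((2 * \<alpha>1 - \<delta>) * p)"
        have "Q_vol TYPE('d) j powr - \<alpha>2 = 2 powr (real j * ((d + 1) * \<alpha>2))"
          by (simp add: Q_vol_def powr_powr d_def algebra_simps)
        then have "epowr (?t \<dd> j L x) p = ennreal (2 powr ?e) * ennreal (norm (conv (shear_kernel \<psi>1h \<psi>2h \<dd> j L) f x) powr p)"
          by (simp only: epowr_ennreal[OF mult_nonneg_nonneg[OF powr_ge_zero norm_ge_zero]] powr_mult powr_powr
              ennreal_mult[OF powr_ge_zero powr_ge_zero] mult.assoc)
        also have "\<dots> \<le> ennreal (2 powr ?e) * (ennreal (D * 2 powr (real j * l * p)) * S j x)"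
          unfolding S_def by (intro mult_left_mono pw1[OF u i ix]) simp
        also have "\<dots> = ennreal D * (ennreal (2 powr (?e + real j * l * p)) * S j x)"
          using D by (simp add: powr_add ennreal_mult mult_ac)
        also have "\<dots> \<le> ennreal D * (ennreal (2 powr (?a + ?b)) * S j x)"
        proof -
          have "real j * p * ((d + 1) * \<alpha>2 + l) \<le> real j * p * (2 * \<alpha>1 - \<delta> - ((d - 1) * r + \<delta>))"
            using p by (intro mult_left_mono gap) simp
          then have "?e + real j * l * p \<le> ?a + ?b" by (simp add: algebra_simps)
          then show ?thesis by (intro mult_left_mono mult_right_mono ennreal_leI powr_mono) auto
        qed
        also have "\<dots> = ennreal (2 powr ?a) * (ennreal D * (ennreal (2 powr ?b) * S j x))"
          by (simp only: powr_add ennreal_mult[OF powr_ge_zero powr_ge_zero] mult_ac)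
        also have "\<dots> \<le> ennreal (2 powr ?a) * (ennreal D * Z x)" by (intro mult_left_mono Z_ge) simp_all
        also have "\<dots> = epowr (c j * epowr (ennreal D * Z x) (1 / p)) p"
          using p unfolding epowr_mult[OF p] epowr_epowr c_def epowr_ennreal[OF powr_ge_zero] powr_powr by simp
        finally show "epowr (?t \<dd> j L x) p \<le> epowr (c j * epowr (ennreal D * Z x) (1 / p)) p" .
      qed
      have "(\<integral>\<^sup>+x. epowr (lq_norm q shear_index (\<lambda>(\<dd>, j, L). ?t \<dd> j L x)) p \<partial>lborel) \<le> (\<integral>\<^sup>+x. (epowr Lc p * ennreal D) * Z x \<partial>lborel)"
      proof (rule nn_integral_mono)
        fix x
        have "lq_norm q shear_index (\<lambda>(\<dd>, j, L). ?t \<dd> j L x) \<le> Lc * epowr (ennreal D * Z x) (1 / p)"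
          unfolding Lc_def
        proof (rule lq_norm_mult_le[OF q])
          fix k :: "'d \<times> nat \<times> (int^'d)" assume k: "k \<in> shear_index"
          obtain \<dd> j L where [simp]: "k = (\<dd>, j, L)" by (cases k)
          show "(case k of (\<dd>, j, L) \<Rightarrow> ?t \<dd> j L x) \<le> (case k of (\<dd>, j, L) \<Rightarrow> c j) * epowr (ennreal D * Z x) (1 / p)"
            using t_le[of \<dd> j L x] k by simp
        qed
        then have "epowr (lq_norm q shear_index (\<lambda>(\<dd>, j, L). ?t \<dd> j L x)) p \<le> epowr (Lc * epowr (ennreal D * Z x) (1 / p)) p"
          by (rule epowr_mono) (use p in simp)
        also have "\<dots> = (epowr Lc p * ennreal D) * Z x"
          using p unfolding epowr_mult[OF p] epowr_epowr by (simp add: mult.assoc)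
        finally show "epowr (lq_norm q shear_index (\<lambda>(\<dd>, j, L). ?t \<dd> j L x)) p \<le> (epowr Lc p * ennreal D) * Z x" .
      qed
      also have "\<dots> = (epowr Lc p * ennreal D) * (\<integral>\<^sup>+x. Z x \<partial>lborel)" by (rule nn_integral_cmult) measurable
      also have "(\<integral>\<^sup>+x. Z x \<partial>lborel) = (\<Sum>j. \<integral>\<^sup>+x. ennreal (2 powr (real j * ((2 * \<alpha>1 - \<delta>) * p))) * S j x \<partial>lborel)"
        unfolding Z_def by (rule nn_integral_suminf) measurable
      also have "\<dots> \<le> (\<Sum>j. ennreal (\<rho> ^ j) * (V * epowr ?N p))"
      proof (intro suminf_le summableI)
        fix j
        \<comment> \<open>The part with \<alpha>1 is exactly compensated by the bound
          \<open>Si\<close>; what is left over is the geometric factor \<rho> to the power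
          \<open>j\<close>.\<close>
        have "2 powr (real j * ((2 * \<alpha>1 - \<delta>) * p)) = 2 powr (- (\<delta> * p) * real j) * 2 powr (2 * real j * (\<alpha>1 * p))"
          by (simp add: powr_add[symmetric] algebra_simps)
        also have "2 powr (- (\<delta> * p) * real j) = \<rho> ^ j"
          using \<rho>(1) by (simp add: powr_realpow[symmetric] \<rho>_def powr_powr)
        finally have e: "ennreal (2 powr (real j * ((2 * \<alpha>1 - \<delta>) * p))) = ennreal (\<rho> ^ j) * ennreal (2 powr (2 * real j * (\<alpha>1 * p)))"
          using \<rho>(1) by (simp add: ennreal_mult)
        have "(\<integral>\<^sup>+x. ennreal (2 powr (real j * ((2 * \<alpha>1 - \<delta>) * p))) * S j x \<partial>lborel) = ennreal (2 powr (real j * ((2 * \<alpha>1 - \<delta>) * p))) * (\<integral>\<^sup>+x. S j x \<partial>lborel)"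
          by (rule nn_integral_cmult) measurable
        also have "\<dots> = ennreal (\<rho> ^ j) * (ennreal (2 powr (2 * real j * (\<alpha>1 * p))) * (\<integral>\<^sup>+x. S j x \<partial>lborel))"
          unfolding e by (simp only: mult.assoc)
        also have "\<dots> \<le> ennreal (\<rho> ^ j) * (V * epowr ?N p)" by (intro mult_left_mono Si) simp
        finally show "(\<integral>\<^sup>+x. ennreal (2 powr (real j * ((2 * \<alpha>1 - \<delta>) * p))) * S j x \<partial>lborel) \<le> ennreal (\<rho> ^ j) * (V * epowr ?N p)" .
      qed
      also have "\<dots> = G * (V * epowr ?N p)" unfolding G_def by (rule ennreal_suminf_multc)
      finally show "(\<integral>\<^sup>+x. epowr (lq_norm q shear_index (\<lambda>(\<dd>, j, L). ?t \<dd> j L x)) p \<partial>lborel) \<le> epowr Lc p * (ennreal D * (G * V)) * epowr ?N p"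
        by (simp add: mult_left_mono mult.assoc)
    qed
    ultimately show ?thesis
      unfolding shear_TL_norm_def K_def distrib_right shear_kernel_def by (rule add_mono)
  qed
  show ?thesis unfolding embeds_def
  proof (intro conjI subsetI exI[of _ "enn2real K"] ballI)
    fix f assume f: "f \<in> TL_space \<Phi> \<phi> \<alpha>1 q p"
    have "shear_TL_norm \<psi>1h \<psi>2h \<Psi>h \<alpha>2 q p f < top"
      by (rule order.strict_trans1[OF main[OF f]]) (use K f in \<open>simp add: ennreal_mult_less_top TL_space_def\<close>)
    then show "f \<in> shear_TL_space \<psi>1h \<psi>2h \<Psi>h \<alpha>2 q p" using f by (simp add: shear_TL_space_def TL_space_def)
    show "shear_TL_norm \<psi>1h \<psi>2h \<Psi>h \<alpha>2 q p f \<le> ennreal (enn2real K) * TL_norm \<Phi> \<phi> \<alpha>1 q p f" using main[OF f] K by simp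
  qed
qed

end
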